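(* Let $\Sigma$ be a differential system of $s$ equations in $n$ variables defining a diffiety in a neighborhood of a point $\eta\in\mathbf J(\mathbb R,\mathbb R^n)$, the values at $\eta$ of the partial derivatives $\partial P/\partial x$, $P\in\Sigma$, $x\in X$, being given elements of an effective subfield $\mathbb K\subset\mathbb R$. Consider the algorithm $\bar O$-reg applied to $(\Sigma,\eta)$. (i) The algorithm tests whether $\Sigma$ is $\bar o$-regular at $\eta$, and if so returns $Y\subset X$ such that $\mathcal O_{Y,\Sigma}=0$ and $\nabla_{Y,\Sigma}(\eta)\neq0$ (otherwise it returns "failed"). (ii) It works in $O(p(qd^2+s)n)$ elementary operations in $\mathbb K$, where $p$ is the number of recursive calls of $\bar O$-reg, and $q$ and $d$ are respectively the maximal number of iterations of Seq and the maximal number of nontrivial rows in $B$ at each recursive call of $\bar O$-reg. (iii) If $q=1$ and $C_0=\emptyset$ at each recursive call of $\bar O$-reg, then using balanced trees one can achieve a complexity of $O((d^2+\ln(s)s)n)$ elementary operations.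
   Context: All functions are analytic. $\mathbf J(\mathbb R,\mathbb R^n)$ is the infinite jet space with coordinates $t$, $x_j^{(k)}$ ($1\le j\le n$, $k\in\mathbb N$) and derivation $d_t=\partial_t+\sum_{j,k}x_j^{(k+1)}\partial/\partial x_j^{(k)}$. A differential system $\Sigma=\{P_1,\dots,P_s\}$ in $X=\{x_1,\dots,x_n\}$ is a finite set of differential functions (analytic functions of finitely many coordinates); near a point $\eta$ where all $d_t^kP_i$ vanish it defines a diffiety, the common zero set of all $d_t^kP_i$. Jacobi numbers and regularity. $\mathrm{ord}_{x_j}P$ is the largest $k$ such that $P$ depends on $x_j^{(k)}$, $-\infty$ if none; $A_\Sigma=(a_{i,j})$, $a_{i,j}=\mathrm{ord}_{x_j}P_i$. For $Y\subset X$, $\sharp Y=s$, $\mathcal O_{Y,\Sigma}=\max_\sigma\sum_ia_{i,\sigma(i)}$ over bijections $\sigma:\{1,\dots,s\}\to Y$. If $\mathcal O_{Y,\Sigma}\ne-\infty$, a canon of $(a_{i,j})_{j\in Y}$ is $\ell\in\mathbb N^s$ such that for some bijection $\sigma_0:\{1,\dots,s\}\to Y$, $a_{i,\sigma_0(i)}+\ell_i=\max_{i'}(a_{i',\sigma_0(i)}+\ell_{i'})$ for all $i$; there is a unique componentwise minimal canon $\lambda$. With $\alpha_i=\max_k\lambda_k-\lambda_i$, $\beta_j=\max_i(a_{i,j}-\alpha_i)$, $\nabla_{Y,\Sigma}$ is the determinant of the matrix with entries ($j\in Y$) $\partial P_i/\partial x_j^{(a_{i,j})}$ if $a_{i,j}=\alpha_i+\beta_j$,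 and $0$ otherwise. $\Sigma$ is $\bar o$-regular at $\eta$ if there is $Y$ with $\mathcal O_{Y,\Sigma}=0$ and $\nabla_{Y,\Sigma}(\eta)\ne0$. Subroutines. They act on pairs $(B,J)$ of a matrix $B$ with entries in $\{0,-\infty\}$ and a real matrix $J$ with the same rows and columns. HK$(B)$: let $r$ be the maximal number of entries $0$ of $B$ in pairwise different rows and columns; among pairs $(R,C)$ of a set of rows and a set of columns with $\sharp R+\sharp C=r$ covering all entries $0$ there is a unique one $(R_0,C_0)$ with $R_0$ maximal and $C_0$ minimal for inclusion, which is returned. This requires $O(r^{1/2}s'n')$ operations for an $s'\times n'$ matrix. Kernel-Support$(B,J)$: compute the space $K$ of linear relations between the rows of $J$, the set $R_{[K]}$ of rows having a nonzero coefficient in some relation, and the set $C_{[K]}$ of columns of $B$ containing an entry $0$ in some row of $R_{[K]}$; return $B$ and $J$ with the rows in $R_{[K]}$ and columns in $C_{[K]}$ deleted. (Gaussian elimination.) Seq$(B,J)$: compute $(R_0,C_0)=$ HK$(B)$, restrict $B$ and $J$ to the rows in $R_0$ and to the columns not in $C_0$, apply Kernel-Support to get $(B'',J')$; if $B''=B$ return $(B'',J')$, otherwise return Seq$(B'',J')$. Seq2$(B,J)$: let $(B'',J')=$ Seq$(B,J)$. If $B''$ is empty return "failed". Otherwise return $(Y_1,\Sigma_2)$, where $Y_1$ is a set of columns of $B''$, with as many elements as $B''$ has rows, such that the corresponding minor of $J'$ is nonzero, and $\Sigma_2$ is the set of equations not corresponding to rows of $B''$. Algorithm $\bar O$-reg$(\Sigma,\eta)$: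 if $\Sigma=\emptyset$ return $\emptyset$. Let $A=A_\Sigma$. If $s>n$ or $A$ contains a full row of $-\infty$, return "failed". Suppress from $A$ all columns of $-\infty$. Build $B$, the submatrix of the columns $C$ containing only $-\infty$ or $0$ entries, and $J=(\frac{\partial P_i}{\partial x_j}(\eta)\mid 1\le i\le s,\ j\in C)$. If Seq2$(B,J)$ is "failed" return "failed"; otherwise let $(Y_1,\Sigma_2)=$ Seq2$(B,J)$. If $\bar O$-reg$(\Sigma_2,\eta)$ is "failed" return "failed"; otherwise let $Y_2=\bar O$-reg$(\Sigma_2,\eta)$ and return $Y_1\cup Y_2$. Nontrivial rows of $B$ are those containing an entry $0$. The number $p$ counts all calls of $\bar O$-reg, including the first. Elementary operations include operations in $\mathbb K$, in $\mathbb N$ and faster ones; the cost of computing the Jacobian matrix at $\eta$ is neglected. A balanced (AVL) tree storing the sorted entries of a column of length $s$ is built in $O(s\ln s)$ operations and allows deletion of an element and access to the greatest element in $O(\ln s)$ operations. *)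

theory Defs
  imports "HOL-Analysis.Analysis" "Jordan_Normal_Form.Determinant"
begin

section \<open>Differential systems\<close>

text \<open>
  \<open>Deriv j k\<close> is the coordinate $x_j^{(k)}$. Variables are numbered $0,\dots,n-1$ and equations
  $0,\dots,s-1$. The type \<open>jet\<close> carries the product topology; it has coordinates for every
  \<open>j\<close>, but differential functions only involve those in \<open>jet_coords n\<close>.
\<close>

datatype coord = Time | Deriv nat nat

type_synonym jet = "coord \<Rightarrow> real"
type_synonym dfun = "jet \<Rightarrow> real"

definition jet_coords :: "nat \<Rightarrow> coord set" where
  "jet_coords n = insert Time {Deriv j k | j k. j < n}"

text \<open>
  Around each point of \<open>U\<close>, \<open>f\<close> is the sum of a power series in the finitely many
  coordinates \<open>V\<close>; the \<open>m\<close> are multi-indices.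
\<close>

definition analytic_in :: "coord set \<Rightarrow> jet set \<Rightarrow> dfun \<Rightarrow> bool" where
  "analytic_in V U f \<longleftrightarrow>
     (\<forall>a\<in>U. \<exists>c r. 0 < r \<and>
        (\<forall>y\<in>U. (\<forall>v\<in>V. \<bar>y v - a v\<bar> < r) \<longrightarrow>
           ((\<lambda>m. c m * (\<Prod>v\<in>V. (y v - a v) ^ m v)) has_sum f y)
             {m :: coord \<Rightarrow> nat. \<forall>v. v \<notin> V \<longrightarrow> m v = 0}))"

definition differential_function :: "nat \<Rightarrow> jet set \<Rightarrow> dfun \<Rightarrow> bool" where
  "differential_function n U f \<longleftrightarrow> (\<exists>V. finite V \<and> V \<subseteq> jet_coords n \<and> analytic_in V U f)"

definition pdiff :: "dfun \<Rightarrow> coord \<Rightarrow> dfun" where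
  "pdiff f v y = deriv (\<lambda>x. f (y(v := x))) (y v)"

text \<open>The sum has finitely many nonzero terms when \<open>f\<close> depends on finitely many coordinates.\<close>

definition total_deriv :: "nat \<Rightarrow> dfun \<Rightarrow> dfun" where
  "total_deriv n f y =
     pdiff f Time y + (\<Sum>\<^sub>\<infinity>(j, k)\<in>{..<n} \<times> UNIV. y (Deriv j (Suc k)) * pdiff f (Deriv j k) y)"

definition diffiety :: "nat \<Rightarrow> nat \<Rightarrow> (nat \<Rightarrow> dfun) \<Rightarrow> jet set \<Rightarrow> jet set" where
  "diffiety n s P U = {y\<in>U. \<forall>i<s. \<forall>k. (total_deriv n ^^ k) (P i) y = 0}"

definition system_at :: "nat \<Rightarrow> nat \<Rightarrow> (nat \<Rightarrow> dfun) \<Rightarrow> jet set \<Rightarrow> jet \<Rightarrow> bool" where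
  "system_at n s P U \<eta> \<longleftrightarrow>
     open U \<and> (\<forall>i<s. differential_function n U (P i)) \<and> \<eta> \<in> diffiety n s P U"

text \<open>
  \<open>f\<close> depends on a coordinate if its partial derivative does not vanish identically on \<open>U\<close>.
  The supremum of the empty set is $-\infty$ in \<^typ>\<open>ereal\<close>; for differential functions the set is
  finite, so that the supremum is the maximum otherwise.
\<close>

definition ord_on :: "jet set \<Rightarrow> dfun \<Rightarrow> nat \<Rightarrow> ereal" where
  "ord_on U f j = (SUP k\<in>{k. \<exists>y\<in>U. pdiff f (Deriv j k) y \<noteq> 0}. ereal (real k))"

definition order_matrix :: "jet set \<Rightarrow> (nat \<Rightarrow> dfun) \<Rightarrow> nat \<Rightarrow> nat \<Rightarrow> ereal" where
  "order_matrix U P i j = ord_on U (P i) j"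

definition jacobian_at :: "(nat \<Rightarrow> dfun) \<Rightarrow> jet \<Rightarrow> nat \<Rightarrow> nat \<Rightarrow> real" where
  "jacobian_at P \<eta> i j = pdiff (P i) (Deriv j 0) \<eta>"


section \<open>Jacobi numbers, canons and regularity\<close>

text \<open>For \<open>card Y = s\<close> the supremum is a maximum, over finitely many values.\<close>

definition jacobi_number :: "nat \<Rightarrow> (nat \<Rightarrow> nat \<Rightarrow> ereal) \<Rightarrow> nat set \<Rightarrow> ereal" where
  "jacobi_number s a Y = (SUP \<sigma>\<in>{\<sigma>. bij_betw \<sigma> {..<s} Y}. \<Sum>i<s. a i (\<sigma> i))"

text \<open>Elements of $\mathbb N^s$ are functions vanishing from \<open>s\<close> on.\<close>

definition is_canon :: "nat \<Rightarrow> (nat \<Rightarrow> nat \<Rightarrow> ereal) \<Rightarrow> nat set \<Rightarrow> (nat \<Rightarrow> nat) \<Rightarrow> bool" where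
  "is_canon s a Y l \<longleftrightarrow>
     (\<forall>i\<ge>s. l i = 0) \<and>
     (\<exists>\<sigma>. bij_betw \<sigma> {..<s} Y \<and>
        (\<forall>i<s. a i (\<sigma> i) + ereal (real (l i)) =
               Max ((\<lambda>i'. a i' (\<sigma> i) + ereal (real (l i'))) ` {..<s})))"

definition minimal_canon :: "nat \<Rightarrow> (nat \<Rightarrow> nat \<Rightarrow> ereal) \<Rightarrow> nat set \<Rightarrow> nat \<Rightarrow> nat" where
  "minimal_canon s a Y =
     (THE l. is_canon s a Y l \<and> (\<forall>l'. is_canon s a Y l' \<longrightarrow> (\<forall>i. l i \<le> l' i)))"

definition canon_alpha :: "nat \<Rightarrow> (nat \<Rightarrow> nat \<Rightarrow> ereal) \<Rightarrow> nat set \<Rightarrow> nat \<Rightarrow> ereal" where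
  "canon_alpha s a Y i =
     ereal (real (Max (minimal_canon s a Y ` {..<s})) - real (minimal_canon s a Y i))"

definition canon_beta :: "nat \<Rightarrow> (nat \<Rightarrow> nat \<Rightarrow> ereal) \<Rightarrow> nat set \<Rightarrow> nat \<Rightarrow> ereal" where
  "canon_beta s a Y j = Max ((\<lambda>i. a i j - canon_alpha s a Y i) ` {..<s})"

text \<open>Determinant of a submatrix with the rows \<open>R\<close> and the columns \<open>S\<close> in increasing order.\<close>

definition minor :: "(nat \<Rightarrow> nat \<Rightarrow> real) \<Rightarrow> nat set \<Rightarrow> nat set \<Rightarrow> real" where
  "minor M R S =
     Determinant.det (Matrix.mat (card R) (card S)
       (\<lambda>(k, l). M (sorted_list_of_set R ! k) (sorted_list_of_set S ! l)))"

definition order_nat :: "ereal \<Rightarrow> nat" where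
  "order_nat e = nat \<lfloor>real_of_ereal e\<rfloor>"

definition nabla :: "nat \<Rightarrow> (nat \<Rightarrow> dfun) \<Rightarrow> jet set \<Rightarrow> nat set \<Rightarrow> dfun" where
  "nabla s P U Y y =
     (let a = order_matrix U P in
      minor (\<lambda>i j. if a i j = canon_alpha s a Y i + canon_beta s a Y j
                    then pdiff (P i) (Deriv j (order_nat (a i j))) y else 0)
            {..<s} Y)"

definition obar_regular_wrt ::
    "nat \<Rightarrow> nat \<Rightarrow> (nat \<Rightarrow> dfun) \<Rightarrow> jet set \<Rightarrow> jet \<Rightarrow> nat set \<Rightarrow> bool" where
  "obar_regular_wrt n s P U \<eta> Y \<longleftrightarrow>
     Y \<subseteq> {..<n} \<and> card Y = s \<and>
     jacobi_number s (order_matrix U P) Y = 0 \<and> nabla s P U Y \<eta> \<noteq> 0"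

definition obar_regular :: "nat \<Rightarrow> nat \<Rightarrow> (nat \<Rightarrow> dfun) \<Rightarrow> jet set \<Rightarrow> jet \<Rightarrow> bool" where
  "obar_regular n s P U \<eta> \<longleftrightarrow> (\<exists>Y. obar_regular_wrt n s P U \<eta> Y)"


section \<open>The algorithm\<close>

text \<open>
  All matrices \<open>B\<close>, \<open>J\<close> occurring in a run are submatrices of $A_\Sigma$ and of the Jacobian matrix
  at $\eta$, with common sets of rows and columns. They are represented by these sets \<open>R\<close>, \<open>C\<close>,
  the full matrices \<open>a\<close>, \<open>J\<close> being fixed; likewise subsystems of $\Sigma$ by sets of row indices.
\<close>

definition zero_entries :: "(nat \<Rightarrow> nat \<Rightarrow> ereal) \<Rightarrow> nat set \<Rightarrow> nat set \<Rightarrow> (nat \<times> nat) set" where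
  "zero_entries a R C = {(i, j) \<in> R \<times> C. a i j = 0}"

definition term_rank :: "(nat \<Rightarrow> nat \<Rightarrow> ereal) \<Rightarrow> nat set \<Rightarrow> nat set \<Rightarrow> nat" where
  "term_rank a R C = Max (card ` {M. M \<subseteq> zero_entries a R C \<and> inj_on fst M \<and> inj_on snd M})"

definition minimum_covers ::
    "(nat \<Rightarrow> nat \<Rightarrow> ereal) \<Rightarrow> nat set \<Rightarrow> nat set \<Rightarrow> (nat set \<times> nat set) set" where
  "minimum_covers a R C =
     {(R1, C1). R1 \<subseteq> R \<and> C1 \<subseteq> C \<and> card R1 + card C1 = term_rank a R C \<and>
        (\<forall>(i, j)\<in>zero_entries a R C. i \<in> R1 \<or> j \<in> C1)}"

definition HK :: "(nat \<Rightarrow> nat \<Rightarrow> ereal) \<Rightarrow> nat set \<Rightarrow> nat set \<Rightarrow> nat set \<times> nat set" where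
  "HK a R C = (THE (R0, C0). (R0, C0) \<in> minimum_covers a R C \<and>
                 (\<forall>(R1, C1)\<in>minimum_covers a R C. R1 \<subseteq> R0 \<and> C0 \<subseteq> C1))"

definition row_relations :: "(nat \<Rightarrow> nat \<Rightarrow> real) \<Rightarrow> nat set \<Rightarrow> nat set \<Rightarrow> (nat \<Rightarrow> real) set" where
  "row_relations J R C =
     {c. (\<forall>i. i \<notin> R \<longrightarrow> c i = 0) \<and> (\<forall>j\<in>C. (\<Sum>i\<in>R. c i * J i j) = 0)}"

definition related_rows :: "(nat \<Rightarrow> nat \<Rightarrow> real) \<Rightarrow> nat set \<Rightarrow> nat set \<Rightarrow> nat set" where
  "related_rows J R C = {i\<in>R. \<exists>c\<in>row_relations J R C. c i \<noteq> 0}"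

definition related_columns ::
    "(nat \<Rightarrow> nat \<Rightarrow> ereal) \<Rightarrow> (nat \<Rightarrow> nat \<Rightarrow> real) \<Rightarrow> nat set \<Rightarrow> nat set \<Rightarrow> nat set" where
  "related_columns a J R C = {j\<in>C. \<exists>i\<in>related_rows J R C. a i j = 0}"

definition Kernel_Support ::
    "(nat \<Rightarrow> nat \<Rightarrow> ereal) \<Rightarrow> (nat \<Rightarrow> nat \<Rightarrow> real) \<Rightarrow> nat set \<Rightarrow> nat set \<Rightarrow> nat set \<times> nat set" where
  "Kernel_Support a J R C = (R - related_rows J R C, C - related_columns a J R C)"

text \<open>
  A run of the algorithm is recorded with its intermediate results. A \<open>pass\<close> is one iteration of
  Seq: the pair $(R_0,C_0)$ returned by HK, and the rows and columns of $B''$.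
  A \<open>call\<close> is one call of $\bar O$-reg: its equations, the columns of $B$, the passes of Seq and the
  set $Y_1$ (the last three are empty when they are not reached).
\<close>

datatype pass = Pass (cover_rows: "nat set") (cover_cols: "nat set")
                     (rest_rows: "nat set") (rest_cols: "nat set")

datatype call = Call (equations: "nat set") (columns: "nat set")
                     (passes: "pass list") (chosen: "nat set")

inductive Seq_run ::
    "(nat \<Rightarrow> nat \<Rightarrow> ereal) \<Rightarrow> (nat \<Rightarrow> nat \<Rightarrow> real) \<Rightarrow> nat set \<Rightarrow> nat set \<Rightarrow>
     pass list \<Rightarrow> nat set \<Rightarrow> nat set \<Rightarrow> bool"
  for a J where
  Seq_stop:
    "\<lbrakk>HK a R C = (R0, C0); Kernel_Support a J R0 (C - C0) = (R, C)\<rbrakk>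
     \<Longrightarrow> Seq_run a J R C [Pass R0 C0 R C] R C"
| Seq_again:
    "\<lbrakk>HK a R C = (R0, C0); Kernel_Support a J R0 (C - C0) = (R', C'); (R', C') \<noteq> (R, C);
      Seq_run a J R' C' ps R'' C''\<rbrakk>
     \<Longrightarrow> Seq_run a J R C (Pass R0 C0 R' C' # ps) R'' C''"

text \<open>Columns containing only $-\infty$ and $0$, those containing only $-\infty$ being suppressed.\<close>

definition B_columns :: "nat \<Rightarrow> (nat \<Rightarrow> nat \<Rightarrow> ereal) \<Rightarrow> nat set \<Rightarrow> nat set" where
  "B_columns n a I =
     {j. j < n \<and> (\<exists>i\<in>I. a i j \<noteq> -\<infinity>) \<and> (\<forall>i\<in>I. a i j = -\<infinity> \<or> a i j = 0)}"

definition hopeless :: "nat \<Rightarrow> (nat \<Rightarrow> nat \<Rightarrow> ereal) \<Rightarrow> nat set \<Rightarrow> bool" where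
  "hopeless n a I \<longleftrightarrow> card I > n \<or> (\<exists>i\<in>I. \<forall>j<n. a i j = -\<infinity>)"

text \<open>
  \<open>Obar_reg n a J I cs res\<close>: the call of $\bar O$-reg for the subsystem \<open>I\<close> may return \<open>res\<close>, with
  record \<open>cs\<close>; \<open>None\<close> stands for ``failed''. It is a relation as the choice of $Y_1$ is free.
\<close>

inductive Obar_reg ::
    "nat \<Rightarrow> (nat \<Rightarrow> nat \<Rightarrow> ereal) \<Rightarrow> (nat \<Rightarrow> nat \<Rightarrow> real) \<Rightarrow> nat set \<Rightarrow>
     call list \<Rightarrow> nat set option \<Rightarrow> bool"
  for n a J where
  Obar_empty:
    "Obar_reg n a J {} [Call {} {} [] {}] (Some {})"
| Obar_hopeless:
    "\<lbrakk>I \<noteq> {}; hopeless n a I\<rbrakk> \<Longrightarrow> Obar_reg n a J I [Call I {} [] {}] None"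
| Obar_stuck:
    "\<lbrakk>I \<noteq> {}; \<not> hopeless n a I; Seq_run a J I (B_columns n a I) ps R C; R = {} \<or> C = {}\<rbrakk>
     \<Longrightarrow> Obar_reg n a J I [Call I (B_columns n a I) ps {}] None"
| Obar_split:
    "\<lbrakk>I \<noteq> {}; \<not> hopeless n a I; Seq_run a J I (B_columns n a I) ps R C; \<not> (R = {} \<or> C = {});
      Y1 \<subseteq> C; card Y1 = card R; minor J R Y1 \<noteq> 0;
      Obar_reg n a J (I - R) cs res\<rbrakk>
     \<Longrightarrow> Obar_reg n a J I (Call I (B_columns n a I) ps Y1 # cs) (map_option (\<lambda>Y2. Y1 \<union> Y2) res)"

definition nontrivial_rows :: "(nat \<Rightarrow> nat \<Rightarrow> ereal) \<Rightarrow> call \<Rightarrow> nat set" where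
  "nontrivial_rows a c = {i\<in>equations c. \<exists>j\<in>columns c. a i j = 0}"

text \<open>
  Trivial rows never belong to $R_0$, so the test $B''=B$ always fails on the first pass if $B$ has
  such rows. As is implicit in counting only nontrivial rows in $d$, a first pass that discards
  nothing but the trivial rows is counted as conclusive: otherwise $q=1$ would require that $B$ has
  no trivial row at all. The resulting count is at most \<open>length (passes c)\<close>, so that a bound in
  terms of it, or under the hypothesis that it is 1, also holds for \<open>length (passes c)\<close>.
\<close>

definition Seq_iterations :: "(nat \<Rightarrow> nat \<Rightarrow> ereal) \<Rightarrow> call \<Rightarrow> nat" where
  "Seq_iterations a c =
     (case passes c of
        [] \<Rightarrow> 0
      | b # ps \<Rightarrow> if rest_rows b = nontrivial_rows a c \<and> rest_cols b = columns c
                  then 1 else Suc (length ps))"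

definition num_calls :: "call list \<Rightarrow> nat" where
  "num_calls cs = length cs"

definition max_iterations :: "(nat \<Rightarrow> nat \<Rightarrow> ereal) \<Rightarrow> call list \<Rightarrow> nat" where
  "max_iterations a cs = Max (Seq_iterations a ` set cs)"

definition max_nontrivial :: "(nat \<Rightarrow> nat \<Rightarrow> ereal) \<Rightarrow> call list \<Rightarrow> nat" where
  "max_nontrivial a cs = Max ((\<lambda>c. card (nontrivial_rows a c)) ` set cs)"


section \<open>Elementary operations\<close>

text \<open>
  Complexity refers to a random access machine with finitely many arrays of natural numbers and
  finitely many arrays of elements of a field \<open>K\<close>, with indirect addressing and an output tape.
  Scalar variables are cells of arrays. Every arithmetic operation, comparison, memory access and
  elementary command costs 1. In a program array names are constants and the only constants
  of \<open>K\<close> are 0 and 1, so that a program does not depend on the size of its input or on \<open>K\<close>.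
\<close>

datatype nexp = Num nat | NGet nat nexp
  | NAdd nexp nexp | NSub nexp nexp | NMul nexp nexp

datatype kexp = KZero | KOne | KGet nat nexp
  | KAdd kexp kexp | KSub kexp kexp | KMul kexp kexp | KDiv kexp kexp

datatype bexp = NLess nexp nexp | NEq nexp nexp | KEq kexp kexp | BNot bexp | BAnd bexp bexp

datatype prog = Skip
  | NPut nat nexp nexp
  | KPut nat nexp kexp
  | Output nexp
  | Then prog prog
  | Cond bexp prog prog
  | Loop bexp prog

record mem =
  narr :: "nat \<Rightarrow> nat \<Rightarrow> nat"
  karr :: "nat \<Rightarrow> nat \<Rightarrow> real"
  tape :: "nat list"

fun nval :: "nexp \<Rightarrow> mem \<Rightarrow> nat" where
  "nval (Num k) m = k"
| "nval (NGet x e) m = narr m x (nval e m)"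
| "nval (NAdd e f) m = nval e m + nval f m"
| "nval (NSub e f) m = nval e m - nval f m"
| "nval (NMul e f) m = nval e m * nval f m"

fun kval :: "kexp \<Rightarrow> mem \<Rightarrow> real" where
  "kval KZero m = 0"
| "kval KOne m = 1"
| "kval (KGet x e) m = karr m x (nval e m)"
| "kval (KAdd e f) m = kval e m + kval f m"
| "kval (KSub e f) m = kval e m - kval f m"
| "kval (KMul e f) m = kval e m * kval f m"
| "kval (KDiv e f) m = kval e m / kval f m"

fun bval :: "bexp \<Rightarrow> mem \<Rightarrow> bool" where
  "bval (NLess e f) m = (nval e m < nval f m)"
| "bval (NEq e f) m = (nval e m = nval f m)"
| "bval (KEq e f) m = (kval e m = kval f m)"
| "bval (BNot b) m = (\<not> bval b m)"
| "bval (BAnd b c) m = (bval b m \<and> bval c m)"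

fun ncost :: "nexp \<Rightarrow> nat" where
  "ncost (Num k) = 1"
| "ncost (NGet x e) = 1 + ncost e"
| "ncost (NAdd e f) = 1 + ncost e + ncost f"
| "ncost (NSub e f) = 1 + ncost e + ncost f"
| "ncost (NMul e f) = 1 + ncost e + ncost f"

fun kcost :: "kexp \<Rightarrow> nat" where
  "kcost KZero = 1"
| "kcost KOne = 1"
| "kcost (KGet x e) = 1 + ncost e"
| "kcost (KAdd e f) = 1 + kcost e + kcost f"
| "kcost (KSub e f) = 1 + kcost e + kcost f"
| "kcost (KMul e f) = 1 + kcost e + kcost f"
| "kcost (KDiv e f) = 1 + kcost e + kcost f"

fun bcost :: "bexp \<Rightarrow> nat" where
  "bcost (NLess e f) = 1 + ncost e + ncost f"
| "bcost (NEq e f) = 1 + ncost e + ncost f"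
| "bcost (KEq e f) = 1 + kcost e + kcost f"
| "bcost (BNot b) = 1 + bcost b"
| "bcost (BAnd b c) = 1 + bcost b + bcost c"

text \<open>\<open>exec K p m t m'\<close>: \<open>p\<close> started in \<open>m\<close> stops in \<open>m'\<close> after \<open>t\<close> elementary operations.\<close>

inductive exec :: "real set \<Rightarrow> prog \<Rightarrow> mem \<Rightarrow> nat \<Rightarrow> mem \<Rightarrow> bool" for K where
  "exec K Skip m 1 m"
| "exec K (NPut x e f) m (1 + ncost e + ncost f)
     (m\<lparr>narr := (narr m)(x := (narr m x)(nval e m := nval f m))\<rparr>)"
| "kval f m \<in> K \<Longrightarrow>
   exec K (KPut x e f) m (1 + ncost e + kcost f)
     (m\<lparr>karr := (karr m)(x := (karr m x)(nval e m := kval f m))\<rparr>)"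
| "exec K (Output e) m (1 + ncost e) (m\<lparr>tape := tape m @ [nval e m]\<rparr>)"
| "\<lbrakk>exec K p m t m'; exec K q m' t' m''\<rbrakk> \<Longrightarrow> exec K (Then p q) m (t + t') m''"
| "\<lbrakk>bval b m; exec K p m t m'\<rbrakk> \<Longrightarrow> exec K (Cond b p q) m (1 + bcost b + t) m'"
| "\<lbrakk>\<not> bval b m; exec K q m t m'\<rbrakk> \<Longrightarrow> exec K (Cond b p q) m (1 + bcost b + t) m'"
| "\<not> bval b m \<Longrightarrow> exec K (Loop b p) m (1 + bcost b) m"
| "\<lbrakk>bval b m; exec K p m t m'; exec K (Loop b p) m' t' m''\<rbrakk>
   \<Longrightarrow> exec K (Loop b p) m (1 + bcost b + t + t') m''"

definition real_subfield :: "real set \<Rightarrow> bool" where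
  "real_subfield K \<longleftrightarrow>
     0 \<in> K \<and> 1 \<in> K \<and>
     (\<forall>x\<in>K. \<forall>y\<in>K. x + y \<in> K \<and> x - y \<in> K \<and> x * y \<in> K \<and> x / y \<in> K)"

text \<open>
  The input consists of \<open>s\<close>, \<open>n\<close>, the order matrix (with $-\infty$ coded by 0 and the order $k$
  by $k+1$) and the Jacobian matrix, both stored row by row.
\<close>

definition order_code :: "ereal \<Rightarrow> nat" where
  "order_code e = (if e = -\<infinity> then 0 else Suc (order_nat e))"

definition input_mem :: "nat \<Rightarrow> nat \<Rightarrow> (nat \<Rightarrow> nat \<Rightarrow> ereal) \<Rightarrow> (nat \<Rightarrow> nat \<Rightarrow> real) \<Rightarrow> mem" where
  "input_mem s n a J =
     \<lparr>narr = (\<lambda>x k. if x = 0 \<and> k = 0 then s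
                     else if x = 0 \<and> k = 1 then n
                     else if x = 1 \<and> k < s * n then order_code (a (k div n) (k mod n))
                     else 0),
      karr = (\<lambda>x k. if x = 0 \<and> k < s * n then J (k div n) (k mod n) else 0),
      tape = []\<rparr>"

text \<open>
  A program carries out $\bar O$-reg if it prints the record of a run, followed by the
  result. Hence it has to go through the successive iterations of the algorithm and to compute their
  intermediate results, and not merely to find a correct set $Y$ by any other means. Sets are
  printed as their size followed by their elements in any order.
\<close>

definition cat :: "nat list set list \<Rightarrow> nat list set" where
  "cat Ls = concat ` listset Ls"

definition set_codes :: "nat set \<Rightarrow> nat list set" where
  "set_codes S = {length xs # xs | xs. distinct xs \<and> set xs = S}"

definition pass_codes :: "pass \<Rightarrow> nat list set" where
  "pass_codes b =
     cat [{[3]}, set_codes (cover_rows b), set_codes (cover_cols b),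
          set_codes (rest_rows b), set_codes (rest_cols b)]"

definition call_codes :: "call \<Rightarrow> nat list set" where
  "call_codes c =
     cat ([{[2]}, set_codes (equations c), set_codes (columns c)] @
          map pass_codes (passes c) @ [{[4]}, set_codes (chosen c)])"

definition result_codes :: "nat set option \<Rightarrow> nat list set" where
  "result_codes res = (case res of None \<Rightarrow> {[0]} | Some Y \<Rightarrow> cat [{[1]}, set_codes Y])"

definition run_codes :: "call list \<Rightarrow> nat set option \<Rightarrow> nat list set" where
  "run_codes cs res = cat (map call_codes cs @ [result_codes res])"

definition carries_out ::
    "real set \<Rightarrow> prog \<Rightarrow> nat \<Rightarrow> nat \<Rightarrow> (nat \<Rightarrow> nat \<Rightarrow> ereal) \<Rightarrow> (nat \<Rightarrow> nat \<Rightarrow> real) \<Rightarrow>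
     call list \<Rightarrow> nat set option \<Rightarrow> nat \<Rightarrow> bool" where
  "carries_out K p s n a J cs res t \<longleftrightarrow>
     Obar_reg n a J {..<s} cs res \<and>
     (\<exists>m. exec K p (input_mem s n a J) t m \<and> tape m \<in> run_codes cs res)"

end

theory Submission imports Defs begin

text \<open>
  \<^bold>\<open>Part (i).\<close> The orders are natural numbers or \<open>-\<infinity>\<close>. Hence the Jacobi number of \<open>Y\<close> is 0 iff some
  transversal of the columns \<open>Y\<close> meets only orders 0 and no transversal meets finite orders one of
  which is positive. In this case \<open>nabla\<close> is the determinant of the Jacobian matrix restricted to the
  entries of order 0 (\<open>nabla_eq_minor\<close>): whatever the canon, the entries used by \<open>nabla\<close> and the
  entries of order 0 contain the same transversals, so that both determinants have the same Leibniz
  expansion. This turns regularity into a statement on the two matrices only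
  (\<open>obar_regular_wrt_iff\<close>).

  By Koenig's theorem for the finite entries, such a system is block triangular
  (\<open>terminal_block_exists\<close>, \<open>regular_triangular\<close>): there are equations \<open>R\<close> and as many columns \<open>C\<close>,
  with a nonzero minor, such that the entries in the columns \<open>C\<close> are 0 or \<open>-\<infinity>\<close> in the rows \<open>R\<close> and
  \<open>-\<infinity>\<close> in the other rows, and the remaining equations are regular in the remaining columns. The
  columns \<open>C\<close> are among those of \<open>B\<close>. Neither HK nor Kernel-Support ever discards a row or a column
  of such a block (\<open>HK_keeps_confined\<close>, \<open>related_rows_avoid_confined\<close>), so that Seq ends with a
  nonempty matrix if there is a block at all. What Seq leaves is itself such a block, as its rows are
  independent, and a system remains block triangular when equations are removed
  (\<open>triangular_subsystem\<close>). Therefore any block may be split off first, and the algorithm succeeds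
  exactly on regular systems (\<open>Obar_reg_correct\<close>).

  \<^bold>\<open>Parts (ii) and (iii)\<close> are proved with the same program. It obtains a maximal matching of the
  entries 0 of \<open>B\<close> by an auction: an unmatched row takes the cheapest column in which it has an
  entry 0, at a price raised by 1, from the row that owned it, and gives up when this price has reached
  the number \<open>d\<close> of nontrivial rows. As long as a row is unmatched, fewer than \<open>d\<close> columns are owned, so
  that some price between 1 and \<open>d\<close> is not attained; this gap separates the columns that are reachable
  from unmatched rows by alternating paths from the unmatched columns (\<open>price_gap\<close>). So the matching is maximal after at most \<open>d\<^sup>2\<close> rises of a price, and the cover
  returned by HK consists of the reachable columns and of the owners of the others
  (\<open>minimum_cover_of_closure\<close>). Together with an elimination by columns, which yields both the related
  rows and a nonzero minor, a pass of Seq costs \<open>O(d\<^sup>2l)\<close> operations for \<open>l\<close> columns.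

  For every variable the program keeps the number of entries 0 and of positive entries in its column
  among the equations left. As every entry of the order matrix is deleted at most once, the counters
  cost \<open>O(sn)\<close> operations altogether, and they give the columns of \<open>B\<close> in \<open>O(n)\<close> operations per call.
  The total is therefore at most a constant times \<open>sn\<close> plus the cost of the single calls
  (\<open>wp_obar_prog\<close>). Bounding each call separately yields (ii). If \<open>q = 1\<close>, all nontrivial rows are
  removed by the call in which they occur; the columns of \<open>B\<close> then contain only \<open>-\<infinity>\<close> in the equations
  left, so that \<open>B\<close> has at most \<open>n\<close> columns in all calls together (\<open>Obar_reg_totals\<close>). Hence the passes
  cost \<open>O(d\<^sup>2n)\<close> in total, and \<open>O((d\<^sup>2 + s)n)\<close> remains, which is within the bound of (iii).
\<close>

section \<open>Matchings and minimum covers\<close>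

text \<open>
  \<open>own c\<close> is \<open>Suc r\<close> if column \<open>c\<close> is matched with row \<open>r\<close>, and 0 if it is unmatched; this is also
  the contents of an array of the program.
\<close>

definition assigned :: "(nat \<Rightarrow> nat) \<Rightarrow> nat set \<Rightarrow> nat set" where
  "assigned own C = {r. \<exists>c\<in>C. own c = Suc r}"

definition matching :: "(nat \<Rightarrow> nat \<Rightarrow> ereal) \<Rightarrow> nat set \<Rightarrow> nat set \<Rightarrow> (nat \<Rightarrow> nat) \<Rightarrow> bool" where
  "matching a R C own \<longleftrightarrow>
     (\<forall>c\<in>C. \<forall>r. own c = Suc r \<longrightarrow> r \<in> R \<and> a r c = 0) \<and>
     (\<forall>c\<in>C. \<forall>c'\<in>C. own c = own c' \<longrightarrow> own c \<noteq> 0 \<longrightarrow> c = c')"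

text \<open>
  The state of the auction with the limit \<open>L\<close> for prices. The second line is the essential invariant:
  a row owns a column that is, up to 1, the cheapest one it could have.
\<close>

definition auction ::
    "(nat \<Rightarrow> nat \<Rightarrow> ereal) \<Rightarrow> nat set \<Rightarrow> nat set \<Rightarrow> nat \<Rightarrow> (nat \<Rightarrow> nat) \<Rightarrow> (nat \<Rightarrow> nat) \<Rightarrow> bool" where
  "auction a R C L own price \<longleftrightarrow> matching a R C own \<and>
     (\<forall>c\<in>C. \<forall>r. own c = Suc r \<longrightarrow> (\<forall>c'\<in>C. a r c' = 0 \<longrightarrow> price c \<le> Suc (price c'))) \<and>
     (\<forall>c\<in>C. price c > 0 \<longrightarrow> own c \<noteq> 0) \<and> (\<forall>c\<in>C. price c \<le> L)"

text \<open>
  \<open>X\<close> contains all columns that can be reached from unmatched rows by alternating paths.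
\<close>

definition alternating_closed ::
    "(nat \<Rightarrow> nat \<Rightarrow> ereal) \<Rightarrow> nat set \<Rightarrow> nat set \<Rightarrow> (nat \<Rightarrow> nat) \<Rightarrow> nat set \<Rightarrow> bool" where
  "alternating_closed a R C own X \<longleftrightarrow> X \<subseteq> C \<and>
     (\<forall>u\<in>R - assigned own C. \<forall>c\<in>C. a u c = 0 \<longrightarrow> c \<in> X) \<and>
     (\<forall>c\<in>X. \<forall>r. own c = Suc r \<longrightarrow> (\<forall>c'\<in>C. a r c' = 0 \<longrightarrow> c' \<in> X))"

lemma matchingD:
  assumes "matching a R C own" "c \<in> C" "own c = Suc r"
  shows "r \<in> R" "a r c = 0" "\<And>c'. \<lbrakk>c' \<in> C; own c' = Suc r\<rbrakk> \<Longrightarrow> c' = c"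
  using assms unfolding matching_def by (blast, blast, metis nat.distinct(1))

lemma auction_start: "auction a R C L (\<lambda>c. 0) (\<lambda>c. 0)"
  by (simp add: auction_def matching_def)

lemma auction_cong:
  assumes "\<And>c. c \<in> C \<Longrightarrow> own c = own' c" "\<And>c. c \<in> C \<Longrightarrow> price c = price' c"
  shows "auction a R C L own price \<longleftrightarrow> auction a R C L own' price'"
  using assms by (simp add: auction_def matching_def)

lemma auction_bid:
  assumes "auction a R C L own price" "u \<in> R" "u \<notin> assigned own C" "b \<in> C" "a u b = 0" "price b < L"
    and "\<And>c. \<lbrakk>c \<in> C; a u c = 0\<rbrakk> \<Longrightarrow> price b \<le> price c"
  shows "auction a R C L (own(b := Suc u)) (price(b := Suc (price b)))"
proof -
  have m: "matching a R C own" and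
    p: "\<And>c r c'. \<lbrakk>c \<in> C; own c = Suc r; c' \<in> C; a r c' = 0\<rbrakk> \<Longrightarrow> price c \<le> Suc (price c')"
    and o: "\<And>c. \<lbrakk>c \<in> C; price c > 0\<rbrakk> \<Longrightarrow> own c \<noteq> 0" and L: "\<And>c. c \<in> C \<Longrightarrow> price c \<le> L"
    using assms(1) by (auto simp: auction_def)
  have "own c \<noteq> Suc u" "Suc u \<noteq> own c" if "c \<in> C" for c
    using assms(3) that by (auto simp: assigned_def)
  then have "matching a R C (own(b := Suc u))"
    using m assms(2,5) by (auto simp: matching_def)
  moreover have "(price(b := Suc (price b))) c \<le> Suc ((price(b := Suc (price b))) c')"
    if c: "c \<in> C" "(own(b := Suc u)) c = Suc r" "c' \<in> C" "a r c' = 0" for c r c'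
  proof (cases "c = b")
    case True
    then show ?thesis using c assms(7)[of c'] by auto
  next
    case False
    then show ?thesis using c p[of c r c'] by (cases "c' = b") auto
  qed
  ultimately show ?thesis
    using o L assms(6) by (auto simp: auction_def Suc_le_eq)
qed

text \<open>
  Columns of positive price are owned, by rows other than an unmatched row \<open>u\<close>; hence there are fewer
  of them than \<open>L\<close>, and some price between 1 and \<open>L\<close> is not attained. An alternating path starts from an
  unmatched row with a column of price at least \<open>L\<close>, and the price of the next column is at least that
  of the previous one minus 1. So the path stays above the gap, where all columns are owned.
\<close>

lemma price_gap:
  assumes au: "auction a R C L own price" and fin: "finite R" "finite C" and "card R \<le> L"
    and stuck: "\<And>u c. \<lbrakk>u \<in> R - assigned own C; c \<in> C; a u c = 0\<rbrakk> \<Longrightarrow> price c \<ge> L"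
  shows "\<exists>X. alternating_closed a R C own X \<and> (\<forall>c\<in>X. own c \<noteq> 0)"
proof (cases "R \<subseteq> assigned own C")
  case True
  then show ?thesis by (intro exI[of _ "{}"]) (auto simp: alternating_closed_def)
next
  case False
  then obtain u where u: "u \<in> R" "u \<notin> assigned own C" by blast
  have m: "matching a R C own" using au by (simp add: auction_def)
  let ?P = "{c \<in> C. price c > 0}"
  have inj: "inj_on (\<lambda>c. own c - 1) ?P"
  proof (rule inj_onI)
    fix c c' assume c: "c \<in> ?P" "c' \<in> ?P" "own c - 1 = own c' - 1"
    then have "own c \<noteq> 0" "own c' \<noteq> 0" using au by (auto simp: auction_def)
    with c(3) have "own c = own c'" by arith
    with c(1,2) \<open>own c \<noteq> 0\<close> m show "c = c'" unfolding matching_def by blast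
  qed
  have "own c - 1 \<in> R - {u}" if c: "c \<in> ?P" for c
  proof -
    obtain r where r: "own c = Suc r"
      using c au unfolding auction_def by (metis (mono_tags, lifting) mem_Collect_eq not0_implies_Suc)
    then have "r \<in> assigned own C" using c by (auto simp: assigned_def)
    then show ?thesis using r c matchingD(1)[OF m, of c r] u by auto
  qed
  then have "(\<lambda>c. own c - 1) ` ?P \<subseteq> R - {u}" by blast
  then have "card ?P \<le> card (R - {u})" using card_inj_on_le[OF inj] fin by simp
  also have "\<dots> < card R" using u fin by (meson card_Diff1_less)
  finally have "card (price ` ?P) < L" using \<open>card R \<le> L\<close> card_image_le[of ?P price] fin by fastforce
  then have "\<not> {1..L} \<subseteq> price ` ?P"
    using card_mono[of "price ` ?P" "{1..L}"] fin by auto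
  then obtain g where g0: "g \<in> {1..L}" and g3: "g \<notin> price ` ?P" by blast
  then have g: "1 \<le> g" "g \<le> L" "g \<notin> price ` ?P" by auto
  have g': "price c \<noteq> g" if "c \<in> C" for c using that g by auto
  let ?X = "{c \<in> C. price c > g}"
  have "alternating_closed a R C own ?X"
    unfolding alternating_closed_def
  proof (intro conjI ballI allI impI)
    show "c \<in> ?X" if "v \<in> R - assigned own C" "c \<in> C" "a v c = 0" for v c
      using stuck[OF that] g(2) g'[OF that(2)] that(2) by auto
    show "c' \<in> ?X" if "c \<in> ?X" "own c = Suc r" "c' \<in> C" "a r c' = 0" for c r c'
    proof -
      have "price c \<le> Suc (price c')" using au that by (auto simp: auction_def)
      then show ?thesis using that(1,3) g'[OF that(3)] by auto
    qed
  qed auto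
  moreover have "\<forall>c\<in>?X. own c \<noteq> 0" using au by (auto simp: auction_def)
  ultimately show ?thesis by blast
qed

text \<open>
  Every bid raises the sum of the prices, which is bounded; an auction with the largest sum is stuck.
\<close>

lemma stuck_auction_exists:
  assumes fin: "finite R" "finite C"
  shows "\<exists>own price. auction a R C L own price \<and>
    (\<forall>u\<in>R - assigned own C. \<forall>c\<in>C. a u c = 0 \<longrightarrow> price c \<ge> L)"
proof -
  let ?A = "\<lambda>k. \<exists>own price. auction a R C L own price \<and> sum price C = k"
  have bound: "\<forall>k. ?A k \<longrightarrow> k \<le> card C * L"
    by (auto simp: auction_def intro!: sum_bounded_above[of C _ L, simplified])
  have "?A 0" using auction_start[of a R C L] by (intro exI[of _ "\<lambda>c. 0"]) auto
  then obtain k where k: "?A k" "\<forall>k'. ?A k' \<longrightarrow> k' \<le> k"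
    using Nat.ex_has_greatest_nat[of ?A 0 "card C * L"] bound by blast
  then obtain own price where op: "auction a R C L own price" "sum price C = k" by blast
  have "price c \<ge> L" if u: "u \<in> R - assigned own C" "c \<in> C" "a u c = 0" for u c
  proof (rule ccontr)
    assume n: "\<not> price c \<ge> L"
    let ?N = "{c \<in> C. a u c = 0}"
    have N: "finite ?N" "?N \<noteq> {}" using fin u by auto
    obtain b where b: "b \<in> C" "a u b = 0" "\<And>c. \<lbrakk>c \<in> C; a u c = 0\<rbrakk> \<Longrightarrow> price b \<le> price c"
      using arg_min_if_finite(1)[OF N, of price] arg_min_least[OF N, of _ price] by blast
    have "price b < L" using b(3)[OF u(2,3)] n by linarith
    then have au: "auction a R C L (own(b := Suc u)) (price(b := Suc (price b)))"
      using u(1) by (intro auction_bid[OF op(1) _ _ b(1,2)] b(3)) blast+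
    have "sum (price(b := Suc (price b))) C = Suc (price b) + sum price (C - {b})"
      using b(1) fin by (subst sum.remove[of C b]) (auto intro: sum.cong)
    also have "\<dots> = Suc k" using b(1) fin op(2) sum.remove[of C b price] by simp
    finally have "Suc k \<le> k" using k(2) au by blast
    then show False by simp
  qed
  then show ?thesis using op by blast
qed

lemma matching_le_cover:
  assumes M: "M \<subseteq> zero_entries a R C" "inj_on fst M" "inj_on snd M"
    and fin: "finite R" "finite C" and "R1 \<subseteq> R" "C1 \<subseteq> C"
    and cov: "\<forall>(i, j)\<in>zero_entries a R C. i \<in> R1 \<or> j \<in> C1"
  shows "card M \<le> card R1 + card C1"
proof -
  let ?A = "{e \<in> M. fst e \<in> R1}" and ?B = "{e \<in> M. snd e \<in> C1}"
  have f: "finite R1" "finite C1" using assms finite_subset by blast+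
  have M2: "M = ?A \<union> ?B" using M(1) cov by fastforce
  have "card ?A \<le> card R1"
    by (rule card_inj_on_le[of fst]) (use M(2) f in \<open>auto intro: inj_on_subset\<close>)
  moreover have "card ?B \<le> card C1"
    by (rule card_inj_on_le[of snd]) (use M(3) f in \<open>auto intro: inj_on_subset\<close>)
  moreover have "card M \<le> card ?A + card ?B" using card_Un_le[of ?A ?B] M2 by simp
  ultimately show ?thesis by linarith
qed

lemma term_rank_eqI:
  assumes M: "M \<subseteq> zero_entries a R C" "inj_on fst M" "inj_on snd M"
    and fin: "finite R" "finite C" and c: "R1 \<subseteq> R" "C1 \<subseteq> C"
    and cov: "\<forall>(i, j)\<in>zero_entries a R C. i \<in> R1 \<or> j \<in> C1"
    and eq: "card M = card R1 + card C1"
  shows "term_rank a R C = card M"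
  unfolding term_rank_def
proof (rule Max_eqI)
  have "finite (zero_entries a R C)"
    by (rule finite_subset[of _ "R \<times> C"]) (use fin in \<open>auto simp: zero_entries_def\<close>)
  then have "finite {M. M \<subseteq> zero_entries a R C}" by simp
  then show "finite (card ` {M. M \<subseteq> zero_entries a R C \<and> inj_on fst M \<and> inj_on snd M})"
    by (intro finite_imageI) (auto intro: finite_subset)
  show "k \<le> card M" if "k \<in> card ` {M. M \<subseteq> zero_entries a R C \<and> inj_on fst M \<and> inj_on snd M}" for k
    using that matching_le_cover[OF _ _ _ fin c cov] eq by auto
  show "card M \<in> card ` {M. M \<subseteq> zero_entries a R C \<and> inj_on fst M \<and> inj_on snd M}"
    using M by blast
qed

lemma zero_entries_iff: "(i, j) \<in> zero_entries a R C \<longleftrightarrow> i \<in> R \<and> j \<in> C \<and> a i j = 0"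
  by (auto simp: zero_entries_def)

lemma HK_eqI:
  assumes "(R0, C0) \<in> minimum_covers a R C"
    and "\<And>R1 C1. (R1, C1) \<in> minimum_covers a R C \<Longrightarrow> R1 \<subseteq> R0 \<and> C0 \<subseteq> C1"
  shows "HK a R C = (R0, C0)"
  unfolding HK_def
proof (rule the_equality)
  show "case (R0, C0) of (R0, C0) \<Rightarrow> (R0, C0) \<in> minimum_covers a R C \<and>
      (\<forall>(R1, C1)\<in>minimum_covers a R C. R1 \<subseteq> R0 \<and> C0 \<subseteq> C1)"
    using assms by auto
next
  fix x
  assume "case x of (R0, C0) \<Rightarrow> (R0, C0) \<in> minimum_covers a R C \<and>
      (\<forall>(R1, C1)\<in>minimum_covers a R C. R1 \<subseteq> R0 \<and> C0 \<subseteq> C1)"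
  then show "x = (R0, C0)"
    using assms(1) assms(2)[of "fst x" "snd x"] by (cases x) fastforce
qed

text \<open>
  Koenig's theorem, with the extremal cover. The rows outside \<open>assigned own (C - X)\<close> are unmatched or
  own a column of \<open>X\<close>, so that their entries 0 lie in the columns \<open>X\<close>; as all columns of \<open>X\<close> are owned,
  this cover has the size of the matching. Any cover of this size contains exactly one end of every
  matched pair, therefore its columns are closed under alternating paths and contain \<open>X\<close>.
\<close>

lemma minimum_cover_of_closure:
  assumes fin: "finite R" "finite C" and m: "matching a R C own"
    and cl: "alternating_closed a R C own X" and owned: "\<And>c. c \<in> X \<Longrightarrow> own c \<noteq> 0"
    and least: "\<And>Y. alternating_closed a R C own Y \<Longrightarrow> X \<subseteq> Y"
  shows "(assigned own (C - X), X) \<in> minimum_covers a R C \<and>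
    (\<forall>(R1, C1)\<in>minimum_covers a R C. R1 \<subseteq> assigned own (C - X) \<and> X \<subseteq> C1)"
proof -
  let ?Mt = "{c \<in> C. own c \<noteq> 0}"
  let ?M = "(\<lambda>c. (own c - 1, c)) ` ?Mt"
  let ?R0 = "assigned own (C - X)"
  have XC: "X \<subseteq> C" using cl by (simp add: alternating_closed_def)
  have inj: "inj_on (\<lambda>c. own c - 1) ?Mt"
  proof (rule inj_onI)
    fix c c' assume c: "c \<in> ?Mt" "c' \<in> ?Mt" "own c - 1 = own c' - 1"
    then have "own c = own c'" by auto
    with c m show "c = c'" unfolding matching_def by blast
  qed
  have ow: "own c = Suc (own c - 1)" if "c \<in> ?Mt" for c using that by auto
  have R0: "?R0 = (\<lambda>c. own c - 1) ` (?Mt - X)"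
    by (force simp: assigned_def image_iff)
  have M: "?M \<subseteq> zero_entries a R C" "inj_on fst ?M" "inj_on snd ?M" "card ?M = card ?Mt"
  proof -
    show "?M \<subseteq> zero_entries a R C" using matchingD[OF m _ ow] by (auto simp: zero_entries_iff)
    show "inj_on fst ?M" using inj by (auto simp: inj_on_def)
    show "inj_on snd ?M" by (auto simp: inj_on_def)
    show "card ?M = card ?Mt" by (intro card_image) (auto simp: inj_on_def)
  qed
  have "card ?R0 = card (?Mt - X)"
    unfolding R0 by (intro card_image inj_on_subset[OF inj]) auto
  moreover have "X \<subseteq> ?Mt" using XC owned by auto
  ultimately have card: "card ?M = card ?R0 + card X"
    using M(4) fin card_Diff_subset[of X ?Mt] card_mono[of ?Mt X] finite_subset[OF XC] by auto
  have R0R: "?R0 \<subseteq> R" using matchingD[OF m] by (auto simp: assigned_def)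
  have cov: "\<forall>(i, j)\<in>zero_entries a R C. i \<in> ?R0 \<or> j \<in> X"
  proof clarify
    fix i j assume ij: "(i, j) \<in> zero_entries a R C" "j \<notin> X"
    then have ij': "i \<in> R" "j \<in> C" "a i j = 0" by (auto simp: zero_entries_iff)
    then have "i \<in> assigned own C" using cl ij by (auto simp: alternating_closed_def)
    then obtain c where c: "c \<in> C" "own c = Suc i" by (auto simp: assigned_def)
    then have "c \<notin> X" using cl ij ij' by (auto simp: alternating_closed_def)
    then show "i \<in> ?R0" using c by (auto simp: assigned_def)
  qed
  have tr: "term_rank a R C = card ?M"
    by (rule term_rank_eqI[OF M(1-3) fin R0R XC cov card])
  have "R1 \<subseteq> ?R0 \<and> X \<subseteq> C1" if "(R1, C1) \<in> minimum_covers a R C" for R1 C1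
  proof -
    have c1: "R1 \<subseteq> R" "C1 \<subseteq> C" "card R1 + card C1 = card ?Mt"
      and cov1: "\<And>i j. \<lbrakk>i \<in> R; j \<in> C; a i j = 0\<rbrakk> \<Longrightarrow> i \<in> R1 \<or> j \<in> C1"
      using that tr M(4) by (auto simp: minimum_covers_def zero_entries_def)
    have f1: "finite R1" "finite C1" using c1 fin finite_subset by blast+
    let ?B = "?Mt - C1"
    have BR: "(\<lambda>c. own c - 1) ` ?B \<subseteq> R1"
    proof
      fix r assume "r \<in> (\<lambda>c. own c - 1) ` ?B"
      then obtain c where c: "c \<in> ?Mt" "c \<notin> C1" "r = own c - 1" by auto
      then have "own c = Suc r" by auto
      moreover have "c \<in> C" using c(1) by simp
      ultimately have "r \<in> R" "a r c = 0" using matchingD[OF m] by blast+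
      then show "r \<in> R1" using cov1[of r c] c(2) \<open>c \<in> C\<close> by blast
    qed
    have cB: "card ((\<lambda>c. own c - 1) ` ?B) = card ?B"
      by (intro card_image inj_on_subset[OF inj]) auto
    have "card ?Mt = card (?Mt \<inter> C1) + card ?B"
      using fin by (simp add: card_Int_Diff)
    moreover have "card (?Mt \<inter> C1) \<le> card C1" using f1 by (intro card_mono) auto
    moreover have "card ?B \<le> card R1" using card_mono[OF f1(1) BR] cB by simp
    ultimately have eq: "card (?Mt \<inter> C1) = card C1" "card ?B = card R1" using c1(3) by linarith+
    have C1M: "C1 \<subseteq> ?Mt" using card_subset_eq[of C1 "?Mt \<inter> C1"] f1 eq(1) by auto
    have R1B: "(\<lambda>c. own c - 1) ` ?B = R1" using card_subset_eq[OF f1(1) BR] eq(2) cB by simp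
    have "alternating_closed a R C own C1"
      unfolding alternating_closed_def
    proof (intro conjI ballI allI impI)
      show "C1 \<subseteq> C" by fact
      show "c \<in> C1" if u: "u \<in> R - assigned own C" "c \<in> C" "a u c = 0" for u c
      proof -
        have "u \<notin> R1"
        proof
          assume "u \<in> R1"
          then obtain c' where "c' \<in> ?B" "u = own c' - 1" using R1B by blast
          then have "own c' = Suc u" "c' \<in> C" by auto
          then show False using u by (auto simp: assigned_def)
        qed
        then show ?thesis using cov1 u by auto
      qed
      show "c' \<in> C1" if c: "c \<in> C1" "own c = Suc r" "c' \<in> C" "a r c' = 0" for c r c'
      proof -
        have cC: "c \<in> C" using c c1 by auto
        have "r \<notin> R1"
        proof
          assume "r \<in> R1"
          then obtain c2 where "c2 \<in> ?B" "r = own c2 - 1" using R1B by blast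
          then have c2: "own c2 = Suc r" "c2 \<in> C" "c2 \<notin> C1" by auto
          have "c2 = c" using c2(2,1) by (rule matchingD(3)[OF m cC c(2)])
          with c2 show False using c(1) by blast
        qed
        moreover have "r \<in> R" using matchingD(1)[OF m cC c(2)] .
        ultimately show ?thesis using cov1[of r c'] c by blast
      qed
    qed
    then have XC1: "X \<subseteq> C1" by (rule least)
    moreover have "R1 \<subseteq> ?R0" using R1B XC1 R0 by blast
    ultimately show ?thesis by simp
  qed
  moreover have "(?R0, X) \<in> minimum_covers a R C"
    unfolding minimum_covers_def mem_Collect_eq prod.case
    by (intro conjI) (fact R0R, fact XC, simp only: tr card, fact cov)
  ultimately show ?thesis by (intro conjI ballI) (assumption, clarify)
qed

lemma least_alternating_closed:
  assumes "alternating_closed a R C own Z"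
  shows "\<exists>X. alternating_closed a R C own X \<and> (\<forall>Y. alternating_closed a R C own Y \<longrightarrow> X \<subseteq> Y)"
proof -
  define X where "X = \<Inter> {Y. alternating_closed a R C own Y}"
  have cl: "Y \<subseteq> C" "\<And>u c. \<lbrakk>u \<in> R - assigned own C; c \<in> C; a u c = 0\<rbrakk> \<Longrightarrow> c \<in> Y"
    "\<And>c r c'. \<lbrakk>c \<in> Y; own c = Suc r; c' \<in> C; a r c' = 0\<rbrakk> \<Longrightarrow> c' \<in> Y"
    if "alternating_closed a R C own Y" for Y
    using that unfolding alternating_closed_def by blast+
  have "alternating_closed a R C own X"
    unfolding alternating_closed_def
  proof (intro conjI ballI allI impI)
    show "X \<subseteq> C" unfolding X_def using cl(1)[OF assms] assms by blast
    fix u c assume "u \<in> R - assigned own C" "c \<in> C" "a u c = 0"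
    then show "c \<in> X" unfolding X_def using cl(2) by blast
  next
    show "c' \<in> X" if c: "c \<in> X" "own c = Suc r" "c' \<in> C" "a r c' = 0" for c r c'
    unfolding X_def
    proof (rule InterI)
      fix Y assume "Y \<in> {Y. alternating_closed a R C own Y}"
      then show "c' \<in> Y" using c(1)[unfolded X_def] cl(3)[of Y c r c'] c(2-4) by blast
    qed
  qed
  moreover have "X \<subseteq> Y" if "alternating_closed a R C own Y" for Y using that unfolding X_def by blast
  ultimately show ?thesis by blast
qed

text \<open>
  The description in \<open>HK\<close> is meaningful: the pair that it asks for exists.
\<close>

lemma HK_minimum_cover:
  assumes "finite R" "finite C"
  obtains R0 C0 where "HK a R C = (R0, C0)" "(R0, C0) \<in> minimum_covers a R C"
    "\<And>R1 C1. (R1, C1) \<in> minimum_covers a R C \<Longrightarrow> R1 \<subseteq> R0 \<and> C0 \<subseteq> C1"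
proof -
  obtain own price where au: "auction a R C (card R) own price"
    and st: "\<forall>u\<in>R - assigned own C. \<forall>c\<in>C. a u c = 0 \<longrightarrow> price c \<ge> card R"
    using stuck_auction_exists[OF assms] by metis
  then obtain Z where Z: "alternating_closed a R C own Z" "\<forall>c\<in>Z. own c \<noteq> 0"
    using price_gap[OF au assms] by blast
  then obtain X where X: "alternating_closed a R C own X" "\<And>Y. alternating_closed a R C own Y \<Longrightarrow> X \<subseteq> Y"
    using least_alternating_closed by metis
  have "matching a R C own" using au by (simp add: auction_def)
  from minimum_cover_of_closure[OF assms this X(1) _ X(2)] X(2)[OF Z(1)] Z(2)
  have *: "(assigned own (C - X), X) \<in> minimum_covers a R C"
    "\<And>R1 C1. (R1, C1) \<in> minimum_covers a R C \<Longrightarrow> R1 \<subseteq> assigned own (C - X) \<and> X \<subseteq> C1"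
    by blast+
  from HK_eqI[OF *] * that show ?thesis by blast
qed

lemma minimum_coversD:
  assumes "(R0, C0) \<in> minimum_covers a R C"
  shows "R0 \<subseteq> R" "C0 \<subseteq> C" "\<And>i j. \<lbrakk>i \<in> R; j \<in> C; a i j = 0\<rbrakk> \<Longrightarrow> i \<in> R0 \<or> j \<in> C0"
    "card R0 + card C0 = term_rank a R C"
  using assms by (auto simp: minimum_covers_def zero_entries_def)

lemma HK_subset:
  assumes "finite R" "finite C" "HK a R C = (R0, C0)"
  shows "R0 \<subseteq> R" "C0 \<subseteq> C" "\<And>i j. \<lbrakk>i \<in> R; j \<in> C; a i j = 0\<rbrakk> \<Longrightarrow> i \<in> R0 \<or> j \<in> C0"
    "(R0, C0) \<in> minimum_covers a R C"
    "\<And>R1 C1. (R1, C1) \<in> minimum_covers a R C \<Longrightarrow> R1 \<subseteq> R0 \<and> C0 \<subseteq> C1"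
proof -
  obtain R' C' where *: "HK a R C = (R', C')" "(R', C') \<in> minimum_covers a R C"
    "\<And>R1 C1. (R1, C1) \<in> minimum_covers a R C \<Longrightarrow> R1 \<subseteq> R' \<and> C' \<subseteq> C1"
    using HK_minimum_cover[OF assms(1,2)] by metis
  then show "(R0, C0) \<in> minimum_covers a R C"
    "\<And>R1 C1. (R1, C1) \<in> minimum_covers a R C \<Longrightarrow> R1 \<subseteq> R0 \<and> C0 \<subseteq> C1"
    using assms(3) by auto
  then show "R0 \<subseteq> R" "C0 \<subseteq> C" "\<And>i j. \<lbrakk>i \<in> R; j \<in> C; a i j = 0\<rbrakk> \<Longrightarrow> i \<in> R0 \<or> j \<in> C0"
    by (auto dest: minimum_coversD)
qed

section \<open>Column elimination\<close>

text \<open>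
  Clears the other entries of row \<open>i\<close> with the pivot column \<open>b\<close>.
\<close>

definition eliminate :: "nat \<Rightarrow> nat \<Rightarrow> (nat \<Rightarrow> nat \<Rightarrow> real) \<Rightarrow> nat \<Rightarrow> nat \<Rightarrow> real" where
  "eliminate i b M k c = (if c = b then M k c else M k c - M i c / M i b * M k b)"

text \<open>
  The state of the elimination after the rows \<open>E\<close>, with \<open>piv c = Suc r\<close> if \<open>c\<close> is the pivot column of
  row \<open>r\<close> and 0 if \<open>c\<close> has no pivot. Column operations do not change the relations between the rows;
  as only pivot columns are subtracted, this even holds on every set of columns containing them all,
  in particular on the pivot columns alone.
\<close>

definition eliminated ::
    "nat set \<Rightarrow> nat set \<Rightarrow> (nat \<Rightarrow> nat \<Rightarrow> real) \<Rightarrow> nat set \<Rightarrow> (nat \<Rightarrow> nat) \<Rightarrow> (nat \<Rightarrow> nat \<Rightarrow> real) \<Rightarrow> bool"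
where
  "eliminated R D J E piv M \<longleftrightarrow> E \<subseteq> R \<and>
     (\<forall>c\<in>D. \<forall>r. piv c = Suc r \<longrightarrow> r \<in> E \<and> M r c \<noteq> 0 \<and> (\<forall>c'\<in>D. c' \<noteq> c \<longrightarrow> M r c' = 0)) \<and>
     (\<forall>k\<in>E. \<forall>c\<in>D. piv c = 0 \<longrightarrow> M k c = 0) \<and>
     (\<forall>X. {c \<in> D. piv c \<noteq> 0} \<subseteq> X \<longrightarrow> X \<subseteq> D \<longrightarrow> row_relations M R X = row_relations J R X)"

lemma row_relations_cong:
  assumes "\<And>i j. \<lbrakk>i \<in> R; j \<in> C\<rbrakk> \<Longrightarrow> M i j = M' i j"
  shows "row_relations M R C = row_relations M' R C"
  unfolding row_relations_def using assms by (auto cong: sum.cong)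

lemma eliminatedD:
  assumes "eliminated R D J E piv M"
  shows "E \<subseteq> R"
    "\<And>c r. \<lbrakk>c \<in> D; piv c = Suc r\<rbrakk> \<Longrightarrow> r \<in> E"
    "\<And>c r. \<lbrakk>c \<in> D; piv c = Suc r\<rbrakk> \<Longrightarrow> M r c \<noteq> 0"
    "\<And>c r c'. \<lbrakk>c \<in> D; piv c = Suc r; c' \<in> D; c' \<noteq> c\<rbrakk> \<Longrightarrow> M r c' = 0"
    "\<And>k c. \<lbrakk>k \<in> E; c \<in> D; piv c = 0\<rbrakk> \<Longrightarrow> M k c = 0"
    "\<And>X. \<lbrakk>{c \<in> D. piv c \<noteq> 0} \<subseteq> X; X \<subseteq> D\<rbrakk> \<Longrightarrow> row_relations M R X = row_relations J R X"
proof -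
  note a = assms[unfolded eliminated_def]
  show "E \<subseteq> R" using a by (rule conjunct1)
  note p = a[THEN conjunct2, THEN conjunct1]
  show "\<And>c r. \<lbrakk>c \<in> D; piv c = Suc r\<rbrakk> \<Longrightarrow> r \<in> E"
    "\<And>c r. \<lbrakk>c \<in> D; piv c = Suc r\<rbrakk> \<Longrightarrow> M r c \<noteq> 0"
    "\<And>c r c'. \<lbrakk>c \<in> D; piv c = Suc r; c' \<in> D; c' \<noteq> c\<rbrakk> \<Longrightarrow> M r c' = 0"
    using p by blast+
  show "\<And>k c. \<lbrakk>k \<in> E; c \<in> D; piv c = 0\<rbrakk> \<Longrightarrow> M k c = 0"
    using a[THEN conjunct2, THEN conjunct2, THEN conjunct1] by blast
  show "\<And>X. \<lbrakk>{c \<in> D. piv c \<noteq> 0} \<subseteq> X; X \<subseteq> D\<rbrakk> \<Longrightarrow> row_relations M R X = row_relations J R X"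
    using a[THEN conjunct2, THEN conjunct2, THEN conjunct2] by (elim allE impE)
qed

lemma eliminated_start: "eliminated R D J {} (\<lambda>c. 0) J"
  by (simp add: eliminated_def)

lemma eliminated_cong:
  assumes "\<And>c. c \<in> D \<Longrightarrow> piv c = piv' c" "\<And>k c. \<lbrakk>k \<in> R; c \<in> D\<rbrakk> \<Longrightarrow> M k c = M' k c"
    and e: "eliminated R D J E piv M"
  shows "eliminated R D J E piv' M'"
  unfolding eliminated_def
proof (intro conjI ballI allI impI)
  note D = eliminatedD[OF e]
  show "E \<subseteq> R" by (fact D(1))
  fix c r assume c: "c \<in> D" "piv' c = Suc r"
  then have p: "piv c = Suc r" using assms(1) by simp
  show "r \<in> E" using D(2) c(1) p .
  then have "r \<in> R" using D(1) by blast
  show "M' r c \<noteq> 0" using D(3)[OF c(1) p] assms(2)[OF \<open>r \<in> R\<close> c(1)] by simp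
  show "M' r c' = 0" if "c' \<in> D" "c' \<noteq> c" for c'
    using D(4)[OF c(1) p that] assms(2)[OF \<open>r \<in> R\<close> that(1)] by simp
next
  fix k c assume "k \<in> E" "c \<in> D" "piv' c = 0"
  then show "M' k c = 0" using eliminatedD(1,5)[OF e] assms(1,2) by (metis subsetD)
next
  fix X assume X: "{c \<in> D. piv' c \<noteq> 0} \<subseteq> X" "X \<subseteq> D"
  then have "{c \<in> D. piv c \<noteq> 0} \<subseteq> X" using assms(1) by auto
  moreover have "row_relations M' R X = row_relations M R X"
    by (rule row_relations_cong) (use X assms(2) in auto)
  ultimately show "row_relations M' R X = row_relations J R X"
    using eliminatedD(6)[OF e _ X(2)] by simp
qed

lemma eliminated_skip:
  assumes e: "eliminated R D J E piv M" and "i \<in> R" "\<And>c. \<lbrakk>c \<in> D; piv c = 0\<rbrakk> \<Longrightarrow> M i c = 0"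
  shows "eliminated R D J (insert i E) piv M"
proof -
  note D = eliminatedD[OF e]
  show ?thesis
    unfolding eliminated_def
    by (intro conjI ballI allI impI) (use D(1) assms(2) in blast, use D(2) in blast, use D(3) in blast,
      use D(4) in blast, use D(5) assms(3) in blast, rule D(6))
qed

lemma eliminated_pivot:
  assumes e: "eliminated R D J E piv M" and "finite R" and i: "i \<in> R" "i \<notin> E"
    and b: "b \<in> D" "piv b = 0" "M i b \<noteq> 0"
  shows "eliminated R D J (insert i E) (piv(b := Suc i)) (eliminate i b M)"
  unfolding eliminated_def
proof (intro conjI ballI allI impI)
  note D = eliminatedD[OF e]
  have E0: "eliminate i b M k c = M k c" if "k \<in> E" for k c
    using D(5)[OF that b(1,2)] by (simp add: eliminate_def)
  have I0: "eliminate i b M i c = 0" if "c \<noteq> b" for c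
    using b(3) that by (simp add: eliminate_def)
  show "insert i E \<subseteq> R" using D(1) i by blast
  {
    fix c r assume c: "c \<in> D" "(piv(b := Suc i)) c = Suc r"
    show "r \<in> insert i E" using c D(2) by (auto split: if_splits)
    show "eliminate i b M r c \<noteq> 0"
    proof (cases "c = b")
      case True
      then show ?thesis using c b(3) by (simp add: eliminate_def)
    next
      case False
      then have "piv c = Suc r" using c(2) by simp
      then show ?thesis using E0[OF D(2)] D(3) c(1) by metis
    qed
    show "eliminate i b M r c' = 0" if "c' \<in> D" "c' \<noteq> c" for c'
      using c D(2,4) E0 I0 that by (cases "c = b") auto
  }
  show "eliminate i b M k c = 0" if "k \<in> insert i E" "c \<in> D" "(piv(b := Suc i)) c = 0" for k c
    using that E0 I0 D(5) by (auto split: if_splits)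
  show "row_relations (eliminate i b M) R X = row_relations J R X"
    if X: "{c \<in> D. (piv(b := Suc i)) c \<noteq> 0} \<subseteq> X" "X \<subseteq> D" for X
  proof -
    have bX: "b \<in> X" using X b by auto
    have s: "(\<Sum>k\<in>R. w k * eliminate i b M k c) =
        (if c = b then (\<Sum>k\<in>R. w k * M k b)
         else (\<Sum>k\<in>R. w k * M k c) - M i c / M i b * (\<Sum>k\<in>R. w k * M k b))" for w c
      by (simp add: eliminate_def algebra_simps sum_subtractf sum_distrib_left)
    have "row_relations (eliminate i b M) R X = row_relations M R X"
    proof -
      have "(\<forall>c\<in>X. (\<Sum>k\<in>R. w k * eliminate i b M k c) = 0) \<longleftrightarrow> (\<forall>c\<in>X. (\<Sum>k\<in>R. w k * M k c) = 0)" for w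
      proof
        assume h: "\<forall>c\<in>X. (\<Sum>k\<in>R. w k * eliminate i b M k c) = 0"
        then have 0: "(\<Sum>k\<in>R. w k * M k b) = 0" using bX s[of w b] by simp
        show "\<forall>c\<in>X. (\<Sum>k\<in>R. w k * M k c) = 0"
        proof
          fix c assume "c \<in> X"
          with h have "(\<Sum>k\<in>R. w k * eliminate i b M k c) = 0" by blast
          then show "(\<Sum>k\<in>R. w k * M k c) = 0" unfolding s using 0 by (simp split: if_splits)
        qed
      next
        assume h: "\<forall>c\<in>X. (\<Sum>k\<in>R. w k * M k c) = 0"
        then have 0: "(\<Sum>k\<in>R. w k * M k b) = 0" using bX by blast
        show "\<forall>c\<in>X. (\<Sum>k\<in>R. w k * eliminate i b M k c) = 0" unfolding s 0 using h by simp
      qed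
      then show ?thesis unfolding row_relations_def by simp
    qed
    also have "\<dots> = row_relations J R X"
      by (rule D(6)) (use X b in \<open>auto split: if_splits\<close>)
    finally show ?thesis .
  qed
qed

lemma eliminated_exists:
  assumes "finite R" "finite D"
  shows "\<exists>piv M. eliminated R D J R piv M"
proof -
  have "\<exists>piv M. eliminated R D J E piv M" if "finite E" "E \<subseteq> R" for E
    using that
  proof (induction E rule: finite_induct)
    case empty
    then show ?case using eliminated_start by blast
  next
    case (insert i E)
    then obtain piv M where e: "eliminated R D J E piv M" by blast
    show ?case
    proof (cases "\<exists>b\<in>D. piv b = 0 \<and> M i b \<noteq> 0")
      case True
      then show ?thesis using eliminated_pivot[OF e assms(1)] insert by blast
    next
      case False
      then show ?thesis using eliminated_skip[OF e] insert by blast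
    qed
  qed
  then show ?thesis using assms by blast
qed

lemma related_rowsD: "\<lbrakk>related_rows J R C = {}; w \<in> row_relations J R C\<rbrakk> \<Longrightarrow> w i = 0"
  by (auto simp: related_rows_def row_relations_def)

definition pivotless :: "nat set \<Rightarrow> nat set \<Rightarrow> (nat \<Rightarrow> nat) \<Rightarrow> nat set" where
  "pivotless R D piv = {i \<in> R. \<forall>c\<in>D. piv c \<noteq> Suc i}"

text \<open>
  In the final matrix a row with a pivot vanishes outside its pivot column. Hence a relation is
  determined by its coefficients on the rows without pivot, and these are arbitrary: the coefficient of
  the row with pivot column \<open>c\<close> has to cancel the contribution of the pivotless rows to column \<open>c\<close>.
\<close>

lemma related_rows_eliminated:
  assumes fin: "finite R" and e: "eliminated R D J R piv M"
  shows "related_rows J R D = {i \<in> R. \<forall>c\<in>D. piv c = Suc i \<longrightarrow> (\<exists>k\<in>pivotless R D piv. M k c \<noteq> 0)}"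
proof -
  note D = eliminatedD[OF e]
  let ?N = "pivotless R D piv"
  have rel: "row_relations J R D = row_relations M R D" using D(6)[of D] by auto
  have finN: "finite ?N" using fin by (simp add: pivotless_def)
  \<comment> \<open>A pivot column meets no other row with a pivot.\<close>
  have col: "(\<Sum>k\<in>R. w k * M k c) = w r * M r c + (\<Sum>k\<in>?N. w k * M k c)"
    if c: "c \<in> D" "piv c = Suc r" for w c r
  proof -
    have r: "r \<in> R" "r \<notin> ?N" using D(2) c by (auto simp: pivotless_def)
    have "(\<Sum>k\<in>R. w k * M k c) = (\<Sum>k\<in>insert r ?N. w k * M k c)"
    proof (rule sum.mono_neutral_right)
      show "insert r ?N \<subseteq> R" using r by (auto simp: pivotless_def)
      show "\<forall>k\<in>R - insert r ?N. w k * M k c = 0"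
      proof
        fix k assume k: "k \<in> R - insert r ?N"
        then obtain c' where "c' \<in> D" "piv c' = Suc k" by (auto simp: pivotless_def)
        moreover have "c \<noteq> c'" using k calculation(2) c(2) by auto
        ultimately have "M k c = 0" using D(4) c(1) by blast
        then show "w k * M k c = 0" by simp
      qed
    qed (use fin in auto)
    then show ?thesis using r finN by simp
  qed
  have ker: "\<exists>w\<in>row_relations J R D. \<forall>i. i \<in> R \<longrightarrow> w i = (if i = k then 1 else
      if i \<in> ?N then 0 else (let c = (THE c. c \<in> D \<and> piv c = Suc i) in - M k c / M i c))"
    if k: "k \<in> ?N" for k
  proof -
    define w where "w i = (if i \<notin> R then 0 else if i = k then 1 else if i \<in> ?N then 0 else
      (let c = (THE c. c \<in> D \<and> piv c = Suc i) in - M k c / M i c))" for i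
    have "(\<Sum>i\<in>R. w i * M i c) = 0" if c: "c \<in> D" for c
    proof (cases "piv c")
      case 0
      then have "\<forall>i\<in>R. M i c = 0" using D(5) c by blast
      then show ?thesis by simp
    next
      case (Suc r)
      have r: "r \<in> R" "r \<notin> ?N" using D(2) c Suc by (auto simp: pivotless_def)
      have "(THE c. c \<in> D \<and> piv c = Suc r) = c"
        using D(3,4) c Suc by (intro the_equality) blast+
      then have "w r = - M k c / M r c" using r k by (auto simp: w_def)
      moreover have "(\<Sum>i\<in>?N. w i * M i c) = (\<Sum>i\<in>?N. if i = k then M k c else 0)"
        by (rule sum.cong) (auto simp: w_def pivotless_def)
      moreover have "\<dots> = M k c" using k finN by simp
      ultimately show ?thesis unfolding col[OF c Suc] using D(3)[OF c Suc] by simp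
    qed
    then have "w \<in> row_relations M R D" by (auto simp: row_relations_def w_def)
    then show ?thesis unfolding rel by (intro bexI[of _ w]) (auto simp: w_def)
  qed
  show ?thesis
  proof (intro equalityI subsetI)
    fix i assume "i \<in> related_rows J R D"
    then obtain w where i: "i \<in> R" and w: "w \<in> row_relations M R D" "w i \<noteq> 0"
      unfolding related_rows_def rel by blast
    have "\<exists>k\<in>?N. M k c \<noteq> 0" if c: "c \<in> D" "piv c = Suc i" for c
    proof (rule ccontr)
      assume "\<not> ?thesis"
      then have "(\<Sum>k\<in>?N. w k * M k c) = 0" by simp
      moreover have "(\<Sum>k\<in>R. w k * M k c) = 0" using w(1) c(1) by (auto simp: row_relations_def)
      ultimately have "w i * M i c = 0" using col[OF c, of w] by simp
      then show False using w(2) D(3)[OF c] by simp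
    qed
    then show "i \<in> {i \<in> R. \<forall>c\<in>D. piv c = Suc i \<longrightarrow> (\<exists>k\<in>?N. M k c \<noteq> 0)}" using i by blast
  next
    fix i assume "i \<in> {i \<in> R. \<forall>c\<in>D. piv c = Suc i \<longrightarrow> (\<exists>k\<in>?N. M k c \<noteq> 0)}"
    then have i: "i \<in> R" and h: "\<And>c. \<lbrakk>c \<in> D; piv c = Suc i\<rbrakk> \<Longrightarrow> \<exists>k\<in>?N. M k c \<noteq> 0" by auto
    show "i \<in> related_rows J R D"
    proof (cases "i \<in> ?N")
      case True
      from ker[OF this] obtain w where w: "w \<in> row_relations J R D" and
        "\<forall>i'. i' \<in> R \<longrightarrow> w i' = (if i' = i then 1 else if i' \<in> ?N then 0
           else (let c = (THE c. c \<in> D \<and> piv c = Suc i') in - M i c / M i' c))" by blast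
      from this(2)[rule_format, OF i] have "w i \<noteq> 0" by simp
      with w i show ?thesis unfolding related_rows_def by blast
    next
      case False
      then obtain c where c: "c \<in> D" "piv c = Suc i" using i by (auto simp: pivotless_def)
      obtain k where k: "k \<in> ?N" "M k c \<noteq> 0" using h[OF c] by blast
      have the: "(THE c. c \<in> D \<and> piv c = Suc i) = c"
        using D(3,4) c by (intro the_equality) blast+
      have "i \<noteq> k" using k(1) False by blast
      from ker[OF k(1)] obtain w where w: "w \<in> row_relations J R D"
        "w i = - M k c / M i c" using i the False \<open>i \<noteq> k\<close> by (auto simp: Let_def)
      have "w i \<noteq> 0" unfolding w(2) using k(2) D(3)[OF c] by simp
      then show ?thesis using i w(1) by (auto simp: related_rows_def)
    qed
  qed
qed

section \<open>Minors\<close>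

lemma sum_sorted_list_nth:
  assumes "finite R"
  shows "(\<Sum>k<card R. f (sorted_list_of_set R ! k)) = (\<Sum>i\<in>R. f i)"
  using assms
  by (intro sum.reindex_bij_betw bij_betw_nth) (auto simp: lessThan_def)

lemma minor_cong:
  assumes "finite R" "finite S" "\<And>i j. \<lbrakk>i \<in> R; j \<in> S\<rbrakk> \<Longrightarrow> M i j = M' i j"
  shows "minor M R S = minor M' R S"
proof -
  have "M (sorted_list_of_set R ! k) (sorted_list_of_set S ! l) =
    M' (sorted_list_of_set R ! k) (sorted_list_of_set S ! l)" if "k < card R" "l < card S" for k l
    using that assms by (metis length_sorted_list_of_set nth_mem set_sorted_list_of_set)
  then show ?thesis unfolding minor_def by (intro arg_cong[where f = det] eq_matI) auto
qed

lemma minor_transpose: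
  assumes "card R = card S"
  shows "minor (\<lambda>i j. M j i) S R = minor M R S"
proof -
  let ?A = "Matrix.mat (card R) (card S) (\<lambda>(k, l). M (sorted_list_of_set R ! k) (sorted_list_of_set S ! l))"
  have "minor (\<lambda>i j. M j i) S R = Determinant.det (transpose_mat ?A)"
    unfolding minor_def by (rule arg_cong[where f = det], rule eq_matI) auto
  also have "\<dots> = Determinant.det ?A"
    by (rule det_transpose[of _ "card R"]) (auto simp: assms)
  finally show ?thesis by (simp add: minor_def)
qed

text \<open>
  This lets all arguments about minors be carried out with relations between rows, for which the order
  of rows and columns in a determinant is irrelevant.
\<close>

lemma minor_nonzero_iff:
  assumes fin: "finite R" "finite S" and card: "card R = card S"
  shows "minor M R S \<noteq> 0 \<longleftrightarrow> related_rows M R S = {}"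
proof -
  let ?rs = "sorted_list_of_set R" and ?ss = "sorted_list_of_set S" and ?n = "card R"
  let ?A = "Matrix.mat ?n ?n (\<lambda>(k, l). M (?rs ! l) (?ss ! k))"
  have "minor M R S = minor (\<lambda>i j. M j i) S R" using minor_transpose[OF card] by simp
  also have "\<dots> = Determinant.det ?A" by (simp add: minor_def card)
  finally have det: "minor M R S = Determinant.det ?A" .
  have A: "?A \<in> carrier_mat ?n ?n" by simp
  have prod: "(?A *\<^sub>v v) $ k = (\<Sum>l<?n. v $ l * M (?rs ! l) (?ss ! k))"
    if "v \<in> carrier_vec ?n" "k < ?n" for v k
    using that by (auto simp: scalar_prod_def lessThan_atLeast0 mult.commute intro!: sum.cong)
  have rs: "length ?rs = ?n" "set ?rs = R" "distinct ?rs" and ss: "length ?ss = ?n" "set ?ss = S"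
    using fin card by auto
  have "Determinant.det ?A = 0 \<longleftrightarrow> related_rows M R S \<noteq> {}"
  proof
    assume "Determinant.det ?A = 0"
    then obtain v where v: "v \<in> carrier_vec ?n" "v \<noteq> 0\<^sub>v ?n" "?A *\<^sub>v v = 0\<^sub>v ?n"
      using det_0_iff_vec_prod_zero_field[OF A] by blast
    define w where "w i = (if i \<in> R then v $ (THE l. l < ?n \<and> ?rs ! l = i) else 0)" for i
    have wv: "w (?rs ! l) = v $ l" if "l < ?n" for l
    proof -
      have "(THE l'. l' < ?n \<and> ?rs ! l' = ?rs ! l) = l"
        using that rs by (intro the_equality) (auto simp: nth_eq_iff_index_eq)
      moreover have "?rs ! l \<in> R" using that rs nth_mem by metis
      ultimately show ?thesis by (simp add: w_def)
    qed
    have "(\<Sum>i\<in>R. w i * M i j) = 0" if "j \<in> S" for j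
    proof -
      have "j \<in> set ?ss" using that fin by simp
      then obtain k where k: "k < ?n" "j = ?ss ! k" unfolding in_set_conv_nth ss(1) by blast
      have "(\<Sum>i\<in>R. w i * M i j) = (\<Sum>l<?n. w (?rs ! l) * M (?rs ! l) j)"
        using sum_sorted_list_nth[OF fin(1), of "\<lambda>i. w i * M i j"] by simp
      also have "\<dots> = (?A *\<^sub>v v) $ k" using prod[OF v(1) k(1)] wv k by simp
      also have "\<dots> = 0" using v(3) k by simp
      finally show ?thesis .
    qed
    then have w: "w \<in> row_relations M R S" by (auto simp: row_relations_def w_def)
    obtain l where l: "l < ?n" "v $ l \<noteq> 0" using v(1,2) by (metis carrier_vecD eq_vecI index_zero_vec)
    have "?rs ! l \<in> R" using l rs nth_mem by metis
    moreover have "w (?rs ! l) \<noteq> 0" using wv l by simp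
    ultimately have "?rs ! l \<in> related_rows M R S" using w unfolding related_rows_def by blast
    then show "related_rows M R S \<noteq> {}" by blast
  next
    assume "related_rows M R S \<noteq> {}"
    then obtain w i where w: "w \<in> row_relations M R S" "i \<in> R" "w i \<noteq> 0"
      by (auto simp: related_rows_def)
    define v where "v = Matrix.vec ?n (\<lambda>l. w (?rs ! l))"
    have v: "v \<in> carrier_vec ?n" by (simp add: v_def)
    have "?A *\<^sub>v v = 0\<^sub>v ?n"
    proof (rule eq_vecI)
      fix k assume "k < dim_vec (0\<^sub>v ?n :: real Matrix.vec)"
      then have k: "k < ?n" by simp
      have "?ss ! k \<in> S" using k ss nth_mem by metis
      have "(?A *\<^sub>v v) $ k = (\<Sum>l<?n. w (?rs ! l) * M (?rs ! l) (?ss ! k))"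
        unfolding prod[OF v k] by (auto simp: v_def)
      also have "\<dots> = 0"
        using w(1) \<open>?ss ! k \<in> S\<close> sum_sorted_list_nth[OF fin(1), of "\<lambda>i. w i * M i (?ss ! k)"]
        by (simp add: row_relations_def)
      finally show "(?A *\<^sub>v v) $ k = 0\<^sub>v ?n $ k" using k by simp
    qed simp
    moreover obtain l where "l < ?n" "?rs ! l = i" using w(2) rs by (metis in_set_conv_nth)
    then have "v \<noteq> 0\<^sub>v ?n" using w(3) by (auto simp: v_def dest: arg_cong[where f = "\<lambda>v. v $ l"])
    ultimately show "Determinant.det ?A = 0" using det_0_iff_vec_prod_zero_field[OF A] v by blast
  qed
  then show ?thesis using det by simp
qed

lemma eliminated_independent:
  assumes fin: "finite R" "finite D" and e: "eliminated R D J R piv M" and "related_rows J R D = {}"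
  shows "card {c \<in> D. piv c \<noteq> 0} = card R" "minor J R {c \<in> D. piv c \<noteq> 0} \<noteq> 0"
proof -
  note D = eliminatedD[OF e]
  let ?Y = "{c \<in> D. piv c \<noteq> 0}"
  have sel: "\<exists>c\<in>D. piv c = Suc i" if "i \<in> R" for i
    using assms(4) that unfolding related_rows_eliminated[OF fin(1) e] by (auto)
  have "bij_betw (\<lambda>c. piv c - 1) ?Y R"
  proof (rule bij_betwI')
    fix c c' assume c: "c \<in> ?Y" "c' \<in> ?Y"
    show "(piv c - 1 = piv c' - 1) = (c = c')"
    proof
      assume "piv c - 1 = piv c' - 1"
      then have "piv c = Suc (piv c - 1)" "piv c' = Suc (piv c - 1)" using c by auto
      then show "c = c'" using D(3,4) c by blast
    qed simp
  next
    fix c assume c: "c \<in> ?Y"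
    then have "piv c = Suc (piv c - 1)" by auto
    then show "piv c - 1 \<in> R" using D(2) c by blast
  next
    fix i assume "i \<in> R"
    then obtain c where "c \<in> D" "piv c = Suc i" using sel by blast
    then show "\<exists>c\<in>?Y. i = piv c - 1" by (intro bexI[of _ c]) auto
  qed
  then show card: "card ?Y = card R" by (rule bij_betw_same_card)
  have "w i = 0" if w: "w \<in> row_relations J R ?Y" for w i
  proof (cases "i \<in> R")
    case True
    then obtain c where c: "c \<in> D" "piv c = Suc i" using sel by blast
    have "w \<in> row_relations M R ?Y" using w D(6)[of ?Y] by auto
    then have "(\<Sum>k\<in>R. w k * M k c) = 0" using c by (auto simp: row_relations_def)
    moreover have "(\<Sum>k\<in>R. w k * M k c) = (\<Sum>k\<in>R. if k = i then w i * M i c else 0)"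
    proof (rule sum.cong)
      fix k assume k: "k \<in> R"
      show "w k * M k c = (if k = i then w i * M i c else 0)"
      proof (cases "k = i")
        case False
        obtain c' where c': "c' \<in> D" "piv c' = Suc k" using sel k by blast
        then have "c \<noteq> c'" using c False by auto
        then have "M k c = 0" using D(4)[OF c'] c by blast
        then show ?thesis using False by simp
      qed simp
    qed simp
    ultimately have "w i * M i c = 0" using True fin by simp
    then show ?thesis using D(3)[OF c] by simp
  next
    case False
    then show ?thesis using w by (auto simp: row_relations_def)
  qed
  then have "related_rows J R ?Y = {}" by (auto simp: related_rows_def)
  then show "minor J R ?Y \<noteq> 0" using minor_nonzero_iff[OF fin(1) _ card[symmetric]] fin by simp
qed

lemma independent_minor_exists:
  assumes "finite R" "finite D" "related_rows J R D = {}"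
  shows "\<exists>Y. Y \<subseteq> D \<and> card Y = card R \<and> minor J R Y \<noteq> 0"
proof -
  obtain piv M where e: "eliminated R D J R piv M" using eliminated_exists[OF assms(1,2)] by blast
  have "{c \<in> D. piv c \<noteq> 0} \<subseteq> D" by blast
  with eliminated_independent[OF assms(1,2) e assms(3)] show ?thesis by (intro exI conjI)
qed

text \<open>
  Minors agree if the terms of their Leibniz expansions do.
\<close>

lemma minor_eqI:
  assumes fin: "finite R" "finite S" and card: "card R = card S"
    and eq: "\<And>\<sigma>. bij_betw \<sigma> R S \<Longrightarrow> (\<Prod>i\<in>R. M i (\<sigma> i)) = (\<Prod>i\<in>R. M' i (\<sigma> i))"
  shows "minor M R S = minor M' R S"
proof -
  let ?rs = "sorted_list_of_set R" and ?ss = "sorted_list_of_set S" and ?n = "card R"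
  have rs: "length ?rs = ?n" "set ?rs = R" "distinct ?rs" using fin by simp_all
  have ss: "length ?ss = ?n" "set ?ss = S" "distinct ?ss" using fin by (simp_all add: card)
  have br: "bij_betw ((!) ?rs) {0..<?n} R"
    by (rule bij_betw_nth) (simp_all add: fin lessThan_atLeast0)
  have bs: "bij_betw ((!) ?ss) {0..<?n} S"
    by (rule bij_betw_nth) (simp_all add: fin card lessThan_atLeast0)
  have "(\<Prod>k = 0..<?n. M (?rs ! k) (?ss ! p k)) = (\<Prod>k = 0..<?n. M' (?rs ! k) (?ss ! p k))"
    if p: "p permutes {0..<?n}" for p
  proof -
    define g where "g = inv_into {0..<?n} ((!) ?rs)"
    define \<sigma> where "\<sigma> = (!) ?ss \<circ> p \<circ> g"
    have "bij_betw g R {0..<?n}" unfolding g_def by (rule bij_betw_inv_into[OF br])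
    then have b: "bij_betw \<sigma> R S" unfolding \<sigma>_def
      using permutes_imp_bij[OF p] bs by (intro bij_betw_trans)
    have gk: "g (?rs ! k) = k" if "k \<in> {0..<?n}" for k
      unfolding g_def using bij_betw_inv_into_left[OF br that] .
    have "(\<Prod>k = 0..<?n. N (?rs ! k) (?ss ! p k)) = (\<Prod>i\<in>R. N i (\<sigma> i))" for N :: "nat \<Rightarrow> nat \<Rightarrow> real"
    proof -
      have "(\<Prod>i\<in>R. N i (\<sigma> i)) = (\<Prod>k = 0..<?n. N (?rs ! k) (\<sigma> (?rs ! k)))"
        by (rule prod.reindex_bij_betw[OF br, symmetric])
      also have "\<dots> = (\<Prod>k = 0..<?n. N (?rs ! k) (?ss ! p k))"
        using gk by (intro prod.cong) (auto simp: \<sigma>_def)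
      finally show ?thesis by simp
    qed
    then show ?thesis using eq[OF b] by simp
  qed
  then show ?thesis
    unfolding minor_def Determinant.det_def
    by (auto simp: card permutes_in_image intro!: sum.cong arg_cong2[where f = "(*)"] prod.cong)
qed

section \<open>Regular systems are block triangular\<close>

definition admissible :: "nat \<Rightarrow> (nat \<Rightarrow> nat \<Rightarrow> ereal) \<Rightarrow> (nat \<Rightarrow> nat \<Rightarrow> real) \<Rightarrow> nat set \<Rightarrow> bool" where
  "admissible n a J I \<longleftrightarrow> finite I \<and>
     (\<forall>i\<in>I. \<forall>j<n. (a i j = -\<infinity> \<and> J i j = 0) \<or> (\<exists>k. a i j = ereal (real k)))"

text \<open>
  The matrix whose minors replace \<open>nabla\<close> when the Jacobi number is 0.
\<close>

definition order_zero_part :: "(nat \<Rightarrow> nat \<Rightarrow> ereal) \<Rightarrow> (nat \<Rightarrow> nat \<Rightarrow> real) \<Rightarrow> nat \<Rightarrow> nat \<Rightarrow> real" where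
  "order_zero_part a J i j = (if a i j = 0 then J i j else 0)"

text \<open>
  Together with the existence of a transversal of zeros this says that the Jacobi number is 0. The
  transversal is supplied by a nonzero minor of \<open>order_zero_part\<close>.
\<close>

definition no_positive_transversal :: "(nat \<Rightarrow> nat \<Rightarrow> ereal) \<Rightarrow> nat set \<Rightarrow> nat set \<Rightarrow> bool" where
  "no_positive_transversal a I Y \<longleftrightarrow>
     (\<forall>\<sigma>. bij_betw \<sigma> I Y \<longrightarrow> (\<forall>i\<in>I. a i (\<sigma> i) \<noteq> -\<infinity>) \<longrightarrow> (\<forall>i\<in>I. a i (\<sigma> i) = 0))"

definition regular :: "(nat \<Rightarrow> nat \<Rightarrow> ereal) \<Rightarrow> (nat \<Rightarrow> nat \<Rightarrow> real) \<Rightarrow> nat set \<Rightarrow> nat set \<Rightarrow> bool" where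
  "regular a J I Y \<longleftrightarrow> card I = card Y \<and> no_positive_transversal a I Y \<and>
     minor (order_zero_part a J) I Y \<noteq> 0"

text \<open>
  A subsystem that the algorithm can split off in one call: the conditions on the orders say that the
  columns \<open>C\<close> only contain \<open>-\<infinity>\<close> and 0, with all zeros in the rows \<open>R\<close>.
\<close>

definition good_block ::
    "(nat \<Rightarrow> nat \<Rightarrow> ereal) \<Rightarrow> (nat \<Rightarrow> nat \<Rightarrow> real) \<Rightarrow> nat set \<Rightarrow> nat set \<Rightarrow> nat set \<Rightarrow> bool" where
  "good_block a J I R C \<longleftrightarrow> R \<noteq> {} \<and> R \<subseteq> I \<and> card C = card R \<and> minor J R C \<noteq> 0 \<and>
     (\<forall>j\<in>C. (\<forall>i\<in>R. a i j = 0 \<or> a i j = -\<infinity>) \<and> (\<forall>i\<in>I - R. a i j = -\<infinity>))"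

inductive triangular ::
    "(nat \<Rightarrow> nat \<Rightarrow> ereal) \<Rightarrow> (nat \<Rightarrow> nat \<Rightarrow> real) \<Rightarrow> nat set \<Rightarrow> nat set \<Rightarrow> bool" for a J where
  triangular_empty: "triangular a J {} {}"
| triangular_block: "\<lbrakk>good_block a J I R C; C \<subseteq> Y; triangular a J (I - R) (Y - C)\<rbrakk> \<Longrightarrow> triangular a J I Y"

lemma admissibleD:
  assumes "admissible n a J I"
  shows "finite I"
    "\<And>i j. \<lbrakk>i \<in> I; j < n; a i j = -\<infinity>\<rbrakk> \<Longrightarrow> J i j = 0"
    "\<And>i j. \<lbrakk>i \<in> I; j < n; a i j \<noteq> -\<infinity>\<rbrakk> \<Longrightarrow> \<exists>k. a i j = ereal (real k)"
  using assms by (fastforce simp: admissible_def)+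

lemma admissible_subset: "\<lbrakk>admissible n a J I; I' \<subseteq> I\<rbrakk> \<Longrightarrow> admissible n a J I'"
  by (auto simp: admissible_def intro: finite_subset)

lemma bij_betw_split:
  assumes s: "bij_betw \<sigma> I Y" and "R \<subseteq> I"
  shows "bij_betw \<sigma> R (\<sigma> ` R)" "bij_betw \<sigma> (I - R) (Y - \<sigma> ` R)"
proof -
  show "bij_betw \<sigma> R (\<sigma> ` R)" using assms bij_betw_subset by blast
  have "inj_on \<sigma> I" "\<sigma> ` I = Y" using s by (auto simp: bij_betw_def)
  then have "\<sigma> ` (I - R) = Y - \<sigma> ` R" using inj_on_image_set_diff[of \<sigma> I I R] assms(2) by auto
  then show "bij_betw \<sigma> (I - R) (Y - \<sigma> ` R)" using s bij_betw_subset by (metis Diff_subset)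
qed

text \<open>
  The rows outside \<open>R\<close> have no finite entry in \<open>C\<close>, so that only the rows \<open>R\<close> are left for these columns.
\<close>

lemma transversal_into_block:
  assumes s: "bij_betw \<sigma> I Y" and fin: "finite I" and RC: "R \<subseteq> I" "C \<subseteq> Y" "card C = card R"
    and z: "\<And>i j. \<lbrakk>i \<in> I - R; j \<in> C\<rbrakk> \<Longrightarrow> a i j = -\<infinity>" and f: "\<And>i. i \<in> I \<Longrightarrow> a i (\<sigma> i) \<noteq> (-\<infinity> :: ereal)"
  shows "\<sigma> ` R = C"
proof -
  have inj: "inj_on \<sigma> I" and im: "\<sigma> ` I = Y" using s by (auto simp: bij_betw_def)
  have "C \<subseteq> \<sigma> ` R"
  proof
    fix j assume j: "j \<in> C"
    then obtain i where i: "i \<in> I" "\<sigma> i = j" using RC(2) im by blast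
    have "i \<in> R"
    proof (rule ccontr)
      assume "i \<notin> R"
      then have "a i j = -\<infinity>" using z i(1) j by blast
      then show False using f[OF i(1)] i(2) by simp
    qed
    then show "j \<in> \<sigma> ` R" using i(2) by blast
  qed
  moreover have "finite R" using RC(1) fin by (rule finite_subset)
  moreover have "card (\<sigma> ` R) = card R" using inj RC(1) by (intro card_image) (rule inj_on_subset)
  ultimately show ?thesis using card_subset_eq[of "\<sigma> ` R" C] RC(3) by simp
qed

lemma minor_nonzero_transversal:
  assumes fin: "finite R" "finite S" and card: "card R = card S" and m: "minor M R S \<noteq> 0"
  shows "\<exists>\<sigma>. bij_betw \<sigma> R S \<and> (\<forall>i\<in>R. M i (\<sigma> i) \<noteq> 0)"
proof (rule ccontr)
  assume a: "\<not> ?thesis"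
  have prods: "(\<Prod>i\<in>R. M i (\<sigma> i)) = (\<Prod>i\<in>R. 0)" if b: "bij_betw \<sigma> R S" for \<sigma>
  proof -
    obtain i where "i \<in> R" "M i (\<sigma> i) = 0" using a b by blast
    then have "\<exists>i\<in>R. M i (\<sigma> i) = 0" "\<exists>i\<in>R. (0 :: real) = 0" by blast+
    then show ?thesis by (simp only: prod_zero[OF fin(1)])
  qed
  have eq: "minor M R S = minor (\<lambda>i j. 0) R S" by (rule minor_eqI[OF fin card prods])
  have "R \<noteq> {}"
  proof
    assume "R = {}"
    then have "bij_betw id R S" using card fin by (simp add: bij_betw_def)
    then show False using a \<open>R = {}\<close> by blast
  qed
  then obtain i where i: "i \<in> R" by blast
  let ?w = "\<lambda>k. if k \<in> R then 1 else 0 :: real"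
  have "i \<in> related_rows (\<lambda>i j. 0) R S"
    unfolding related_rows_def mem_Collect_eq
    by (intro conjI bexI[of _ ?w]) (simp_all add: row_relations_def i)
  then have "minor (\<lambda>i j. 0) R S = 0" using minor_nonzero_iff[OF fin card] by blast
  then show False using eq m by simp
qed

lemma zero_transversal:
  assumes "finite I" "finite Y" and r: "regular a J I Y"
  obtains \<sigma> where "bij_betw \<sigma> I Y" "\<And>i. i \<in> I \<Longrightarrow> a i (\<sigma> i) = 0"
proof -
  obtain \<sigma> where s: "bij_betw \<sigma> I Y" "\<And>i. i \<in> I \<Longrightarrow> order_zero_part a J i (\<sigma> i) \<noteq> 0"
    using minor_nonzero_transversal[OF assms(1,2), of "order_zero_part a J"] r
    unfolding regular_def by blast
  have "a i (\<sigma> i) = 0" if "i \<in> I" for i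
    using s(2)[OF that] by (simp add: order_zero_part_def split: if_splits)
  with s(1) show ?thesis by (rule that)
qed

text \<open>
  Restricted to the columns \<open>C\<close>, a relation only involves the rows \<open>R\<close>; it vanishes there, and what is
  left is a relation of the other block.
\<close>

lemma independent_block_union:
  assumes fin: "finite I" and "R \<subseteq> I" "C \<subseteq> Y"
    and z: "\<And>i j. \<lbrakk>i \<in> I - R; j \<in> C\<rbrakk> \<Longrightarrow> M i j = 0"
    and i1: "related_rows M R C = {}" and i2: "related_rows M (I - R) (Y - C) = {}"
  shows "related_rows M I Y = {}"
proof -
  have "w i = 0" if w: "w \<in> row_relations M I Y" and "i \<in> I" for w i
  proof -
    have w0: "w i = 0" if "i \<notin> I" for i using w that by (simp add: row_relations_def)
    have ws: "(\<Sum>i\<in>I. w i * M i j) = 0" if "j \<in> Y" for j using w that by (simp add: row_relations_def)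
    have split: "(\<Sum>i\<in>I. w i * M i j) = (\<Sum>i\<in>I - R. w i * M i j) + (\<Sum>i\<in>R. w i * M i j)" for j
      using sum.subset_diff[OF assms(2) fin] .
    define u where "u k = (if k \<in> R then w k else 0)" for k
    have "(\<Sum>i\<in>R. u i * M i j) = 0" if "j \<in> C" for j
    proof -
      have "(\<Sum>i\<in>I - R. w i * M i j) = 0" by (rule sum.neutral) (simp add: z that)
      then have "(\<Sum>i\<in>R. w i * M i j) = 0" using split[of j] ws[of j] that assms(3) by auto
      moreover have "(\<Sum>i\<in>R. u i * M i j) = (\<Sum>i\<in>R. w i * M i j)" by (intro sum.cong) (auto simp: u_def)
      ultimately show ?thesis by simp
    qed
    then have "u \<in> row_relations M R C" by (simp add: row_relations_def u_def)
    then have u0: "u k = 0" for k by (rule related_rowsD[OF i1])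
    have wR: "w k = 0" if "k \<in> R" for k using u0[of k] that by (simp add: u_def)
    have "(\<Sum>i\<in>I - R. w i * M i j) = 0" if "j \<in> Y - C" for j
      using split[of j] ws[of j] that wR by simp
    then have "w \<in> row_relations M (I - R) (Y - C)" using w0 wR by (auto simp: row_relations_def)
    then show ?thesis by (rule related_rowsD[OF i2])
  qed
  then show ?thesis unfolding related_rows_def by blast
qed

lemma good_blockD:
  assumes "good_block a J I R C"
  shows "R \<noteq> {}" "R \<subseteq> I" "card C = card R" "minor J R C \<noteq> 0"
    "\<And>i j. \<lbrakk>i \<in> R; j \<in> C\<rbrakk> \<Longrightarrow> a i j = 0 \<or> a i j = -\<infinity>"
    "\<And>i j. \<lbrakk>i \<in> I - R; j \<in> C\<rbrakk> \<Longrightarrow> a i j = -\<infinity>"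
  using assms by (auto simp: good_block_def)

lemma good_block_minor:
  assumes "admissible n a J I" "good_block a J I R C" "C \<subseteq> {..<n}"
  shows "minor (order_zero_part a J) R C = minor J R C"
proof (rule minor_cong)
  show "finite R" using assms(1,2) admissibleD(1) good_blockD(2) finite_subset by metis
  show "finite C" using assms(3) finite_subset by blast
  fix i j assume ij: "i \<in> R" "j \<in> C"
  then have "i \<in> I" "j < n" using good_blockD(2)[OF assms(2)] assms(3) by auto
  then show "order_zero_part a J i j = J i j"
    using good_blockD(5)[OF assms(2) ij] admissibleD(2)[OF assms(1)]
    by (auto simp: order_zero_part_def)
qed

text \<open>
  A transversal with finite entries maps \<open>R\<close> onto \<open>C\<close>, where it only meets zeros, and induces a
  transversal of the remaining system; likewise the minor is nonzero as both diagonal blocks are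
  independent.
\<close>

lemma triangular_regular:
  assumes "triangular a J I Y" "admissible n a J I" "Y \<subseteq> {..<n}"
  shows "regular a J I Y"
  using assms
proof (induction rule: triangular.induct)
  case triangular_empty
  have "minor (order_zero_part a J) {} {} \<noteq> 0"
    using minor_nonzero_iff[of "{}" "{}"] by (simp add: related_rows_def)
  then show ?case by (simp add: regular_def no_positive_transversal_def)
next
  case (triangular_block I R C Y)
  note g = good_blockD[OF triangular_block.hyps(1)]
  have CY: "C \<subseteq> Y" by fact
  have fI: "finite I" using triangular_block.prems(1) by (rule admissibleD(1))
  have fY: "finite Y" using triangular_block.prems(2) by (rule finite_subset) simp
  have fin: "finite I" "finite Y" "finite R" "finite C"
    using fI fY finite_subset[OF g(2) fI] finite_subset[OF CY fY] by simp_all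
  have ih: "regular a J (I - R) (Y - C)"
    using triangular_block.prems by (intro triangular_block.IH) (auto intro: admissible_subset)
  have cardR: "card R \<le> card I" "card C \<le> card Y" using fin g(2) CY by (auto intro: card_mono)
  then have card: "card I = card Y"
    using ih g(3) card_Diff_subset[OF fin(3) g(2)] card_Diff_subset[OF fin(4) CY]
    unfolding regular_def by linarith
  have "no_positive_transversal a I Y"
    unfolding no_positive_transversal_def
  proof (intro allI impI ballI)
    fix \<sigma> i assume s: "bij_betw \<sigma> I Y" "\<forall>i\<in>I. a i (\<sigma> i) \<noteq> -\<infinity>" "i \<in> I"
    have im: "\<sigma> ` R = C"
      using transversal_into_block[OF s(1) fin(1) g(2) CY g(3), of a] g(6) s(2) by blast
    show "a i (\<sigma> i) = 0"
    proof (cases "i \<in> R")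
      case True
      then have "\<sigma> i \<in> C" using im by blast
      then show ?thesis using g(5)[OF True] s(2,3) by blast
    next
      case False
      have "bij_betw \<sigma> (I - R) (Y - C)" using bij_betw_split(2)[OF s(1) g(2)] im by simp
      then show ?thesis using ih s(2,3) False unfolding regular_def no_positive_transversal_def by blast
    qed
  qed
  moreover have "minor (order_zero_part a J) I Y \<noteq> 0"
  proof -
    have "minor (order_zero_part a J) R C \<noteq> 0"
      using good_block_minor[OF triangular_block.prems(1) triangular_block.hyps(1)] CY
        triangular_block.prems(2) g(4) by simp
    then have "related_rows (order_zero_part a J) R C = {}"
      using minor_nonzero_iff[OF fin(3,4)] g(3) by simp
    moreover have "related_rows (order_zero_part a J) (I - R) (Y - C) = {}"
      using ih minor_nonzero_iff[of "I - R" "Y - C"] fin unfolding regular_def by simp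
    ultimately have "related_rows (order_zero_part a J) I Y = {}"
      using g(6) by (intro independent_block_union[OF fin(1) g(2) CY]) (simp_all add: order_zero_part_def)
    then show ?thesis using minor_nonzero_iff[OF fin(1,2) card] by simp
  qed
  ultimately show ?case using card by (simp add: regular_def)
qed

lemma no_positive_transversal_block:
  assumes np: "no_positive_transversal a I Y" and s: "bij_betw \<sigma> I Y" "\<And>i. i \<in> I \<Longrightarrow> a i (\<sigma> i) = 0"
    and R: "R \<subseteq> I"
  shows "no_positive_transversal a R (\<sigma> ` R)"
  unfolding no_positive_transversal_def
proof (intro allI impI)
  fix \<tau> assume t: "bij_betw \<tau> R (\<sigma> ` R)" "\<forall>i\<in>R. a i (\<tau> i) \<noteq> -\<infinity>"
  define \<rho> where "\<rho> i = (if i \<in> R then \<tau> i else \<sigma> i)" for i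
  have "bij_betw \<rho> (R \<union> (I - R)) (\<sigma> ` R \<union> (Y - \<sigma> ` R))"
  proof (rule bij_betw_combine)
    show "bij_betw \<rho> R (\<sigma> ` R)" using t(1) by (subst bij_betw_cong[of _ _ \<tau>]) (simp_all add: \<rho>_def)
    show "bij_betw \<rho> (I - R) (Y - \<sigma> ` R)"
      using bij_betw_split(2)[OF s(1) R] by (subst bij_betw_cong[of _ _ \<sigma>]) (simp_all add: \<rho>_def)
  qed blast
  moreover have "R \<union> (I - R) = I" using R by blast
  moreover have "\<sigma> ` R \<union> (Y - \<sigma> ` R) = Y" using R s(1) by (auto simp: bij_betw_def)
  ultimately have "bij_betw \<rho> I Y" by simp
  moreover have "\<forall>i\<in>I. a i (\<rho> i) \<noteq> -\<infinity>" using t(2) s(2) by (simp add: \<rho>_def)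
  ultimately have "\<forall>i\<in>I. a i (\<rho> i) = 0" using np unfolding no_positive_transversal_def by blast
  then have "a i (\<rho> i) = 0" if "i \<in> R" for i using R that by blast
  then show "\<forall>i\<in>R. a i (\<tau> i) = 0" by (simp add: \<rho>_def)
qed

lemma full_matching_bij:
  assumes M: "M \<subseteq> A \<times> B" "inj_on fst M" "inj_on snd M" and fin: "finite A" "finite B"
    and card: "card A = card B" "card A \<le> card M"
  obtains \<tau> where "bij_betw \<tau> A B" "\<And>i. i \<in> A \<Longrightarrow> (i, \<tau> i) \<in> M"
proof -
  have "fst ` M = A" using M(1,2) fin(1) card by (intro card_seteq) (auto simp: card_image)
  then have f: "bij_betw fst M A" using M(2) by (simp add: bij_betw_def)
  have "snd ` M = B" using M(1,3) fin(2) card by (intro card_seteq) (auto simp: card_image)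
  then have s: "bij_betw snd M B" using M(3) by (simp add: bij_betw_def)
  let ?g = "inv_into M fst"
  have g: "bij_betw ?g A M" using f by (rule bij_betw_inv_into)
  show ?thesis
  proof (rule that)
    show "bij_betw (snd \<circ> ?g) A B" using g s by (rule bij_betw_trans)
    fix i assume i: "i \<in> A"
    have "?g i \<in> M" using g i by (auto simp: bij_betw_def)
    moreover have "fst (?g i) = i" using f i by (simp add: bij_betw_inv_into_right)
    ultimately show "(i, (snd \<circ> ?g) i) \<in> M" by (metis comp_apply prod.collapse)
  qed
qed

text \<open>
  If all finite entries are 0, the whole system is a block. Otherwise let the entry at \<open>(i1, j1)\<close> be
  positive. There is no transversal with finite entries of the other rows and columns, for it would be
  completed by \<open>(i1, j1)\<close>. By Koenig's theorem for the finite entries there are then rows \<open>T\<close> whose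
  finite entries are in as many columns only, which are therefore the columns \<open>\<sigma> ` T\<close>. The other rows
  form a smaller system in whose columns the rows \<open>T\<close> are \<open>-\<infinity>\<close>, and induction applies to it.
\<close>

lemma terminal_block_exists:
  assumes "finite I" "I \<noteq> {}" "bij_betw \<sigma> I Y" "\<And>i. i \<in> I \<Longrightarrow> a i (\<sigma> i) = 0" "no_positive_transversal a I Y"
  shows "\<exists>R\<subseteq>I. R \<noteq> {} \<and> (\<forall>j\<in>\<sigma> ` R. (\<forall>i\<in>R. a i j = 0 \<or> a i j = -\<infinity>) \<and> (\<forall>i\<in>I - R. a i j = -\<infinity>))"
  using assms
proof (induction "card I" arbitrary: I Y rule: less_induct)
  case less
  note fin = less.prems(1) and s = less.prems(3) and z = less.prems(4) and np = less.prems(5)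
  have im: "\<sigma> ` I = Y" and inj: "inj_on \<sigma> I" using s by (auto simp: bij_betw_def)
  have finY: "finite Y" using fin im by blast
  have cardIY: "card I = card Y" using s by (rule bij_betw_same_card)
  show ?case
  proof (cases "\<forall>i\<in>I. \<forall>j\<in>Y. a i j = 0 \<or> a i j = -\<infinity>")
    case True
    then show ?thesis using less.prems(2) im by (intro exI[of _ I]) blast
  next
    case False
    then obtain i1 j1 where ij: "i1 \<in> I" "j1 \<in> Y" "a i1 j1 \<noteq> 0" "a i1 j1 \<noteq> -\<infinity>" by blast
    \<comment> \<open>The zeros of \<open>b\<close> are the finite entries of \<open>a\<close>, so that the results on covers apply to them.\<close>
    define b where "b i j = (if a i j = -\<infinity> then 1 else 0 :: ereal)" for i j
    let ?A = "I - {i1}" and ?B = "Y - {j1}"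
    have finAB: "finite ?A" "finite ?B" using fin finY by auto
    have cAB: "card ?A = card I - 1" "card ?B = card I - 1" using ij fin finY cardIY by auto
    have pos: "card I \<ge> 1" using ij(1) fin by (metis One_nat_def Suc_leI card_gt_0_iff empty_iff)
    have tr: "term_rank b ?A ?B < card I - 1"
    proof (rule ccontr)
      assume "\<not> term_rank b ?A ?B < card I - 1"
      moreover have "term_rank b ?A ?B \<in>
          card ` {M. M \<subseteq> zero_entries b ?A ?B \<and> inj_on fst M \<and> inj_on snd M}"
        unfolding term_rank_def
      proof (rule Max_in)
        have "finite (zero_entries b ?A ?B)"
          by (rule finite_subset[of _ "?A \<times> ?B"]) (use finAB in \<open>auto simp: zero_entries_def\<close>)
        then have "finite {M. M \<subseteq> zero_entries b ?A ?B}" by simp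
        then show "finite (card ` {M. M \<subseteq> zero_entries b ?A ?B \<and> inj_on fst M \<and> inj_on snd M})"
          by (intro finite_imageI) (auto intro: finite_subset)
        have "{} \<in> {M. M \<subseteq> zero_entries b ?A ?B \<and> inj_on fst M \<and> inj_on snd M}" by simp
        then show "card ` {M. M \<subseteq> zero_entries b ?A ?B \<and> inj_on fst M \<and> inj_on snd M} \<noteq> {}" by blast
      qed
      ultimately obtain M where M: "M \<subseteq> zero_entries b ?A ?B" "inj_on fst M" "inj_on snd M"
        "card ?A \<le> card M" unfolding cAB by auto
      have "M \<subseteq> ?A \<times> ?B" using M(1) by (auto simp: zero_entries_def)
      from full_matching_bij[OF this M(2,3) finAB _ M(4)] cAB obtain \<tau> where
        t: "bij_betw \<tau> ?A ?B" "\<And>i. i \<in> ?A \<Longrightarrow> (i, \<tau> i) \<in> M" by auto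
      define \<rho> where "\<rho> i = (if i = i1 then j1 else \<tau> i)" for i
      have "bij_betw \<rho> ({i1} \<union> ?A) ({j1} \<union> ?B)"
      proof (rule bij_betw_combine)
        show "bij_betw \<rho> {i1} {j1}" by (simp add: \<rho>_def bij_betw_def)
        show "bij_betw \<rho> ?A ?B" using t(1) by (subst bij_betw_cong[of _ _ \<tau>]) (simp_all add: \<rho>_def)
      qed blast
      moreover have "{i1} \<union> ?A = I" "{j1} \<union> ?B = Y" using ij by blast+
      ultimately have "bij_betw \<rho> I Y" by simp
      moreover have "\<forall>i\<in>I. a i (\<rho> i) \<noteq> -\<infinity>"
      proof
        fix i assume "i \<in> I"
        show "a i (\<rho> i) \<noteq> -\<infinity>"
        proof (cases "i = i1")
          case True
          then show ?thesis using ij by (simp add: \<rho>_def)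
        next
          case False
          then have "(i, \<tau> i) \<in> zero_entries b ?A ?B" using t(2) M(1) \<open>i \<in> I\<close> by blast
          then show ?thesis using False by (auto simp: \<rho>_def zero_entries_def b_def split: if_splits)
        qed
      qed
      ultimately have "a i1 (\<rho> i1) = 0" using np ij(1) unfolding no_positive_transversal_def by blast
      then show False using ij(3) by (simp add: \<rho>_def)
    qed
    obtain R1 C1 where "HK b ?A ?B = (R1, C1)" by fastforce
    note rc = HK_subset(4)[OF finAB this]
    note rc' = minimum_coversD[OF rc]
    let ?P = "?A - R1" and ?Q = "?B - C1"
    have PQ: "a i j = -\<infinity>" if "i \<in> ?P" "j \<in> ?Q" for i j
      using rc'(3)[of i j] that by (cases "a i j = -\<infinity>") (auto simp: b_def)
    have "finite R1" "finite C1" using rc'(1,2) finAB finite_subset by blast+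
    then have "card ?P = card I - 1 - card R1" "card ?Q = card I - 1 - card C1"
      using rc'(1,2) cAB by (simp_all add: card_Diff_subset)
    then have big: "card ?P + card ?Q \<ge> card I" using rc'(4) tr pos by linarith
    have disj: "\<sigma> ` ?P \<inter> ?Q = {}"
    proof -
      have "a i (\<sigma> i) = 0" if "i \<in> ?P" for i using z that by blast
      then show ?thesis using PQ by fastforce
    qed
    have injP: "inj_on \<sigma> ?P" using inj by (rule inj_on_subset) blast
    have "card (\<sigma> ` ?P \<union> ?Q) = card ?P + card ?Q"
      using disj finAB card_image[OF injP] by (subst card_Un_disjoint) auto
    moreover have sub: "\<sigma> ` ?P \<union> ?Q \<subseteq> Y" using im by blast
    ultimately have eq: "\<sigma> ` ?P \<union> ?Q = Y" using big cardIY by (intro card_seteq[OF finY sub]) simp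
    let ?I = "I - ?P"
    have imI: "\<sigma> ` ?I = ?Q"
    proof -
      have "?P \<subseteq> I" by blast
      have "\<sigma> ` ?I = \<sigma> ` I - \<sigma> ` ?P"
        by (rule inj_on_image_set_diff[OF inj Diff_subset \<open>?P \<subseteq> I\<close>])
      also have "\<dots> = (\<sigma> ` ?P \<union> ?Q) - \<sigma> ` ?P" unfolding im eq ..
      also have "\<dots> = ?Q" using disj by (simp add: Un_Diff Diff_triv Int_commute)
      finally show ?thesis .
    qed
    have "j1 \<notin> ?Q" by blast
    then have "?P \<noteq> {}" using eq ij(2) by blast
    then have lt: "card ?I < card I" using fin by (intro psubset_card_mono) auto
    have bI: "bij_betw \<sigma> ?I ?Q" using inj imI by (auto simp: bij_betw_def intro: inj_on_subset)
    have "no_positive_transversal a ?I (\<sigma> ` ?I)"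
      by (rule no_positive_transversal_block[OF np s z]) auto
    then have npI: "no_positive_transversal a ?I ?Q" unfolding imI .
    have "i1 \<in> ?I" using ij(1) by blast
    then have neI: "?I \<noteq> {}" by blast
    have finI: "finite ?I" using fin by blast
    have zI: "a i (\<sigma> i) = 0" if "i \<in> ?I" for i using z that by blast
    from less.hyps[OF lt finI neI bI zI npI] obtain R where R: "R \<subseteq> ?I" "R \<noteq> {}"
      "\<forall>j\<in>\<sigma> ` R. (\<forall>i\<in>R. a i j = 0 \<or> a i j = -\<infinity>) \<and> (\<forall>i\<in>?I - R. a i j = -\<infinity>)"
      by blast
    have "a i j = -\<infinity>" if "i \<in> I - R" "j \<in> \<sigma> ` R" for i j
    proof (cases "i \<in> ?P")
      case True
      have "j \<in> \<sigma> ` ?I" using that(2) R(1) by blast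
      then have "j \<in> ?Q" unfolding imI .
      then show ?thesis using PQ[OF True] by blast
    next
      case False
      then show ?thesis using R(3) that by blast
    qed
    then show ?thesis using R by (intro exI[of _ R]) blast
  qed
qed

text \<open>
  The terminal block inherits a nonzero minor from the whole matrix: the other rows vanish in its
  columns, so that a relation between the columns of the block would be one between columns of the whole
  matrix, and a relation between the remaining rows in the remaining columns one of the whole matrix.
\<close>

lemma regular_triangular:
  assumes "admissible n a J I" "Y \<subseteq> {..<n}" "regular a J I Y"
  shows "triangular a J I Y"
  using assms
proof (induction "card I" arbitrary: I Y rule: less_induct)
  case less
  have fin: "finite I" using less.prems(1) by (rule admissibleD(1))
  moreover have "finite Y" using less.prems(2) by (rule finite_subset) simp
  ultimately have fin: "finite I" "finite Y" by simp_all
  have card: "card I = card Y" and np: "no_positive_transversal a I Y"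
    and mi: "minor (order_zero_part a J) I Y \<noteq> 0"
    using less.prems(3) by (auto simp: regular_def)
  show ?case
  proof (cases "I = {}")
    case True
    then have "Y = {}" using card fin by simp
    then show ?thesis using True triangular_empty by simp
  next
    case False
    obtain \<sigma> where s: "bij_betw \<sigma> I Y" "\<And>i. i \<in> I \<Longrightarrow> a i (\<sigma> i) = 0"
      using zero_transversal[OF fin less.prems(3)] by blast
    obtain R where R: "R \<subseteq> I" "R \<noteq> {}" and
      blk: "\<forall>j\<in>\<sigma> ` R. (\<forall>i\<in>R. a i j = 0 \<or> a i j = -\<infinity>) \<and> (\<forall>i\<in>I - R. a i j = -\<infinity>)"
      using terminal_block_exists[OF fin(1) False s np] by blast
    let ?C = "\<sigma> ` R" and ?M = "order_zero_part a J"
    have CY: "?C \<subseteq> Y" using s(1) R(1) by (auto simp: bij_betw_def)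
    have finRC: "finite R" "finite ?C" using R(1) fin CY finite_subset by blast+
    have cRC: "card R = card ?C" using bij_betw_split(1)[OF s(1) R(1)] by (rule bij_betw_same_card)
    have z: "?M i j = 0" if "i \<in> I - R" "j \<in> ?C" for i j
      using blk that by (auto simp: order_zero_part_def)
    have rI: "related_rows ?M I Y = {}" using mi minor_nonzero_iff[OF fin card] by simp
    have cI: "related_rows (\<lambda>i j. ?M j i) Y I = {}"
      using mi minor_nonzero_iff[OF fin(2,1) card[symmetric], of "\<lambda>i j. ?M j i"] minor_transpose[OF card, of ?M]
      by simp
    have "v j = 0" if v: "v \<in> row_relations (\<lambda>i j. ?M j i) ?C R" for v j
    proof -
      have v0: "v j = 0" if "j \<notin> ?C" for j using v that by (simp add: row_relations_def)
      have "(\<Sum>j\<in>Y. v j * ?M i j) = 0" if i: "i \<in> I" for i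
      proof -
        have "(\<Sum>j\<in>Y. v j * ?M i j) = (\<Sum>j\<in>?C. v j * ?M i j)"
          using v0 by (intro sum.mono_neutral_right fin(2) CY) auto
        also have "\<dots> = 0"
        proof (cases "i \<in> R")
          case True
          then show ?thesis using v by (simp add: row_relations_def)
        next
          case False
          then have "?M i j = 0" if "j \<in> ?C" for j using z i that by blast
          then show ?thesis by simp
        qed
        finally show ?thesis .
      qed
      then have "v \<in> row_relations (\<lambda>i j. ?M j i) Y I" using v0 CY by (auto simp: row_relations_def)
      then show ?thesis by (rule related_rowsD[OF cI])
    qed
    then have "related_rows (\<lambda>i j. ?M j i) ?C R = {}" unfolding related_rows_def by blast
    then have "minor (\<lambda>i j. ?M j i) ?C R \<noteq> 0"
      using minor_nonzero_iff[OF finRC(2,1) cRC[symmetric]] by simp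
    then have mRC: "minor ?M R ?C \<noteq> 0" using minor_transpose[OF cRC, of ?M] by simp
    moreover have "minor ?M R ?C = minor J R ?C"
    proof (rule minor_cong[OF finRC])
      fix i j assume ij: "i \<in> R" "j \<in> ?C"
      then have "i \<in> I" "j < n" using R(1) CY less.prems(2) by auto
      moreover have "a i j = 0 \<or> a i j = -\<infinity>" using blk ij by blast
      ultimately show "?M i j = J i j"
        using admissibleD(2)[OF less.prems(1)] by (auto simp: order_zero_part_def)
    qed
    ultimately have g: "good_block a J I R ?C" using R blk cRC by (simp add: good_block_def)
    have "triangular a J (I - R) (Y - ?C)"
    proof (rule less.hyps)
      show "card (I - R) < card I" using R fin by (intro psubset_card_mono) auto
      show "admissible n a J (I - R)" using less.prems(1) by (rule admissible_subset) blast
      show "Y - ?C \<subseteq> {..<n}" using less.prems(2) by blast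
      have b: "bij_betw \<sigma> (I - R) (Y - ?C)" using bij_betw_split(2)[OF s(1) R(1)] .
      then have c: "card (I - R) = card (Y - ?C)" by (rule bij_betw_same_card)
      have "no_positive_transversal a (I - R) (\<sigma> ` (I - R))"
        by (rule no_positive_transversal_block[OF np s]) auto
      moreover have "\<sigma> ` (I - R) = Y - ?C" using b by (simp add: bij_betw_def)
      ultimately have "no_positive_transversal a (I - R) (Y - ?C)" by simp
      moreover have "minor ?M (I - R) (Y - ?C) \<noteq> 0"
      proof -
        have "w i = 0" if w: "w \<in> row_relations ?M (I - R) (Y - ?C)" for w i
        proof -
          have w0: "w i = 0" if "i \<notin> I - R" for i using w that by (simp add: row_relations_def)
          have "(\<Sum>i\<in>I. w i * ?M i j) = 0" if j: "j \<in> Y" for j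
          proof -
            have "(\<Sum>i\<in>I. w i * ?M i j) = (\<Sum>i\<in>I - R. w i * ?M i j)"
              using w0 by (intro sum.mono_neutral_right fin(1)) auto
            also have "\<dots> = 0"
            proof (cases "j \<in> ?C")
              case True
              then have "?M i j = 0" if "i \<in> I - R" for i using z that by blast
              then show ?thesis by simp
            next
              case False
              then show ?thesis using w j by (simp add: row_relations_def)
            qed
            finally show ?thesis .
          qed
          then have "w \<in> row_relations ?M I Y" using w0 by (auto simp: row_relations_def)
          then show ?thesis by (rule related_rowsD[OF rI])
        qed
        then have "related_rows ?M (I - R) (Y - ?C) = {}" unfolding related_rows_def by blast
        then show ?thesis using minor_nonzero_iff[of "I - R" "Y - ?C" ?M] fin c by simp
      qed
      ultimately show "regular a J (I - R) (Y - ?C)" using c by (simp add: regular_def)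
    qed
    then show ?thesis using triangular_block[OF g CY] by blast
  qed
qed

lemma related_rows_mono:
  assumes "finite R" "R' \<subseteq> R" "related_rows J R C = {}"
  shows "related_rows J R' C = {}"
proof -
  have "w i = 0" if w: "w \<in> row_relations J R' C" for w i
  proof -
    have w0: "w i = 0" if "i \<notin> R'" for i using w that by (simp add: row_relations_def)
    have "(\<Sum>i\<in>R. w i * J i j) = 0" if j: "j \<in> C" for j
    proof -
      have "(\<Sum>i\<in>R. w i * J i j) = (\<Sum>i\<in>R'. w i * J i j)"
        using w0 by (intro sum.mono_neutral_right assms(1,2)) auto
      then show ?thesis using w j by (simp add: row_relations_def)
    qed
    then have "w \<in> row_relations J R C" using w0 assms(2) by (auto simp: row_relations_def)
    then show ?thesis by (rule related_rowsD[OF assms(3)])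
  qed
  then show ?thesis unfolding related_rows_def by blast
qed

text \<open>
  The rows of a block that belong to the subsystem are still independent in the columns of the block, and
  some of these columns carry a nonzero minor. This makes it harmless to split off any block first.
\<close>

lemma triangular_subsystem:
  assumes "triangular a J I Y" "finite I" "finite Y" "I' \<subseteq> I"
  shows "\<exists>Y'\<subseteq>Y. triangular a J I' Y'"
  using assms
proof (induction arbitrary: I' rule: triangular.induct)
  case triangular_empty
  then have "I' = {}" by simp
  then show ?case using triangular.triangular_empty[of a J] by (intro exI[of _ "{}"]) simp
next
  case (triangular_block I R C Y)
  note g = good_blockD[OF triangular_block.hyps(1)]
  have fin: "finite R" "finite C"
    using finite_subset[OF g(2) triangular_block.prems(1)]
      finite_subset[OF triangular_block.hyps(2) triangular_block.prems(2)] by simp_all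
  obtain Y2 where Y2: "Y2 \<subseteq> Y - C" "triangular a J (I' - R) Y2"
    using triangular_block.IH[of "I' - R"] triangular_block.prems by blast
  let ?R = "R \<inter> I'"
  show ?case
  proof (cases "?R = {}")
    case True
    then have "I' - R = I'" by blast
    then show ?thesis using Y2 by auto
  next
    case False
    have "related_rows J R C = {}" using g(3,4) minor_nonzero_iff[OF fin] by simp
    then have rel: "related_rows J ?R C = {}" by (rule related_rows_mono[OF fin(1) Int_lower1])
    have "finite ?R" using fin(1) by simp
    then obtain D where D: "D \<subseteq> C" "card D = card ?R" "minor J ?R D \<noteq> 0"
      using independent_minor_exists[OF _ fin(2) rel] by blast
    have "good_block a J I' ?R D"
      unfolding good_block_def
    proof (intro conjI ballI)
      show "a i j = 0 \<or> a i j = -\<infinity>" if "j \<in> D" "i \<in> ?R" for i j using g(5) D(1) that by blast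
      show "a i j = -\<infinity>" if "j \<in> D" "i \<in> I' - ?R" for i j
        using g(6) D(1) triangular_block.prems(3) that by blast
    qed (use False D(2,3) in auto)
    moreover have "D \<subseteq> D \<union> Y2" by blast
    moreover have "I' - ?R = I' - R" "D \<union> Y2 - D = Y2" using Y2(1) D(1) by blast+
    ultimately have "triangular a J I' (D \<union> Y2)"
      using triangular.triangular_block[of a J I' ?R D "D \<union> Y2"] Y2(2) by simp
    moreover have "D \<union> Y2 \<subseteq> Y" using D(1) Y2(1) triangular_block.hyps(2) by blast
    ultimately show ?thesis by blast
  qed
qed

text \<open>
  A block is given the value 0 and the rows outside are raised by \<open>W\<close> above it: they have no finite
  entries in the columns of the block, and the entries of the block in their columns are at most \<open>W\<close>.
\<close>

lemma transversal_potential: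
  assumes "finite I" "bij_betw \<sigma> I Y" "\<And>i. i \<in> I \<Longrightarrow> a i (\<sigma> i) = 0" "no_positive_transversal a I Y"
    and "\<And>i i'. \<lbrakk>i \<in> I; i' \<in> I\<rbrakk> \<Longrightarrow> a i' (\<sigma> i) \<le> ereal (real W)"
  shows "\<exists>l :: nat \<Rightarrow> nat. \<forall>i\<in>I. \<forall>i'\<in>I. a i' (\<sigma> i) + ereal (real (l i')) \<le> ereal (real (l i))"
  using assms
proof (induction "card I" arbitrary: I Y rule: less_induct)
  case less
  note s = less.prems(2) and z = less.prems(3)
  show ?case
  proof (cases "I = {}")
    case True
    then show ?thesis by simp
  next
    case False
    obtain R where R: "R \<subseteq> I" "R \<noteq> {}" and
      blk: "\<forall>j\<in>\<sigma> ` R. (\<forall>i\<in>R. a i j = 0 \<or> a i j = -\<infinity>) \<and> (\<forall>i\<in>I - R. a i j = -\<infinity>)"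
      using terminal_block_exists[OF less.prems(1) False s z less.prems(4)] by blast
    have b: "bij_betw \<sigma> (I - R) (Y - \<sigma> ` R)" using bij_betw_split(2)[OF s R(1)] .
    have "no_positive_transversal a (I - R) (\<sigma> ` (I - R))"
      by (rule no_positive_transversal_block[OF less.prems(4) s z]) auto
    moreover have "\<sigma> ` (I - R) = Y - \<sigma> ` R" using b by (simp add: bij_betw_def)
    ultimately have np: "no_positive_transversal a (I - R) (Y - \<sigma> ` R)" by simp
    have "\<exists>l :: nat \<Rightarrow> nat. \<forall>i\<in>I - R. \<forall>i'\<in>I - R. a i' (\<sigma> i) + ereal (real (l i')) \<le> ereal (real (l i))"
    proof (rule less.hyps[OF _ _ b _ np])
      show "card (I - R) < card I" using R less.prems(1) by (intro psubset_card_mono) auto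
      show "finite (I - R)" using less.prems(1) by blast
      show "a i (\<sigma> i) = 0" if "i \<in> I - R" for i using z that by blast
      show "a i' (\<sigma> i) \<le> ereal (real W)" if "i \<in> I - R" "i' \<in> I - R" for i i'
        using less.prems(5) that by blast
    qed
    then obtain l :: "nat \<Rightarrow> nat" where
      l: "\<And>i i'. \<lbrakk>i \<in> I - R; i' \<in> I - R\<rbrakk> \<Longrightarrow> a i' (\<sigma> i) + ereal (real (l i')) \<le> ereal (real (l i))"
      by blast
    define m where "m i = (if i \<in> R then 0 else l i + W)" for i
    have "a i' (\<sigma> i) + ereal (real (m i')) \<le> ereal (real (m i))" if i: "i \<in> I" "i' \<in> I" for i i'
    proof (cases "i \<in> R")
      case True
      then have "if i' \<in> R then a i' (\<sigma> i) = 0 \<or> a i' (\<sigma> i) = -\<infinity> else a i' (\<sigma> i) = -\<infinity>"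
        using blk i by auto
      then show ?thesis using True by (auto simp: m_def split: if_splits)
    next
      case False
      show ?thesis
      proof (cases "i' \<in> R")
        case True
        have "a i' (\<sigma> i) \<le> ereal (real W)" using less.prems(5) i .
        also have "\<dots> \<le> ereal (real (l i + W))" by simp
        finally show ?thesis using True False by (simp add: m_def)
      next
        case F2: False
        have "a i' (\<sigma> i) + ereal (real (l i')) + ereal (real W) \<le> ereal (real (l i)) + ereal (real W)"
          using l[of i i'] i False F2 by (intro add_right_mono) auto
        then show ?thesis using False F2 by (simp add: m_def add.assoc)
      qed
    qed
    then show ?thesis by blast
  qed
qed

section \<open>Blocks that survive Seq\<close>

lemma cover_ge_term_rank:
  assumes fin: "finite R" "finite C" and "R1 \<subseteq> R" "C1 \<subseteq> C"
    and cov: "\<And>i j. \<lbrakk>i \<in> R; j \<in> C; a i j = 0\<rbrakk> \<Longrightarrow> i \<in> R1 \<or> j \<in> C1"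
  shows "term_rank a R C \<le> card R1 + card C1"
  unfolding term_rank_def
proof (rule Max.boundedI)
  let ?S = "{M. M \<subseteq> zero_entries a R C \<and> inj_on fst M \<and> inj_on snd M}"
  have "finite (zero_entries a R C)"
    by (rule finite_subset[of _ "R \<times> C"]) (use fin in \<open>auto simp: zero_entries_def\<close>)
  then have "finite {M. M \<subseteq> zero_entries a R C}" by simp
  then show "finite (card ` ?S)" by (intro finite_imageI) (auto intro: finite_subset)
  have "{} \<in> ?S" by simp
  then show "card ` ?S \<noteq> {}" by blast
  fix k assume "k \<in> card ` ?S"
  then obtain M where M: "M \<subseteq> zero_entries a R C" "inj_on fst M" "inj_on snd M" "k = card M" by blast
  have "\<forall>(i, j)\<in>zero_entries a R C. i \<in> R1 \<or> j \<in> C1" using cov by (auto simp: zero_entries_def)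
  from matching_le_cover[OF M(1-3) fin assms(3,4) this] M(4) show "k \<le> card R1 + card C1" by simp
qed

text \<open>
  A weaker form of \<open>good_block\<close> that is inherited by the matrices that Seq works on: it does not mention
  the orders of entries outside the zeros of \<open>B\<close>, but only that they do not contribute to the Jacobian.
\<close>

definition confined ::
    "(nat \<Rightarrow> nat \<Rightarrow> ereal) \<Rightarrow> (nat \<Rightarrow> nat \<Rightarrow> real) \<Rightarrow> nat set \<Rightarrow> nat set \<Rightarrow> nat set \<Rightarrow> bool" where
  "confined a J I R C \<longleftrightarrow> R \<subseteq> I \<and> finite C \<and> card C = card R \<and> minor J R C \<noteq> 0 \<and>
     (\<forall>i\<in>I. \<forall>j\<in>C. a i j \<noteq> 0 \<longrightarrow> J i j = 0) \<and> (\<forall>i\<in>I - R. \<forall>j\<in>C. a i j \<noteq> 0)"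

lemma confinedD:
  assumes "confined a J I R C"
  shows "R \<subseteq> I" "finite C" "card R = card C" "minor J R C \<noteq> 0"
    "\<And>i j. \<lbrakk>i \<in> I; j \<in> C; a i j \<noteq> 0\<rbrakk> \<Longrightarrow> J i j = 0"
    "\<And>i j. \<lbrakk>i \<in> I - R; j \<in> C\<rbrakk> \<Longrightarrow> a i j \<noteq> 0"
  using assms by (auto simp: confined_def)

lemma confined_subset:
  assumes "confined a J I R C" "R \<subseteq> I'" "I' \<subseteq> I"
  shows "confined a J I' R C"
  unfolding confined_def using confinedD[OF assms(1)] assms(2,3)
  by (intro conjI ballI impI) (auto dest: subsetD)

text \<open>
  The nonzero minor provides zeros \<open>a i (\<sigma> i)\<close> matching \<open>S\<close> with \<open>D\<close>. The rows of \<open>S\<close> outside \<open>R0\<close> are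
  covered by columns of \<open>C0 \<inter> D\<close>, at least as many. Replacing all columns \<open>C0 \<inter> D\<close> by the rows \<open>S\<close>
  therefore gives a cover that is not larger, as all zeros in \<open>D\<close> are in \<open>S\<close>; it is minimum, and
  by the extremality of \<open>(R0, C0)\<close> it does not differ from it.
\<close>

lemma HK_keeps_confined:
  assumes fin: "finite R" "finite C" and hk: "HK a R C = (R0, C0)"
    and conf: "confined a J R S D" and DC: "D \<subseteq> C"
  shows "S \<subseteq> R0" "D \<subseteq> C - C0"
proof -
  note c = confinedD[OF conf] and h = HK_subset[OF fin hk]
  have finS: "finite S" using c(1) fin(1) by (rule finite_subset)
  obtain \<sigma> where s: "bij_betw \<sigma> S D" "\<forall>i\<in>S. J i (\<sigma> i) \<noteq> 0"
    using minor_nonzero_transversal[OF finS c(2,3,4)] by blast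
  have sD: "\<sigma> i \<in> D" if "i \<in> S" for i using s(1) that by (auto simp: bij_betw_def)
  have s0: "a i (\<sigma> i) = 0" if "i \<in> S" for i
    using c(1) c(5)[of i "\<sigma> i"] sD s(2) that by blast
  have f0: "finite R0" "finite C0" using h(1,2) fin finite_subset by blast+
  have "\<sigma> ` (S - R0) \<subseteq> C0 \<inter> D"
  proof
    fix j assume "j \<in> \<sigma> ` (S - R0)"
    then obtain i where i: "i \<in> S" "i \<notin> R0" "j = \<sigma> i" by blast
    then show "j \<in> C0 \<inter> D" using h(3)[of i j] s0[OF i(1)] sD[OF i(1)] c(1) DC by blast
  qed
  moreover have "inj_on \<sigma> (S - R0)" using s(1) by (auto simp: bij_betw_def intro: inj_on_subset)
  ultimately have le: "card (S - R0) \<le> card (C0 \<inter> D)"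
    using f0(2) by (intro card_inj_on_le[of \<sigma>]) auto
  have cov: "i \<in> R0 \<union> S \<or> j \<in> C0 - D" if "i \<in> R" "j \<in> C" "a i j = 0" for i j
    using h(3)[OF that] c(6)[of i j] that by blast
  have "card (R0 \<union> S) = card R0 + card (S - R0)"
    using card_Un_disjoint[of R0 "S - R0"] f0(1) finS by (simp add: Un_Diff_cancel)
  moreover have "card (C0 - D) = card C0 - card (C0 \<inter> D)"
    using card_Diff_subset_Int[of C0 D] f0(2) by simp
  moreover have "card (C0 \<inter> D) \<le> card C0" using f0(2) by (intro card_mono) auto
  moreover have "card R0 + card C0 = term_rank a R C" using minimum_coversD(4)[OF h(4)] .
  ultimately have up: "card (R0 \<union> S) + card (C0 - D) \<le> term_rank a R C" using le by linarith
  have sub: "R0 \<union> S \<subseteq> R" "C0 - D \<subseteq> C" using h(1,2) c(1) by blast+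
  have "term_rank a R C \<le> card (R0 \<union> S) + card (C0 - D)"
    by (rule cover_ge_term_rank[OF fin sub]) (rule cov)
  then have "(R0 \<union> S, C0 - D) \<in> minimum_covers a R C"
    unfolding minimum_covers_def mem_Collect_eq prod.case
    using up sub cov by (intro conjI) (auto simp: zero_entries_def)
  then have "R0 \<union> S \<subseteq> R0 \<and> C0 \<subseteq> C0 - D" by (rule h(5))
  then show "S \<subseteq> R0" "D \<subseteq> C - C0" using DC by blast+
qed

text \<open>
  In the columns \<open>D\<close> the Jacobian vanishes outside the rows \<open>S\<close>, so that a relation restricts to one
  between the rows \<open>S\<close>, which are independent there.
\<close>

lemma related_rows_avoid_confined:
  assumes fin: "finite R" and conf: "confined a J R S D" and DC: "D \<subseteq> C"
  shows "S \<inter> related_rows J R C = {}"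
proof -
  note c = confinedD[OF conf]
  have finS: "finite S" using c(1) fin by (rule finite_subset)
  have "w i = 0" if w: "w \<in> row_relations J R C" and i: "i \<in> S" for w i
  proof -
    define u where "u k = (if k \<in> S then w k else 0)" for k
    have "(\<Sum>k\<in>S. u k * J k j) = 0" if j: "j \<in> D" for j
    proof -
      have "(\<Sum>k\<in>R. w k * J k j) = (\<Sum>k\<in>S. w k * J k j)"
        using c(1,5,6) j by (intro sum.mono_neutral_right fin c(1)) auto
      moreover have "(\<Sum>k\<in>R. w k * J k j) = 0" using w j DC by (auto simp: row_relations_def)
      moreover have "(\<Sum>k\<in>S. u k * J k j) = (\<Sum>k\<in>S. w k * J k j)"
        by (intro sum.cong) (simp_all add: u_def)
      ultimately show ?thesis by simp
    qed
    then have "u \<in> row_relations J S D" by (simp add: row_relations_def u_def)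
    moreover have "related_rows J S D = {}" using minor_nonzero_iff[OF finS c(2,3)] c(4) by blast
    ultimately have "u i = 0" by (intro related_rowsD)
    then show ?thesis using i by (simp add: u_def)
  qed
  then show ?thesis unfolding related_rows_def by blast
qed

lemma Seq_step:
  assumes fin: "finite R" "finite C" and hk: "HK a R C = (R0, C0)"
    and ks: "Kernel_Support a J R0 (C - C0) = (R', C')"
  shows "R' \<subseteq> R0" "R' \<subseteq> R" "C' \<subseteq> C - C0" "C' \<subseteq> C" "\<And>i j. \<lbrakk>i \<in> R - R'; j \<in> C'\<rbrakk> \<Longrightarrow> a i j \<noteq> 0"
    "\<And>S D. \<lbrakk>confined a J R S D; D \<subseteq> C\<rbrakk> \<Longrightarrow> S \<subseteq> R' \<and> D \<subseteq> C' \<and> confined a J R' S D"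
proof -
  note h = HK_subset[OF fin hk]
  have R': "R' = R0 - related_rows J R0 (C - C0)" and
    C': "C' = C - C0 - related_columns a J R0 (C - C0)"
    using ks by (auto simp: Kernel_Support_def)
  show "R' \<subseteq> R0" "R' \<subseteq> R" "C' \<subseteq> C - C0" "C' \<subseteq> C" using R' C' h(1) by blast+
  show "a i j \<noteq> 0" if "i \<in> R - R'" "j \<in> C'" for i j
  proof
    assume z: "a i j = 0"
    then have "i \<in> R0" using h(3)[of i j] that C' by blast
    then have "i \<in> related_rows J R0 (C - C0)" using that(1) R' by blast
    then have "j \<in> related_columns a J R0 (C - C0)"
      using z that(2) C' unfolding related_columns_def by blast
    then show False using that(2) C' by blast
  qed
  fix S D assume conf: "confined a J R S D" and D: "D \<subseteq> C"
  note k = HK_keeps_confined[OF fin hk conf D]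
  have conf0: "confined a J R0 S D" using conf k(1) h(1) by (rule confined_subset)
  have finR0: "finite R0" using h(1) fin(1) by (rule finite_subset)
  have avoid: "S \<inter> related_rows J R0 (C - C0) = {}"
    using related_rows_avoid_confined[OF finR0 conf0 k(2)] .
  have SR: "S \<subseteq> R'" using avoid k(1) R' by blast
  have "j \<notin> related_columns a J R0 (C - C0)" if "j \<in> D" for j
  proof
    assume "j \<in> related_columns a J R0 (C - C0)"
    then obtain i where "i \<in> related_rows J R0 (C - C0)" "a i j = 0"
      unfolding related_columns_def by blast
    moreover have "i \<in> R0" using calculation(1) unfolding related_rows_def by blast
    ultimately show False using confinedD(6)[OF conf0, of i j] avoid that by blast
  qed
  then have "D \<subseteq> C'" using k(2) C' by blast
  moreover have "confined a J R' S D" using conf SR \<open>R' \<subseteq> R\<close> by (rule confined_subset)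
  ultimately show "S \<subseteq> R' \<and> D \<subseteq> C' \<and> confined a J R' S D" using SR by blast
qed

text \<open>
  A pass that changes nothing has removed no related row.
\<close>

lemma Seq_stop_independent:
  assumes fin: "finite R" "finite C" and hk: "HK a R C = (R0, C0)"
    and ks: "Kernel_Support a J R0 (C - C0) = (R, C)"
  shows "R0 = R" "C0 = {}" "related_rows J R C = {}"
proof -
  note h = HK_subset[OF fin hk]
  note ks' = ks[unfolded Kernel_Support_def prod.inject]
  have R': "R0 - related_rows J R0 (C - C0) = R" using ks' by (rule conjunct1)
  have C': "C - C0 - related_columns a J R0 (C - C0) = C" using ks' by (rule conjunct2)
  have "R \<subseteq> R0" by (subst R'[symmetric]) (rule Diff_subset)
  then show R0: "R0 = R" using h(1) by (rule equalityI[rotated])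
  have "C \<subseteq> C - C0" by (subst (1) C'[symmetric]) (rule Diff_subset)
  then show C0: "C0 = {}" using h(2) by blast
  have "related_rows J R C \<subseteq> R" unfolding related_rows_def by blast
  moreover have "R - related_rows J R C = R" using R' unfolding R0 C0 by simp
  ultimately show "related_rows J R C = {}" by blast
qed

lemma Seq_run_result:
  assumes "Seq_run a J R C ps R' C'" "finite R" "finite C"
  shows "R' \<subseteq> R" "C' \<subseteq> C" "\<And>i j. \<lbrakk>i \<in> R - R'; j \<in> C'\<rbrakk> \<Longrightarrow> a i j \<noteq> 0" "related_rows J R' C' = {}"
    "\<And>S D. \<lbrakk>confined a J R S D; D \<subseteq> C\<rbrakk> \<Longrightarrow> S \<subseteq> R' \<and> D \<subseteq> C'"
proof -
  have "R' \<subseteq> R \<and> C' \<subseteq> C \<and> (\<forall>i\<in>R - R'. \<forall>j\<in>C'. a i j \<noteq> 0) \<and> related_rows J R' C' = {} \<and>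
    (\<forall>S D. confined a J R S D \<longrightarrow> D \<subseteq> C \<longrightarrow> S \<subseteq> R' \<and> D \<subseteq> C')"
    using assms
  proof (induction rule: Seq_run.induct)
    case (Seq_stop R C R0 C0)
    have "related_rows J R C = {}"
      by (rule Seq_stop_independent(3)[OF Seq_stop.prems Seq_stop.hyps])
    then show ?case using confinedD(1)[of a J R] by (intro conjI allI impI ballI) auto
  next
    case (Seq_again R C R0 C0 R1 C1 ps R2 C2)
    note st = Seq_step[OF Seq_again.prems Seq_again.hyps(1,2)]
    have fin1: "finite R1" "finite C1" using st(2,4) Seq_again.prems finite_subset by blast+
    note ih = Seq_again.IH[OF fin1]
    note ih1 = ih[THEN conjunct1] and ih2 = ih[THEN conjunct2, THEN conjunct1]
      and ih3 = ih[THEN conjunct2, THEN conjunct2, THEN conjunct1]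
      and ih4 = ih[THEN conjunct2, THEN conjunct2, THEN conjunct2, THEN conjunct1]
      and ih5 = ih[THEN conjunct2, THEN conjunct2, THEN conjunct2, THEN conjunct2, rule_format]
    show ?case
    proof (intro conjI ballI allI impI)
      show "R2 \<subseteq> R" using ih1 st(2) by (rule subset_trans)
      show "C2 \<subseteq> C" using ih2 st(4) by (rule subset_trans)
      show "related_rows J R2 C2 = {}" by (rule ih4)
      show "a i j \<noteq> 0" if "i \<in> R - R2" "j \<in> C2" for i j
      proof (cases "i \<in> R1")
        case True
        then show ?thesis using ih3 that by blast
      next
        case False
        then show ?thesis using st(5)[of i j] ih2 that by blast
      qed
      fix S D assume "confined a J R S D" "D \<subseteq> C"
      from st(6)[OF this] have "confined a J R1 S D" "D \<subseteq> C1" by simp_all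
      from ih5[OF this] show "S \<subseteq> R2" "D \<subseteq> C2" by simp_all
    qed
  qed
  note res = this
  show "R' \<subseteq> R" using res by (elim conjE)
  show "C' \<subseteq> C" using res by (elim conjE)
  show "\<And>i j. \<lbrakk>i \<in> R - R'; j \<in> C'\<rbrakk> \<Longrightarrow> a i j \<noteq> 0"
    using res[THEN conjunct2, THEN conjunct2, THEN conjunct1] by blast
  show "related_rows J R' C' = {}" using res by (elim conjE)
  show "\<And>S D. \<lbrakk>confined a J R S D; D \<subseteq> C\<rbrakk> \<Longrightarrow> S \<subseteq> R' \<and> D \<subseteq> C'"
    using res[THEN conjunct2, THEN conjunct2, THEN conjunct2, THEN conjunct2] by (elim allE impE)
qed

lemma Seq_run_exists:
  assumes "finite R" "finite C"
  shows "\<exists>ps R' C'. Seq_run a J R C ps R' C'"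
  using assms
proof (induction "card R + card C" arbitrary: R C rule: less_induct)
  case less
  obtain R0 C0 where hk: "HK a R C = (R0, C0)" by fastforce
  obtain R1 C1 where ks: "Kernel_Support a J R0 (C - C0) = (R1, C1)" by fastforce
  note st = Seq_step[OF less.prems hk ks]
  show ?case
  proof (cases "(R1, C1) = (R, C)")
    case True
    then show ?thesis using Seq_stop[OF hk] ks by metis
  next
    case False
    have "card R1 + card C1 < card R + card C"
    proof (cases "R1 = R")
      case True
      then have "C1 \<subset> C" using False st(4) by blast
      then show ?thesis using psubset_card_mono[OF less.prems(2)] True by simp
    next
      case False
      then have "R1 \<subset> R" using st(2) by blast
      then show ?thesis using psubset_card_mono[OF less.prems(1)] card_mono[OF less.prems(2) st(4)]
        by (metis add_less_le_mono)
    qed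
    moreover have "finite R1" "finite C1" using st(2,4) less.prems finite_subset by blast+
    ultimately obtain ps R' C' where "Seq_run a J R1 C1 ps R' C'" using less.hyps by blast
    then show ?thesis using Seq_again[OF hk ks False] by blast
  qed
qed

section \<open>Correctness of the algorithm\<close>

lemma finite_B_columns: "finite (B_columns n a I)"
  by (rule finite_subset[of _ "{..<n}"]) (auto simp: B_columns_def)

lemma B_columnsD:
  assumes "j \<in> B_columns n a I"
  shows "j < n" "\<And>i. i \<in> I \<Longrightarrow> a i j = -\<infinity> \<or> a i j = 0"
  using assms by (auto simp: B_columns_def)

lemma Obar_reg_exists:
  assumes "finite I"
  shows "\<exists>cs res. Obar_reg n a J I cs res"
  using assms
proof (induction "card I" arbitrary: I rule: less_induct)
  case less
  show ?case
  proof (cases "I = {} \<or> hopeless n a I")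
    case True
    then show ?thesis using Obar_empty Obar_hopeless by (cases "I = {}") blast+
  next
    case False
    then have I: "I \<noteq> {}" "\<not> hopeless n a I" by auto
    obtain ps R C where run: "Seq_run a J I (B_columns n a I) ps R C"
      using Seq_run_exists[OF less.prems finite_B_columns] by blast
    note sr = Seq_run_result[OF run less.prems finite_B_columns]
    show ?thesis
    proof (cases "R = {} \<or> C = {}")
      case True
      then show ?thesis using Obar_stuck[OF I run] by blast
    next
      case False
      have "finite R" using sr(1) less.prems by (rule finite_subset)
      moreover have "finite C" using sr(2) finite_B_columns by (rule finite_subset)
      ultimately obtain Y where Y: "Y \<subseteq> C" "card Y = card R" "minor J R Y \<noteq> 0"
        using independent_minor_exists[OF _ _ sr(4)] by blast
      have "card (I - R) < card I" using False sr(1) less.prems by (intro psubset_card_mono) auto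
      then obtain cs res where "Obar_reg n a J (I - R) cs res" using less.hyps less.prems by blast
      then show ?thesis using Obar_split[OF I run False Y] by blast
    qed
  qed
qed

lemma triangular_card:
  assumes "triangular a J I Y" "admissible n a J I" "Y \<subseteq> {..<n}"
  shows "card I = card Y" "\<exists>\<sigma>. bij_betw \<sigma> I Y \<and> (\<forall>i\<in>I. a i (\<sigma> i) = 0)"
proof -
  have r: "regular a J I Y" using triangular_regular[OF assms] .
  then show "card I = card Y" by (simp add: regular_def)
  have "finite Y" using assms(3) by (rule finite_subset) simp
  from zero_transversal[OF admissibleD(1)[OF assms(2)] this r]
  show "\<exists>\<sigma>. bij_betw \<sigma> I Y \<and> (\<forall>i\<in>I. a i (\<sigma> i) = 0)" by metis
qed

lemma good_block_confined:
  assumes ad: "admissible n a J I" and g: "good_block a J I R C" and C: "C \<subseteq> {..<n}"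
  shows "confined a J I R C" "C \<subseteq> B_columns n a I"
proof -
  note b = good_blockD[OF g]
  have finI: "finite I" using ad by (rule admissibleD(1))
  have finC: "finite C" using C by (rule finite_subset) simp
  have m: "a i j = -\<infinity> \<or> a i j = 0" if "i \<in> I" "j \<in> C" for i j
    using b(5,6) that by blast
  show "confined a J I R C"
    unfolding confined_def
  proof (intro conjI ballI impI)
    show "J i j = 0" if "i \<in> I" "j \<in> C" "a i j \<noteq> 0" for i j
      using m[OF that(1,2)] that admissibleD(2)[OF ad that(1)] C by blast
    show "a i j \<noteq> 0" if "i \<in> I - R" "j \<in> C" for i j using b(6)[OF that] by simp
  qed (use b finC in auto)
  obtain \<sigma> where s: "bij_betw \<sigma> R C" "\<forall>i\<in>R. J i (\<sigma> i) \<noteq> 0"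
    using minor_nonzero_transversal[of R C J] b(3,4) finC finite_subset[OF b(2) finI] by metis
  show "C \<subseteq> B_columns n a I"
  proof
    fix j assume j: "j \<in> C"
    then obtain i where i: "i \<in> R" "\<sigma> i = j" using s(1) by (auto simp: bij_betw_def)
    then have iI: "i \<in> I" using b(2) by blast
    have "a i j \<noteq> -\<infinity>" using s(2) i admissibleD(2)[OF ad iI, of j] j C by blast
    then show "j \<in> B_columns n a I" unfolding B_columns_def using j C iI m by blast
  qed
qed

text \<open>
  Failure excludes a block, hence triangularity: Seq would keep it if there is one, and the equations
  left would stay triangular. Success exhibits the blocks of a triangular system.
\<close>

lemma Obar_reg_correct:
  assumes "Obar_reg n a J I cs res" "admissible n a J I"
  shows "(res = None \<longrightarrow> \<not> (\<exists>Y\<subseteq>{..<n}. triangular a J I Y)) \<and>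
    (\<forall>Y. res = Some Y \<longrightarrow> Y \<subseteq> {..<n} \<and> triangular a J I Y)"
  using assms
proof (induction rule: Obar_reg.induct)
  case Obar_empty
  then show ?case by (simp add: triangular_empty)
next
  case (Obar_hopeless I)
  have False if Y: "Y \<subseteq> {..<n}" "triangular a J I Y" for Y
    using Obar_hopeless.hyps(2) unfolding hopeless_def
  proof
    assume "card I > n"
    then show False using triangular_card(1)[OF Y(2) Obar_hopeless.prems Y(1)] card_mono[of "{..<n}" Y] Y(1)
      by simp
  next
    assume "\<exists>i\<in>I. \<forall>j<n. a i j = -\<infinity>"
    then obtain i where i: "i \<in> I" "\<forall>j<n. a i j = -\<infinity>" by blast
    obtain \<sigma> where s: "bij_betw \<sigma> I Y" "\<forall>i\<in>I. a i (\<sigma> i) = 0"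
      using triangular_card(2)[OF Y(2) Obar_hopeless.prems Y(1)] by blast
    have "\<sigma> i < n" using s(1) i(1) Y(1) by (auto simp: bij_betw_def)
    then have "a i (\<sigma> i) = -\<infinity>" using i(2) by blast
    then show False using s(2) i(1) by simp
  qed
  then show ?case by blast
next
  case (Obar_stuck I ps R C)
  have finI: "finite I" using Obar_stuck.prems by (rule admissibleD(1))
  have False if Y: "Y \<subseteq> {..<n}" "triangular a J I Y" for Y
    using Y(2)
  proof (cases rule: triangular.cases)
    case triangular_empty
    then show False using Obar_stuck.hyps(1) by blast
  next
    case (triangular_block S D)
    have D: "D \<subseteq> {..<n}" using triangular_block(2) Y(1) by blast
    note gc = good_block_confined[OF Obar_stuck.prems triangular_block(1) D]
    have "S \<subseteq> R \<and> D \<subseteq> C"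
      using Seq_run_result(5)[OF Obar_stuck.hyps(3) finI finite_B_columns gc] .
    moreover have S: "S \<noteq> {}" using good_blockD(1)[OF triangular_block(1)] .
    moreover have "finite S" using good_blockD(2)[OF triangular_block(1)] finI by (rule finite_subset)
    moreover have "card D = card S" using good_blockD(3)[OF triangular_block(1)] .
    ultimately show False using Obar_stuck.hyps(4) by (metis card.empty card_0_eq subset_empty)
  qed
  then show ?case by blast
next
  case (Obar_split I ps R C Y1 cs res)
  have finI: "finite I" using Obar_split.prems by (rule admissibleD(1))
  note sr = Seq_run_result[OF Obar_split.hyps(3) finI finite_B_columns]
  have ad: "admissible n a J (I - R)" using Obar_split.prems by (rule admissible_subset) blast
  note ih = Obar_split.IH[OF ad]
  show ?case
  proof (cases res)
    case None
    have False if Y: "Y \<subseteq> {..<n}" "triangular a J I Y" for Y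
    proof -
      have "finite Y" using Y(1) by (rule finite_subset) simp
      then obtain Y' where "Y' \<subseteq> Y" "triangular a J (I - R) Y'"
        using triangular_subsystem[OF Y(2) finI, of "I - R"] by blast
      then show False using ih None Y(1) by blast
    qed
    then show ?thesis using None by auto
  next
    case (Some Y2)
    then have Y2: "Y2 \<subseteq> {..<n}" "triangular a J (I - R) Y2" using ih by blast+
    have YB: "Y1 \<subseteq> B_columns n a I" using Obar_split.hyps(5) sr(2) by blast
    have neg: "a i j = -\<infinity>" if "i \<in> I - R" "j \<in> Y1" for i j
    proof -
      have "a i j \<noteq> 0" using sr(3)[OF that(1)] that(2) Obar_split.hyps(5) by blast
      moreover have "j \<in> B_columns n a I" using YB that(2) by blast
      ultimately show ?thesis using B_columnsD(2)[of j n a I i] that(1) by blast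
    qed
    have "good_block a J I R Y1"
      unfolding good_block_def
    proof (intro conjI ballI)
      show "a i j = 0 \<or> a i j = -\<infinity>" if "j \<in> Y1" "i \<in> R" for i j
        using B_columnsD(2)[of j n a I i] YB that sr(1) by blast
    qed (use Obar_split.hyps sr(1) neg in auto)
    moreover have "Y1 \<inter> Y2 = {}"
    proof -
      obtain \<sigma> where s: "bij_betw \<sigma> (I - R) Y2" "\<forall>i\<in>I - R. a i (\<sigma> i) = 0"
        using triangular_card(2)[OF Y2(2) ad Y2(1)] by blast
      have False if "j \<in> Y1" "j \<in> Y2" for j
      proof -
        obtain i where i: "i \<in> I - R" "\<sigma> i = j" using s(1) \<open>j \<in> Y2\<close> unfolding bij_betw_def by blast
        then show False using s(2) neg[OF i(1) \<open>j \<in> Y1\<close>] by auto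
      qed
      then show ?thesis by blast
    qed
    then have "(Y1 \<union> Y2) - Y1 = Y2" by blast
    ultimately have "triangular a J I (Y1 \<union> Y2)"
      using triangular_block[of a J I R Y1 "Y1 \<union> Y2"] Y2(2) by simp
    moreover have "Y1 \<subseteq> {..<n}" using YB by (auto dest: B_columnsD(1))
    ultimately show ?thesis using Some Y2(1) by auto
  qed
qed

section \<open>Orders of differential functions\<close>

text \<open>
  The power series expansion around \<open>y\<close> does not involve the coordinate \<open>v\<close>, so that \<open>f\<close> is constant
  in this direction near \<open>y\<close>. This makes the orders finite.
\<close>

lemma pdiff_zero_outside:
  assumes "open U" "analytic_in V U f" "y \<in> U" "v \<notin> V"
  shows "pdiff f v y = 0"
proof -
  let ?S = "{m :: coord \<Rightarrow> nat. \<forall>v. v \<notin> V \<longrightarrow> m v = 0}"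
  obtain c r where r: "0 < r" and
    e: "\<And>z. \<lbrakk>z \<in> U; \<forall>v\<in>V. \<bar>z v - y v\<bar> < r\<rbrakk> \<Longrightarrow>
      ((\<lambda>m. c m * (\<Prod>v\<in>V. (z v - y v) ^ m v)) has_sum f z) ?S"
    using assms(2,3) unfolding analytic_in_def by blast
  have const: "f y = f (y(v := x))" if "y(v := x) \<in> U" for x
  proof -
    let ?z = "y(v := x)"
    have eq: "?z w = y w" if "w \<in> V" for w using that assms(4) by auto
    have 1: "((\<lambda>m. c m * (\<Prod>v\<in>V. (?z v - y v) ^ m v)) has_sum f ?z) ?S"
      by (rule e[OF that]) (use r eq in simp)
    have 2: "((\<lambda>m. c m * (\<Prod>v\<in>V. (y v - y v) ^ m v)) has_sum f y) ?S"
      by (rule e[OF assms(3)]) (use r in simp)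
    have "(\<Prod>v\<in>V. (?z v - y v) ^ m v) = (\<Prod>v\<in>V. (y v - y v) ^ m v)" for m :: "coord \<Rightarrow> nat"
      using eq by (intro prod.cong) simp_all
    from 1[unfolded this] 2 show ?thesis by (rule has_sum_unique[rotated])
  qed
  have "continuous_on UNIV (\<lambda>x. (y(v := x)) i)" for i
    by (cases "i = v") (simp_all add: continuous_on_id continuous_on_const)
  then have cont: "continuous_on UNIV (\<lambda>x. y(v := x))"
    by (rule continuous_on_coordinatewise_then_product)
  have "((\<lambda>x. f (y(v := x))) has_field_derivative 0) (at (y v))"
  proof (rule has_field_derivative_transform_within_open)
    show "((\<lambda>x. f y) has_field_derivative 0) (at (y v))" by simp
    show "open ((\<lambda>x. y(v := x)) -` U)" using assms(1) cont by (rule open_vimage)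
    show "y v \<in> (\<lambda>x. y(v := x)) -` U" using assms(3) by simp
    show "f y = f (y(v := x))" if "x \<in> (\<lambda>x. y(v := x)) -` U" for x using const that by simp
  qed
  then show ?thesis unfolding pdiff_def by (rule DERIV_imp_deriv)
qed

lemma ord_on_cases:
  assumes "open U" "differential_function n U f"
  shows "(ord_on U f j = -\<infinity> \<and> (\<forall>y\<in>U. \<forall>k. pdiff f (Deriv j k) y = 0)) \<or>
    (\<exists>k. ord_on U f j = ereal (real k))"
proof -
  obtain V where V: "finite V" "analytic_in V U f"
    using assms(2) unfolding differential_function_def by blast
  let ?K = "{k. \<exists>y\<in>U. pdiff f (Deriv j k) y \<noteq> 0}"
  have "?K \<subseteq> Deriv j -` V" using pdiff_zero_outside[OF assms(1) V(2)] by blast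
  moreover have "finite (Deriv j -` V)" using V(1) by (intro finite_vimageI) (auto simp: inj_def)
  ultimately have fin: "finite ?K" by (rule finite_subset)
  show ?thesis
  proof (cases "?K = {}")
    case True
    then have "ord_on U f j = -\<infinity>" unfolding ord_on_def by (simp add: bot_ereal_def)
    then show ?thesis using True by blast
  next
    case False
    let ?O = "(\<lambda>k. ereal (real k)) ` ?K"
    have "ord_on U f j = Max ?O" unfolding ord_on_def using fin False by (intro Max_Sup[symmetric]) simp_all
    moreover have "Max ?O \<in> ?O" using fin False by (intro Max_in) simp_all
    ultimately show ?thesis by auto
  qed
qed

lemma system_admissible:
  assumes "system_at n s P U \<eta>"
  shows "admissible n (order_matrix U P) (jacobian_at P \<eta>) {..<s}"
  unfolding admissible_def
proof (intro conjI ballI allI impI)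
  fix i j assume i: "i \<in> {..<s}"
  have o: "open U" "differential_function n U (P i)" "\<eta> \<in> U"
    using assms i by (auto simp: system_at_def diffiety_def)
  show "(order_matrix U P i j = -\<infinity> \<and> jacobian_at P \<eta> i j = 0) \<or> (\<exists>k. order_matrix U P i j = ereal (real k))"
    using ord_on_cases[OF o(1,2), of j] o(3) unfolding order_matrix_def jacobian_at_def by blast
qed simp

section \<open>Canons and nabla\<close>

text \<open>
  A canon along a transversal \<open>\<sigma>\<close> of zeros, with the maxima written as inequalities. In this form the
  componentwise minimum of canons is visibly a canon.
\<close>

definition potential :: "nat \<Rightarrow> (nat \<Rightarrow> nat \<Rightarrow> ereal) \<Rightarrow> (nat \<Rightarrow> nat) \<Rightarrow> (nat \<Rightarrow> nat) \<Rightarrow> bool" where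
  "potential s a \<sigma> l \<longleftrightarrow> (\<forall>i\<ge>s. l i = 0) \<and>
     (\<forall>i<s. \<forall>i'<s. a i' (\<sigma> i) + ereal (real (l i')) \<le> ereal (real (l i)))"

lemma potential_is_canon:
  assumes s: "bij_betw \<sigma> {..<s} Y" "\<And>i. i < s \<Longrightarrow> a i (\<sigma> i) = 0" and l: "potential s a \<sigma> l"
  shows "is_canon s a Y l"
  unfolding is_canon_def
proof (intro conjI exI allI impI)
  show "l i = 0" if "s \<le> i" for i using l that unfolding potential_def by blast
  show "bij_betw \<sigma> {..<s} Y" by fact
  fix i assume i: "i < s"
  have "Max ((\<lambda>i'. a i' (\<sigma> i) + ereal (real (l i'))) ` {..<s}) = ereal (real (l i))"
  proof (rule Max_eqI)
    show "y \<le> ereal (real (l i))" if "y \<in> (\<lambda>i'. a i' (\<sigma> i) + ereal (real (l i'))) ` {..<s}" for y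
      using l that i unfolding potential_def by blast
    show "ereal (real (l i)) \<in> (\<lambda>i'. a i' (\<sigma> i) + ereal (real (l i'))) ` {..<s}"
      using s(2)[OF i] i by (intro image_eqI[of _ _ i]) simp_all
  qed simp
  then show "a i (\<sigma> i) + ereal (real (l i)) = Max ((\<lambda>i'. a i' (\<sigma> i) + ereal (real (l i'))) ` {..<s})"
    using s(2)[OF i] by simp
qed

text \<open>
  A canon comes with its own transversal \<open>\<tau>\<close>, which consists of zeros too. Comparing \<open>\<sigma>\<close> with \<open>\<tau>\<close> yields a
  permutation of the rows that does not decrease \<open>l\<close> anywhere. As it preserves the sum of \<open>l\<close>, it
  preserves \<open>l\<close>.
\<close>

lemma canon_is_potential:
  assumes np: "no_positive_transversal a {..<s} Y"
    and s: "bij_betw \<sigma> {..<s} Y" "\<And>i. i < s \<Longrightarrow> a i (\<sigma> i) = 0" and l: "is_canon s a Y l"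
  shows "potential s a \<sigma> l"
proof -
  obtain \<tau> where t: "bij_betw \<tau> {..<s} Y" and
    mx: "\<And>i. i < s \<Longrightarrow> a i (\<tau> i) + ereal (real (l i)) = Max ((\<lambda>i'. a i' (\<tau> i) + ereal (real (l i'))) ` {..<s})"
    and l0: "\<And>i. s \<le> i \<Longrightarrow> l i = 0"
    using l unfolding is_canon_def by blast
  have le: "a i' (\<tau> i) + ereal (real (l i')) \<le> a i (\<tau> i) + ereal (real (l i))" if "i < s" "i' < s" for i i'
    unfolding mx[OF that(1)] using that(2) by (intro Max_ge) auto
  have "a i (\<tau> i) \<noteq> -\<infinity>" if i: "i < s" for i
  proof
    assume m: "a i (\<tau> i) = -\<infinity>"
    have "\<tau> i \<in> Y" using t i by (auto simp: bij_betw_def)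
    then have "\<tau> i \<in> \<sigma> ` {..<s}" using s(1) by (simp add: bij_betw_def)
    then obtain k where k: "k < s" "\<tau> i = \<sigma> k" by blast
    then have "a k (\<tau> i) = 0" using s(2) by simp
    then show False using le[OF i k(1)] m by simp
  qed
  then have t0: "a i (\<tau> i) = 0" if "i < s" for i
    using np t that unfolding no_positive_transversal_def by blast
  define \<pi> where "\<pi> i = inv_into {..<s} \<tau> (\<sigma> i)" for i
  have tp: "\<pi> i < s" "\<tau> (\<pi> i) = \<sigma> i" if "i < s" for i
  proof -
    have "\<sigma> i \<in> \<tau> ` {..<s}" using s(1) t that by (auto simp: bij_betw_def)
    then show "\<pi> i < s" "\<tau> (\<pi> i) = \<sigma> i"
      unfolding \<pi>_def using inv_into_into[of "\<sigma> i" \<tau> "{..<s}"] by (auto simp: f_inv_into_f)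
  qed
  have "bij_betw (inv_into {..<s} \<tau> \<circ> \<sigma>) {..<s} {..<s}"
    using s(1) bij_betw_inv_into[OF t] by (rule bij_betw_trans)
  then have bp: "bij_betw \<pi> {..<s} {..<s}" unfolding \<pi>_def[abs_def] comp_def .
  have ge: "l i \<le> l (\<pi> i)" if "i < s" for i
    using le[OF tp(1)[OF that] that] t0[OF tp(1)[OF that]] tp(2)[OF that] s(2)[OF that] by simp
  have sm: "(\<Sum>i<s. l (\<pi> i)) = (\<Sum>i<s. l i)"
    using sum.reindex_bij_betw[OF bp, of l] .
  have eq: "l (\<pi> i) = l i" if i: "i < s" for i
  proof (rule ccontr)
    assume "l (\<pi> i) \<noteq> l i"
    then have "l i < l (\<pi> i)" using ge[OF i] by simp
    then have "(\<Sum>i<s. l i) < (\<Sum>i<s. l (\<pi> i))"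
      using ge i by (intro sum_strict_mono_ex1) auto
    then show False using sm by simp
  qed
  show ?thesis
    unfolding potential_def
  proof (intro conjI allI impI)
    show "l i = 0" if "s \<le> i" for i using l0[OF that] .
    show "a i' (\<sigma> i) + ereal (real (l i')) \<le> ereal (real (l i))" if "i < s" "i' < s" for i i'
      using le[OF tp(1)[OF that(1)] that(2)] t0[OF tp(1)[OF that(1)]] tp(2)[OF that(1)] eq[OF that(1)] by simp
  qed
qed

lemma minimal_canon_potential:
  assumes np: "no_positive_transversal a {..<s} Y"
    and s: "bij_betw \<sigma> {..<s} Y" "\<And>i. i < s \<Longrightarrow> a i (\<sigma> i) = 0"
    and W: "\<And>i j. \<lbrakk>i < s; j \<in> Y\<rbrakk> \<Longrightarrow> a i j \<le> ereal (real W)"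
  shows "potential s a \<sigma> (minimal_canon s a Y)"
proof -
  have sY: "\<sigma> i \<in> Y" if "i < s" for i using s(1) that by (auto simp: bij_betw_def)
  have "\<exists>l :: nat \<Rightarrow> nat. \<forall>i\<in>{..<s}. \<forall>i'\<in>{..<s}. a i' (\<sigma> i) + ereal (real (l i')) \<le> ereal (real (l i))"
    by (rule transversal_potential[OF _ s(1) _ np, of W]) (use s(2) W sY in auto)
  then obtain l :: "nat \<Rightarrow> nat" where
    l: "\<And>i i'. \<lbrakk>i < s; i' < s\<rbrakk> \<Longrightarrow> a i' (\<sigma> i) + ereal (real (l i')) \<le> ereal (real (l i))" by blast
  let ?P = "{l. potential s a \<sigma> l}"
  define m where "m i = Inf ((\<lambda>l. l i) ` ?P)" for i
  have "potential s a \<sigma> (\<lambda>i. if i < s then l i else 0)"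
    unfolding potential_def using l by simp
  then have ne: "?P \<noteq> {}" by blast
  have att: "\<exists>l\<in>?P. l i = m i" for i
  proof -
    have "m i \<in> (\<lambda>l. l i) ` ?P" unfolding m_def using ne by (intro Inf_nat_def1) blast
    then show ?thesis by force
  qed
  have low: "m i \<le> l i" if "l \<in> ?P" for l i
    unfolding m_def using that by (intro cInf_lower) auto
  have pm: "potential s a \<sigma> m"
    unfolding potential_def
  proof (intro conjI allI impI)
    show "m i = 0" if "s \<le> i" for i
      using att[of i] that unfolding potential_def by force
    fix i i' assume i: "i < s" "i' < s"
    obtain l where l: "l \<in> ?P" "l i = m i" using att by blast
    have "a i' (\<sigma> i) + ereal (real (m i')) \<le> a i' (\<sigma> i) + ereal (real (l i'))"
      using low[OF l(1)] by (intro add_left_mono) simp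
    also have "\<dots> \<le> ereal (real (l i))" using l(1) i unfolding potential_def by blast
    finally show "a i' (\<sigma> i) + ereal (real (m i')) \<le> ereal (real (m i))" using l(2) by simp
  qed
  have "minimal_canon s a Y = m"
    unfolding minimal_canon_def
  proof (rule the_equality)
    show m: "is_canon s a Y m \<and> (\<forall>l'. is_canon s a Y l' \<longrightarrow> (\<forall>i. m i \<le> l' i))"
      using potential_is_canon[OF s pm] canon_is_potential[OF np s] low by blast
    show "l = m" if "is_canon s a Y l \<and> (\<forall>l'. is_canon s a Y l' \<longrightarrow> (\<forall>i. l i \<le> l' i))" for l
      using that m by (intro ext le_antisym) blast+
  qed
  then show ?thesis using pm by simp
qed

text \<open>
  The entries used by \<open>nabla\<close> are those for which the canon inequality is tight. Along a transversal of
  zeros the canon inequalities say that a permutation does not decrease \<open>l\<close> anywhere; they are then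
  equalities, as the sum of \<open>l\<close> is preserved.
  Conversely, a transversal of tight entries is finite, hence consists of zeros.
\<close>

lemma nabla_eq_minor:
  assumes ad: "admissible n (order_matrix U P) (jacobian_at P \<eta>) {..<s}"
    and Y: "Y \<subseteq> {..<n}" and np: "no_positive_transversal (order_matrix U P) {..<s} Y"
    and s: "bij_betw \<sigma> {..<s} Y" "\<And>i. i < s \<Longrightarrow> order_matrix U P i (\<sigma> i) = 0"
  shows "nabla s P U Y \<eta> = minor (order_zero_part (order_matrix U P) (jacobian_at P \<eta>)) {..<s} Y"
proof -
  let ?a = "order_matrix U P"
  let ?l = "minimal_canon s ?a Y"
  have finY: "finite Y" using Y by (rule finite_subset) simp
  have cardY: "card {..<s} = card Y" using s(1) by (rule bij_betw_same_card)
  have nat: "?a i j = -\<infinity> \<or> (\<exists>k. ?a i j = ereal (real k))" if "i < s" "j \<in> Y" for i j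
    using admissibleD(3)[OF ad, of i j] that Y by blast
  define W where "W = Max (insert 0 ((\<lambda>(i, j). order_nat (?a i j)) ` ({..<s} \<times> Y)))"
  have "?a i j \<le> ereal (real W)" if ij: "i < s" "j \<in> Y" for i j
  proof -
    have "order_nat (?a i j) \<le> W" unfolding W_def using ij finY by (intro Max_ge) auto
    then show ?thesis using nat[OF ij] by (auto simp: order_nat_def)
  qed
  then have pot: "potential s ?a \<sigma> ?l" using minimal_canon_potential[OF np s] by blast
  define \<Lambda> where "\<Lambda> = real (Max (?l ` {..<s}))"
  have al: "canon_alpha s ?a Y i = ereal (\<Lambda> - real (?l i))" for i
    by (simp add: canon_alpha_def \<Lambda>_def)
  have be: "canon_beta s ?a Y (\<sigma> k) = ereal (real (?l k) - \<Lambda>)" if k: "k < s" for k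
    unfolding canon_beta_def
  proof (rule Max_eqI)
    show "finite ((\<lambda>i. ?a i (\<sigma> k) - canon_alpha s ?a Y i) ` {..<s})" by simp
    show "ereal (real (?l k) - \<Lambda>) \<in> (\<lambda>i. ?a i (\<sigma> k) - canon_alpha s ?a Y i) ` {..<s}"
      using k s(2)[OF k] by (intro image_eqI[of _ _ k]) (simp_all add: al)
    fix y assume "y \<in> (\<lambda>i. ?a i (\<sigma> k) - canon_alpha s ?a Y i) ` {..<s}"
    then obtain i where i: "i < s" "y = ?a i (\<sigma> k) - canon_alpha s ?a Y i" by blast
    have "?a i (\<sigma> k) + ereal (real (?l i)) \<le> ereal (real (?l k))"
      using pot i(1) k unfolding potential_def by blast
    then show "y \<le> ereal (real (?l k) - \<Lambda>)"
      unfolding i(2) al by (cases "?a i (\<sigma> k)") auto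
  qed
  let ?M1 = "\<lambda>i j. if ?a i j = canon_alpha s ?a Y i + canon_beta s ?a Y j
                    then pdiff (P i) (Deriv j (order_nat (?a i j))) \<eta> else 0"
  let ?M2 = "order_zero_part ?a (jacobian_at P \<eta>)"
  have tight: "?a i (\<sigma> k) = canon_alpha s ?a Y i + canon_beta s ?a Y (\<sigma> k) \<longleftrightarrow>
      ?a i (\<sigma> k) = ereal (real (?l k) - real (?l i))" if "k < s" for i k
    unfolding al be[OF that] by simp
  have "minor ?M1 {..<s} Y = minor ?M2 {..<s} Y"
  proof (rule minor_eqI[OF _ finY cardY])
    fix \<tau> assume t: "bij_betw \<tau> {..<s} Y"
    define \<pi> where "\<pi> i = inv_into {..<s} \<sigma> (\<tau> i)" for i
    have tp: "\<pi> i < s" "\<sigma> (\<pi> i) = \<tau> i" if "i < s" for i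
    proof -
      have "\<tau> i \<in> \<sigma> ` {..<s}" using s(1) t that by (auto simp: bij_betw_def)
      then show "\<pi> i < s" "\<sigma> (\<pi> i) = \<tau> i"
        unfolding \<pi>_def using inv_into_into[of "\<tau> i" \<sigma> "{..<s}"] by (auto simp: f_inv_into_f)
    qed
    have "bij_betw (inv_into {..<s} \<sigma> \<circ> \<tau>) {..<s} {..<s}"
      using t bij_betw_inv_into[OF s(1)] by (rule bij_betw_trans)
    then have bp: "bij_betw \<pi> {..<s} {..<s}" unfolding \<pi>_def[abs_def] comp_def .
    show "(\<Prod>i\<in>{..<s}. ?M1 i (\<tau> i)) = (\<Prod>i\<in>{..<s}. ?M2 i (\<tau> i))"
    proof (cases "\<forall>i<s. ?a i (\<tau> i) = 0")
      case True
      have le: "?l i \<le> ?l (\<pi> i)" if i: "i < s" for i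
      proof -
        have "?a i (\<sigma> (\<pi> i)) + ereal (real (?l i)) \<le> ereal (real (?l (\<pi> i)))"
          using pot i tp(1)[OF i] unfolding potential_def by blast
        then show ?thesis using True i tp(2)[OF i] by simp
      qed
      have sm: "(\<Sum>i<s. ?l (\<pi> i)) = (\<Sum>i<s. ?l i)"
        using sum.reindex_bij_betw[OF bp, of ?l] .
      have eq: "?l (\<pi> i) = ?l i" if i: "i < s" for i
      proof (rule ccontr)
        assume "?l (\<pi> i) \<noteq> ?l i"
        then have "?l i < ?l (\<pi> i)" using le[OF i] by simp
        then have "(\<Sum>i<s. ?l i) < (\<Sum>i<s. ?l (\<pi> i))"
          using le i by (intro sum_strict_mono_ex1) auto
        then show False using sm by simp
      qed
      have M1: "?M1 i (\<tau> i) = jacobian_at P \<eta> i (\<tau> i)" if i: "i < s" for i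
      proof -
        have "?a i (\<tau> i) = canon_alpha s ?a Y i + canon_beta s ?a Y (\<tau> i)"
          using tight[OF tp(1)[OF i], of i] tp(2)[OF i] eq[OF i] True i by (simp add: zero_ereal_def)
        then show ?thesis using True i by (simp add: jacobian_at_def order_nat_def)
      qed
      show ?thesis
      proof (rule prod.cong)
        fix i assume "i \<in> {..<s}"
        then have i: "i < s" by simp
        have "?M2 i (\<tau> i) = jacobian_at P \<eta> i (\<tau> i)" using True i by (simp add: order_zero_part_def)
        then show "?M1 i (\<tau> i) = ?M2 i (\<tau> i)" using M1[OF i] by simp
      qed simp
    next
      case False
      then obtain i where i: "i < s" "?a i (\<tau> i) \<noteq> 0" by blast
      have "?M2 i (\<tau> i) = 0" using i(2) by (simp add: order_zero_part_def)
      then have "\<exists>i\<in>{..<s}. ?M2 i (\<tau> i) = 0" using i(1) by blast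
      then have p2: "(\<Prod>i\<in>{..<s}. ?M2 i (\<tau> i)) = 0" by (rule prod_zero[rotated]) simp
      have "\<exists>i<s. ?a i (\<tau> i) \<noteq> canon_alpha s ?a Y i + canon_beta s ?a Y (\<tau> i)"
      proof (rule ccontr)
        assume "\<not> ?thesis"
        then have "?a i (\<tau> i) = ereal (real (?l (\<pi> i)) - real (?l i))" if "i < s" for i
          using tight[OF tp(1)[OF that], of i] tp(2)[OF that] that by simp
        then have "\<forall>i\<in>{..<s}. ?a i (\<tau> i) \<noteq> -\<infinity>" by simp
        then show False using np t i unfolding no_positive_transversal_def by blast
      qed
      then obtain k where k: "k < s" "?a k (\<tau> k) \<noteq> canon_alpha s ?a Y k + canon_beta s ?a Y (\<tau> k)" by blast
      have "?M1 k (\<tau> k) = 0" using k(2) by (rule if_not_P)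
      then have "\<exists>i\<in>{..<s}. ?M1 i (\<tau> i) = 0" using k(1) by blast
      then have "(\<Prod>i\<in>{..<s}. ?M1 i (\<tau> i)) = 0" by (rule prod_zero[rotated]) simp
      also note p2[symmetric]
      finally show ?thesis .
    qed
  qed simp
  then show ?thesis unfolding nabla_def Let_def .
qed

lemma sum_MInf:
  fixes f :: "nat \<Rightarrow> ereal"
  assumes "finite A" "i \<in> A" "f i = -\<infinity>" "\<And>k. k \<in> A \<Longrightarrow> f k \<noteq> \<infinity>"
  shows "sum f A = -\<infinity>"
proof -
  have "sum f (A - {i}) \<noteq> \<infinity>" using assms(4) by (auto simp: sum_Pinfty)
  then show ?thesis using sum.remove[OF assms(1,2), of f] assms(3) by simp
qed

text \<open>
  The Jacobi number is a supremum of sums of orders, and a sum of orders is 0 only if all of them are.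
\<close>

lemma obar_regular_wrt_iff:
  assumes "system_at n s P U \<eta>"
  shows "obar_regular_wrt n s P U \<eta> Y \<longleftrightarrow>
    Y \<subseteq> {..<n} \<and> regular (order_matrix U P) (jacobian_at P \<eta>) {..<s} Y"
proof -
  let ?a = "order_matrix U P" and ?J = "jacobian_at P \<eta>"
  have ad: "admissible n ?a ?J {..<s}" using assms by (rule system_admissible)
  have nat: "?a i j = -\<infinity> \<or> (\<exists>k. ?a i j = ereal (real k))" if "i < s" "j < n" for i j
    using admissibleD(3)[OF ad, of i j] that by blast
  show ?thesis
  proof
    assume r: "obar_regular_wrt n s P U \<eta> Y"
    then have Y: "Y \<subseteq> {..<n}" "card Y = s" and O: "jacobi_number s ?a Y = 0" and N: "nabla s P U Y \<eta> \<noteq> 0"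
      by (auto simp: obar_regular_wrt_def)
    have np: "no_positive_transversal ?a {..<s} Y"
      unfolding no_positive_transversal_def
    proof (intro allI impI)
      fix \<sigma> assume s: "bij_betw \<sigma> {..<s} Y" "\<forall>i\<in>{..<s}. ?a i (\<sigma> i) \<noteq> -\<infinity>"
      have sY: "\<sigma> i < n" if "i < s" for i using s(1) Y(1) that by (auto simp: bij_betw_def)
      have nn: "?a i (\<sigma> i) \<ge> 0" if "i < s" for i
        using nat[OF that sY[OF that]] s(2) that by auto
      have "(\<Sum>i<s. ?a i (\<sigma> i)) \<le> jacobi_number s ?a Y"
        unfolding jacobi_number_def using s(1) by (intro SUP_upper) simp
      then have "(\<Sum>i<s. ?a i (\<sigma> i)) = 0" using O nn by (intro antisym sum_nonneg) auto
      then show "\<forall>i\<in>{..<s}. ?a i (\<sigma> i) = 0" using nn by (subst (asm) sum_nonneg_eq_0_iff) auto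
    qed
    have "\<exists>\<sigma>. bij_betw \<sigma> {..<s} Y \<and> (\<forall>i\<in>{..<s}. ?a i (\<sigma> i) = 0)"
    proof (rule ccontr)
      assume no: "\<not> ?thesis"
      have "(\<Sum>i<s. ?a i (\<sigma> i)) \<le> -\<infinity>" if "\<sigma> \<in> {\<sigma>. bij_betw \<sigma> {..<s} Y}" for \<sigma>
      proof -
        have b: "bij_betw \<sigma> {..<s} Y" using that by simp
        then have "\<not> (\<forall>i\<in>{..<s}. ?a i (\<sigma> i) \<noteq> -\<infinity>)"
          using no np unfolding no_positive_transversal_def by blast
        then obtain i where i: "i < s" "?a i (\<sigma> i) = -\<infinity>" by auto
        have "?a k (\<sigma> k) \<noteq> \<infinity>" if "k < s" for k
        proof -
          have "\<sigma> k < n" using b Y(1) that by (auto simp: bij_betw_def)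
          then show ?thesis using nat[OF that] by fastforce
        qed
        then have "(\<Sum>i<s. ?a i (\<sigma> i)) = -\<infinity>" using i by (intro sum_MInf[of _ i]) auto
        then show ?thesis by simp
      qed
      then have "jacobi_number s ?a Y \<le> -\<infinity>" unfolding jacobi_number_def by (rule SUP_least)
      then show False using O by simp
    qed
    then obtain \<sigma> where s: "bij_betw \<sigma> {..<s} Y" "\<And>i. i < s \<Longrightarrow> ?a i (\<sigma> i) = 0" by blast
    have "nabla s P U Y \<eta> = minor (order_zero_part ?a ?J) {..<s} Y"
      by (rule nabla_eq_minor[OF ad Y(1) np s])
    then show "Y \<subseteq> {..<n} \<and> regular ?a ?J {..<s} Y"
      using N np Y by (simp add: regular_def)
  next
    assume r: "Y \<subseteq> {..<n} \<and> regular ?a ?J {..<s} Y"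
    then have Y: "Y \<subseteq> {..<n}" "card Y = s" and np: "no_positive_transversal ?a {..<s} Y"
      and m: "minor (order_zero_part ?a ?J) {..<s} Y \<noteq> 0"
      by (auto simp: regular_def)
    have "finite Y" using Y(1) by (rule finite_subset) simp
    then obtain \<sigma> where s: "bij_betw \<sigma> {..<s} Y" "\<And>i. i \<in> {..<s} \<Longrightarrow> ?a i (\<sigma> i) = 0"
      using zero_transversal[of "{..<s}" Y ?a ?J] r by auto
    have "nabla s P U Y \<eta> = minor (order_zero_part ?a ?J) {..<s} Y"
      by (rule nabla_eq_minor[OF ad Y(1) np s(1)]) (simp add: s(2))
    moreover have "jacobi_number s ?a Y = 0"
      unfolding jacobi_number_def
    proof (rule antisym)
      show "(SUP \<sigma>\<in>{\<sigma>. bij_betw \<sigma> {..<s} Y}. \<Sum>i<s. ?a i (\<sigma> i)) \<le> 0"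
      proof (rule SUP_least)
        fix \<tau> assume "\<tau> \<in> {\<sigma>. bij_betw \<sigma> {..<s} Y}"
        then have t: "bij_betw \<tau> {..<s} Y" by simp
        show "(\<Sum>i<s. ?a i (\<tau> i)) \<le> 0"
        proof (cases "\<forall>i\<in>{..<s}. ?a i (\<tau> i) \<noteq> -\<infinity>")
          case True
          then have "\<forall>i\<in>{..<s}. ?a i (\<tau> i) = 0" using np t unfolding no_positive_transversal_def by blast
          then show ?thesis by simp
        next
          case False
          then obtain i where i: "i < s" "?a i (\<tau> i) = -\<infinity>" by auto
          have "?a k (\<tau> k) \<noteq> \<infinity>" if "k < s" for k
          proof -
            have "\<tau> k < n" using t Y(1) that by (auto simp: bij_betw_def)
            then show ?thesis using nat[OF that] by fastforce
          qed
          then have "(\<Sum>i<s. ?a i (\<tau> i)) = -\<infinity>" using i by (intro sum_MInf[of _ i]) auto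
          then show ?thesis by simp
        qed
      qed
      have "(\<Sum>i<s. ?a i (\<sigma> i)) = 0" using s(2) by simp
      moreover have "(\<Sum>i<s. ?a i (\<sigma> i)) \<le> (SUP \<sigma>\<in>{\<sigma>. bij_betw \<sigma> {..<s} Y}. \<Sum>i<s. ?a i (\<sigma> i))"
        using s(1) by (intro SUP_upper) simp
      ultimately show "0 \<le> (SUP \<sigma>\<in>{\<sigma>. bij_betw \<sigma> {..<s} Y}. \<Sum>i<s. ?a i (\<sigma> i))" by simp
    qed
    ultimately show "obar_regular_wrt n s P U \<eta> Y" using Y m by (simp add: obar_regular_wrt_def)
  qed
qed

theorem correctness:
  assumes sys: "system_at n s P U \<eta>"
  shows "\<exists>cs res. Obar_reg n (order_matrix U P) (jacobian_at P \<eta>) {..<s} cs res"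
    and "Obar_reg n (order_matrix U P) (jacobian_at P \<eta>) {..<s} cs res \<Longrightarrow>
      (res = None \<longleftrightarrow> \<not> obar_regular n s P U \<eta>) \<and> (\<forall>Y. res = Some Y \<longrightarrow> obar_regular_wrt n s P U \<eta> Y)"
proof -
  let ?a = "order_matrix U P" and ?J = "jacobian_at P \<eta>"
  show "\<exists>cs res. Obar_reg n ?a ?J {..<s} cs res" by (rule Obar_reg_exists) simp
  have ad: "admissible n ?a ?J {..<s}" using sys by (rule system_admissible)
  have eq: "obar_regular_wrt n s P U \<eta> Y \<longleftrightarrow> Y \<subseteq> {..<n} \<and> triangular ?a ?J {..<s} Y" for Y
    unfolding obar_regular_wrt_iff[OF sys]
    using triangular_regular[OF _ ad] regular_triangular[OF ad] by blast
  assume "Obar_reg n ?a ?J {..<s} cs res"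
  from Obar_reg_correct[OF this ad] show
    "(res = None \<longleftrightarrow> \<not> obar_regular n s P U \<eta>) \<and> (\<forall>Y. res = Some Y \<longrightarrow> obar_regular_wrt n s P U \<eta> Y)"
    unfolding obar_regular_def eq by (cases res) auto
qed

section \<open>Reasoning about programs\<close>

text \<open>
  Total correctness with a count of operations: \<open>Q\<close> holds for the time and for the final memory.
\<close>

definition wp :: "real set \<Rightarrow> prog \<Rightarrow> mem \<Rightarrow> (nat \<Rightarrow> mem \<Rightarrow> bool) \<Rightarrow> bool" where
  "wp K p m Q \<longleftrightarrow> (\<exists>t m'. exec K p m t m' \<and> Q t m')"

lemma wp_Skip [simp]: "wp K Skip m Q \<longleftrightarrow> Q 1 m"
  unfolding wp_def by (blast intro: exec.intros elim: exec.cases)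

lemma wp_NPut [simp]: "wp K (NPut x e f) m Q \<longleftrightarrow>
    Q (1 + ncost e + ncost f) (m\<lparr>narr := (narr m)(x := (narr m x)(nval e m := nval f m))\<rparr>)"
  unfolding wp_def by (blast intro: exec.intros elim: exec.cases)

lemma wp_KPut [simp]: "wp K (KPut x e f) m Q \<longleftrightarrow>
    kval f m \<in> K \<and>
    Q (1 + ncost e + kcost f) (m\<lparr>karr := (karr m)(x := (karr m x)(nval e m := kval f m))\<rparr>)"
  unfolding wp_def by (blast intro: exec.intros elim: exec.cases)

lemma wp_Output [simp]: "wp K (Output e) m Q \<longleftrightarrow> Q (1 + ncost e) (m\<lparr>tape := tape m @ [nval e m]\<rparr>)"
  unfolding wp_def by (blast intro: exec.intros elim: exec.cases)

lemma wp_Then [simp]: "wp K (Then p q) m Q \<longleftrightarrow> wp K p m (\<lambda>t m'. wp K q m' (\<lambda>t' m''. Q (t + t') m''))"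
proof
  assume "wp K (Then p q) m Q"
  then obtain t m' where e: "exec K (Then p q) m t m'" and "Q t m'"
    unfolding wp_def by blast
  then show "wp K p m (\<lambda>t m'. wp K q m' (\<lambda>t' m''. Q (t + t') m''))"
    unfolding wp_def by (cases rule: exec.cases) auto
next
  assume "wp K p m (\<lambda>t m'. wp K q m' (\<lambda>t' m''. Q (t + t') m''))"
  then show "wp K (Then p q) m Q"
    unfolding wp_def by (blast intro: exec.intros)
qed

lemma wp_Cond [simp]: "wp K (Cond b p q) m Q \<longleftrightarrow>
    (if bval b m then wp K p m (\<lambda>t. Q (1 + bcost b + t)) else wp K q m (\<lambda>t. Q (1 + bcost b + t)))"
proof
  assume "wp K (Cond b p q) m Q"
  then obtain t m' where e: "exec K (Cond b p q) m t m'" and "Q t m'"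
    unfolding wp_def by blast
  then show "if bval b m then wp K p m (\<lambda>t. Q (1 + bcost b + t)) else wp K q m (\<lambda>t. Q (1 + bcost b + t))"
    unfolding wp_def by (cases rule: exec.cases) auto
next
  assume "if bval b m then wp K p m (\<lambda>t. Q (1 + bcost b + t)) else wp K q m (\<lambda>t. Q (1 + bcost b + t))"
  then show "wp K (Cond b p q) m Q"
    unfolding wp_def by (cases "bval b m") (simp only: if_True if_False simp_thms, blast intro: exec.intros)+
qed

fun nwrites :: "prog \<Rightarrow> nat set" where
  "nwrites Skip = {}"
| "nwrites (NPut x e f) = {x}"
| "nwrites (KPut x e f) = {}"
| "nwrites (Output e) = {}"
| "nwrites (Then p q) = nwrites p \<union> nwrites q"
| "nwrites (Cond b p q) = nwrites p \<union> nwrites q"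
| "nwrites (Loop b p) = nwrites p"

fun kwrites :: "prog \<Rightarrow> nat set" where
  "kwrites Skip = {}"
| "kwrites (NPut x e f) = {}"
| "kwrites (KPut x e f) = {x}"
| "kwrites (Output e) = {}"
| "kwrites (Then p q) = kwrites p \<union> kwrites q"
| "kwrites (Cond b p q) = kwrites p \<union> kwrites q"
| "kwrites (Loop b p) = kwrites p"

fun silent :: "prog \<Rightarrow> bool" where
  "silent (Output e) \<longleftrightarrow> False"
| "silent (Then p q) \<longleftrightarrow> silent p \<and> silent q"
| "silent (Cond b p q) \<longleftrightarrow> silent p \<and> silent q"
| "silent (Loop b p) \<longleftrightarrow> silent p"
| "silent p \<longleftrightarrow> True"

text \<open>
  \<open>V\<close> and \<open>W\<close> are the arrays that may be modified; the flag says that nothing is printed.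
\<close>

definition unchanged :: "nat set \<Rightarrow> nat set \<Rightarrow> bool \<Rightarrow> mem \<Rightarrow> mem \<Rightarrow> bool" where
  "unchanged V W q m m' \<longleftrightarrow>
     (\<forall>x. x \<notin> V \<longrightarrow> narr m' x = narr m x) \<and> (\<forall>x. x \<notin> W \<longrightarrow> karr m' x = karr m x) \<and>
     (q \<longrightarrow> tape m' = tape m)"

lemma exec_unchanged: "exec K p m t m' \<Longrightarrow> unchanged (nwrites p) (kwrites p) (silent p) m m'"
  by (induction rule: exec.induct) (auto simp: unchanged_def)

text \<open>
  Specifications of subprograms only speak of their results; the frame is added when they are used.
\<close>

lemma wp_call:
  assumes "wp K p m Q0"
    and "\<And>t m'. \<lbrakk>Q0 t m'; unchanged (nwrites p) (kwrites p) (silent p) m m'\<rbrakk> \<Longrightarrow> Q t m'"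
  shows "wp K p m Q"
  using assms exec_unchanged unfolding wp_def by blast

lemma unchangedD:
  assumes "unchanged V W q m m'"
  shows "\<And>x. x \<notin> V \<Longrightarrow> narr m' x = narr m x"
    and "\<And>x. x \<notin> W \<Longrightarrow> karr m' x = karr m x"
    and "q \<Longrightarrow> tape m' = tape m"
  using assms by (auto simp: unchanged_def)

text \<open>
  The potential \<open>\<Phi>\<close> pays for the iterations; it bounds their time and proves termination.
\<close>

lemma wp_Loop:
  assumes "Inv m"
    and step: "\<And>m'. \<lbrakk>Inv m'; bval b m'; unchanged (nwrites p) (kwrites p) (silent p) m m'\<rbrakk> \<Longrightarrow>
          wp K p m' (\<lambda>t m''. Inv m'' \<and> t + 1 + bcost b + \<Phi> m'' \<le> \<Phi> m')"
    and fin: "\<And>t m'. \<lbrakk>Inv m'; \<not> bval b m'; unchanged (nwrites p) (kwrites p) (silent p) m m';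
          t + \<Phi> m' \<le> \<Phi> m + 1 + bcost b\<rbrakk> \<Longrightarrow> Q t m'"
  shows "wp K (Loop b p) m Q"
proof -
  let ?U = "unchanged (nwrites p) (kwrites p) (silent p)"
  have "\<exists>t m''. exec K (Loop b p) m' t m'' \<and> Inv m'' \<and> \<not> bval b m'' \<and> ?U m m'' \<and>
          t + \<Phi> m'' \<le> \<Phi> m' + 1 + bcost b" if "Inv m'" "?U m m'" for m'
    using that
  proof (induction "\<Phi> m'" arbitrary: m' rule: less_induct)
    case less
    show ?case
    proof (cases "bval b m'")
      case False
      then show ?thesis using less.prems by (intro exI[of _ "1 + bcost b"] exI[of _ m']) (simp add: exec.intros(8)[simplified])
    next
      case True
      from step[OF less.prems(1) True less.prems(2)] obtain t1 m1 where
        e: "exec K p m' t1 m1" and i: "Inv m1" and c: "t1 + 1 + bcost b + \<Phi> m1 \<le> \<Phi> m'"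
        unfolding wp_def by blast
      have u: "?U m m1" using exec_unchanged[OF e] less.prems(2) by (auto simp: unchanged_def)
      have "\<Phi> m1 < \<Phi> m'" using c by linarith
      from less.hyps[OF this i u] obtain t2 m2 where
        "exec K (Loop b p) m1 t2 m2" "Inv m2" "\<not> bval b m2" "?U m m2" "t2 + \<Phi> m2 \<le> \<Phi> m1 + 1 + bcost b"
        by blast
      moreover have "exec K (Loop b p) m' (1 + bcost b + t1 + t2) m2"
        using True e calculation(1) by (rule exec.intros)
      ultimately show ?thesis using c by (intro exI[of _ "1 + bcost b + t1 + t2"] exI[of _ m2]) auto
    qed
  qed
  from this[OF assms(1)] show ?thesis
    unfolding wp_def using fin by (auto simp: unchanged_def)
qed

subsection \<open>Lists in arrays\<close>

text \<open>
  Lists are stored with their length in cell 0.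
\<close>

definition lst :: "(nat \<Rightarrow> nat) \<Rightarrow> nat list \<Rightarrow> bool" where
  "lst f xs \<longleftrightarrow> f 0 = length xs \<and> (\<forall>k<length xs. f (Suc k) = xs ! k)"

abbreviation at0 :: "nat \<Rightarrow> nexp" where "at0 x \<equiv> NGet x (Num 0)"
abbreviation at1 :: "nat \<Rightarrow> nexp" where "at1 x \<equiv> NGet x (Num 1)"

definition Clear :: "nat \<Rightarrow> prog" where
  "Clear x = NPut x (Num 0) (Num 0)"

definition Push :: "nat \<Rightarrow> nexp \<Rightarrow> prog" where
  "Push x e = Then (NPut x (NAdd (at0 x) (Num 1)) e) (NPut x (Num 0) (NAdd (at0 x) (Num 1)))"

definition Pop :: "nat \<Rightarrow> nat \<Rightarrow> prog" where
  "Pop u x = Then (NPut u (Num 0) (NGet x (at0 x))) (NPut x (Num 0) (NSub (at0 x) (Num 1)))"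

text \<open>
  Cell 1 of the array \<open>e\<close> is the current position and cell 0 the current element.
\<close>

definition Foreach :: "nat \<Rightarrow> nat \<Rightarrow> prog \<Rightarrow> prog" where
  "Foreach e x p =
     Then (NPut e (Num 1) (Num 0))
       (Loop (NLess (at1 e) (at0 x))
         (Then (NPut e (Num 1) (NAdd (at1 e) (Num 1)))
         (Then (NPut e (Num 0) (NGet x (at1 e))) p)))"

definition Print :: "nat \<Rightarrow> nat \<Rightarrow> prog" where
  "Print e x = Then (Output (at0 x)) (Foreach e x (Output (at0 e)))"

definition Filter :: "nat \<Rightarrow> nat \<Rightarrow> nat \<Rightarrow> prog \<Rightarrow> bexp \<Rightarrow> prog" where
  "Filter e x y p b = Then (Clear y) (Foreach e x (Then p (Cond b (Push y (at0 e)) Skip)))"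

definition Exists :: "nat \<Rightarrow> nat \<Rightarrow> nat \<Rightarrow> bexp \<Rightarrow> prog" where
  "Exists e x y b = Then (NPut y (Num 0) (Num 0)) (Foreach e x (Cond b (NPut y (Num 0) (Num 1)) Skip))"

definition Range :: "nat \<Rightarrow> nexp \<Rightarrow> prog" where
  "Range x e = Then (Clear x) (Loop (NLess (at0 x) e) (Push x (at0 x)))"

lemma writes_macros [simp]:
  "nwrites (Clear x) = {x}" "nwrites (Push x e) = {x}" "nwrites (Pop u x) = {u, x}"
  "nwrites (Foreach i x p) = insert i (nwrites p)" "nwrites (Print i x) = {i}"
  "nwrites (Filter i x y p b) = {i, y} \<union> nwrites p" "nwrites (Exists i x y b) = {i, y}"
  "nwrites (Range x e) = {x}"
  "kwrites (Clear x) = {}" "kwrites (Push x e) = {}" "kwrites (Pop u x) = {}"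
  "kwrites (Foreach i x p) = kwrites p" "kwrites (Print i x) = {}"
  "kwrites (Filter i x y p b) = kwrites p" "kwrites (Exists i x y b) = {}"
  "kwrites (Range x e) = {}"
  "silent (Clear x)" "silent (Push x e)" "silent (Pop u x)"
  "silent (Foreach i x p) = silent p" "\<not> silent (Print i x)"
  "silent (Filter i x y p b) = silent p" "silent (Exists i x y b)" "silent (Range x e)"
  by (auto simp: Clear_def Push_def Pop_def Foreach_def Print_def Filter_def Exists_def Range_def)

lemma lst_0: "lst f xs \<Longrightarrow> f 0 = length xs"
  by (simp add: lst_def)

lemma lst_Nil: "lst f [] \<longleftrightarrow> f 0 = 0"
  by (simp add: lst_def)

lemma wp_Clear:
  assumes "\<And>f t. \<lbrakk>lst f []; t \<le> 3\<rbrakk> \<Longrightarrow> Q t (m\<lparr>narr := (narr m)(x := f)\<rparr>)"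
  shows "wp K (Clear x) m Q"
  by (auto simp: Clear_def lst_def intro!: assms)

lemma wp_Push:
  assumes "lst (narr m x) xs"
    and "\<And>f t. \<lbrakk>lst f (xs @ [nval e m]); t \<le> 11 + ncost e\<rbrakk> \<Longrightarrow> Q t (m\<lparr>narr := (narr m)(x := f)\<rparr>)"
  shows "wp K (Push x e) m Q"
  using assms(1) by (auto simp: Push_def lst_def nth_append intro!: assms(2))

lemma wp_Pop:
  assumes "lst (narr m x) (xs @ [a])" "u \<noteq> x"
    and "\<And>f g t. \<lbrakk>lst f xs; g 0 = a; t \<le> 12\<rbrakk> \<Longrightarrow> Q t (m\<lparr>narr := (narr m)(u := g, x := f)\<rparr>)"
  shows "wp K (Pop u x) m Q"
  using assms(1,2) by (auto simp: Pop_def lst_def nth_append intro!: assms(3))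

lemma wp_Foreach:
  assumes xs: "lst (narr m x) xs" and dist: "x \<noteq> e" "x \<notin> nwrites p" "e \<notin> nwrites p"
    and init: "Inv [] m"
    and stable: "\<And>ys m' f. Inv ys m' \<Longrightarrow> Inv ys (m'\<lparr>narr := (narr m')(e := f)\<rparr>)"
    and step: "\<And>ys y zs m'. \<lbrakk>xs = ys @ y # zs; Inv ys m'; narr m' e 0 = y;
        unchanged (insert e (nwrites p)) (kwrites p) (silent p) m m'\<rbrakk> \<Longrightarrow>
        wp K p m' (\<lambda>t m''. t \<le> T \<and> Inv (ys @ [y]) m'')"
    and fin: "\<And>t m'. \<lbrakk>Inv xs m'; unchanged (insert e (nwrites p)) (kwrites p) (silent p) m m';
        t \<le> 10 + length xs * (T + 20)\<rbrakk> \<Longrightarrow> Q t m'"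
  shows "wp K (Foreach e x p) m Q"
proof -
  let ?U = "unchanged (insert e (nwrites p)) (kwrites p) (silent p)"
  let ?I = "\<lambda>m'. narr m' e 1 \<le> length xs \<and> Inv (take (narr m' e 1) xs) m' \<and> ?U m m'"
  let ?\<Phi> = "\<lambda>m'. (length xs - narr m' e 1) * (T + 20)"
  have "wp K (Loop (NLess (at1 e) (at0 x))
         (Then (NPut e (Num 1) (NAdd (at1 e) (Num 1)))
         (Then (NPut e (Num 0) (NGet x (at1 e))) p))) (m\<lparr>narr := (narr m)(e := (narr m e)(1 := 0))\<rparr>)
       (\<lambda>t. Q (3 + t))"
  proof (rule wp_Loop[where Inv = ?I and \<Phi> = ?\<Phi>], goal_cases)
    case 1
    then show ?case using stable[OF init] by (auto simp: unchanged_def)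
  next
    case (2 m')
    let ?k = "narr m' e 1"
    have l: "narr m' x = narr m x" using 2(1) dist by (auto simp: unchanged_def)
    have k: "?k < length xs" using 2(2) l xs by (simp add: lst_def)
    let ?y = "xs ! ?k"
    have spl: "xs = take ?k xs @ ?y # drop (Suc ?k) xs" using k by (simp add: id_take_nth_drop)
    let ?m1 = "m'\<lparr>narr := (narr m')(e := (narr m' e)(1 := Suc ?k, 0 := ?y))\<rparr>"
    have "wp K p ?m1 (\<lambda>t m''. t \<le> T \<and> Inv (take ?k xs @ [?y]) m'')"
      using 2(1) by (intro step[OF spl]) (auto simp: unchanged_def intro!: stable)
    then have "wp K p ?m1 (\<lambda>t m''. t \<le> T \<and> Inv (take (Suc ?k) xs) m'')"
      using k by (simp add: take_Suc_conv_app_nth)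
    then have w: "wp K p ?m1 (\<lambda>t m''. t \<le> T \<and> Inv (take (narr m'' e 1) xs) m'' \<and> narr m'' e 1 = Suc ?k \<and> ?U m m'')"
    proof (rule wp_call)
      fix t m''
      assume a: "t \<le> T \<and> Inv (take (Suc ?k) xs) m''" "unchanged (nwrites p) (kwrites p) (silent p) ?m1 m''"
      from a(2) dist have "narr m'' e = narr ?m1 e" unfolding unchanged_def by blast
      moreover have "?U m m''" using a(2) 2(1) by (auto simp: unchanged_def)
      ultimately show "t \<le> T \<and> Inv (take (narr m'' e 1) xs) m'' \<and> narr m'' e 1 = Suc ?k \<and> ?U m m''"
        using a(1) by simp
    qed
    have ar: "t + 17 + (length xs - Suc ?k) * (T + 20) \<le> (length xs - ?k) * (T + 20)" if "t \<le> T" for t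
    proof -
      have "length xs - ?k = Suc (length xs - Suc ?k)" using k by simp
      then show ?thesis using that by simp
    qed
    show ?case
      using l k dist xs w by (auto simp: lst_def elim!: wp_call dest: ar)
  next
    case (3 t m')
    have l: "narr m' x = narr m x" using 3(1) dist by (auto simp: unchanged_def)
    have "narr m' e 1 = length xs" using 3(1,2) l xs by (simp add: lst_def)
    then show ?case using 3(1,4) by (intro fin) auto
  qed
  then show ?thesis by (simp add: Foreach_def numeral_3_eq_3)
qed

lemma wp_Print:
  assumes "lst (narr m x) xs" "x \<noteq> e"
    and "\<And>t m'. \<lbrakk>tape m' = tape m @ length xs # xs; t \<le> 13 + length xs * 23; unchanged {e} {} False m m'\<rbrakk> \<Longrightarrow> Q t m'"
  shows "wp K (Print e x) m Q"
  unfolding Print_def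
  using assms
  apply simp
  apply (rule wp_Foreach[where xs = xs and T = 3 and Inv = "\<lambda>ys m'. tape m' = tape m @ length xs # ys"])
        apply (auto simp: lst_def unchanged_def)
  done

lemma wp_Exists:
  assumes "lst (narr m x) xs" "x \<noteq> e" "x \<noteq> y" "e \<noteq> y"
    and b: "\<And>z m'. \<lbrakk>z \<in> set xs; unchanged {e, y} {} True m m'; narr m' e 0 = z\<rbrakk> \<Longrightarrow> bval b m' \<longleftrightarrow> P z"
    and Q: "\<And>t m'. \<lbrakk>narr m' y 0 = (if \<exists>z\<in>set xs. P z then 1 else 0); unchanged {e, y} {} True m m';
        t \<le> 13 + length xs * (bcost b + 24)\<rbrakk> \<Longrightarrow> Q t m'"
  shows "wp K (Exists e x y b) m Q"
  unfolding Exists_def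
  using assms(1-4)
  apply simp
  apply (rule wp_Foreach[where xs = xs and T = "bcost b + 4"
        and Inv = "\<lambda>ys m'. narr m' y 0 = (if \<exists>z\<in>set ys. P z then 1 else 0)"])
        apply (auto simp: lst_def unchanged_def)[6]
  subgoal for ys z zs m'
    using b[of z m'] by (auto simp: unchanged_def)
  subgoal for t m'
    by (rule Q) (auto simp: unchanged_def algebra_simps)
  done

lemma wp_Filter:
  assumes "lst (narr m x) xs" "x \<noteq> e" "x \<noteq> y" "e \<noteq> y" "e \<notin> nwrites p" "y \<notin> nwrites p" "x \<notin> nwrites p"
    and "silent p" "kwrites p = {}"
    and b: "\<And>z m'. \<lbrakk>z \<in> set xs; unchanged ({e, y} \<union> nwrites p) {} True m m'; narr m' e 0 = z\<rbrakk> \<Longrightarrow>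
       wp K p m' (\<lambda>t m''. t \<le> T \<and> (bval b m'' \<longleftrightarrow> P z))"
    and Q: "\<And>t m'. \<lbrakk>lst (narr m' y) (filter P xs); unchanged ({e, y} \<union> nwrites p) {} True m m';
        t \<le> 13 + length xs * (T + bcost b + 34)\<rbrakk> \<Longrightarrow> Q t m'"
  shows "wp K (Filter e x y p b) m Q"
  unfolding Filter_def
  apply simp
  apply (rule wp_Clear)
  apply (rule wp_Foreach[where xs = xs and T = "T + bcost b + 14"
        and Inv = "\<lambda>ys m'. lst (narr m' y) (filter P ys)"])
         using assms(1-9) apply (auto simp: unchanged_def)[6]
  subgoal premises prems for f t0 ys z zs m'
    unfolding wp_Then
  proof (rule wp_call[OF b[of z m']], goal_cases)
    case 1
    then show ?case using prems by simp
  next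
    case 2
    then show ?case using prems assms(1-9) by (auto simp: unchanged_def)
  next
    case 3
    then show ?case using prems by simp
  next
    case (4 t m'')
    have [simp]: "narr m'' e = narr m' e" "narr m'' y = narr m' y"
      using 4 assms(1-9) by (auto simp: unchanged_def)
    show ?case using 4 prems assms(2-4) by (auto intro!: wp_Push[where xs = "filter P ys"])
  qed
  subgoal for f t0 t m'
    by (rule Q) (use assms(1-9) in \<open>auto simp: unchanged_def algebra_simps\<close>)
  done

lemma wp_Range:
  assumes e: "\<And>m'. unchanged {x} {} True m m' \<Longrightarrow> nval e m' = k"
    and Q: "\<And>t m'. \<lbrakk>lst (narr m' x) [0..<k]; unchanged {x} {} True m m'; t \<le> 3 + k * (ncost e + 20) + 5 + ncost e\<rbrakk> \<Longrightarrow> Q t m'"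
  shows "wp K (Range x e) m Q"
  unfolding Range_def
  apply simp
  apply (rule wp_Clear)
  apply (rule wp_Loop[where Inv = "\<lambda>m'. lst (narr m' x) [0..<narr m' x 0] \<and> narr m' x 0 \<le> k \<and> unchanged {x} {} True m m'"
        and \<Phi> = "\<lambda>m'. (k - narr m' x 0) * (ncost e + 20)"])
  subgoal by (auto simp: lst_def unchanged_def)
  subgoal premises prems for f t0 m'
  proof -
    have k: "narr m' x 0 < k" using prems e[of m'] by simp
    have ar: "k - narr m' x 0 = Suc (k - Suc (narr m' x 0))" using k by simp
    show ?thesis
      apply (rule wp_Push[where xs = "[0..<narr m' x 0]"])
      using prems k by (auto simp: unchanged_def ar lst_0)
  qed
  subgoal for f t0 t m'
    by (rule Q) (use e[of m'] in \<open>auto simp: lst_def unchanged_def\<close>)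
  done

section \<open>The program\<close>

text \<open>
  The arrays of the program. The arrays \<open>aSIZE\<close>, \<open>aORDER\<close> and \<open>kJAC\<close> contain the input. \<open>aEQS\<close> lists the
  equations left, \<open>aROWS\<close> and \<open>aCOLS\<close> the current rows and columns of Seq; the trivial rows are never put
  into \<open>aROWS\<close>. \<open>aCROWS\<close>, \<open>aCCOLS\<close> and \<open>aWORK\<close> are the cover and the columns outside of it, \<open>aRROWS\<close>
  and \<open>aRCOLS\<close> the result of a pass. \<open>aPOS\<close> and \<open>aZERO\<close> count the positive entries and the entries 0 of
  each column. \<open>aSTATE\<close> is 1 as long as calls are to be made, 0 after a failure and 2 after a success.
\<close>

abbreviation (input) "aSIZE \<equiv> 0 :: nat"
abbreviation (input) "aORDER \<equiv> 1 :: nat"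
abbreviation (input) "aPOS \<equiv> 2 :: nat"
abbreviation (input) "aZERO \<equiv> 3 :: nat"
abbreviation (input) "aEQS \<equiv> 4 :: nat"
abbreviation (input) "aALL \<equiv> 5 :: nat"
abbreviation (input) "aFLAG \<equiv> 6 :: nat"
abbreviation (input) "aBAD \<equiv> 7 :: nat"
abbreviation (input) "aSTATE \<equiv> 8 :: nat"
abbreviation (input) "aCOLS \<equiv> 9 :: nat"
abbreviation (input) "aROWS \<equiv> 10 :: nat"
abbreviation (input) "aOWN \<equiv> 11 :: nat"
abbreviation (input) "aPRICE \<equiv> 12 :: nat"
abbreviation (input) "aMARK \<equiv> 13 :: nat"
abbreviation (input) "aFREE \<equiv> 14 :: nat"
abbreviation (input) "aLOST \<equiv> 15 :: nat"
abbreviation (input) "aCUR \<equiv> 16 :: nat"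
abbreviation (input) "aBEST \<equiv> 17 :: nat"
abbreviation (input) "aCROWS \<equiv> 18 :: nat"
abbreviation (input) "aCCOLS \<equiv> 19 :: nat"
abbreviation (input) "aWORK \<equiv> 20 :: nat"
abbreviation (input) "aPIVOT \<equiv> 21 :: nat"
abbreviation (input) "aNOPIV \<equiv> 22 :: nat"
abbreviation (input) "aREL \<equiv> 23 :: nat"
abbreviation (input) "aRROWS \<equiv> 24 :: nat"
abbreviation (input) "aRCOLS \<equiv> 25 :: nat"
abbreviation (input) "aY1 \<equiv> 26 :: nat"
abbreviation (input) "aY \<equiv> 27 :: nat"
abbreviation (input) "aMORE \<equiv> 28 :: nat"
abbreviation (input) "aPREV \<equiv> 29 :: nat"
abbreviation (input) "aI \<equiv> 30 :: nat"
abbreviation (input) "aJ \<equiv> 31 :: nat"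
abbreviation (input) "aK \<equiv> 32 :: nat"
abbreviation (input) "aGONE \<equiv> 33 :: nat"
abbreviation (input) "kJAC \<equiv> 0 :: nat"
abbreviation (input) "kMAT \<equiv> 1 :: nat"
abbreviation (input) "kFAC \<equiv> 2 :: nat"

abbreviation entry :: "nexp \<Rightarrow> nexp \<Rightarrow> nexp" where "entry i j \<equiv> NAdd (NMul i (at1 aSIZE)) j"
abbreviation order_at :: "nexp \<Rightarrow> nexp \<Rightarrow> nexp" where "order_at i j \<equiv> NGet aORDER (entry i j)"

lemma order_code_simps:
  "order_code (-\<infinity>) = 0" "order_code (ereal (real k)) = Suc k" "order_code 0 = Suc 0"
  by (simp_all add: order_code_def order_nat_def)

lemma entry_eq_iff:
  assumes "(j :: nat) < n" "j' < n"
  shows "i * n + j = i' * n + j' \<longleftrightarrow> i = i' \<and> j = j'"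
proof
  assume h: "i * n + j = i' * n + j'"
  have "(i * n + j) div n = (i' * n + j') div n" "(i * n + j) mod n = (i' * n + j') mod n"
    using h by simp_all
  then show "i = i' \<and> j = j'" using assms by simp
qed simp

locale algorithm_input =
  fixes n s :: nat and a :: "nat \<Rightarrow> nat \<Rightarrow> ereal" and J :: "nat \<Rightarrow> nat \<Rightarrow> real" and K :: "real set"
  assumes ad: "admissible n a J {..<s}"
    and K: "real_subfield K"
    and JK: "\<And>i j. \<lbrakk>i < s; j < n\<rbrakk> \<Longrightarrow> J i j \<in> K"
begin

definition stored :: "mem \<Rightarrow> bool" where
  "stored m \<longleftrightarrow> narr m aSIZE 0 = s \<and> narr m aSIZE 1 = n \<and>
     (\<forall>i<s. \<forall>j<n. narr m aORDER (i * n + j) = order_code (a i j) \<and> karr m kJAC (i * n + j) = J i j)"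

lemma storedD:
  assumes "stored m"
  shows "narr m aSIZE 0 = s" "narr m aSIZE (Suc 0) = n"
    "\<And>i j. \<lbrakk>i < s; j < n\<rbrakk> \<Longrightarrow> narr m aORDER (i * n + j) = order_code (a i j)"
    "\<And>i j. \<lbrakk>i < s; j < n\<rbrakk> \<Longrightarrow> karr m kJAC (i * n + j) = J i j"
  using assms by (auto simp: stored_def)

lemma stored_unchanged:
  "\<lbrakk>stored m; unchanged V W q m m'; aSIZE \<notin> V; aORDER \<notin> V; kJAC \<notin> W\<rbrakk> \<Longrightarrow> stored m'"
  by (simp add: stored_def unchangedD)

lemma order_cases:
  assumes "i < s" "j < n"
  obtains "a i j = -\<infinity>" "order_code (a i j) = 0" | "a i j = 0" "order_code (a i j) = Suc 0"
  | k where "a i j = ereal (real (Suc k))" "order_code (a i j) = Suc (Suc k)" "a i j \<noteq> 0" "a i j \<noteq> -\<infinity>"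
proof -
  have "a i j = -\<infinity> \<or> (\<exists>k. a i j = ereal (real k))" using admissibleD(3)[OF ad, of i j] assms by blast
  then consider "a i j = -\<infinity>" | k where "a i j = ereal (real k)" by blast
  then show thesis
  proof cases
    case 1
    then show thesis by (intro that(1)) (simp_all add: order_code_simps)
  next
    case (2 k)
    show thesis
    proof (cases k)
      case 0
      then have "a i j = 0" using 2 by (simp add: zero_ereal_def)
      then show thesis by (intro that(2)) (simp_all add: order_code_simps(3))
    next
      case (Suc k')
      have "order_code (a i j) = Suc k" unfolding 2 by (rule order_code_simps(2))
      then show thesis using 2 Suc by (intro that(3)[of k']) (simp_all add: zero_ereal_def)
    qed
  qed
qed

lemma code_one_iff: "\<lbrakk>i < s; j < n\<rbrakk> \<Longrightarrow> order_code (a i j) = Suc 0 \<longleftrightarrow> a i j = 0"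
  by (rule order_cases[of i j]) auto

lemma code_zero_iff: "\<lbrakk>i < s; j < n\<rbrakk> \<Longrightarrow> order_code (a i j) = 0 \<longleftrightarrow> a i j = -\<infinity>"
  by (rule order_cases[of i j]) auto

end

subsection \<open>Computing the minimum cover\<close>

definition best_bid :: prog where
  "best_bid = Then (NPut aBEST (Num 0) (Num 0))
     (Foreach aI aCOLS
       (Cond (BAnd (NEq (order_at (at0 aCUR) (at0 aI)) (Num 1))
               (BNot (BAnd (NLess (Num 0) (at0 aBEST))
                 (BNot (NLess (NGet aPRICE (at0 aI)) (NGet aPRICE (NSub (at0 aBEST) (Num 1))))))))
         (NPut aBEST (Num 0) (NAdd (at0 aI) (Num 1))) Skip))"

text \<open>
  \<open>aBEST\<close> contains \<open>Suc b\<close> for the best column \<open>b\<close>, or 0 if the row has no entry 0. The former owner of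
  \<open>b\<close> becomes free again, and a row that finds only columns at the limit is lost.
\<close>

definition place_bid :: prog where
  "place_bid =
     Cond (BAnd (NLess (Num 0) (at0 aBEST)) (NLess (NGet aPRICE (NSub (at0 aBEST) (Num 1))) (at0 aROWS)))
       (Then (Cond (NLess (Num 0) (NGet aOWN (NSub (at0 aBEST) (Num 1))))
               (Push aFREE (NSub (NGet aOWN (NSub (at0 aBEST) (Num 1))) (Num 1))) Skip)
       (Then (NPut aOWN (NSub (at0 aBEST) (Num 1)) (NAdd (at0 aCUR) (Num 1)))
         (NPut aPRICE (NSub (at0 aBEST) (Num 1)) (NAdd (NGet aPRICE (NSub (at0 aBEST) (Num 1))) (Num 1)))))
       (Push aLOST (at0 aCUR))"

definition bid_loop :: prog where
  "bid_loop = Loop (NLess (Num 0) (at0 aFREE)) (Then (Pop aCUR aFREE) (Then best_bid place_bid))"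

definition clear_columns :: prog where
  "clear_columns = Foreach aI aCOLS
     (Then (NPut aOWN (at0 aI) (Num 0)) (Then (NPut aPRICE (at0 aI) (Num 0)) (NPut aMARK (at0 aI) (Num 0))))"

definition copy_list :: "nat \<Rightarrow> nat \<Rightarrow> prog" where
  "copy_list x y = Filter aI x y Skip (NEq (Num 0) (Num 0))"

text \<open>
  The rows from which the marking has still to be continued are on the stack \<open>aLOST\<close>, which initially
  consists of the unmatched rows. All marked columns are owned, hence their owner can be pushed.
\<close>

definition mark_columns :: prog where
  "mark_columns = Foreach aI aCOLS
     (Cond (BAnd (NEq (order_at (at0 aCUR) (at0 aI)) (Num 1)) (NEq (NGet aMARK (at0 aI)) (Num 0)))
       (Then (NPut aMARK (at0 aI) (Num 1)) (Push aLOST (NSub (NGet aOWN (at0 aI)) (Num 1)))) Skip)"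

definition mark_loop :: prog where
  "mark_loop = Loop (NLess (Num 0) (at0 aLOST)) (Then (Pop aCUR aLOST) mark_columns)"

definition extract_column :: prog where
  "extract_column = Cond (NEq (NGet aMARK (at0 aI)) (Num 0))
     (Then (Push aWORK (at0 aI))
       (Cond (NLess (Num 0) (NGet aOWN (at0 aI))) (Push aCROWS (NSub (NGet aOWN (at0 aI)) (Num 1))) Skip))
     (Push aCCOLS (at0 aI))"

definition extract_cover :: prog where
  "extract_cover = Then (Clear aCROWS) (Then (Clear aCCOLS) (Then (Clear aWORK)
     (Foreach aI aCOLS extract_column)))"

definition cover_prog :: prog where
  "cover_prog = Then clear_columns (Then (copy_list aROWS aFREE) (Then (Clear aLOST)
     (Then bid_loop (Then mark_loop extract_cover))))"

lemma cover_writes [simp]: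
  "nwrites best_bid = {aBEST, aI}" "kwrites best_bid = {}" "silent best_bid"
  "nwrites place_bid = {aFREE, aOWN, aPRICE, aLOST}" "kwrites place_bid = {}" "silent place_bid"
  "nwrites bid_loop = {aCUR, aFREE, aBEST, aI, aOWN, aPRICE, aLOST}" "kwrites bid_loop = {}" "silent bid_loop"
  "nwrites clear_columns = {aI, aOWN, aPRICE, aMARK}" "kwrites clear_columns = {}" "silent clear_columns"
  "nwrites (copy_list x y) = {aI, y}" "kwrites (copy_list x y) = {}" "silent (copy_list x y)"
  "nwrites mark_columns = {aI, aMARK, aLOST}" "kwrites mark_columns = {}" "silent mark_columns"
  "nwrites mark_loop = {aCUR, aI, aMARK, aLOST}" "kwrites mark_loop = {}" "silent mark_loop"
  "nwrites extract_column = {aCROWS, aCCOLS, aWORK}" "kwrites extract_column = {}" "silent extract_column"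
  "nwrites extract_cover = {aCROWS, aCCOLS, aWORK, aI}" "kwrites extract_cover = {}" "silent extract_cover"
  "nwrites cover_prog = {aCUR, aI, aMARK, aLOST, aFREE, aBEST, aOWN, aPRICE, aCROWS, aCCOLS, aWORK}"
  "kwrites cover_prog = {}" "silent cover_prog"
  by (auto simp: best_bid_def place_bid_def bid_loop_def clear_columns_def copy_list_def
      mark_columns_def mark_loop_def extract_column_def extract_cover_def cover_prog_def)

lemma wp_copy_list:
  assumes "lst (narr m x) xs" "x \<noteq> aI" "y \<noteq> aI" "x \<noteq> y"
    and Q: "\<And>t m'. \<lbrakk>lst (narr m' y) xs; unchanged {aI, y} {} True m m'; t \<le> 13 + length xs * 38\<rbrakk> \<Longrightarrow> Q t m'"
  shows "wp K (copy_list x y) m Q"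
  unfolding copy_list_def
proof (rule wp_Filter[where xs = xs and T = 1 and P = "\<lambda>_. True"])
  fix t m' assume h: "lst (narr m' y) (filter (\<lambda>_. True) xs)"
    "unchanged ({aI, y} \<union> nwrites Skip) {} True m m'" "t \<le> 13 + length xs * (1 + bcost (NEq (Num 0) (Num 0)) + 34)"
  show "Q t m'" by (rule Q) (use h in simp_all)
qed (use assms in simp_all)

definition best_choice :: "(nat \<Rightarrow> nat \<Rightarrow> ereal) \<Rightarrow> (nat \<Rightarrow> nat) \<Rightarrow> nat \<Rightarrow> nat set \<Rightarrow> nat \<Rightarrow> bool" where
  "best_choice a price u C v \<longleftrightarrow>
     (case v of 0 \<Rightarrow> \<forall>c\<in>C. a u c \<noteq> 0
      | Suc b \<Rightarrow> b \<in> C \<and> a u b = 0 \<and> (\<forall>c\<in>C. a u c = 0 \<longrightarrow> price b \<le> price c))"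

lemma best_choice_empty: "best_choice a price u {} 0"
  by (simp add: best_choice_def)

lemma best_choice_insert:
  assumes "best_choice a price u C v"
  shows "best_choice a price u (insert c C)
    (if a u c = 0 \<and> \<not> (0 < v \<and> \<not> price c < price (v - 1)) then Suc c else v)"
  using assms by (auto simp: best_choice_def split: nat.splits)

context algorithm_input begin

lemma wp_best_bid:
  assumes st: "stored m" and cl: "lst (narr m aCOLS) cl" "set cl \<subseteq> {..<n}" and u: "narr m aCUR 0 < s"
  shows "wp K best_bid m (\<lambda>t m'. t \<le> 13 + length cl * 60 \<and>
    best_choice a (narr m aPRICE) (narr m aCUR 0) (set cl) (narr m' aBEST 0))"
  unfolding best_bid_def wp_Then wp_NPut
proof (rule wp_Foreach[where xs = cl and T = 40 and
      Inv = "\<lambda>ys m'. best_choice a (narr m aPRICE) (narr m aCUR 0) (set ys) (narr m' aBEST 0)"], goal_cases)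
  case (7 ys y zs m')
  have un: "narr m' aPRICE = narr m aPRICE" "narr m' aCUR = narr m aCUR" "narr m' aSIZE = narr m aSIZE"
    "narr m' aORDER = narr m aORDER"
    using 7(4) by (simp_all add: unchanged_def)
  have y: "y < n" using 7(1) cl(2) by auto
  have c: "narr m' aORDER (narr m' aCUR 0 * narr m' aSIZE (Suc 0) + narr m' aI 0) = Suc 0 \<longleftrightarrow> a (narr m aCUR 0) y = 0"
    using storedD[OF st] code_one_iff[OF u y] u y 7(3) un by simp
  show ?case
    using best_choice_insert[OF 7(2), of y] 7(3) c un by (auto simp: insert_commute)
qed (use cl in \<open>auto simp: best_choice_empty\<close>)

end

text \<open>
  \<open>fr\<close> are the rows that are still to bid and \<open>lo\<close> those that have given up; together with the owners
  of columns they make up \<open>R\<close>.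
\<close>

definition bidding ::
    "(nat \<Rightarrow> nat \<Rightarrow> ereal) \<Rightarrow> nat set \<Rightarrow> nat set \<Rightarrow> nat list \<Rightarrow> nat list \<Rightarrow> (nat \<Rightarrow> nat) \<Rightarrow> (nat \<Rightarrow> nat) \<Rightarrow> bool"
where
  "bidding a R C fr lo own price \<longleftrightarrow> auction a R C (card R) own price \<and> distinct (fr @ lo) \<and>
     set fr \<union> set lo \<union> assigned own C = R \<and> (set fr \<union> set lo) \<inter> assigned own C = {} \<and>
     (\<forall>u\<in>set lo. \<forall>c\<in>C. a u c = 0 \<longrightarrow> price c \<ge> card R)"

lemma biddingD:
  assumes "bidding a R C fr lo own price"
  shows "auction a R C (card R) own price" "distinct (fr @ lo)"
    "set fr \<union> set lo \<union> assigned own C = R" "(set fr \<union> set lo) \<inter> assigned own C = {}"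
    "\<And>u c. \<lbrakk>u \<in> set lo; c \<in> C; a u c = 0\<rbrakk> \<Longrightarrow> price c \<ge> card R"
  using assms unfolding bidding_def by simp_all

lemma bidding_start:
  assumes "distinct rl" "set rl = R" "\<And>c. c \<in> C \<Longrightarrow> own c = 0" "\<And>c. c \<in> C \<Longrightarrow> price c = 0"
  shows "bidding a R C rl [] own price"
proof -
  have "auction a R C (card R) own price"
    using auction_start[of a R C "card R"] auction_cong[of C own "\<lambda>c. 0" price "\<lambda>c. 0" a R "card R"] assms(3,4)
    by simp
  moreover have "assigned own C = {}" using assms(3) by (auto simp: assigned_def)
  ultimately show ?thesis using assms(1,2) by (simp add: bidding_def)
qed

lemma bidding_lose:
  assumes b: "bidding a R C (fr @ [u]) lo own price" and "\<And>c. \<lbrakk>c \<in> C; a u c = 0\<rbrakk> \<Longrightarrow> price c \<ge> card R"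
  shows "bidding a R C fr (lo @ [u]) own price"
proof -
  note d = biddingD[OF b]
  have "set (fr @ [u]) \<union> set lo = set fr \<union> set (lo @ [u])" by auto
  then show ?thesis
    unfolding bidding_def
    by (intro conjI ballI impI) (use d assms(2) in auto)
qed

text \<open>
  The price rises by 1 above a minimal one, which keeps the invariant of the auction for the new owner,
  and for all others as prices only grow.
\<close>

lemma bidding_win:
  assumes b: "bidding a R C (fr @ [u]) lo own price" and c: "c \<in> C" "a u c = 0" "price c < card R"
    and best: "\<And>c'. \<lbrakk>c' \<in> C; a u c' = 0\<rbrakk> \<Longrightarrow> price c \<le> price c'"
  shows "bidding a R C (if own c = 0 then fr else fr @ [own c - 1]) lo (own(c := Suc u)) (price(c := Suc (price c)))"
proof -
  note d = biddingD[OF b]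
  let ?own = "own(c := Suc u)"
  let ?new = "if own c = 0 then {} else {own c - 1}"
  have m: "matching a R C own" using d(1) by (simp add: auction_def)
  have u: "u \<in> R" "u \<notin> assigned own C" using d(3,4) by auto
  have new: "?new \<subseteq> assigned own C" using c(1) by (auto simp: assigned_def)
  have asg: "assigned ?own C = insert u (assigned own C - ?new)"
  proof (intro equalityI subsetI)
    fix r assume "r \<in> assigned ?own C"
    then obtain c' where c': "c' \<in> C" "?own c' = Suc r" unfolding assigned_def by blast
    show "r \<in> insert u (assigned own C - ?new)"
    proof (cases "c' = c")
      case True
      then show ?thesis using c'(2) by simp
    next
      case False
      then have o: "own c' = Suc r" using c'(2) by simp
      have "r \<notin> ?new"
      proof
        assume "r \<in> ?new"
        then have "own c = Suc r" by (auto split: if_splits)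
        then show False using matchingD(3)[OF m c'(1) o c(1)] False by simp
      qed
      then show ?thesis using o c'(1) unfolding assigned_def by blast
    qed
  next
    fix r assume r: "r \<in> insert u (assigned own C - ?new)"
    show "r \<in> assigned ?own C"
    proof (cases "r = u")
      case True
      then show ?thesis using c(1) unfolding assigned_def by (intro CollectI bexI[of _ c]) simp_all
    next
      case False
      then obtain c' where c': "c' \<in> C" "own c' = Suc r" using r unfolding assigned_def by blast
      have "c' \<noteq> c" using r False c' by auto
      then show ?thesis using c' unfolding assigned_def by (intro CollectI bexI[of _ c']) simp_all
    qed
  qed
  have "auction a R C (card R) ?own (price(c := Suc (price c)))"
    by (rule auction_bid[OF d(1) u c best])
  moreover have set: "set (if own c = 0 then fr else fr @ [own c - 1]) = set fr \<union> ?new" by simp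
  have dis: "distinct (fr @ lo)" "u \<notin> set fr \<union> set lo" using d(2) by auto
  have new_fresh: "?new \<inter> (set fr \<union> set lo) = {}" using new d(4) by auto
  moreover have "distinct ((if own c = 0 then fr else fr @ [own c - 1]) @ lo)"
    using dis(1) new_fresh by (cases "own c = 0") auto
  moreover have "(set fr \<union> ?new) \<union> set lo \<union> assigned ?own C = R"
    unfolding asg d(3)[symmetric] using new by auto
  moreover have "((set fr \<union> ?new) \<union> set lo) \<inter> assigned ?own C = {}"
    unfolding asg using d(4) dis(2) new u(2) by auto
  moreover have "\<forall>v\<in>set lo. \<forall>c'\<in>C. a v c' = 0 \<longrightarrow> (price(c := Suc (price c))) c' \<ge> card R"
    using d(5) by (auto intro: le_SucI)
  ultimately show ?thesis unfolding bidding_def set by blast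
qed

lemma matched_columns_le:
  assumes m: "matching a R C own" and "finite R" "finite C"
  shows "card {c \<in> C. own c \<noteq> 0} \<le> card R"
proof (rule card_inj_on_le[of "\<lambda>c. own c - 1"])
  show "inj_on (\<lambda>c. own c - 1) {c \<in> C. own c \<noteq> 0}"
  proof (rule inj_onI)
    fix c c' assume c: "c \<in> {c \<in> C. own c \<noteq> 0}" "c' \<in> {c \<in> C. own c \<noteq> 0}" "own c - 1 = own c' - 1"
    then have o: "own c = Suc (own c - 1)" "own c' = Suc (own c - 1)" by auto
    show "c = c'" using matchingD(3)[OF m _ o(2), of c] c(1,2) o(1) by blast
  qed
  show "(\<lambda>c. own c - 1) ` {c \<in> C. own c \<noteq> 0} \<subseteq> R"
  proof (rule image_subsetI)
    fix c assume c: "c \<in> {c \<in> C. own c \<noteq> 0}"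
    then have "own c = Suc (own c - 1)" by simp
    then show "own c - 1 \<in> R" using matchingD(1)[OF m] c by blast
  qed
qed (fact assms(2))

text \<open>
  There are at most \<open>card R\<close> owned columns, with prices at most \<open>card R\<close>, and the others are free.
\<close>

lemma price_sum_le:
  assumes au: "auction a R C (card R) own price" and fin: "finite R" "finite C"
  shows "sum price C \<le> card R * card R"
proof -
  let ?M = "{c \<in> C. own c \<noteq> 0}"
  have p: "price c \<le> card R" "own c = 0 \<Longrightarrow> price c = 0" if "c \<in> C" for c
    using au that unfolding auction_def by auto
  have "sum price C = sum price ?M"
    using p fin by (intro sum.mono_neutral_right) auto
  also have "\<dots> \<le> of_nat (card ?M) * card R" by (rule sum_bounded_above) (use p in auto)
  also have "\<dots> \<le> card R * card R"
    using matched_columns_le[of a R C own] au fin by (simp add: auction_def mult_le_mono1)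
  finally show ?thesis .
qed

lemma sum_fun_upd_Suc:
  fixes p :: "nat \<Rightarrow> nat"
  assumes "finite C" "c \<in> C"
  shows "sum (p(c := Suc (p c))) C = Suc (sum p C)"
proof -
  have "sum (p(c := Suc (p c))) C = Suc (p c) + sum p (C - {c})"
    using assms by (subst sum.remove[of _ c]) (auto intro: sum.cong)
  then show ?thesis using sum.remove[of C c p] assms by simp
qed

lemma wp_place_win:
  assumes "narr m aBEST 0 = Suc c" "narr m aPRICE c < narr m aROWS 0" "lst (narr m aFREE) fr"
  shows "wp K place_bid m (\<lambda>t m'. t \<le> 90 \<and>
    lst (narr m' aFREE) (if narr m aOWN c = 0 then fr else fr @ [narr m aOWN c - 1]) \<and>
    narr m' aOWN = (narr m aOWN)(c := Suc (narr m aCUR 0)) \<and>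
    narr m' aPRICE = (narr m aPRICE)(c := Suc (narr m aPRICE c)) \<and> narr m' aLOST = narr m aLOST)"
proof (cases "narr m aOWN c = 0")
  case True
  then show ?thesis using assms by (simp add: place_bid_def)
next
  case False
  have "wp K (Push aFREE (NSub (NGet aOWN (NSub (at0 aBEST) (Num 1))) (Num 1))) m
     (\<lambda>t m'. t \<le> 20 \<and> lst (narr m' aFREE) (fr @ [narr m aOWN c - 1]))"
    by (rule wp_Push[where xs = fr]) (use assms in simp_all)
  then show ?thesis
    using assms False by (auto simp: place_bid_def unchanged_def elim!: wp_call)
qed

lemma wp_place_lose:
  assumes "\<not> (0 < narr m aBEST 0 \<and> narr m aPRICE (narr m aBEST 0 - 1) < narr m aROWS 0)"
    and "lst (narr m aLOST) lo"
  shows "wp K place_bid m (\<lambda>t m'. t \<le> 90 \<and> lst (narr m' aLOST) (lo @ [narr m aCUR 0]) \<and>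
    narr m' aFREE = narr m aFREE \<and> narr m' aOWN = narr m aOWN \<and> narr m' aPRICE = narr m aPRICE)"
proof -
  have "wp K (Push aLOST (at0 aCUR)) m (\<lambda>t m'. t \<le> 13 \<and> lst (narr m' aLOST) (lo @ [narr m aCUR 0]))"
    by (rule wp_Push[where xs = lo]) (use assms in simp_all)
  then show ?thesis
    using assms(1) by (auto simp: place_bid_def unchanged_def elim!: wp_call)
qed

context algorithm_input begin

text \<open>
  Each iteration either raises the sum of the prices, at most \<open>d\<^sup>2\<close>, or loses one of the \<open>d\<close> rows;
  this is the potential.
\<close>

lemma wp_bid_loop:
  assumes st: "stored m" and cl: "lst (narr m aCOLS) cl" "set cl \<subseteq> {..<n}"
    and rl: "lst (narr m aROWS) rl" "distinct rl" "set rl \<subseteq> {..<s}"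
    and free: "lst (narr m aFREE) rl" and lost: "lst (narr m aLOST) []"
    and zero: "\<And>c. c \<in> set cl \<Longrightarrow> narr m aOWN c = 0" "\<And>c. c \<in> set cl \<Longrightarrow> narr m aPRICE c = 0"
  shows "wp K bid_loop m (\<lambda>t m'. t \<le> 6 + (length cl * 60 + 150) * (length rl * length rl + length rl) \<and>
    (\<exists>lo. lst (narr m' aLOST) lo \<and> bidding a (set rl) (set cl) [] lo (narr m' aOWN) (narr m' aPRICE)))"
  unfolding bid_loop_def
proof (rule wp_Loop[where
      Inv = "\<lambda>m'. \<exists>fr lo. lst (narr m' aFREE) fr \<and> lst (narr m' aLOST) lo \<and>
        bidding a (set rl) (set cl) fr lo (narr m' aOWN) (narr m' aPRICE)" and
      \<Phi> = "\<lambda>m'. (length cl * 60 + 150) *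
        ((length rl * length rl - sum (narr m' aPRICE) (set cl)) + (length rl - narr m' aLOST 0))"], goal_cases)
  case 1
  show ?case
    by (intro exI conjI) (rule free, rule lost, rule bidding_start[OF rl(2) refl zero])
next
  case (2 m')
  let ?R = "set rl" and ?C = "set cl" and ?L = "length rl"
  define B where "B = length cl * 60 + 150"
  have L: "card ?R = ?L" using rl(2) by (rule distinct_card)
  obtain fr lo where i: "lst (narr m' aFREE) fr" "lst (narr m' aLOST) lo"
    "bidding a ?R ?C fr lo (narr m' aOWN) (narr m' aPRICE)" using 2(1) by blast
  have "fr \<noteq> []" using 2(2) i(1) by (auto simp: lst_def)
  then obtain fr' u where fr: "fr = fr' @ [u]" by (metis rev_exhaust)
  note b = i(3)[unfolded fr]
  have uR: "u \<in> ?R" using biddingD(3)[OF b] by auto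
  have us: "u < s" using uR rl(3) by auto
  have un: "narr m' aCOLS = narr m aCOLS" "narr m' aROWS = narr m aROWS"
    using 2(3) by (simp_all add: unchanged_def)
  have st': "stored m'" using st 2(3) by (rule stored_unchanged) simp_all
  let ?Q = "\<lambda>t m''. (\<exists>fr lo. lst (narr m'' aFREE) fr \<and> lst (narr m'' aLOST) lo \<and>
        bidding a ?R ?C fr lo (narr m'' aOWN) (narr m'' aPRICE)) \<and>
      t + 1 + bcost (NLess (Num 0) (at0 aFREE)) +
        B * ((?L * ?L - sum (narr m'' aPRICE) ?C) + (?L - narr m'' aLOST 0))
      \<le> B * ((?L * ?L - sum (narr m' aPRICE) ?C) + (?L - narr m' aLOST 0))"
  have "wp K (Pop aCUR aFREE) m' (\<lambda>t m1. wp K best_bid m1 (\<lambda>t' m2. wp K place_bid m2 (\<lambda>t'' m3. ?Q (t + (t' + t'')) m3)))"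
  proof (rule wp_Pop[OF i(1)[unfolded fr]])
    fix f g :: "nat \<Rightarrow> nat" and t :: nat assume f: "lst f fr'" "g 0 = u" "t \<le> (12::nat)"
    let ?m1 = "m'\<lparr>narr := (narr m')(aCUR := g, aFREE := f)\<rparr>"
    have bb: "wp K best_bid ?m1 (\<lambda>t m2. t \<le> 13 + length cl * 60 \<and>
      best_choice a (narr ?m1 aPRICE) (narr ?m1 aCUR 0) (set cl) (narr m2 aBEST 0))"
      by (rule wp_best_bid) (use st' cl un f us in \<open>auto simp: stored_def\<close>)
    show "wp K best_bid ?m1 (\<lambda>t' m2. wp K place_bid m2 (\<lambda>t'' m3. ?Q (t + (t' + t'')) m3))"
    proof (rule wp_call[OF bb])
      fix t' m2
      assume h: "t' \<le> 13 + length cl * 60 \<and>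
        best_choice a (narr ?m1 aPRICE) (narr ?m1 aCUR 0) (set cl) (narr m2 aBEST 0)"
        "unchanged (nwrites best_bid) (kwrites best_bid) (silent best_bid) ?m1 m2"
      have un2: "narr m2 aFREE = f" "narr m2 aLOST = narr m' aLOST" "narr m2 aOWN = narr m' aOWN"
        "narr m2 aPRICE = narr m' aPRICE" "narr m2 aCUR = g" "narr m2 aROWS = narr m aROWS"
        using h(2) un by (simp_all add: unchanged_def)
      have bc: "best_choice a (narr m' aPRICE) u ?C (narr m2 aBEST 0)" using h(1) f(2) by simp
      have tB: "t + (t' + t'') + 1 + bcost (NLess (Num 0) (at0 aFREE)) \<le> B" if "t'' \<le> 90" for t''
        using that f(3) h(1)[THEN conjunct1] by (simp add: B_def)
      have rows: "narr m2 aROWS 0 = ?L" using un2(6) rl(1) by (simp add: lst_0)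
      have lo0: "narr m' aLOST 0 = length lo" using i(2) by (rule lst_0)
      show "wp K place_bid m2 (\<lambda>t'' m3. ?Q (t + (t' + t'')) m3)"
      proof (cases "0 < narr m2 aBEST 0 \<and> narr m' aPRICE (narr m2 aBEST 0 - 1) < ?L")
        case True
        then obtain c where c: "narr m2 aBEST 0 = Suc c" "narr m' aPRICE c < ?L"
          by (cases "narr m2 aBEST 0") auto
        then have c': "c \<in> ?C" "a u c = 0" "\<And>c'. \<lbrakk>c' \<in> ?C; a u c' = 0\<rbrakk> \<Longrightarrow> narr m' aPRICE c \<le> narr m' aPRICE c'"
          using bc by (simp_all add: best_choice_def)
        let ?own = "(narr m' aOWN)(c := Suc u)" and ?pr = "(narr m' aPRICE)(c := Suc (narr m' aPRICE c))"
        have win: "bidding a ?R ?C (if narr m' aOWN c = 0 then fr' else fr' @ [narr m' aOWN c - 1]) lo ?own ?pr"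
          by (rule bidding_win[OF b c'(1,2) _ c'(3)]) (use c(2) L in simp)
        have s1: "sum ?pr ?C = Suc (sum (narr m' aPRICE) ?C)" using c'(1) by (intro sum_fun_upd_Suc) simp_all
        have s2: "sum ?pr ?C \<le> ?L * ?L"
          using price_sum_le[OF biddingD(1)[OF win]] L by simp
        have dec: "B + B * ((?L * ?L - sum ?pr ?C) + (?L - length lo))
            \<le> B * ((?L * ?L - sum (narr m' aPRICE) ?C) + (?L - length lo))"
        proof -
          from s1 s2 have "?L * ?L - sum (narr m' aPRICE) ?C = Suc (?L * ?L - sum ?pr ?C)" by simp
          then show ?thesis by (simp only: add_Suc mult_Suc_right)
        qed
        show ?thesis
        proof (rule wp_call[OF wp_place_win])
          show "narr m2 aBEST 0 = Suc c" by (fact c(1))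
          show "narr m2 aPRICE c < narr m2 aROWS 0" using c(2) un2 rows by simp
          show "lst (narr m2 aFREE) fr'" using un2 f by simp
          fix t'' :: nat and m3
          assume p: "t'' \<le> 90 \<and>
            lst (narr m3 aFREE) (if narr m2 aOWN c = 0 then fr' else fr' @ [narr m2 aOWN c - 1]) \<and>
            narr m3 aOWN = (narr m2 aOWN)(c := Suc (narr m2 aCUR 0)) \<and>
            narr m3 aPRICE = (narr m2 aPRICE)(c := Suc (narr m2 aPRICE c)) \<and> narr m3 aLOST = narr m2 aLOST"
          have p': "narr m3 aOWN = ?own" "narr m3 aPRICE = ?pr" "narr m3 aLOST = narr m' aLOST"
            using p un2 f(2) by simp_all
          have p4: "lst (narr m3 aFREE) (if narr m' aOWN c = 0 then fr' else fr' @ [narr m' aOWN c - 1])"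
            using p unfolding un2(3) by (elim conjE)
          show "?Q (t + (t' + t'')) m3"
            unfolding p'(1,2,3)
          proof (intro conjI exI)
            show "lst (narr m3 aFREE) (if narr m' aOWN c = 0 then fr' else fr' @ [narr m' aOWN c - 1])"
              by (fact p4)
            show "lst (narr m' aLOST) lo" by (fact i(2))
            show "bidding a ?R ?C (if narr m' aOWN c = 0 then fr' else fr' @ [narr m' aOWN c - 1]) lo ?own ?pr"
              by (fact win)
            show "t + (t' + t'') + 1 + bcost (NLess (Num 0) (at0 aFREE)) +
                B * ((?L * ?L - sum ?pr ?C) + (?L - narr m' aLOST 0))
              \<le> B * ((?L * ?L - sum (narr m' aPRICE) ?C) + (?L - narr m' aLOST 0))"
              using dec tB[OF p[THEN conjunct1]] unfolding lo0 by linarith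
          qed
        qed
      next
        case False
        have high: "narr m' aPRICE c \<ge> card ?R" if "c \<in> ?C" "a u c = 0" for c
        proof (cases "narr m2 aBEST 0")
          case 0
          then show ?thesis using bc that by (simp add: best_choice_def)
        next
          case (Suc b)
          then have "narr m' aPRICE b \<le> narr m' aPRICE c" "\<not> narr m' aPRICE b < ?L"
            using bc that False by (simp_all add: best_choice_def)
          then show ?thesis using L by simp
        qed
        have lose: "bidding a ?R ?C fr' (lo @ [u]) (narr m' aOWN) (narr m' aPRICE)"
          using bidding_lose[OF b high] by blast
        have le: "length (lo @ [u]) \<le> ?L"
        proof -
          have "distinct (lo @ [u])" "set (lo @ [u]) \<subseteq> ?R" using biddingD(2,3)[OF lose] by auto
          then show ?thesis using L distinct_card[of "lo @ [u]"] card_mono[of ?R "set (lo @ [u])"] by simp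
        qed
        have dec: "B + B * ((?L * ?L - sum (narr m' aPRICE) ?C) + (?L - length (lo @ [u])))
            \<le> B * ((?L * ?L - sum (narr m' aPRICE) ?C) + (?L - length lo))"
        proof -
          from le have "?L - length lo = Suc (?L - length (lo @ [u]))" by simp
          then show ?thesis by (simp only: add_Suc_right mult_Suc_right)
        qed
        show ?thesis
        proof (rule wp_call[OF wp_place_lose])
          show "\<not> (0 < narr m2 aBEST 0 \<and> narr m2 aPRICE (narr m2 aBEST 0 - 1) < narr m2 aROWS 0)"
            using False un2 rows by simp
          show "lst (narr m2 aLOST) lo" using un2 i(2) by simp
          fix t'' :: nat and m3
          assume p: "t'' \<le> 90 \<and> lst (narr m3 aLOST) (lo @ [narr m2 aCUR 0]) \<and>
            narr m3 aFREE = narr m2 aFREE \<and> narr m3 aOWN = narr m2 aOWN \<and> narr m3 aPRICE = narr m2 aPRICE"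
          have p': "narr m3 aOWN = narr m' aOWN" "narr m3 aPRICE = narr m' aPRICE" "narr m3 aFREE = f"
            "lst (narr m3 aLOST) (lo @ [u])"
            using p un2 f(2) by simp_all
          show "?Q (t + (t' + t'')) m3"
            unfolding p'(1,2,3)
          proof (intro conjI exI)
            show "lst f fr'" by (fact f(1))
            show "lst (narr m3 aLOST) (lo @ [u])" by (fact p'(4))
            show "bidding a ?R ?C fr' (lo @ [u]) (narr m' aOWN) (narr m' aPRICE)" by (fact lose)
            show "t + (t' + t'') + 1 + bcost (NLess (Num 0) (at0 aFREE)) +
                B * ((?L * ?L - sum (narr m' aPRICE) ?C) + (?L - narr m3 aLOST 0))
              \<le> B * ((?L * ?L - sum (narr m' aPRICE) ?C) + (?L - narr m' aLOST 0))"
              using dec tB[OF p[THEN conjunct1]] unfolding lo0 lst_0[OF p'(4)] by linarith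
          qed
        qed
      qed
    qed
  qed simp
  then show ?case by (simp only: wp_Then B_def)
next
  case (3 t m')
  obtain fr lo where i: "lst (narr m' aFREE) fr" "lst (narr m' aLOST) lo"
    "bidding a (set rl) (set cl) fr lo (narr m' aOWN) (narr m' aPRICE)" using 3(1) by blast
  have "fr = []" using 3(2) i(1) by (auto simp: lst_def)
  moreover have "t \<le> 6 + (length cl * 60 + 150) * (length rl * length rl + length rl)"
    using 3(4) zero(2) lost by (simp add: lst_def)
  ultimately show ?case using i by blast
qed

end

definition reached :: "nat set \<Rightarrow> nat set \<Rightarrow> (nat \<Rightarrow> nat) \<Rightarrow> nat set \<Rightarrow> nat set" where
  "reached R C own M = (R - assigned own C) \<union> assigned own M"

lemma reached_subset:
  assumes m: "matching a R C own" and M: "M \<subseteq> C"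
  shows "reached R C own M \<subseteq> R"
proof
  fix r assume r: "r \<in> reached R C own M"
  show "r \<in> R"
  proof (cases "r \<in> assigned own M")
    case True
    then obtain c where c: "c \<in> M" "own c = Suc r" unfolding assigned_def by blast
    have "c \<in> C" using c(1) M by blast
    then show ?thesis using c(2) by (rule matchingD(1)[OF m])
  next
    case False
    then show ?thesis using r unfolding reached_def by blast
  qed
qed

text \<open>
  \<open>M\<close> are the marked columns and \<open>q\<close> the stack of reached rows whose columns are not marked yet.
\<close>

definition marking ::
    "(nat \<Rightarrow> nat \<Rightarrow> ereal) \<Rightarrow> nat set \<Rightarrow> nat set \<Rightarrow> (nat \<Rightarrow> nat) \<Rightarrow> nat list \<Rightarrow> nat set \<Rightarrow> bool" where
  "marking a R C own q M \<longleftrightarrow> M \<subseteq> C \<and> set q \<subseteq> reached R C own M \<and>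
     (\<forall>X. alternating_closed a R C own X \<longrightarrow> M \<subseteq> X) \<and>
     (\<forall>r\<in>reached R C own M - set q. \<forall>c\<in>C. a r c = 0 \<longrightarrow> c \<in> M)"

text \<open>
  The state while the row \<open>u\<close>, taken from the stack, is processed; its columns \<open>Z\<close> are done.
\<close>

definition marking_row ::
    "(nat \<Rightarrow> nat \<Rightarrow> ereal) \<Rightarrow> nat set \<Rightarrow> nat set \<Rightarrow> (nat \<Rightarrow> nat) \<Rightarrow> nat list \<Rightarrow> nat set \<Rightarrow> nat \<Rightarrow> nat set \<Rightarrow> bool"
where
  "marking_row a R C own q M u Z \<longleftrightarrow> M \<subseteq> C \<and> set q \<subseteq> reached R C own M \<and>
     (\<forall>X. alternating_closed a R C own X \<longrightarrow> M \<subseteq> X) \<and> u \<in> reached R C own M \<and>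
     (\<forall>r\<in>reached R C own M - set q - {u}. \<forall>c\<in>C. a r c = 0 \<longrightarrow> c \<in> M) \<and>
     (\<forall>c\<in>Z. a u c = 0 \<longrightarrow> c \<in> M)"

lemma marking_pop: "marking a R C own (q @ [u]) M \<Longrightarrow> marking_row a R C own q M u {}"
  unfolding marking_def marking_row_def by auto

lemma marking_row_skip:
  assumes "marking_row a R C own q M u Z" "\<not> (a u c = 0 \<and> c \<notin> M)"
  shows "marking_row a R C own q M u (insert c Z)"
  using assms unfolding marking_row_def by simp

lemma marking_row_reaches:
  assumes m: "marking_row a R C own q M u Z" and c: "c \<in> C" "a u c = 0" and X: "alternating_closed a R C own X"
  shows "c \<in> X"
proof -
  have MX: "M \<subseteq> X" and u: "u \<in> reached R C own M" using m X unfolding marking_row_def by simp_all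
  show ?thesis
  proof (cases "u \<in> R - assigned own C")
    case True
    then show ?thesis using X c unfolding alternating_closed_def by simp
  next
    case False
    then have "u \<in> assigned own M" using u unfolding reached_def by blast
    then obtain c0 where "c0 \<in> M" "own c0 = Suc u" unfolding assigned_def by blast
    then show ?thesis using X c MX unfolding alternating_closed_def by (metis subsetD)
  qed
qed

lemma marking_row_mark:
  assumes m: "marking_row a R C own q M u Z" and c: "c \<in> C" "a u c = 0" "own c = Suc r"
  shows "marking_row a R C own (q @ [r]) (insert c M) u (insert c Z)"
proof -
  have asg: "reached R C own (insert c M) = insert r (reached R C own M)"
    using c(3) unfolding reached_def assigned_def by auto
  have "insert c M \<subseteq> X" if "alternating_closed a R C own X" for X
    using marking_row_reaches[OF m c(1,2) that] m that unfolding marking_row_def by simp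
  then show ?thesis
    using m c(1) unfolding marking_row_def asg by auto
qed

lemma marking_row_done: "marking_row a R C own q M u C \<Longrightarrow> marking a R C own q M"
  unfolding marking_def marking_row_def by blast

lemma marking_closed:
  assumes "marking a R C own [] M"
  shows "alternating_closed a R C own M"
  unfolding alternating_closed_def
proof (intro conjI ballI allI impI)
  show "M \<subseteq> C" using assms by (simp add: marking_def)
  have *: "c \<in> M" if "r \<in> reached R C own M" "c \<in> C" "a r c = 0" for r c
    using assms that by (simp add: marking_def)
  show "c \<in> M" if "u \<in> R - assigned own C" "c \<in> C" "a u c = 0" for u c
    by (rule *[of u]) (use that in \<open>simp_all add: reached_def\<close>)
  show "c' \<in> M" if "c \<in> M" "own c = Suc r" "c' \<in> C" "a r c' = 0" for c r c'
    by (rule *[of r]) (use that in \<open>auto simp: reached_def assigned_def\<close>)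
qed

text \<open>
  The rows outside \<open>S\<close> are trivial, so that the cover of the smaller matrix serves for the larger one.
\<close>

lemma HK_of_matching:
  assumes fin: "finite R" "finite C" and S: "S \<subseteq> R" "\<And>r c. \<lbrakk>r \<in> R - S; c \<in> C\<rbrakk> \<Longrightarrow> a r c \<noteq> 0"
    and m: "matching a S C own" and cl: "alternating_closed a S C own X"
    and least: "\<And>Z. alternating_closed a S C own Z \<Longrightarrow> X \<subseteq> Z" and owned: "\<And>c. c \<in> X \<Longrightarrow> own c \<noteq> 0"
  shows "HK a R C = (assigned own (C - X), X)"
proof -
  have m': "matching a R C own" using m S(1) unfolding matching_def by blast
  have eq: "alternating_closed a R C own Z \<longleftrightarrow> alternating_closed a S C own Z" for Z
    unfolding alternating_closed_def using S by blast
  note mc = minimum_cover_of_closure[OF fin m', of X, unfolded eq, OF cl owned least]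
  show ?thesis by (rule HK_eqI) (use mc in \<open>simp, fastforce\<close>)
qed

context algorithm_input begin

text \<open>
  The set \<open>X0\<close> provided by the gap in the prices contains all columns that are marked, and shows that
  they are owned. The last equation says that a row is pushed only when an owned column is marked; it is
  the potential for the stack.
\<close>

lemma wp_mark_columns:
  assumes st: "stored m" and cl: "lst (narr m aCOLS) cl" "distinct cl" "set cl \<subseteq> {..<n}"
    and u: "narr m aCUR 0 = u" "u < s" and q: "lst (narr m aLOST) q"
    and mk: "marking_row a R (set cl) (narr m aOWN) q {c \<in> set cl. narr m aMARK c \<noteq> 0} u {}"
    and X0: "alternating_closed a R (set cl) (narr m aOWN) X0" "\<And>c. c \<in> X0 \<Longrightarrow> narr m aOWN c \<noteq> 0"
  shows "wp K mark_columns m (\<lambda>t m'. t \<le> 10 + length cl * 80 \<and>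
    (\<exists>q'. lst (narr m' aLOST) q' \<and>
      marking a R (set cl) (narr m aOWN) q' {c \<in> set cl. narr m' aMARK c \<noteq> 0} \<and>
      length q' + card {c \<in> set cl. narr m' aMARK c = 0 \<and> narr m aOWN c \<noteq> 0} =
      length q + card {c \<in> set cl. narr m aMARK c = 0 \<and> narr m aOWN c \<noteq> 0}))"
  unfolding mark_columns_def
proof (rule wp_Foreach[where xs = cl and T = 60 and Inv = "\<lambda>ys m'.
    (\<exists>q'. lst (narr m' aLOST) q' \<and>
      marking_row a R (set cl) (narr m aOWN) q' {c \<in> set cl. narr m' aMARK c \<noteq> 0} u (set ys) \<and>
      length q' + card {c \<in> set cl. narr m' aMARK c = 0 \<and> narr m aOWN c \<noteq> 0} =
      length q + card {c \<in> set cl. narr m aMARK c = 0 \<and> narr m aOWN c \<noteq> 0})"], goal_cases)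
  case (7 ys y zs m')
  obtain q' where q': "lst (narr m' aLOST) q'"
    "marking_row a R (set cl) (narr m aOWN) q' {c \<in> set cl. narr m' aMARK c \<noteq> 0} u (set ys)"
    "length q' + card {c \<in> set cl. narr m' aMARK c = 0 \<and> narr m aOWN c \<noteq> 0} =
      length q + card {c \<in> set cl. narr m aMARK c = 0 \<and> narr m aOWN c \<noteq> 0}" using 7(2) by blast
  have un: "narr m' aOWN = narr m aOWN" "narr m' aCUR = narr m aCUR" "narr m' aSIZE = narr m aSIZE"
    "narr m' aORDER = narr m aORDER"
    using 7(4) by (simp_all add: unchanged_def)
  have y: "y \<in> set cl" using 7(1) by simp
  then have yn: "y < n" using cl(3) by auto
  have c: "narr m' aORDER (narr m' aCUR 0 * narr m' aSIZE (Suc 0) + narr m' aI 0) = Suc 0 \<longleftrightarrow> a u y = 0"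
    using storedD[OF st] code_one_iff[OF u(2) yn] u yn 7(3) un by simp
  show ?case
  proof (cases "a u y = 0 \<and> narr m' aMARK y = 0")
    case True
    have "narr m aOWN y \<noteq> 0" using X0(2) marking_row_reaches[OF q'(2) y _ X0(1)] True by blast
    then obtain r where r: "narr m aOWN y = Suc r" using not0_implies_Suc by blast
    let ?mk = "(narr m' aMARK)(y := Suc 0)"
    have set: "{c \<in> set cl. ?mk c \<noteq> 0} = insert y {c \<in> set cl. narr m' aMARK c \<noteq> 0}" using y by auto
    have mr: "marking_row a R (set cl) (narr m aOWN) (q' @ [r]) {c \<in> set cl. ?mk c \<noteq> 0} u (set (ys @ [y]))"
      using marking_row_mark[OF q'(2) y _ r] True unfolding set by simp
    have "{c \<in> set cl. narr m' aMARK c = 0 \<and> narr m aOWN c \<noteq> 0} =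
        insert y {c \<in> set cl. ?mk c = 0 \<and> narr m aOWN c \<noteq> 0}" using y True r by auto
    then have "card {c \<in> set cl. narr m' aMARK c = 0 \<and> narr m aOWN c \<noteq> 0} =
        Suc (card {c \<in> set cl. ?mk c = 0 \<and> narr m aOWN c \<noteq> 0})" by simp
    then have cnt: "length (q' @ [r]) + card {c \<in> set cl. ?mk c = 0 \<and> narr m aOWN c \<noteq> 0} =
        length q + card {c \<in> set cl. narr m aMARK c = 0 \<and> narr m aOWN c \<noteq> 0}" using q'(3) by simp
    let ?m1 = "m'\<lparr>narr := (narr m')(aMARK := ?mk)\<rparr>"
    have "wp K (Push aLOST (NSub (NGet aOWN (at0 aI)) (Num 1))) ?m1 (\<lambda>t m''. t \<le> 16 \<and>
        lst (narr m'' aLOST) (q' @ [r]) \<and> narr m'' aMARK = ?mk)"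
      by (rule wp_Push[where xs = q']) (use q' un r 7(3) in simp_all)
    then have "wp K (Push aLOST (NSub (NGet aOWN (at0 aI)) (Num 1))) ?m1 (\<lambda>t m''. t \<le> 16 \<and>
      (\<exists>q'. lst (narr m'' aLOST) q' \<and>
        marking_row a R (set cl) (narr m aOWN) q' {c \<in> set cl. narr m'' aMARK c \<noteq> 0} u (set (ys @ [y])) \<and>
        length q' + card {c \<in> set cl. narr m'' aMARK c = 0 \<and> narr m aOWN c \<noteq> 0} =
        length q + card {c \<in> set cl. narr m aMARK c = 0 \<and> narr m aOWN c \<noteq> 0}))"
    proof (rule wp_call)
      fix t m'' assume "t \<le> 16 \<and> lst (narr m'' aLOST) (q' @ [r]) \<and> narr m'' aMARK = ?mk"
      then have h: "t \<le> 16" "lst (narr m'' aLOST) (q' @ [r])" "narr m'' aMARK = ?mk" by simp_all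
      show "t \<le> 16 \<and>
      (\<exists>q'. lst (narr m'' aLOST) q' \<and>
        marking_row a R (set cl) (narr m aOWN) q' {c \<in> set cl. narr m'' aMARK c \<noteq> 0} u (set (ys @ [y])) \<and>
        length q' + card {c \<in> set cl. narr m'' aMARK c = 0 \<and> narr m aOWN c \<noteq> 0} =
        length q + card {c \<in> set cl. narr m aMARK c = 0 \<and> narr m aOWN c \<noteq> 0})"
        unfolding h(3) by (intro conjI exI) (fact h(1), fact h(2), fact mr, fact cnt)
    qed
    then show ?thesis
      using True c 7(3) by (auto elim!: wp_call)
  next
    case False
    have "marking_row a R (set cl) (narr m aOWN) q' {c \<in> set cl. narr m' aMARK c \<noteq> 0} u (set (ys @ [y]))"
      using marking_row_skip[OF q'(2), of y] False y by (simp add: insert_commute)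
    then show ?thesis using False c q'(1,3) 7(3) by auto
  qed
next
  case (8 t m')
  then obtain q' where q': "lst (narr m' aLOST) q'"
    "marking_row a R (set cl) (narr m aOWN) q' {c \<in> set cl. narr m' aMARK c \<noteq> 0} u (set cl)"
    "length q' + card {c \<in> set cl. narr m' aMARK c = 0 \<and> narr m aOWN c \<noteq> 0} =
      length q + card {c \<in> set cl. narr m aMARK c = 0 \<and> narr m aOWN c \<noteq> 0}" by blast
  have "t \<le> 10 + length cl * 80" using 8(3) by simp
  with q'(1,3) marking_row_done[OF q'(2)] show ?case by (intro conjI exI)
qed (use cl q mk in auto)

lemma wp_mark_loop:
  assumes st: "stored m" and cl: "lst (narr m aCOLS) cl" "distinct cl" "set cl \<subseteq> {..<n}"
    and R: "finite R" "R \<subseteq> {..<s}" and m: "matching a R (set cl) (narr m aOWN)"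
    and lo: "lst (narr m aLOST) lo" "set lo = R - assigned (narr m aOWN) (set cl)" "length lo \<le> card R"
    and mk0: "\<And>c. c \<in> set cl \<Longrightarrow> narr m aMARK c = 0"
    and X0: "alternating_closed a R (set cl) (narr m aOWN) X0" "\<And>c. c \<in> X0 \<Longrightarrow> narr m aOWN c \<noteq> 0"
  shows "wp K mark_loop m (\<lambda>t m'. t \<le> 6 + (length cl * 80 + 40) * (2 * card R) \<and>
    (let X = {c \<in> set cl. narr m' aMARK c \<noteq> 0} in
      alternating_closed a R (set cl) (narr m aOWN) X \<and>
      (\<forall>Z. alternating_closed a R (set cl) (narr m aOWN) Z \<longrightarrow> X \<subseteq> Z)))"
  unfolding mark_loop_def
proof (rule wp_Loop[where
      Inv = "\<lambda>m'. \<exists>q. lst (narr m' aLOST) q \<and> marking a R (set cl) (narr m aOWN) q {c \<in> set cl. narr m' aMARK c \<noteq> 0}" and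
      \<Phi> = "\<lambda>m'. (length cl * 80 + 40) *
        (narr m' aLOST 0 + card {c \<in> set cl. narr m' aMARK c = 0 \<and> narr m aOWN c \<noteq> 0})"], goal_cases)
  case 1
  have "{c \<in> set cl. narr m aMARK c \<noteq> 0} = {}" using mk0 by auto
  moreover have "marking a R (set cl) (narr m aOWN) lo {}"
    unfolding marking_def reached_def using lo(2) by (simp add: assigned_def)
  ultimately show ?case using lo(1) by metis
next
  case (2 m')
  define B where "B = length cl * 80 + 40"
  obtain q where q: "lst (narr m' aLOST) q" "marking a R (set cl) (narr m aOWN) q {c \<in> set cl. narr m' aMARK c \<noteq> 0}"
    using 2(1) by blast
  have "q \<noteq> []" using 2(2) q(1) by (auto simp: lst_def)
  then obtain q1 u where qe: "q = q1 @ [u]" by (metis rev_exhaust)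
 have "set q \<subseteq> reached R (set cl) (narr m aOWN) {c \<in> set cl. narr m' aMARK c \<noteq> 0}"
    using q(2) unfolding marking_def by (elim conjE)
  moreover have "u \<in> set q" unfolding qe by simp
  ultimately have "u \<in> reached R (set cl) (narr m aOWN) {c \<in> set cl. narr m' aMARK c \<noteq> 0}"
    by (rule subsetD)
  then have "u \<in> R" by (rule subsetD[OF reached_subset[OF m Collect_restrict]])
  then have "u \<in> {..<s}" by (rule subsetD[OF R(2)])
  then have us: "u < s" by simp
  have un: "narr m' aCOLS = narr m aCOLS" "narr m' aOWN = narr m aOWN"
    using 2(3) by (simp_all add: unchanged_def)
  have st': "stored m'" using st 2(3) by (rule stored_unchanged) simp_all
  let ?cnt = "\<lambda>m'. card {c \<in> set cl. narr m' aMARK c = 0 \<and> narr m aOWN c \<noteq> 0}"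
  let ?Q = "\<lambda>t m''. (\<exists>q. lst (narr m'' aLOST) q \<and>
      marking a R (set cl) (narr m aOWN) q {c \<in> set cl. narr m'' aMARK c \<noteq> 0}) \<and>
      t + 1 + bcost (NLess (Num 0) (at0 aLOST)) + B * (narr m'' aLOST 0 + ?cnt m'') \<le> B * (narr m' aLOST 0 + ?cnt m')"
  have "wp K (Pop aCUR aLOST) m' (\<lambda>t m1. wp K mark_columns m1 (\<lambda>t' m2. ?Q (t + t') m2))"
  proof (rule wp_Pop[OF q(1)[unfolded qe]])
    fix f g :: "nat \<Rightarrow> nat" and t :: nat assume f: "lst f q1" "g 0 = u" "t \<le> 12"
    let ?m1 = "m'\<lparr>narr := (narr m')(aCUR := g, aLOST := f)\<rparr>"
    have mc: "wp K mark_columns ?m1 (\<lambda>t m2. t \<le> 10 + length cl * 80 \<and>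
      (\<exists>q'. lst (narr m2 aLOST) q' \<and>
      marking a R (set cl) (narr ?m1 aOWN) q' {c \<in> set cl. narr m2 aMARK c \<noteq> 0} \<and>
      length q' + card {c \<in> set cl. narr m2 aMARK c = 0 \<and> narr ?m1 aOWN c \<noteq> 0} =
      length q1 + card {c \<in> set cl. narr ?m1 aMARK c = 0 \<and> narr ?m1 aOWN c \<noteq> 0}))"
    proof (rule wp_mark_columns)
      show "stored ?m1" using st' by (simp add: stored_def)
      show "lst (narr ?m1 aCOLS) cl" using cl(1) un by simp
      show "narr ?m1 aCUR 0 = u" using f(2) by simp
      show "lst (narr ?m1 aLOST) q1" using f(1) by simp
      show "marking_row a R (set cl) (narr ?m1 aOWN) q1 {c \<in> set cl. narr ?m1 aMARK c \<noteq> 0} u {}"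
        using marking_pop[OF q(2)[unfolded qe]] un by simp
      show "alternating_closed a R (set cl) (narr ?m1 aOWN) X0" using X0(1) un by simp
      show "narr ?m1 aOWN c \<noteq> 0" if "c \<in> X0" for c using X0(2)[OF that] un by simp
    qed (fact cl(2), fact cl(3), fact us)
    show "wp K mark_columns ?m1 (\<lambda>t' m2. ?Q (t + t') m2)"
    proof (rule wp_call[OF mc])
      fix t' m2
      assume h: "t' \<le> 10 + length cl * 80 \<and>
      (\<exists>q'. lst (narr m2 aLOST) q' \<and>
      marking a R (set cl) (narr ?m1 aOWN) q' {c \<in> set cl. narr m2 aMARK c \<noteq> 0} \<and>
      length q' + card {c \<in> set cl. narr m2 aMARK c = 0 \<and> narr ?m1 aOWN c \<noteq> 0} =
      length q1 + card {c \<in> set cl. narr ?m1 aMARK c = 0 \<and> narr ?m1 aOWN c \<noteq> 0})"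
      have o1: "narr ?m1 aOWN = narr m aOWN" "narr ?m1 aMARK = narr m' aMARK" using un by simp_all
      obtain q' where q': "lst (narr m2 aLOST) q'"
        "marking a R (set cl) (narr m aOWN) q' {c \<in> set cl. narr m2 aMARK c \<noteq> 0}"
        "length q' + ?cnt m2 = length q1 + ?cnt m'" using h unfolding o1 by blast
      have l: "narr m' aLOST 0 = Suc (length q1)" using lst_0[OF q(1)] unfolding qe by simp
      have "narr m' aLOST 0 + ?cnt m' = Suc (narr m2 aLOST 0 + ?cnt m2)"
        using q'(3) unfolding l lst_0[OF q'(1)] by simp
      then have dec: "B * (narr m' aLOST 0 + ?cnt m') = B + B * (narr m2 aLOST 0 + ?cnt m2)" by simp
      have "t + t' + 1 + bcost (NLess (Num 0) (at0 aLOST)) \<le> B"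
        using f(3) h[THEN conjunct1] by (simp add: B_def)
      then have "t + t' + 1 + bcost (NLess (Num 0) (at0 aLOST)) + B * (narr m2 aLOST 0 + ?cnt m2) \<le>
          B * (narr m' aLOST 0 + ?cnt m')" unfolding dec by (rule add_right_mono)
      then show "?Q (t + t') m2" using q'(1,2) by blast
    qed
  qed simp
  then show ?case by (simp only: wp_Then B_def)
next
  case (3 t m')
  obtain q where q: "lst (narr m' aLOST) q" "marking a R (set cl) (narr m aOWN) q {c \<in> set cl. narr m' aMARK c \<noteq> 0}"
    using 3(1) by blast
  have "q = []" using 3(2) q(1) by (auto simp: lst_def)
  then have mk: "marking a R (set cl) (narr m aOWN) [] {c \<in> set cl. narr m' aMARK c \<noteq> 0}" using q(2) by simp
  have "card {c \<in> set cl. narr m aMARK c = 0 \<and> narr m aOWN c \<noteq> 0} \<le> card {c \<in> set cl. narr m aOWN c \<noteq> 0}"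
    by (rule card_mono) auto
  also have "\<dots> \<le> card R" using matched_columns_le[OF m R(1)] by simp
  finally have "narr m aLOST 0 + card {c \<in> set cl. narr m aMARK c = 0 \<and> narr m aOWN c \<noteq> 0} \<le> 2 * card R"
    using lo(3) unfolding lst_0[OF lo(1)] by simp
  then have "(length cl * 80 + 40) *
      (narr m aLOST 0 + card {c \<in> set cl. narr m aMARK c = 0 \<and> narr m aOWN c \<noteq> 0}) \<le>
      (length cl * 80 + 40) * (2 * card R)" by (rule mult_le_mono2)
  moreover have "bcost (NLess (Num 0) (at0 aLOST)) = 4" by simp
  ultimately have "t \<le> 6 + (length cl * 80 + 40) * (2 * card R)" using 3(4) by linarith
  moreover have "\<forall>Z. alternating_closed a R (set cl) (narr m aOWN) Z \<longrightarrow> {c \<in> set cl. narr m' aMARK c \<noteq> 0} \<subseteq> Z"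
    using mk unfolding marking_def by blast
  ultimately show ?case using marking_closed[OF mk] unfolding Let_def by blast
qed

lemma wp_extract_column:
  assumes "lst (narr m aWORK) ws" "lst (narr m aCCOLS) cs" "lst (narr m aCROWS) rs"
    and y: "narr m aI 0 = y"
  shows "wp K extract_column m (\<lambda>t m'. t \<le> 60 \<and>
    lst (narr m' aWORK) (if narr m aMARK y = 0 then ws @ [y] else ws) \<and>
    lst (narr m' aCCOLS) (if narr m aMARK y = 0 then cs else cs @ [y]) \<and>
    lst (narr m' aCROWS) (if narr m aMARK y = 0 \<and> narr m aOWN y \<noteq> 0 then rs @ [narr m aOWN y - 1] else rs))"
proof (cases "narr m aMARK y = 0")
  case True
  show ?thesis
  proof (cases "narr m aOWN y = 0")
    case own: True
    show ?thesis
      apply (simp add: extract_column_def y True own)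
      apply (rule wp_Push[OF assms(1)])
      apply (simp add: y assms own)
      done
  next
    case own: False
    show ?thesis
      using own
      apply (simp add: extract_column_def y True)
      apply (rule wp_Push[OF assms(1)])
      apply (simp add: y)
      apply (rule wp_Push[where xs = rs])
       apply (simp_all add: y assms)
      done
  qed
next
  case False
  show ?thesis
    apply (simp add: extract_column_def y False)
    apply (rule wp_Push[OF assms(2)])
    apply (simp add: y assms)
    done
qed

lemma wp_extract_cover:
  assumes cl: "lst (narr m aCOLS) cl"
  shows "wp K extract_cover m (\<lambda>t m'. t \<le> 30 + length cl * 80 \<and>
    lst (narr m' aWORK) (filter (\<lambda>c. narr m aMARK c = 0) cl) \<and>
    lst (narr m' aCCOLS) (filter (\<lambda>c. narr m aMARK c \<noteq> 0) cl) \<and>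
    lst (narr m' aCROWS) (map (\<lambda>c. narr m aOWN c - 1) (filter (\<lambda>c. narr m aMARK c = 0 \<and> narr m aOWN c \<noteq> 0) cl)))"
proof -
  let ?W = "\<lambda>ys. filter (\<lambda>c. narr m aMARK c = 0) ys" and ?C = "\<lambda>ys. filter (\<lambda>c. narr m aMARK c \<noteq> 0) ys"
    and ?R = "\<lambda>ys. map (\<lambda>c. narr m aOWN c - 1) (filter (\<lambda>c. narr m aMARK c = 0 \<and> narr m aOWN c \<noteq> 0) ys)"
  show ?thesis
    unfolding extract_cover_def wp_Then
    apply (rule wp_Clear)
    apply (rule wp_Clear)
    apply (rule wp_Clear)
    subgoal for f1 t1 f2 t2 f3 t3
    proof (rule wp_Foreach[where xs = cl and T = 60 and Inv = "\<lambda>ys m'.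
        lst (narr m' aWORK) (?W ys) \<and> lst (narr m' aCCOLS) (?C ys) \<and> lst (narr m' aCROWS) (?R ys)"], goal_cases)
      case (7 ys y zs m')
      have un: "narr m' aOWN = narr m aOWN" "narr m' aMARK = narr m aMARK"
        using 7 by (simp_all add: unchanged_def)
      have i: "lst (narr m' aWORK) (?W ys)" "lst (narr m' aCCOLS) (?C ys)" "lst (narr m' aCROWS) (?R ys)"
        using 7 by blast+
      have y: "narr m' aI 0 = y" using 7 by blast
      show ?case
        by (rule wp_call[OF wp_extract_column[OF i y]]) (auto simp: un)
    qed (use cl in \<open>auto simp: lst_Nil\<close>)
    done
qed

end

definition cover_time :: "nat \<Rightarrow> nat \<Rightarrow> nat" where
  "cover_time d l = 200 + 100 * d + 200 * l + (l * 60 + 150) * (d * d + d) + (l * 80 + 40) * (2 * d)"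

context algorithm_input begin

lemma wp_cover_prog:
  assumes st: "stored m" and cl: "lst (narr m aCOLS) cl" "distinct cl" "set cl \<subseteq> {..<n}"
    and rl: "lst (narr m aROWS) rl" "distinct rl" "set rl \<subseteq> R" "\<And>r c. \<lbrakk>r \<in> R - set rl; c \<in> set cl\<rbrakk> \<Longrightarrow> a r c \<noteq> 0"
    and R: "R \<subseteq> {..<s}"
  shows "wp K cover_prog m (\<lambda>t m'. t \<le> cover_time (length rl) (length cl) \<and>
    (\<exists>cr cc wk. lst (narr m' aCROWS) cr \<and> lst (narr m' aCCOLS) cc \<and> lst (narr m' aWORK) wk \<and>
      distinct cr \<and> distinct cc \<and> distinct wk \<and> set wk = set cl - set cc \<and>
      HK a R (set cl) = (set cr, set cc)))"
proof -
  let ?C = "set cl" and ?S = "set rl"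
  have finR: "finite R" using R by (rule finite_subset) simp
  have Ss: "?S \<subseteq> {..<s}" using rl(3) R by blast
  have L: "card ?S = length rl" using rl(2) by (rule distinct_card)
  let ?post = "\<lambda>m'. \<exists>cr cc wk. lst (narr m' aCROWS) cr \<and> lst (narr m' aCCOLS) cc \<and> lst (narr m' aWORK) wk \<and>
      distinct cr \<and> distinct cc \<and> distinct wk \<and> set wk = set cl - set cc \<and> HK a R (set cl) = (set cr, set cc)"
  have clr: "wp K clear_columns m (\<lambda>t m1. t \<le> 10 + length cl * 40 \<and>
      (\<forall>c\<in>?C. narr m1 aOWN c = 0 \<and> narr m1 aPRICE c = 0 \<and> narr m1 aMARK c = 0))"
    unfolding clear_columns_def
  proof (rule wp_Foreach[where xs = cl and T = 20 and Inv = "\<lambda>ys m'.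
      \<forall>c\<in>set ys. narr m' aOWN c = 0 \<and> narr m' aPRICE c = 0 \<and> narr m' aMARK c = 0"], goal_cases)
    case (7 ys y zs m')
    then show ?case by (auto simp: 7)
  qed (use cl in auto)
  show ?thesis
    unfolding cover_prog_def wp_Then
  proof (rule wp_call[OF clr], rule wp_copy_list[where xs = rl], goal_cases)
    case (1 t1 m1)
    then show ?case using rl(1) by (simp add: unchanged_def)
  next
    case (5 t1 m1 t2 m2)
    have e1: "narr m1 aCOLS = narr m aCOLS" "narr m1 aROWS = narr m aROWS" "stored m1"
      using 5(2) stored_unchanged[OF st 5(2)] by (simp_all add: unchanged_def)
    have e2: "narr m2 aCOLS = narr m aCOLS" "narr m2 aROWS = narr m aROWS" "stored m2"
      "narr m2 aOWN = narr m1 aOWN" "narr m2 aPRICE = narr m1 aPRICE" "narr m2 aMARK = narr m1 aMARK"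
      using 5(4) stored_unchanged[OF e1(3) 5(4)] e1 by (simp_all add: unchanged_def)
    have z: "narr m2 aOWN c = 0" "narr m2 aPRICE c = 0" "narr m2 aMARK c = 0" if "c \<in> ?C" for c
      using 5(1) that e2 by simp_all
    show ?case
    proof (rule wp_Clear)
      fix f :: "nat \<Rightarrow> nat" and t3 :: nat assume f: "lst f []" "t3 \<le> 3"
      let ?m3 = "m2\<lparr>narr := (narr m2)(aLOST := f)\<rparr>"
      have st3: "stored ?m3" using e2(3) by (simp add: stored_def)
      have bl: "wp K bid_loop ?m3 (\<lambda>t m'. t \<le> 6 + (length cl * 60 + 150) * (length rl * length rl + length rl) \<and>
        (\<exists>lo. lst (narr m' aLOST) lo \<and> bidding a (set rl) (set cl) [] lo (narr m' aOWN) (narr m' aPRICE)))"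
        by (rule wp_bid_loop[OF st3 _ cl(3) _ rl(2) Ss]) (use e2 cl(1) rl(1) 5(3) f z in simp_all)
      show "wp K bid_loop ?m3 (\<lambda>t4 m4. wp K mark_loop m4 (\<lambda>t5 m5. wp K extract_cover m5 (\<lambda>t6 m6.
          t1 + (t2 + (t3 + (t4 + (t5 + t6)))) \<le> cover_time (length rl) (length cl) \<and> ?post m6)))"
      proof (rule wp_call[OF bl])
        fix t4 m4
        assume h4: "t4 \<le> 6 + (length cl * 60 + 150) * (length rl * length rl + length rl) \<and>
          (\<exists>lo. lst (narr m4 aLOST) lo \<and> bidding a (set rl) (set cl) [] lo (narr m4 aOWN) (narr m4 aPRICE))"
          "unchanged (nwrites bid_loop) (kwrites bid_loop) (silent bid_loop) ?m3 m4"
        obtain lo where lo: "lst (narr m4 aLOST) lo" "bidding a ?S ?C [] lo (narr m4 aOWN) (narr m4 aPRICE)"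
          using h4(1) by blast
        note bd = biddingD[OF lo(2)]
        have st4: "stored m4" using st3 h4(2) by (rule stored_unchanged) simp_all
        have e4: "narr m4 aCOLS = narr m aCOLS" "narr m4 aMARK = narr m2 aMARK"
          using h4(2) e2 by (simp_all add: unchanged_def)
        have mt: "matching a ?S ?C (narr m4 aOWN)" using bd(1) by (simp add: auction_def)
        have slo: "set lo = ?S - assigned (narr m4 aOWN) ?C" using bd(3,4) by auto
        have "\<exists>X. alternating_closed a ?S ?C (narr m4 aOWN) X \<and> (\<forall>c\<in>X. narr m4 aOWN c \<noteq> 0)"
          by (rule price_gap[OF bd(1) _ _ order_refl]) (use bd(5) slo in auto)
        then obtain X0 where X0: "alternating_closed a ?S ?C (narr m4 aOWN) X0" "\<And>c. c \<in> X0 \<Longrightarrow> narr m4 aOWN c \<noteq> 0"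
          by blast
        have lenlo: "length lo \<le> card ?S"
          using bd(2) slo distinct_card[of lo] card_mono[of ?S "set lo"] by auto
        have ml: "wp K mark_loop m4 (\<lambda>t m'. t \<le> 6 + (length cl * 80 + 40) * (2 * card ?S) \<and>
          (let X = {c \<in> set cl. narr m' aMARK c \<noteq> 0} in
            alternating_closed a ?S ?C (narr m4 aOWN) X \<and>
            (\<forall>Z. alternating_closed a ?S ?C (narr m4 aOWN) Z \<longrightarrow> X \<subseteq> Z)))"
          by (rule wp_mark_loop[OF st4 _ cl(2,3) _ Ss mt lo(1) slo lenlo _ X0]) (use e4 cl(1) z(3) in simp_all)
        show "wp K mark_loop m4 (\<lambda>t5 m5. wp K extract_cover m5 (\<lambda>t6 m6.
          t1 + (t2 + (t3 + (t4 + (t5 + t6)))) \<le> cover_time (length rl) (length cl) \<and> ?post m6))"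
        proof (rule wp_call[OF ml])
          fix t5 m5
          assume h5: "t5 \<le> 6 + (length cl * 80 + 40) * (2 * card ?S) \<and>
          (let X = {c \<in> set cl. narr m5 aMARK c \<noteq> 0} in
            alternating_closed a ?S ?C (narr m4 aOWN) X \<and>
            (\<forall>Z. alternating_closed a ?S ?C (narr m4 aOWN) Z \<longrightarrow> X \<subseteq> Z))"
            "unchanged (nwrites mark_loop) (kwrites mark_loop) (silent mark_loop) m4 m5"
          let ?X = "{c \<in> set cl. narr m5 aMARK c \<noteq> 0}"
          have X: "alternating_closed a ?S ?C (narr m4 aOWN) ?X"
            "\<And>Z. alternating_closed a ?S ?C (narr m4 aOWN) Z \<Longrightarrow> ?X \<subseteq> Z"
            using h5(1) unfolding Let_def by blast+
          have e5: "narr m5 aCOLS = narr m aCOLS" "narr m5 aOWN = narr m4 aOWN"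
            using h5(2) e4 by (simp_all add: unchanged_def)
          have ow: "narr m4 aOWN c \<noteq> 0" if "c \<in> ?X" for c
            using X(2)[OF X0(1)] X0(2) that by blast
          have hk: "HK a R ?C = (assigned (narr m4 aOWN) (?C - ?X), ?X)"
            using finR finite_set rl(3,4) mt X(1) X(2) ow by (rule HK_of_matching)
          have c5: "lst (narr m5 aCOLS) cl" using e5(1) cl(1) by simp
          show "wp K extract_cover m5 (\<lambda>t6 m6.
            t1 + (t2 + (t3 + (t4 + (t5 + t6)))) \<le> cover_time (length rl) (length cl) \<and> ?post m6)"
          proof (rule wp_call[OF wp_extract_cover[OF c5]])
            fix t6 m6
            let ?wk = "filter (\<lambda>c. narr m5 aMARK c = 0) cl" and ?cc = "filter (\<lambda>c. narr m5 aMARK c \<noteq> 0) cl"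
              and ?fr = "filter (\<lambda>c. narr m5 aMARK c = 0 \<and> narr m5 aOWN c \<noteq> 0) cl"
            let ?cr = "map (\<lambda>c. narr m5 aOWN c - 1) ?fr"
            assume h6: "t6 \<le> 30 + length cl * 80 \<and> lst (narr m6 aWORK) ?wk \<and>
              lst (narr m6 aCCOLS) ?cc \<and> lst (narr m6 aCROWS) ?cr"
            have inj: "inj_on (\<lambda>c. narr m5 aOWN c - 1) (set ?fr)"
            proof (rule inj_onI)
              fix c c' assume c: "c \<in> set ?fr" "c' \<in> set ?fr" "narr m5 aOWN c - 1 = narr m5 aOWN c' - 1"
              then have o: "narr m4 aOWN c = Suc (narr m5 aOWN c - 1)" "narr m4 aOWN c' = Suc (narr m5 aOWN c - 1)"
                "c \<in> ?C" "c' \<in> ?C" using e5(2) by auto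
              show "c = c'" by (rule matchingD(3)[OF mt o(4,2,3,1)])
            qed
            have "distinct ?fr" using cl(2) by simp
            then have d: "distinct ?cr" unfolding distinct_map using inj by blast
            have s: "set ?cr = assigned (narr m4 aOWN) (?C - ?X)"
            proof (intro equalityI subsetI)
              fix r assume "r \<in> set ?cr"
              then obtain c where "c \<in> set ?fr" and r: "r = narr m5 aOWN c - 1" unfolding set_map image_iff by blast
              then have c: "c \<in> ?C - ?X" "narr m5 aOWN c \<noteq> 0" by simp_all
              have "narr m4 aOWN c = Suc r" unfolding r using c(2) e5(2) by simp
              then show "r \<in> assigned (narr m4 aOWN) (?C - ?X)" using c(1) unfolding assigned_def by blast
            next
              fix r assume "r \<in> assigned (narr m4 aOWN) (?C - ?X)"
              then obtain c where c: "c \<in> ?C - ?X" "narr m4 aOWN c = Suc r" unfolding assigned_def by blast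
              then have "c \<in> set ?fr" "r = narr m5 aOWN c - 1" using e5(2) by simp_all
              then show "r \<in> set ?cr" unfolding set_map by (rule image_eqI[rotated])
            qed
            have cc: "set ?cc = ?X" "set ?wk = ?C - set ?cc" by auto
            have dd: "distinct ?cc" "distinct ?wk" using cl(2) by simp_all
            have time: "t1 + (t2 + (t3 + (t4 + (t5 + t6)))) \<le> cover_time (length rl) (length cl)"
              using 5(1,5) f(2) h4(1)[THEN conjunct1] h5(1)[THEN conjunct1] h6[THEN conjunct1]
              unfolding cover_time_def L by simp
            have "HK a R (set cl) = (set ?cr, set ?cc)" unfolding hk s cc(1) ..
            then have "?post m6" using h6 d dd cc(2)
              by (intro exI[of _ ?cr] exI[of _ ?cc] exI[of _ ?wk] conjI) blast+
            then show "t1 + (t2 + (t3 + (t4 + (t5 + t6)))) \<le> cover_time (length rl) (length cl) \<and> ?post m6"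
              using time by blast
          qed
        qed
      qed
    qed
  qed simp_all
qed

end

subsection \<open>Computing the support of the kernel\<close>

abbreviation matrix_at :: "nexp \<Rightarrow> nexp \<Rightarrow> kexp" where "matrix_at i j \<equiv> KGet kMAT (entry i j)"

definition load_matrix :: prog where
  "load_matrix = Then
     (Foreach aI aCROWS (Foreach aJ aWORK
        (KPut kMAT (entry (at0 aI) (at0 aJ)) (KGet kJAC (entry (at0 aI) (at0 aJ))))))
     (Then (Foreach aI aWORK (NPut aPIVOT (at0 aI) (Num 0))) (Clear aNOPIV))"

definition find_pivot :: prog where
  "find_pivot = Then (NPut aBEST (Num 0) (Num 0))
     (Foreach aJ aWORK
       (Cond (BAnd (NEq (NGet aPIVOT (at0 aJ)) (Num 0)) (BNot (KEq (matrix_at (at0 aI) (at0 aJ)) KZero)))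
         (NPut aBEST (Num 0) (NAdd (at0 aJ) (Num 1))) Skip))"

text \<open>
  The factor has to be saved, because its numerator is overwritten in the loop.
\<close>

definition eliminate_column :: prog where
  "eliminate_column =
     Cond (NEq (NAdd (at0 aJ) (Num 1)) (at0 aBEST)) Skip
       (Then (KPut kFAC (Num 0) (KDiv (matrix_at (at0 aI) (at0 aJ)) (matrix_at (at0 aI) (NSub (at0 aBEST) (Num 1)))))
         (Foreach aK aCROWS
           (KPut kMAT (entry (at0 aK) (at0 aJ))
             (KSub (matrix_at (at0 aK) (at0 aJ))
               (KMul (KGet kFAC (Num 0)) (matrix_at (at0 aK) (NSub (at0 aBEST) (Num 1))))))))"

definition eliminate_row :: prog where
  "eliminate_row = Then find_pivot
     (Cond (NEq (at0 aBEST) (Num 0)) (Push aNOPIV (at0 aI))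
       (Then (Foreach aJ aWORK eliminate_column)
         (NPut aPIVOT (NSub (at0 aBEST) (Num 1)) (NAdd (at0 aI) (Num 1)))))"

text \<open>
  The rows without pivot are related, and a row with a pivot is so iff a row without pivot has a nonzero
  entry in its pivot column, see \<open>related_rows_eliminated\<close>.
\<close>

definition flag_related :: prog where
  "flag_related = Then (Foreach aI aCROWS (NPut aREL (at0 aI) (Num 1)))
     (Foreach aI aWORK
       (Cond (NEq (NGet aPIVOT (at0 aI)) (Num 0)) Skip
         (Then (Exists aJ aNOPIV aFLAG (BNot (KEq (matrix_at (at0 aJ) (at0 aI)) KZero)))
           (NPut aREL (NSub (NGet aPIVOT (at0 aI)) (Num 1)) (at0 aFLAG)))))"

definition restrict_prog :: prog where
  "restrict_prog = Then (Filter aI aCROWS aRROWS Skip (NEq (NGet aREL (at0 aI)) (Num 0)))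
     (Then (Filter aI aWORK aRCOLS
         (Exists aJ aCROWS aFLAG (BAnd (NEq (NGet aREL (at0 aJ)) (Num 1)) (NEq (order_at (at0 aJ) (at0 aI)) (Num 1))))
         (NEq (at0 aFLAG) (Num 0)))
       (Filter aI aWORK aY1 Skip (NLess (Num 0) (NGet aPIVOT (at0 aI)))))"

definition kernel_prog :: prog where
  "kernel_prog = Then load_matrix (Then (Foreach aI aCROWS eliminate_row) (Then flag_related restrict_prog))"

lemma kernel_writes [simp]:
  "nwrites load_matrix = {aI, aJ, aPIVOT, aNOPIV}" "kwrites load_matrix = {kMAT}" "silent load_matrix"
  "nwrites find_pivot = {aBEST, aJ}" "kwrites find_pivot = {}" "silent find_pivot"
  "nwrites eliminate_column = {aK}" "kwrites eliminate_column = {kFAC, kMAT}" "silent eliminate_column"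
  "nwrites eliminate_row = {aBEST, aJ, aNOPIV, aK, aPIVOT}" "kwrites eliminate_row = {kFAC, kMAT}" "silent eliminate_row"
  "nwrites flag_related = {aI, aREL, aJ, aFLAG}" "kwrites flag_related = {}" "silent flag_related"
  "nwrites restrict_prog = {aI, aRROWS, aRCOLS, aY1, aJ, aFLAG}" "kwrites restrict_prog = {}" "silent restrict_prog"
  "nwrites kernel_prog = {aI, aJ, aK, aBEST, aPIVOT, aNOPIV, aREL, aFLAG, aRROWS, aRCOLS, aY1}"
  "kwrites kernel_prog = {kFAC, kMAT}" "silent kernel_prog"
  by (auto simp: load_matrix_def find_pivot_def eliminate_column_def eliminate_row_def flag_related_def
      restrict_prog_def kernel_prog_def)

context algorithm_input begin

definition mat :: "mem \<Rightarrow> nat \<Rightarrow> nat \<Rightarrow> real" where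
  "mat m i j = karr m kMAT (i * n + j)"

lemma mat_eq: "karr m' kMAT = karr m kMAT \<Longrightarrow> mat m' = mat m"
  by (simp add: mat_def fun_eq_iff)

lemma field_ops:
  assumes "x \<in> K" "y \<in> K"
  shows "x - y \<in> K" "x * y \<in> K" "x / y \<in> K"
  using K assms unfolding real_subfield_def by blast+

lemma wp_load_matrix:
  assumes st: "stored m" and cr: "lst (narr m aCROWS) cr" "set cr \<subseteq> {..<s}"
    and wk: "lst (narr m aWORK) wk" "set wk \<subseteq> {..<n}"
  shows "wp K load_matrix m (\<lambda>t m'. t \<le> 40 + length cr * (60 + length wk * 50) + length wk * 40 \<and>
    (\<forall>i\<in>set cr. \<forall>j\<in>set wk. mat m' i j = J i j) \<and> (\<forall>j\<in>set wk. narr m' aPIVOT j = 0) \<and>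
    lst (narr m' aNOPIV) [])"
  unfolding load_matrix_def wp_Then
proof (rule wp_Foreach[where xs = cr and T = "10 + length wk * 50" and
      Inv = "\<lambda>ys m'. \<forall>i\<in>set ys. \<forall>j\<in>set wk. mat m' i j = J i j"], goal_cases)
  case (7 ys y zs m1)
  note h = 7
  have y: "y < s" "y \<in> set cr" using h(1) cr(2) by auto
  have st1: "stored m1" using st h(4) by (rule stored_unchanged) simp_all
  have wk1: "lst (narr m1 aWORK) wk" using h(4) wk(1) by (simp add: unchanged_def)
  show ?case
  proof (rule wp_Foreach[where xs = wk and T = 25 and
      Inv = "\<lambda>zs m'. (\<forall>i\<in>set ys. \<forall>j\<in>set wk. mat m' i j = J i j) \<and> (\<forall>j\<in>set zs. mat m' y j = J y j)"], goal_cases)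
    case (7 us c vs m2)
    have c: "c < n" "c \<in> set wk" using 7(1) wk(2) by auto
    have e: "narr m2 aI 0 = y" using 7(4) h(3) by (simp add: unchanged_def)
    have st2: "stored m2" using st1 7(4) by (rule stored_unchanged) simp_all
    have upd: "(mat (m2\<lparr>karr := (karr m2)(kMAT := (karr m2 kMAT)(y * n + c := J y c))\<rparr>)) i j =
        (if i = y \<and> j = c then J y c else mat m2 i j)" if "j < n" for i j
      using entry_eq_iff[OF that c(1), of i y] by (auto simp: mat_def)
    let ?m3 = "m2\<lparr>karr := (karr m2)(kMAT := (karr m2 kMAT)(y * n + c := J y c))\<rparr>"
    have sub: "j < n" if "j \<in> set wk" for j using that wk(2) by auto
    have A: "\<forall>i\<in>set ys. \<forall>j\<in>set wk. mat ?m3 i j = J i j"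
      using 7(2) upd sub by simp
    have us: "j \<in> set wk" if "j \<in> set us" for j using 7(1) that by simp
    have B: "\<forall>j\<in>set (us @ [c]). mat ?m3 y j = J y j"
      using 7(2) upd[OF sub[OF us]] upd[OF c(1)] by auto
    show ?case
      using e 7(3) storedD[OF st2] c y JK[OF y(1) c(1)] A B by simp
  next
    case (8 t m')
    then show ?case by auto
  qed (use h(2) wk1 in \<open>auto simp: mat_def\<close>)
next
  case (8 t m1)
  note h = 8
  have wk1: "lst (narr m1 aWORK) wk" using h(2) wk(1) by (simp add: unchanged_def)
  show ?case
  proof (rule wp_Foreach[where xs = wk and T = 10 and Inv = "\<lambda>ys m'. \<forall>j\<in>set ys. narr m' aPIVOT j = 0"], goal_cases)
    case (8 t' m2)
    show ?case
    proof (rule wp_Clear)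
      fix f :: "nat \<Rightarrow> nat" and t'' :: nat assume f: "lst f []" "t'' \<le> 3"
      have "mat (m2\<lparr>narr := (narr m2)(aNOPIV := f)\<rparr>) = mat m1"
        using 8(2) by (intro mat_eq) (simp add: unchanged_def)
      then show "t + (t' + t'') \<le> 40 + length cr * (60 + length wk * 50) + length wk * 40 \<and>
          (\<forall>i\<in>set cr. \<forall>j\<in>set wk. mat (m2\<lparr>narr := (narr m2)(aNOPIV := f)\<rparr>) i j = J i j) \<and>
          (\<forall>j\<in>set wk. narr (m2\<lparr>narr := (narr m2)(aNOPIV := f)\<rparr>) aPIVOT j = 0) \<and>
          lst (narr (m2\<lparr>narr := (narr m2)(aNOPIV := f)\<rparr>) aNOPIV) []"
        using f 8(1,3) h(1,3)
        by (auto simp: algebra_simps)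
    qed
  qed (use wk1 in auto)
qed (use cr in \<open>auto simp: mat_def\<close>)

text \<open>
  Pivot positions are coded like owners, with 0 for none.
\<close>

definition pivot_choice :: "(nat \<Rightarrow> nat \<Rightarrow> real) \<Rightarrow> (nat \<Rightarrow> nat) \<Rightarrow> nat \<Rightarrow> nat set \<Rightarrow> nat \<Rightarrow> bool" where
  "pivot_choice M piv i D v \<longleftrightarrow>
     (case v of 0 \<Rightarrow> \<forall>c\<in>D. piv c = 0 \<longrightarrow> M i c = 0 | Suc b \<Rightarrow> b \<in> D \<and> piv b = 0 \<and> M i b \<noteq> 0)"

lemma wp_find_pivot:
  assumes st: "stored m" and i: "narr m aI 0 = i" "i < s" and wk: "lst (narr m aWORK) wk" "set wk \<subseteq> {..<n}"
  shows "wp K find_pivot m (\<lambda>t m'. t \<le> 13 + length wk * 50 \<and>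
    pivot_choice (mat m) (narr m aPIVOT) i (set wk) (narr m' aBEST 0))"
  unfolding find_pivot_def wp_Then wp_NPut
proof (rule wp_Foreach[where xs = wk and T = 30 and
      Inv = "\<lambda>ys m'. pivot_choice (mat m) (narr m aPIVOT) i (set ys) (narr m' aBEST 0)"], goal_cases)
  case (7 ys y zs m')
  have un: "narr m' aPIVOT = narr m aPIVOT" "narr m' aI 0 = i" "narr m' aSIZE (Suc 0) = n" "karr m' kMAT = karr m kMAT"
    using 7(4) i(1) storedD[OF st] by (simp_all add: unchanged_def)
  have y: "karr m' kMAT (i * n + y) = mat m i y" using un by (simp add: mat_def)
  show ?case
    using 7(2,3) un y by (auto simp: pivot_choice_def split: nat.splits)
qed (use wk in \<open>auto simp: pivot_choice_def\<close>)

lemma mat_upd [simp]: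
  "mat (m\<lparr>narr := f\<rparr>) = mat m" "x \<noteq> kMAT \<Longrightarrow> mat (m\<lparr>karr := (karr m)(x := g)\<rparr>) = mat m"
  by (simp_all add: mat_def fun_eq_iff)

text \<open>
  Needed because a program may only write elements of \<open>K\<close>.
\<close>

definition in_field :: "mem \<Rightarrow> nat set \<Rightarrow> nat set \<Rightarrow> bool" where
  "in_field m R D \<longleftrightarrow> (\<forall>i\<in>R. \<forall>j\<in>D. mat m i j \<in> K)"

lemma in_field_upd [simp]:
  "in_field (m\<lparr>narr := f\<rparr>) R D = in_field m R D"
  "x \<noteq> kMAT \<Longrightarrow> in_field (m\<lparr>karr := (karr m)(x := g)\<rparr>) R D = in_field m R D"
  by (simp_all add: in_field_def)

lemma wp_eliminate_column:
  assumes n: "narr m aSIZE (Suc 0) = n" and i: "narr m aI 0 = i" "i \<in> set cr"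
    and c: "narr m aJ 0 = c" "c < n" "c \<in> D" and b: "narr m aBEST 0 = Suc b" "b < n" "b \<in> D" "mat m i b \<noteq> 0"
    and cr: "lst (narr m aCROWS) cr" "distinct cr" and fld: "in_field m (set cr) D" and D: "D \<subseteq> {..<n}"
  shows "wp K eliminate_column m (\<lambda>t m'. t \<le> 60 + length cr * 60 \<and>
    (\<forall>k\<in>set cr. mat m' k c = eliminate i b (mat m) k c) \<and>
    (\<forall>k. \<forall>j<n. j \<noteq> c \<longrightarrow> mat m' k j = mat m k j) \<and> in_field m' (set cr) D)"
proof (cases "c = b")
  case True
  then show ?thesis
    using c b fld by (simp add: eliminate_column_def eliminate_def)
next
  case False
  let ?f = "mat m i c / mat m i b"
  let ?m1 = "m\<lparr>karr := (karr m)(kFAC := (karr m kFAC)(0 := ?f))\<rparr>"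
  have f: "?f \<in> K" using fld i(2) c(3) b(3) field_ops(3) unfolding in_field_def by blast
  have upd: "mat (m2\<lparr>karr := (karr m2)(kMAT := (karr m2 kMAT)(k * n + c := v))\<rparr>) i j =
      (if i = k \<and> j = c then v else mat m2 i j)" if "j < n" for i j k v m2
    using entry_eq_iff[OF that c(2), of i k] by (auto simp: mat_def)
  have "wp K (Foreach aK aCROWS
           (KPut kMAT (entry (at0 aK) (at0 aJ))
             (KSub (matrix_at (at0 aK) (at0 aJ))
               (KMul (KGet kFAC (Num 0)) (matrix_at (at0 aK) (NSub (at0 aBEST) (Num 1))))))) ?m1
    (\<lambda>t m'. t \<le> 10 + length cr * 60 \<and>
      (\<forall>k\<in>set cr. mat m' k c = eliminate i b (mat m) k c) \<and>
      (\<forall>k. \<forall>j<n. j \<noteq> c \<longrightarrow> mat m' k j = mat m k j) \<and> in_field m' (set cr) D)"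
  proof (rule wp_Foreach[where xs = cr and T = 40 and Inv = "\<lambda>ys m'.
      (\<forall>k. mat m' k c = (if k \<in> set ys then eliminate i b (mat m) k c else mat m k c)) \<and>
      (\<forall>k. \<forall>j<n. j \<noteq> c \<longrightarrow> mat m' k j = mat m k j) \<and> in_field m' (set cr) D"], goal_cases)
    case (7 ys y zs m2)
    have un: "narr m2 aSIZE (Suc 0) = n" "narr m2 aJ 0 = c" "narr m2 aBEST 0 = Suc b" "karr m2 kFAC 0 = ?f"
      using 7(4) n c(1) b(1) by (simp_all add: unchanged_def)
    have y: "y \<in> set cr" using 7(1) by simp
    have Mb: "karr m2 kMAT (y * n + b) = mat m y b" using 7(2) b(2) False by (simp add: mat_def)
    have Mc: "karr m2 kMAT (y * n + c) = (if y \<in> set ys then eliminate i b (mat m) y c else mat m y c)"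
      using 7(2) by (simp add: mat_def)
    have ny: "y \<notin> set ys" using 7(1) cr(2) by auto
    let ?v = "eliminate i b (mat m) y c"
    have v: "?v = mat m y c - ?f * mat m y b" using False by (simp add: eliminate_def)
    have vK: "?v \<in> K"
      unfolding v using fld y c(3) b(3) f field_ops(1,2) unfolding in_field_def by blast
    let ?m3 = "m2\<lparr>karr := (karr m2)(kMAT := (karr m2 kMAT)(y * n + c := ?v))\<rparr>"
    have "\<forall>k. mat ?m3 k c = (if k \<in> set (ys @ [y]) then eliminate i b (mat m) k c else mat m k c)"
      using 7(2) upd[OF c(2)] by simp
    moreover have "\<forall>k. \<forall>j<n. j \<noteq> c \<longrightarrow> mat ?m3 k j = mat m k j"
      using 7(2) upd by simp
    moreover have "in_field ?m3 (set cr) D"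
      using 7(2) upd vK D unfolding in_field_def by (auto simp: subset_iff)
    ultimately show ?case
      using un 7(3) Mb Mc ny v vK by simp
  next
    case (8 t m')
    then show ?case by simp
  qed (use cr fld in auto)
  then show ?thesis
    using n i(1) c(1) b(1) False f by (auto simp: eliminate_column_def mat_def elim!: wp_call)
qed

lemma wp_eliminate_columns:
  assumes n: "narr m aSIZE (Suc 0) = n" and i: "narr m aI 0 = i" "i \<in> set cr"
    and b: "narr m aBEST 0 = Suc b" "b \<in> set wk" "mat m i b \<noteq> 0"
    and cr: "lst (narr m aCROWS) cr" "distinct cr" and wk: "lst (narr m aWORK) wk" "distinct wk" "set wk \<subseteq> {..<n}"
    and fld: "in_field m (set cr) (set wk)"
  shows "wp K (Foreach aJ aWORK eliminate_column) m (\<lambda>t m'. t \<le> 10 + length wk * (80 + length cr * 60) \<and>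
    (\<forall>k\<in>set cr. \<forall>j\<in>set wk. mat m' k j = eliminate i b (mat m) k j) \<and> in_field m' (set cr) (set wk))"
proof (rule wp_Foreach[where xs = wk and T = "60 + length cr * 60" and Inv = "\<lambda>ys m'.
    (\<forall>k\<in>set cr. \<forall>j\<in>set wk. mat m' k j = (if j \<in> set ys then eliminate i b (mat m) k j else mat m k j)) \<and>
    in_field m' (set cr) (set wk)"], goal_cases)
  case (7 ys y zs m2)
  have y: "y \<in> set wk" "y \<notin> set ys" using 7(1) wk(2) by auto
  have yn: "y < n" "b < n" using y(1) b(2) wk(3) by auto
  have un: "narr m2 aSIZE (Suc 0) = n" "narr m2 aI 0 = i" "narr m2 aBEST 0 = Suc b" "narr m2 aCROWS = narr m aCROWS"
    using 7(4) n i(1) b(1) by (simp_all add: unchanged_def)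
  have inv: "mat m2 k j = (if j \<in> set ys then eliminate i b (mat m) k j else mat m k j)"
    if "k \<in> set cr" "j \<in> set wk" for k j using 7(2) that by blast
  have mb: "mat m2 k b = mat m k b" if "k \<in> set cr" for k
    using inv[OF that b(2)] by (simp add: eliminate_def)
  have my: "mat m2 k y = mat m k y" if "k \<in> set cr" for k
    using inv[OF that y(1)] y(2) by simp
  have el: "eliminate i b (mat m2) k y = eliminate i b (mat m) k y" if "k \<in> set cr" for k
    using mb[OF that] my[OF that] mb[OF i(2)] my[OF i(2)] by (simp add: eliminate_def)
  show ?case
  proof (rule wp_call[OF wp_eliminate_column])
    show "narr m2 aSIZE (Suc 0) = n" "narr m2 aI 0 = i" "narr m2 aBEST 0 = Suc b" by (fact un)+
    show "i \<in> set cr" by (fact i(2))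
    show "narr m2 aJ 0 = y" by (fact 7(3))
    show "y < n" "b < n" by (fact yn)+
    show "y \<in> set wk" "b \<in> set wk" by (fact y(1) b(2))+
    show "mat m2 i b \<noteq> 0" using mb[OF i(2)] b(3) by simp
    show "lst (narr m2 aCROWS) cr" using un(4) cr(1) by simp
    show "distinct cr" by (fact cr(2))
    show "in_field m2 (set cr) (set wk)" using 7(2) by blast
    show "set wk \<subseteq> {..<n}" by (fact wk(3))
    fix t :: nat and m3 :: mem
    assume h: "t \<le> 60 + length cr * 60 \<and> (\<forall>k\<in>set cr. mat m3 k y = eliminate i b (mat m2) k y) \<and>
      (\<forall>k. \<forall>j<n. j \<noteq> y \<longrightarrow> mat m3 k j = mat m2 k j) \<and> in_field m3 (set cr) (set wk)"
    have "mat m3 k j = (if j \<in> set (ys @ [y]) then eliminate i b (mat m) k j else mat m k j)"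
      if kj: "k \<in> set cr" "j \<in> set wk" for k j
    proof (cases "j = y")
      case True
      then show ?thesis using h kj(1) el by simp
    next
      case False
      have "j < n" using kj(2) wk(3) by auto
      then have "mat m3 k j = mat m2 k j" using h False by blast
      then show ?thesis using inv[OF kj] False by simp
    qed
    then show "t \<le> 60 + length cr * 60 \<and>
      (\<forall>k\<in>set cr. \<forall>j\<in>set wk. mat m3 k j = (if j \<in> set (ys @ [y]) then eliminate i b (mat m) k j else mat m k j)) \<and>
      in_field m3 (set cr) (set wk)" using h by blast
  qed
next
  case (8 t m')
  have "t \<le> 10 + length wk * (80 + length cr * 60)" using 8(3) by (simp add: algebra_simps)
  then show ?case using 8(1) by simp
qed (use wk fld in auto)

definition elimination :: "mem \<Rightarrow> nat set \<Rightarrow> nat set \<Rightarrow> nat set \<Rightarrow> nat list \<Rightarrow> bool" where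
  "elimination m R D E np \<longleftrightarrow> eliminated R D J E (narr m aPIVOT) (mat m) \<and> in_field m R D \<and>
     set np = {k \<in> E. \<forall>c\<in>D. narr m aPIVOT c \<noteq> Suc k}"

lemma wp_eliminate_row:
  assumes st: "stored m" and i: "narr m aI 0 = i" "i \<in> set cr" "i \<notin> E"
    and cr: "lst (narr m aCROWS) cr" "distinct cr" "set cr \<subseteq> {..<s}"
    and wk: "lst (narr m aWORK) wk" "distinct wk" "set wk \<subseteq> {..<n}"
    and np: "lst (narr m aNOPIV) np" and el: "elimination m (set cr) (set wk) E np"
  shows "wp K eliminate_row m (\<lambda>t m'. t \<le> 100 + length wk * (150 + length cr * 60) \<and>
    (\<exists>np'. lst (narr m' aNOPIV) np' \<and> length np' \<le> Suc (length np) \<and>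
      elimination m' (set cr) (set wk) (insert i E) np'))"
proof -
  let ?D = "set wk" and ?R = "set cr"
  have e: "eliminated ?R ?D J E (narr m aPIVOT) (mat m)" and fld: "in_field m ?R ?D"
    and snp: "set np = {k \<in> E. \<forall>c\<in>?D. narr m aPIVOT c \<noteq> Suc k}"
    using el unfolding elimination_def by simp_all
  have il: "i < s" using i(2) cr(3) by auto
  have npi: "narr m aPIVOT c \<noteq> Suc i" if "c \<in> ?D" for c
    using eliminatedD(2)[OF e that] i(3) by blast
  show ?thesis
    unfolding eliminate_row_def wp_Then
  proof (rule wp_call[OF wp_find_pivot[OF st i(1) il wk(1,3)]])
    fix t1 :: nat and m1 :: mem
    assume h: "t1 \<le> 13 + length wk * 50 \<and> pivot_choice (mat m) (narr m aPIVOT) i ?D (narr m1 aBEST 0)"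
      "unchanged (nwrites find_pivot) (kwrites find_pivot) (silent find_pivot) m m1"
    have un: "narr m1 aPIVOT = narr m aPIVOT" "narr m1 aI 0 = i" "narr m1 aNOPIV = narr m aNOPIV"
      "narr m1 aSIZE (Suc 0) = n" "narr m1 aCROWS = narr m aCROWS" "narr m1 aWORK = narr m aWORK"
      using h(2) i(1) storedD[OF st] by (simp_all add: unchanged_def)
    have m1: "mat m1 = mat m" using h(2) by (intro mat_eq) (simp add: unchanged_def)
    show "wp K (Cond (NEq (at0 aBEST) (Num 0)) (Push aNOPIV (at0 aI))
        (Then (Foreach aJ aWORK eliminate_column) (NPut aPIVOT (NSub (at0 aBEST) (Num 1)) (NAdd (at0 aI) (Num 1))))) m1
      (\<lambda>t' m'. t1 + t' \<le> 100 + length wk * (150 + length cr * 60) \<and>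
        (\<exists>np'. lst (narr m' aNOPIV) np' \<and> length np' \<le> Suc (length np) \<and>
          elimination m' ?R ?D (insert i E) np'))"
    proof (cases "narr m1 aBEST 0")
      case 0
      have no: "mat m i c = 0" if "c \<in> ?D" "narr m aPIVOT c = 0" for c
        using h(1) 0 that by (simp add: pivot_choice_def)
      have e': "eliminated ?R ?D J (insert i E) (narr m aPIVOT) (mat m)"
        by (rule eliminated_skip[OF e i(2) no])
      have s': "set (np @ [i]) = {k \<in> insert i E. \<forall>c\<in>?D. narr m aPIVOT c \<noteq> Suc k}"
        using snp npi by auto
      have "wp K (Push aNOPIV (at0 aI)) m1 (\<lambda>t m'. t \<le> 13 \<and> lst (narr m' aNOPIV) (np @ [i]))"
        by (rule wp_Push[where xs = np]) (use un np in simp_all)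
      then have "wp K (Push aNOPIV (at0 aI)) m1 (\<lambda>t m'. t \<le> 13 \<and> lst (narr m' aNOPIV) (np @ [i]) \<and>
          elimination m' ?R ?D (insert i E) (np @ [i]))"
      proof (rule wp_call)
        fix t :: nat and m2 :: mem assume g: "t \<le> 13 \<and> lst (narr m2 aNOPIV) (np @ [i])"
          "unchanged (nwrites (Push aNOPIV (at0 aI))) (kwrites (Push aNOPIV (at0 aI))) (silent (Push aNOPIV (at0 aI))) m1 m2"
        have "narr m2 aPIVOT = narr m aPIVOT" using g(2) un by (simp add: unchanged_def)
        moreover have "mat m2 = mat m" using g(2) m1 by (subst mat_eq[of m2 m1]) (simp_all add: unchanged_def)
        ultimately show "t \<le> 13 \<and> lst (narr m2 aNOPIV) (np @ [i]) \<and> elimination m2 ?R ?D (insert i E) (np @ [i])"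
          using g(1) e' s' fld unfolding elimination_def in_field_def by simp
      qed
      then have "wp K (Push aNOPIV (at0 aI)) m1 (\<lambda>t' m'. t1 + (1 + bcost (NEq (at0 aBEST) (Num 0)) + t') \<le>
          100 + length wk * (150 + length cr * 60) \<and>
        (\<exists>np'. lst (narr m' aNOPIV) np' \<and> length np' \<le> Suc (length np) \<and>
          elimination m' ?R ?D (insert i E) np'))"
      proof (rule wp_call)
        fix t :: nat and m2 :: mem assume g: "t \<le> 13 \<and> lst (narr m2 aNOPIV) (np @ [i]) \<and> elimination m2 ?R ?D (insert i E) (np @ [i])"
        have "t1 + (1 + bcost (NEq (at0 aBEST) (Num 0)) + t) \<le> 100 + length wk * (150 + length cr * 60)"
          using g[THEN conjunct1] h(1)[THEN conjunct1] by (simp add: algebra_simps)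
        then show "t1 + (1 + bcost (NEq (at0 aBEST) (Num 0)) + t) \<le> 100 + length wk * (150 + length cr * 60) \<and>
          (\<exists>np'. lst (narr m2 aNOPIV) np' \<and> length np' \<le> Suc (length np) \<and> elimination m2 ?R ?D (insert i E) np')"
          using g by (intro conjI exI[of _ "np @ [i]"]) simp_all
      qed
      then show ?thesis using 0 by (simp only: wp_Cond bval.simps nval.simps if_True simp_thms)
    next
      case (Suc b)
      have b: "b \<in> ?D" "narr m aPIVOT b = 0" "mat m i b \<noteq> 0"
        using h(1) Suc by (simp_all add: pivot_choice_def)
      let ?piv = "(narr m aPIVOT)(b := Suc i)"
      have e': "eliminated ?R ?D J (insert i E) ?piv (eliminate i b (mat m))"
        by (rule eliminated_pivot[OF e _ i(2,3) b]) simp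
      have s': "set np = {k \<in> insert i E. \<forall>c\<in>?D. ?piv c \<noteq> Suc k}"
        unfolding snp
      proof (intro equalityI subsetI)
        fix k assume k: "k \<in> {k \<in> E. \<forall>c\<in>?D. narr m aPIVOT c \<noteq> Suc k}"
        then have "k \<noteq> i" using i(3) by blast
        then show "k \<in> {k \<in> insert i E. \<forall>c\<in>?D. ?piv c \<noteq> Suc k}" using k by simp
      next
        fix k assume k: "k \<in> {k \<in> insert i E. \<forall>c\<in>?D. ?piv c \<noteq> Suc k}"
        then have "?piv b \<noteq> Suc k" using b(1) by blast
        then have "k \<in> E" using k by simp
        moreover have "narr m aPIVOT c \<noteq> Suc k" if c: "c \<in> ?D" for c
        proof (cases "c = b")
          case True
          then show ?thesis using b(2) by simp
        next
          case False
          have "?piv c \<noteq> Suc k" using k c by blast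
          then show ?thesis using False by simp
        qed
        ultimately show "k \<in> {k \<in> E. \<forall>c\<in>?D. narr m aPIVOT c \<noteq> Suc k}" by blast
      qed
      have ec: "wp K (Foreach aJ aWORK eliminate_column) m1 (\<lambda>t m'. t \<le> 10 + length wk * (80 + length cr * 60) \<and>
        (\<forall>k\<in>?R. \<forall>j\<in>?D. mat m' k j = eliminate i b (mat m1) k j) \<and> in_field m' ?R ?D)"
        by (rule wp_eliminate_columns[OF un(4,2) i(2) Suc b(1) _ _ cr(2) _ wk(2,3)])
          (use un cr(1) wk(1) b(3) m1 fld in \<open>simp_all add: in_field_def\<close>)
      have "wp K (Foreach aJ aWORK eliminate_column) m1 (\<lambda>t m2.
          wp K (NPut aPIVOT (NSub (at0 aBEST) (Num 1)) (NAdd (at0 aI) (Num 1))) m2 (\<lambda>t' m'.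
            t1 + (1 + bcost (NEq (at0 aBEST) (Num 0)) + (t + t')) \<le> 100 + length wk * (150 + length cr * 60) \<and>
            (\<exists>np'. lst (narr m' aNOPIV) np' \<and> length np' \<le> Suc (length np) \<and>
              elimination m' ?R ?D (insert i E) np')))"
      proof (rule wp_call[OF ec])
        fix t :: nat and m2 :: mem
        assume g: "t \<le> 10 + length wk * (80 + length cr * 60) \<and>
          (\<forall>k\<in>?R. \<forall>j\<in>?D. mat m2 k j = eliminate i b (mat m1) k j) \<and> in_field m2 ?R ?D"
          "unchanged (nwrites (Foreach aJ aWORK eliminate_column)) (kwrites (Foreach aJ aWORK eliminate_column))
             (silent (Foreach aJ aWORK eliminate_column)) m1 m2"
        have u2: "narr m2 aPIVOT = narr m aPIVOT" "narr m2 aBEST 0 = Suc b" "narr m2 aI 0 = i"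
          "narr m2 aNOPIV = narr m aNOPIV"
          using g(2) un Suc by (simp_all add: unchanged_def)
        let ?m3 = "m2\<lparr>narr := (narr m2)(aPIVOT := ?piv)\<rparr>"
        have m3: "mat ?m3 = mat m2" by (intro mat_eq) simp
        have "eliminated ?R ?D J (insert i E) ?piv (mat ?m3)"
          by (rule eliminated_cong[OF _ _ e']) (use g(1) m3 m1 in simp_all)
        moreover have "in_field m2 ?R ?D" using g(1) by blast
        ultimately have "elimination ?m3 ?R ?D (insert i E) np"
          unfolding elimination_def using s' by simp
        moreover have "t1 + (1 + bcost (NEq (at0 aBEST) (Num 0)) + (t + (1 + ncost (NSub (at0 aBEST) (Num 1)) +
            ncost (NAdd (at0 aI) (Num 1))))) \<le> 100 + length wk * (150 + length cr * 60)"
          using g(1)[THEN conjunct1] h(1)[THEN conjunct1] by (simp add: algebra_simps)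
        ultimately show "wp K (NPut aPIVOT (NSub (at0 aBEST) (Num 1)) (NAdd (at0 aI) (Num 1))) m2 (\<lambda>t' m'.
            t1 + (1 + bcost (NEq (at0 aBEST) (Num 0)) + (t + t')) \<le> 100 + length wk * (150 + length cr * 60) \<and>
            (\<exists>np'. lst (narr m' aNOPIV) np' \<and> length np' \<le> Suc (length np) \<and>
              elimination m' ?R ?D (insert i E) np'))"
          using u2 np by (auto intro!: exI[of _ np])
      qed
      then show ?thesis using Suc by (simp add: add.assoc)
    qed
  qed
qed

lemma wp_flag_related:
  assumes cr: "lst (narr m aCROWS) cr" and wk: "lst (narr m aWORK) wk" "distinct wk"
    and np: "lst (narr m aNOPIV) np" "length np \<le> length cr"
    and n: "narr m aSIZE (Suc 0) = n" and el: "elimination m (set cr) (set wk) (set cr) np"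
  shows "wp K flag_related m (\<lambda>t m'. t \<le> 30 + length cr * 30 + length wk * (80 + length cr * 50) \<and>
    (\<forall>i\<in>set cr. narr m' aREL i = (if i \<in> related_rows J (set cr) (set wk) then 1 else 0)))"
proof -
  let ?D = "set wk" and ?R = "set cr" and ?piv = "narr m aPIVOT"
  have e: "eliminated ?R ?D J ?R ?piv (mat m)" and snp: "set np = pivotless ?R ?D ?piv"
    using el unfolding elimination_def pivotless_def by simp_all
  let ?bad = "\<lambda>c. \<not> (\<exists>k\<in>set np. mat m k c \<noteq> 0)"
  have rel: "related_rows J ?R ?D = {i \<in> ?R. \<not> (\<exists>c\<in>?D. ?piv c = Suc i \<and> ?bad c)}"
    unfolding related_rows_eliminated[OF finite_set e] snp by blast
  have inj: "c = c'" if "c \<in> ?D" "c' \<in> ?D" "?piv c = Suc r" "?piv c' = Suc r" for c c' r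
    using eliminatedD(3)[OF e that(2,4)] eliminatedD(4)[OF e that(1,3,2)] by blast
  have one: "wp K (Foreach aI aCROWS (NPut aREL (at0 aI) (Num 1))) m
    (\<lambda>t m'. t \<le> 10 + length cr * 30 \<and> (\<forall>i\<in>?R. narr m' aREL i = 1))"
  proof (rule wp_Foreach[where xs = cr and T = 10 and Inv = "\<lambda>ys m'. \<forall>i\<in>set ys. narr m' aREL i = 1"], goal_cases)
    case (7 ys y zs m')
    then show ?case by (auto simp: 7)
  qed (use cr in auto)
  show ?thesis
    unfolding flag_related_def wp_Then
  proof (rule wp_call[OF one])
    fix t1 :: nat and m1 :: mem
    assume h: "t1 \<le> 10 + length cr * 30 \<and> (\<forall>i\<in>?R. narr m1 aREL i = 1)"
      "unchanged (nwrites (Foreach aI aCROWS (NPut aREL (at0 aI) (Num 1))))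
         (kwrites (Foreach aI aCROWS (NPut aREL (at0 aI) (Num 1))))
         (silent (Foreach aI aCROWS (NPut aREL (at0 aI) (Num 1)))) m m1"
    have un: "narr m1 aWORK = narr m aWORK" "narr m1 aPIVOT = ?piv" "narr m1 aNOPIV = narr m aNOPIV"
      "narr m1 aSIZE (Suc 0) = n" "karr m1 kMAT = karr m kMAT"
      using h(2) n by (simp_all add: unchanged_def)
    show "wp K (Foreach aI aWORK
       (Cond (NEq (NGet aPIVOT (at0 aI)) (Num 0)) Skip
         (Then (Exists aJ aNOPIV aFLAG (BNot (KEq (matrix_at (at0 aJ) (at0 aI)) KZero)))
           (NPut aREL (NSub (NGet aPIVOT (at0 aI)) (Num 1)) (at0 aFLAG))))) m1
      (\<lambda>t' m'. t1 + t' \<le> 30 + length cr * 30 + length wk * (80 + length cr * 50) \<and>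
        (\<forall>i\<in>?R. narr m' aREL i = (if i \<in> related_rows J ?R ?D then 1 else 0)))"
    proof (rule wp_Foreach[where xs = wk and T = "60 + length cr * 50" and Inv = "\<lambda>ys m'.
        \<forall>i\<in>?R. narr m' aREL i = (if \<exists>c\<in>set ys. ?piv c = Suc i \<and> ?bad c then 0 else 1)"], goal_cases)
      case (7 ys y zs m2)
      have y: "y \<in> ?D" "y \<notin> set ys" "set ys \<subseteq> ?D" using 7(1) wk(2) by auto
      have u2: "narr m2 aPIVOT = ?piv" "narr m2 aNOPIV = narr m aNOPIV" "narr m2 aSIZE (Suc 0) = n"
        "karr m2 kMAT = karr m kMAT" using 7(4) un by (simp_all add: unchanged_def)
      show ?case
      proof (cases "?piv y")
        case 0
        then show ?thesis using 7(2,3) u2 by auto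
      next
        case (Suc r)
        have "wp K (Exists aJ aNOPIV aFLAG (BNot (KEq (matrix_at (at0 aJ) (at0 aI)) KZero))) m2
          (\<lambda>t m'. t \<le> 13 + length np * 44 \<and> narr m' aFLAG 0 = (if ?bad y then 0 else 1))"
        proof (rule wp_Exists[where xs = np and P = "\<lambda>k. mat m k y \<noteq> 0"], goal_cases)
          case (5 k m')
          then have "narr m' aSIZE (Suc 0) = n" "narr m' aI 0 = y" "karr m' kMAT = karr m kMAT"
            using u2 7(3) by (simp_all add: unchanged_def)
          then show ?case using 5(3) by (simp add: mat_def)
        qed (use u2 np in \<open>auto\<close>)
        then have "wp K (Exists aJ aNOPIV aFLAG (BNot (KEq (matrix_at (at0 aJ) (at0 aI)) KZero))) m2
          (\<lambda>t m3. wp K (NPut aREL (NSub (NGet aPIVOT (at0 aI)) (Num 1)) (at0 aFLAG)) m3 (\<lambda>t' m'.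
            1 + bcost (NEq (NGet aPIVOT (at0 aI)) (Num 0)) + (t + t') \<le> 60 + length cr * 50 \<and>
            (\<forall>i\<in>?R. narr m' aREL i = (if \<exists>c\<in>set (ys @ [y]). ?piv c = Suc i \<and> ?bad c then 0 else 1))))"
        proof (rule wp_call)
          fix t :: nat and m3 :: mem
          assume g: "t \<le> 13 + length np * 44 \<and> narr m3 aFLAG 0 = (if ?bad y then 0 else 1)"
            "unchanged (nwrites (Exists aJ aNOPIV aFLAG (BNot (KEq (matrix_at (at0 aJ) (at0 aI)) KZero))))
              (kwrites (Exists aJ aNOPIV aFLAG (BNot (KEq (matrix_at (at0 aJ) (at0 aI)) KZero))))
              (silent (Exists aJ aNOPIV aFLAG (BNot (KEq (matrix_at (at0 aJ) (at0 aI)) KZero)))) m2 m3"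
          have u3: "narr m3 aPIVOT = ?piv" "narr m3 aI 0 = y" "narr m3 aREL = narr m2 aREL"
            using g(2) u2 7(3) by (simp_all add: unchanged_def)
          have "((narr m2 aREL)(r := narr m3 aFLAG 0)) i = (if \<exists>c\<in>set (ys @ [y]). ?piv c = Suc i \<and> ?bad c then 0 else 1)"
            if i: "i \<in> ?R" for i
          proof (cases "i = r")
            case True
            have "\<not> (\<exists>c\<in>set ys. ?piv c = Suc i)"
              using inj[OF _ y(1) _ Suc] True y(2,3) by blast
            then have "(\<exists>c\<in>set (ys @ [y]). ?piv c = Suc i \<and> ?bad c) \<longleftrightarrow> ?bad y" using Suc True by auto
            then show ?thesis using g(1) True by simp
          next
            case False
            have "(\<exists>c\<in>set (ys @ [y]). ?piv c = Suc i \<and> ?bad c) \<longleftrightarrow> (\<exists>c\<in>set ys. ?piv c = Suc i \<and> ?bad c)"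
              using Suc False by auto
            then show ?thesis using 7(2) i False by simp
          qed
          moreover have "t \<le> 13 + length cr * 44" using g(1) np(2) by simp
          ultimately show "wp K (NPut aREL (NSub (NGet aPIVOT (at0 aI)) (Num 1)) (at0 aFLAG)) m3 (\<lambda>t' m'.
            1 + bcost (NEq (NGet aPIVOT (at0 aI)) (Num 0)) + (t + t') \<le> 60 + length cr * 50 \<and>
            (\<forall>i\<in>?R. narr m' aREL i = (if \<exists>c\<in>set (ys @ [y]). ?piv c = Suc i \<and> ?bad c then 0 else 1)))"
            using u3 Suc by simp
        qed
        then show ?thesis using Suc 7(3) u2 by simp
      qed
    next
      case (8 t m2)
      have "t1 + t \<le> 30 + length cr * 30 + length wk * (80 + length cr * 50)"
        using 8(3) h(1) by (simp add: algebra_simps)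
      then show ?case using 8(1) unfolding rel by simp
    qed (use un wk h in auto)
  qed
qed

lemma wp_restrict_prog:
  assumes st: "stored m" and cr: "lst (narr m aCROWS) cr" "set cr \<subseteq> {..<s}"
    and wk: "lst (narr m aWORK) wk" "set wk \<subseteq> {..<n}"
    and rel: "\<And>i. i \<in> set cr \<Longrightarrow> narr m aREL i = (if i \<in> rr then 1 else 0)"
  shows "wp K restrict_prog m (\<lambda>t m'. t \<le> 50 + length cr * 50 + length wk * (120 + length cr * 50) \<and>
    lst (narr m' aRROWS) (filter (\<lambda>i. i \<notin> rr) cr) \<and>
    lst (narr m' aRCOLS) (filter (\<lambda>c. \<not> (\<exists>i\<in>set cr. i \<in> rr \<and> a i c = 0)) wk) \<and>
    lst (narr m' aY1) (filter (\<lambda>c. narr m aPIVOT c \<noteq> 0) wk))"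
  unfolding restrict_prog_def wp_Then
proof (rule wp_Filter[where xs = cr and T = 1 and P = "\<lambda>i. i \<notin> rr"], goal_cases)
  case (10 z m')
  then have "narr m' aREL = narr m aREL" by (simp add: unchanged_def)
  then show ?case using 10 rel by simp
next
  case (11 t1 m1)
  have un: "narr m1 aWORK = narr m aWORK" "narr m1 aCROWS = narr m aCROWS" "narr m1 aREL = narr m aREL"
    "narr m1 aPIVOT = narr m aPIVOT"
    using 11(2) by (simp_all add: unchanged_def)
  have st1: "stored m1" using st 11(2) by (rule stored_unchanged) simp_all
  show ?case
  proof (rule wp_Filter[where xs = wk and T = "13 + length cr * 47" and
        P = "\<lambda>c. \<not> (\<exists>i\<in>set cr. i \<in> rr \<and> a i c = 0)"], goal_cases)
    case (10 c m')
    note h = 10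
    have c: "c < n" using h(1) wk(2) by auto
    have u2: "narr m' aCROWS = narr m aCROWS" "narr m' aREL = narr m aREL" using h(2) un by (simp_all add: unchanged_def)
    have st2: "stored m'" using st1 h(2) by (rule stored_unchanged) simp_all
    show ?case
    proof (rule wp_Exists[where xs = cr and P = "\<lambda>i. i \<in> rr \<and> a i c = 0"], goal_cases)
      case (5 i m2)
      have i: "i < s" using 5(1) cr(2) by auto
      have u3: "narr m2 aREL = narr m aREL" "narr m2 aI 0 = c" using 5(2) u2 h(3) by (simp_all add: unchanged_def)
      have st3: "stored m2" using st2 5(2) by (rule stored_unchanged) simp_all
      show ?case
        using u3 5(3) rel[OF 5(1)] storedD[OF st3] code_one_iff[OF i c] i c by simp
    next
      case (6 t m2)
      then show ?case by simp
    qed (use u2 cr in auto)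
  next
    case (11 t2 m2)
    note h = 11
    have u2: "narr m2 aWORK = narr m aWORK" "narr m2 aPIVOT = narr m aPIVOT" "narr m2 aRROWS = narr m1 aRROWS"
      using h(2) un by (simp_all add: unchanged_def)
    show ?case
    proof (rule wp_Filter[where xs = wk and T = 1 and P = "\<lambda>c. narr m aPIVOT c \<noteq> 0"], goal_cases)
      case (10 z m')
      then have "narr m' aPIVOT = narr m aPIVOT" using u2 by (simp add: unchanged_def)
      then show ?case using 10 by simp
    next
      case (11 t3 m3)
      have u3: "narr m3 aRCOLS = narr m2 aRCOLS" "narr m3 aRROWS = narr m1 aRROWS"
        using 11(2) u2 by (simp_all add: unchanged_def)
      have "t1 + (t2 + t3) \<le> 50 + length cr * 50 + length wk * (120 + length cr * 50)"
        using 11(3) h(3) \<open>t1 \<le> 13 + length cr * (1 + bcost (NEq (NGet aREL (at0 aI)) (Num 0)) + 34)\<close>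
        by (simp add: algebra_simps)
      then show ?case using u3 11(1) h(1) \<open>lst (narr m1 aRROWS) (filter (\<lambda>i. i \<notin> rr) cr)\<close> by simp
    qed (use u2 wk in auto)
  qed (use un wk in auto)
qed (use cr in auto)

end

definition kernel_time :: "nat \<Rightarrow> nat \<Rightarrow> nat" where
  "kernel_time k l = 200 + k * (300 + l * (300 + k * 60)) + l * (400 + k * 150)"

context algorithm_input begin

text \<open>
  If there are no relations, all rows have a pivot, and the pivot columns \<open>ys\<close> carry a nonzero minor.
  On the last pass of Seq they are the set \<open>Y1\<close> of the algorithm.
\<close>

lemma wp_kernel_prog:
  assumes st: "stored m" and cr: "lst (narr m aCROWS) cr" "distinct cr" "set cr \<subseteq> {..<s}"
    and wk: "lst (narr m aWORK) wk" "distinct wk" "set wk \<subseteq> {..<n}"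
  shows "wp K kernel_prog m (\<lambda>t m'. t \<le> kernel_time (length cr) (length wk) \<and>
    (\<exists>rr rc ys. lst (narr m' aRROWS) rr \<and> lst (narr m' aRCOLS) rc \<and> lst (narr m' aY1) ys \<and>
      distinct rr \<and> distinct rc \<and> distinct ys \<and> set ys \<subseteq> set wk \<and>
      Kernel_Support a J (set cr) (set wk) = (set rr, set rc) \<and>
      (related_rows J (set cr) (set wk) = {} \<longrightarrow> length ys = length cr \<and> minor J (set cr) (set ys) \<noteq> 0)))"
proof -
  let ?R = "set cr" and ?D = "set wk"
  let ?post = "\<lambda>m'. \<exists>rr rc ys. lst (narr m' aRROWS) rr \<and> lst (narr m' aRCOLS) rc \<and> lst (narr m' aY1) ys \<and>
      distinct rr \<and> distinct rc \<and> distinct ys \<and> set ys \<subseteq> ?D \<and>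
      Kernel_Support a J ?R ?D = (set rr, set rc) \<and>
      (related_rows J ?R ?D = {} \<longrightarrow> length ys = length cr \<and> minor J ?R (set ys) \<noteq> 0)"
  let ?T = "kernel_time (length cr) (length wk)"
  show ?thesis
    unfolding kernel_prog_def wp_Then
  proof (rule wp_call[OF wp_load_matrix[OF st cr(1,3) wk(1,3)]])
    fix t1 :: nat and m1 :: mem
    assume h1: "t1 \<le> 40 + length cr * (60 + length wk * 50) + length wk * 40 \<and>
      (\<forall>i\<in>?R. \<forall>j\<in>?D. mat m1 i j = J i j) \<and> (\<forall>j\<in>?D. narr m1 aPIVOT j = 0) \<and> lst (narr m1 aNOPIV) []"
      "unchanged (nwrites load_matrix) (kwrites load_matrix) (silent load_matrix) m m1"
    have st1: "stored m1" using st h1(2) by (rule stored_unchanged) simp_all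
    have u1: "narr m1 aCROWS = narr m aCROWS" "narr m1 aWORK = narr m aWORK"
      using h1(2) by (simp_all add: unchanged_def)
    have "eliminated ?R ?D J {} (narr m1 aPIVOT) (mat m1)"
      by (rule eliminated_cong[OF _ _ eliminated_start]) (use h1(1) in simp_all)
    moreover have "in_field m1 ?R ?D"
      using h1(1) JK cr(3) wk(3) unfolding in_field_def by (auto simp: subset_iff)
    ultimately have el1: "elimination m1 ?R ?D {} []" unfolding elimination_def by simp
    show "wp K (Foreach aI aCROWS eliminate_row) m1 (\<lambda>t2 m2. wp K flag_related m2 (\<lambda>t3 m3.
        wp K restrict_prog m3 (\<lambda>t4 m4. t1 + (t2 + (t3 + t4)) \<le> ?T \<and> ?post m4)))"
    proof (rule wp_Foreach[where xs = cr and T = "100 + length wk * (150 + length cr * 60)" and Inv = "\<lambda>ys m'.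
        \<exists>np. lst (narr m' aNOPIV) np \<and> length np \<le> length ys \<and> elimination m' ?R ?D (set ys) np"], goal_cases)
      case 5
      show ?case using h1(1) el1 by (intro exI[of _ "[]"]) simp
    next
      case (6 ys m' f)
      have "mat (m'\<lparr>narr := (narr m')(aI := f)\<rparr>) = mat m'" by (intro mat_eq) simp
      then show ?case using 6 unfolding elimination_def in_field_def by simp
    next
      case (7 ys y zs m2)
      obtain np where np: "lst (narr m2 aNOPIV) np" "length np \<le> length ys" "elimination m2 ?R ?D (set ys) np"
        using 7(2) by blast
      have y: "y \<in> ?R" "y \<notin> set ys" using 7(1) cr(2) by auto
      have st2: "stored m2" using st1 7(4) by (rule stored_unchanged) simp_all
      have l2: "lst (narr m2 aCROWS) cr" "lst (narr m2 aWORK) wk"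
        using 7(4) u1 cr(1) wk(1) by (simp_all add: unchanged_def)
      show ?case
      proof (rule wp_call[OF wp_eliminate_row[OF st2 7(3) y l2(1) cr(2,3) l2(2) wk(2,3) np(1,3)]])
        fix t :: nat and m3 :: mem
        assume g: "t \<le> 100 + length wk * (150 + length cr * 60) \<and>
          (\<exists>np'. lst (narr m3 aNOPIV) np' \<and> length np' \<le> Suc (length np) \<and> elimination m3 ?R ?D (insert y (set ys)) np')"
        then obtain np' where "lst (narr m3 aNOPIV) np'" "length np' \<le> Suc (length np)"
          "elimination m3 ?R ?D (insert y (set ys)) np'" by blast
        then show "t \<le> 100 + length wk * (150 + length cr * 60) \<and>
          (\<exists>np. lst (narr m3 aNOPIV) np \<and> length np \<le> length (ys @ [y]) \<and> elimination m3 ?R ?D (set (ys @ [y])) np)"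
          using g np(2) by (intro conjI exI[of _ np']) simp_all
      qed
    next
      case (8 t2 m2)
      obtain np where np: "lst (narr m2 aNOPIV) np" "length np \<le> length cr" "elimination m2 ?R ?D ?R np"
        using 8(1) by blast
      have st2: "stored m2" using st1 8(2) by (rule stored_unchanged) simp_all
      have l2: "lst (narr m2 aCROWS) cr" "lst (narr m2 aWORK) wk"
        using 8(2) u1 cr(1) wk(1) by (simp_all add: unchanged_def)
      have e: "eliminated ?R ?D J ?R (narr m2 aPIVOT) (mat m2)" using np(3) by (simp add: elimination_def)
      show ?case
      proof (rule wp_call[OF wp_flag_related[OF l2(1) l2(2) wk(2) np(1,2) storedD(2)[OF st2] np(3)]])
        fix t3 :: nat and m3 :: mem
        assume h3: "t3 \<le> 30 + length cr * 30 + length wk * (80 + length cr * 50) \<and>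
          (\<forall>i\<in>?R. narr m3 aREL i = (if i \<in> related_rows J ?R ?D then 1 else 0))"
          "unchanged (nwrites flag_related) (kwrites flag_related) (silent flag_related) m2 m3"
        have st3: "stored m3" using st2 h3(2) by (rule stored_unchanged) simp_all
        have l3: "lst (narr m3 aCROWS) cr" "lst (narr m3 aWORK) wk" "narr m3 aPIVOT = narr m2 aPIVOT"
          using h3(2) l2 by (simp_all add: unchanged_def)
        have rl3: "narr m3 aREL i = (if i \<in> related_rows J ?R ?D then 1 else 0)" if "i \<in> ?R" for i
          using h3(1) that by blast
        show "wp K restrict_prog m3 (\<lambda>t4 m4. t1 + (t2 + (t3 + t4)) \<le> ?T \<and> ?post m4)"
        proof (rule wp_call[OF wp_restrict_prog[OF st3 l3(1) cr(3) l3(2) wk(3) rl3]], assumption)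
          fix t4 :: nat and m4 :: mem
          let ?rr = "filter (\<lambda>i. i \<notin> related_rows J ?R ?D) cr"
            and ?rc = "filter (\<lambda>c. \<not> (\<exists>i\<in>?R. i \<in> related_rows J ?R ?D \<and> a i c = 0)) wk"
            and ?y = "filter (\<lambda>c. narr m2 aPIVOT c \<noteq> 0) wk"
          assume h4: "t4 \<le> 50 + length cr * 50 + length wk * (120 + length cr * 50) \<and>
            lst (narr m4 aRROWS) ?rr \<and> lst (narr m4 aRCOLS) ?rc \<and>
            lst (narr m4 aY1) (filter (\<lambda>c. narr m3 aPIVOT c \<noteq> 0) wk)"
          have "related_rows J ?R ?D \<subseteq> ?R" unfolding related_rows_def by blast
          then have ks: "Kernel_Support a J ?R ?D = (set ?rr, set ?rc)"
            unfolding Kernel_Support_def related_columns_def by auto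
          have mi: "length ?y = length cr \<and> minor J ?R (set ?y) \<noteq> 0" if "related_rows J ?R ?D = {}"
          proof -
            have sy: "set ?y = {c \<in> ?D. narr m2 aPIVOT c \<noteq> 0}" by simp
            note ei = eliminated_independent[OF finite_set finite_set e that, folded sy]
            have "distinct ?y" using wk(2) by simp
            then have "length ?y = card (set ?y)" by (rule distinct_card[symmetric])
            also have "\<dots> = card ?R" by (rule ei(1))
            also have "\<dots> = length cr" using cr(2) by (rule distinct_card)
            finally show ?thesis using ei(2) by simp
          qed
          have dd: "distinct ?rr" "distinct ?rc" "distinct ?y" "set ?y \<subseteq> ?D" using cr(2) wk(2) by auto
          have "?post m4" using h4 ks mi dd unfolding l3(3)
            by (intro exI[of _ ?rr] exI[of _ ?rc] exI[of _ ?y] conjI) blast+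
          moreover have "t1 + (t2 + (t3 + t4)) \<le> ?T"
            using h1(1)[THEN conjunct1] 8(3) h3(1)[THEN conjunct1] h4[THEN conjunct1]
            unfolding kernel_time_def by (simp add: algebra_simps)
          ultimately show "t1 + (t2 + (t3 + t4)) \<le> ?T \<and> ?post m4" by blast
        qed
      qed
    qed (use u1 cr in auto)
  qed
qed

end

lemma wp_Loop_True:
  assumes "bval b m" "wp K p m (\<lambda>t m'. wp K (Loop b p) m' (\<lambda>t' m''. Q (1 + bcost b + t + t') m''))"
  shows "wp K (Loop b p) m Q"
  using assms unfolding wp_def by (blast intro: exec.intros(9))

lemma wp_Loop_False:
  assumes "\<not> bval b m" "Q (1 + bcost b) m"
  shows "wp K (Loop b p) m Q"
  using assms unfolding wp_def by (blast intro: exec.intros(8))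

subsection \<open>Output codes\<close>

lemma cat_Nil: "[] \<in> cat []"
  by (simp add: cat_def)

lemma cat_Cons:
  assumes "u \<in> L" "v \<in> cat Ls"
  shows "u @ v \<in> cat (L # Ls)"
proof -
  obtain vs where vs: "vs \<in> listset Ls" "v = concat vs" using assms(2) unfolding cat_def by blast
  have "u # vs \<in> listset (L # Ls)" using assms(1) vs(1) by (simp add: set_Cons_def)
  moreover have "u @ v = concat (u # vs)" using vs(2) by simp
  ultimately show ?thesis unfolding cat_def by blast
qed

lemma cat_append: "\<lbrakk>u \<in> cat Ls; v \<in> cat Ms\<rbrakk> \<Longrightarrow> u @ v \<in> cat (Ls @ Ms)"
proof (induction Ls arbitrary: u)
  case Nil
  then show ?case by (simp add: cat_def)
next
  case (Cons L Ls)
  from Cons.prems(1) obtain x y where "x \<in> L" "y \<in> cat Ls" "u = x @ y"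
    by (fastforce simp: cat_def set_Cons_def)
  then show ?case using Cons.IH[of y] Cons.prems(2) cat_Cons[of x L "y @ v"] by simp
qed

lemma set_codes_list: "\<lbrakk>distinct xs; set xs = S\<rbrakk> \<Longrightarrow> length xs # xs \<in> set_codes S"
  unfolding set_codes_def by blast

lemma set_codes_empty: "[0] \<in> set_codes {}"
  using set_codes_list[of "[]" "{}"] by simp

lemma HK_row_nontrivial:
  assumes fin: "finite R" "finite C" and hk: "HK a R C = (R0, C0)" and i: "i \<in> R0"
  shows "\<exists>j\<in>C. a i j = 0"
proof (rule ccontr)
  assume no: "\<not> ?thesis"
  note h = HK_subset[OF fin hk]
  have f0: "finite R0" using h(1) fin(1) by (rule finite_subset)
  have "term_rank a R C \<le> card (R0 - {i}) + card C0"
  proof (rule cover_ge_term_rank[OF fin _ h(2)])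
    show "R0 - {i} \<subseteq> R" using h(1) by blast
    show "i' \<in> R0 - {i} \<or> j \<in> C0" if "i' \<in> R" "j \<in> C" "a i' j = 0" for i' j
      using h(3)[OF that] no that by blast
  qed
  moreover have "card (R0 - {i}) < card R0" using f0 i by (rule card_Diff1_less)
  ultimately show False using minimum_coversD(4)[OF h(4)] by linarith
qed

subsection \<open>The passes of Seq\<close>

definition pass_prog :: prog where
  "pass_prog = Then cover_prog (Then (Output (Num 3)) (Then (Print aI aCROWS) (Then (Print aI aCCOLS)
     (Then kernel_prog (Then (Print aI aRROWS) (Print aI aRCOLS))))))"

text \<open>
  As rows and columns are only removed, a pass has changed nothing iff it has not changed their numbers.
  \<open>aPREV\<close> is the number of rows before the pass, including the trivial ones on the first pass.
\<close>

definition seq_step :: prog where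
  "seq_step = Then pass_prog
     (Then (Cond (BAnd (NEq (at0 aRROWS) (at0 aPREV)) (NEq (at0 aRCOLS) (at0 aCOLS))) (NPut aMORE (Num 0) (Num 0)) Skip)
     (Then (copy_list aRROWS aROWS) (Then (copy_list aRCOLS aCOLS) (NPut aPREV (Num 0) (at0 aROWS)))))"

definition seq_loop :: prog where
  "seq_loop = Loop (NLess (Num 0) (at0 aMORE)) seq_step"

lemma seq_writes [simp]:
  "nwrites pass_prog = {aCUR, aI, aMARK, aLOST, aFREE, aBEST, aOWN, aPRICE, aCROWS, aCCOLS, aWORK, aJ, aK,
     aPIVOT, aNOPIV, aREL, aFLAG, aRROWS, aRCOLS, aY1}"
  "kwrites pass_prog = {kFAC, kMAT}" "\<not> silent pass_prog"
  "nwrites seq_step = {aCUR, aI, aMARK, aLOST, aFREE, aBEST, aOWN, aPRICE, aCROWS, aCCOLS, aWORK, aJ, aK,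
     aPIVOT, aNOPIV, aREL, aFLAG, aRROWS, aRCOLS, aY1, aMORE, aROWS, aCOLS, aPREV}"
  "kwrites seq_step = {kFAC, kMAT}" "\<not> silent seq_step"
  "nwrites seq_loop = {aCUR, aI, aMARK, aLOST, aFREE, aBEST, aOWN, aPRICE, aCROWS, aCCOLS, aWORK, aJ, aK,
     aPIVOT, aNOPIV, aREL, aFLAG, aRROWS, aRCOLS, aY1, aMORE, aROWS, aCOLS, aPREV}"
  "kwrites seq_loop = {kFAC, kMAT}" "\<not> silent seq_loop"
  by (auto simp: pass_prog_def seq_step_def seq_loop_def)

lemma length_le_card:
  assumes "distinct xs" "set xs \<subseteq> S" "finite S"
  shows "length xs \<le> card S"
  using card_mono[OF assms(3,2)] distinct_card[OF assms(1)] by simp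

definition pass_time :: "nat \<Rightarrow> nat \<Rightarrow> nat" where
  "pass_time d l = cover_time d l + kernel_time d l + 300 + 200 * d + 200 * l"

lemma kernel_time_mono: "\<lbrakk>k \<le> k'; l \<le> l'\<rbrakk> \<Longrightarrow> kernel_time k l \<le> kernel_time k' l'"
  unfolding kernel_time_def by (intro add_mono mult_le_mono order_refl) auto

lemma cover_time_mono: "\<lbrakk>k \<le> k'; l \<le> l'\<rbrakk> \<Longrightarrow> cover_time k l \<le> cover_time k' l'"
  unfolding cover_time_def by (intro add_mono mult_le_mono order_refl) auto

lemma pass_time_mono: "\<lbrakk>k \<le> k'; l \<le> l'\<rbrakk> \<Longrightarrow> pass_time k l \<le> pass_time k' l'"
  unfolding pass_time_def using kernel_time_mono[of k k' l l'] cover_time_mono[of k k' l l'] by linarith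

context algorithm_input begin

definition pass_result :: "nat set \<Rightarrow> nat set \<Rightarrow> mem \<Rightarrow> mem \<Rightarrow> bool" where
  "pass_result R C m m' \<longleftrightarrow> (\<exists>R0 C0 rr rc ys w.
     lst (narr m' aRROWS) rr \<and> lst (narr m' aRCOLS) rc \<and> lst (narr m' aY1) ys \<and>
     distinct rr \<and> distinct rc \<and> distinct ys \<and> set ys \<subseteq> C - C0 \<and> HK a R C = (R0, C0) \<and>
     Kernel_Support a J R0 (C - C0) = (set rr, set rc) \<and>
     (related_rows J R0 (C - C0) = {} \<longrightarrow> length ys = card R0 \<and> minor J R0 (set ys) \<noteq> 0) \<and>
     tape m' = tape m @ w \<and> w \<in> pass_codes (Pass R0 C0 (set rr) (set rc)))"

lemma wp_pass_prog:
  assumes st: "stored m" and cl: "lst (narr m aCOLS) cl" "distinct cl" "set cl \<subseteq> {..<n}"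
    and rl: "lst (narr m aROWS) rl" "distinct rl" "set rl \<subseteq> R" "\<And>r c. \<lbrakk>r \<in> R - set rl; c \<in> set cl\<rbrakk> \<Longrightarrow> a r c \<noteq> 0"
    and R: "R \<subseteq> {..<s}"
  shows "wp K pass_prog m (\<lambda>t m'. t \<le> pass_time (length rl) (length cl) \<and> pass_result R (set cl) m m')"
proof -
  let ?C = "set cl" and ?d = "length rl" and ?l = "length cl"
  have finR: "finite R" using R by (rule finite_subset) simp
  show ?thesis
    unfolding pass_prog_def wp_Then
  proof (rule wp_call[OF wp_cover_prog[OF st cl rl R]], assumption, assumption, goal_cases)
    case (1 t1 m1)
    note h1 = 1
    obtain cr cc wk where c: "lst (narr m1 aCROWS) cr" "lst (narr m1 aCCOLS) cc" "lst (narr m1 aWORK) wk"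
      "distinct cr" "distinct cc" "distinct wk" "set wk = ?C - set cc" "HK a R ?C = (set cr, set cc)"
      using h1(1) by blast
    have st1: "stored m1" using st h1(2) by (rule stored_unchanged) simp_all
    have tp1: "tape m1 = tape m" using h1(2) by (simp add: unchanged_def)
    note hk = HK_subset[OF finR finite_set c(8)]
    have crl: "set cr \<subseteq> set rl"
    proof
      fix i assume i: "i \<in> set cr"
      then have "i \<in> R" using hk(1) by blast
      moreover obtain j where "j \<in> ?C" "a i j = 0" using HK_row_nontrivial[OF finR finite_set c(8) i] by blast
      ultimately show "i \<in> set rl" using rl(4) by blast
    qed
    have len: "length cr \<le> ?d" "length cc \<le> ?l" "length wk \<le> ?l"
      using length_le_card[OF c(4) crl] length_le_card[OF c(5) hk(2)] length_le_card[OF c(6), of ?C] c(7)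
        card_length[of rl] card_length[of cl] by auto
    have crs: "set cr \<subseteq> {..<s}" using hk(1) R by blast
    have wkn: "set wk \<subseteq> {..<n}" using c(7) cl(3) by blast
    show ?case
      unfolding wp_Output
    proof (rule wp_Print[where xs = cr], goal_cases)
      case (3 t3 m3)
      note h3 = 3
      have u3: "narr m3 aCROWS = narr m1 aCROWS" "narr m3 aCCOLS = narr m1 aCCOLS" "narr m3 aWORK = narr m1 aWORK"
        using h3(3) by (simp_all add: unchanged_def)
      have st3: "stored m3" using st1 h3(3) by (simp add: stored_def unchanged_def)
      show ?case
      proof (rule wp_Print[where xs = cc], goal_cases)
        case (3 t4 m4)
        note h4 = 3
        have u4: "narr m4 aCROWS = narr m1 aCROWS" "narr m4 aWORK = narr m1 aWORK"
          using h4(3) u3 by (simp_all add: unchanged_def)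
        have st4: "stored m4" using st3 h4(3) by (rule stored_unchanged) simp_all
        have k: "wp K kernel_prog m4 (\<lambda>t m'. t \<le> kernel_time (length cr) (length wk) \<and>
          (\<exists>rr rc ys. lst (narr m' aRROWS) rr \<and> lst (narr m' aRCOLS) rc \<and> lst (narr m' aY1) ys \<and>
            distinct rr \<and> distinct rc \<and> distinct ys \<and> set ys \<subseteq> set wk \<and>
            Kernel_Support a J (set cr) (set wk) = (set rr, set rc) \<and>
            (related_rows J (set cr) (set wk) = {} \<longrightarrow> length ys = length cr \<and> minor J (set cr) (set ys) \<noteq> 0)))"
          by (rule wp_kernel_prog[OF st4 _ c(4) crs _ c(6) wkn]) (use u4 c(1,3) in simp_all)
        show ?case
        proof (rule wp_call[OF k], goal_cases)
          case (1 t5 m5)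
          note h5 = 1
          obtain rr rc ys where r: "lst (narr m5 aRROWS) rr" "lst (narr m5 aRCOLS) rc" "lst (narr m5 aY1) ys"
            "distinct rr" "distinct rc" "distinct ys" "set ys \<subseteq> set wk"
            "Kernel_Support a J (set cr) (set wk) = (set rr, set rc)"
            "related_rows J (set cr) (set wk) = {} \<longrightarrow> length ys = length cr \<and> minor J (set cr) (set ys) \<noteq> 0"
            using h5(1) by blast
          have tp5: "tape m5 = tape m4" using h5(2) by (simp add: unchanged_def)
          have sub: "set rr \<subseteq> set cr" "set rc \<subseteq> set wk" using r(8) by (auto simp: Kernel_Support_def)
          have len2: "length rr \<le> length cr" "length rc \<le> length wk"
            using length_le_card[OF r(4) sub(1)] length_le_card[OF r(5) sub(2)] card_length[of cr] card_length[of wk]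
            by auto
          show ?case
          proof (rule wp_Print[OF r(1)], goal_cases)
            case (2 t6 m6)
            note h6 = 2
            have u6: "narr m6 aRROWS = narr m5 aRROWS" "narr m6 aRCOLS = narr m5 aRCOLS" "narr m6 aY1 = narr m5 aY1"
              using h6(3) by (simp_all add: unchanged_def)
            show ?case
            proof (rule wp_Print[where xs = rc], goal_cases)
              case (3 t7 m7)
              note h7 = 3
              have u7: "lst (narr m7 aRROWS) rr" "lst (narr m7 aRCOLS) rc" "lst (narr m7 aY1) ys"
                using h7(3) u6 r(1-3) by (simp_all add: unchanged_def)
              let ?w = "[3] @ (length cr # cr) @ (length cc # cc) @ (length rr # rr) @ (length rc # rc) @ []"
              have tp: "tape m7 = tape m @ ?w"
                using h7(1) h6(1) tp5 h4(1) h3(1) tp1 by simp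
              have w: "?w \<in> pass_codes (Pass (set cr) (set cc) (set rr) (set rc))"
                unfolding pass_codes_def pass.sel
                by (intro cat_Cons cat_Nil set_codes_list) (use c(4,5) r(4,5) in simp_all)
              have lc: "length cr = card (set cr)" using c(4) by (rule distinct_card[symmetric])
              have pr: "pass_result R ?C m m7"
                unfolding pass_result_def
                by (rule exI[of _ "set cr"], rule exI[of _ "set cc"], rule exI[of _ rr], rule exI[of _ rc],
                    rule exI[of _ ys], rule exI[of _ ?w], intro conjI)
                  (fact u7 r(4-6) c(8) r(7)[unfolded c(7)] r(8)[unfolded c(7)] r(9)[unfolded c(7) lc] tp w)+
              have "kernel_time (length cr) (length wk) \<le> kernel_time ?d ?l" using len by (intro kernel_time_mono)
              then have "t1 + (1 + ncost (Num 3) + (t3 + (t4 + (t5 + (t6 + t7))))) \<le> pass_time ?d ?l"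
                using h1(1)[THEN conjunct1] h3(2) h4(2) h5(1)[THEN conjunct1] h6(2) h7(2) len len2
                unfolding pass_time_def by simp
              then show ?case using pr by blast
            qed (use u6 r(2) in simp_all)
          qed simp
        qed
      qed (use c(2) u3 in simp_all)
    qed (use c(1) in simp_all)
  qed
qed

definition seq_result :: "nat set \<Rightarrow> nat set \<Rightarrow> pass list \<Rightarrow> nat list \<Rightarrow> nat list \<Rightarrow> nat list \<Rightarrow> mem \<Rightarrow> mem \<Rightarrow> bool" where
  "seq_result R C ps rl cl ys m m' \<longleftrightarrow> Seq_run a J R C ps (set rl) (set cl) \<and>
     lst (narr m' aROWS) rl \<and> lst (narr m' aCOLS) cl \<and> lst (narr m' aY1) ys \<and>
     distinct rl \<and> distinct cl \<and> distinct ys \<and> set ys \<subseteq> set cl \<and>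
     length ys = length rl \<and> minor J (set rl) (set ys) \<noteq> 0 \<and>
     (\<exists>w. tape m' = tape m @ w \<and> w \<in> cat (map pass_codes ps))"

definition step_result :: "nat set \<Rightarrow> nat set \<Rightarrow> mem \<Rightarrow> mem \<Rightarrow> bool" where
  "step_result R C m m' \<longleftrightarrow> (\<exists>R0 C0 rr rc ys w. lst (narr m' aROWS) rr \<and> lst (narr m' aCOLS) rc \<and> lst (narr m' aY1) ys \<and>
     distinct rr \<and> distinct rc \<and> distinct ys \<and> set ys \<subseteq> C - C0 \<and> HK a R C = (R0, C0) \<and>
     Kernel_Support a J R0 (C - C0) = (set rr, set rc) \<and>
     (related_rows J R0 (C - C0) = {} \<longrightarrow> length ys = card R0 \<and> minor J R0 (set ys) \<noteq> 0) \<and>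
     tape m' = tape m @ w \<and> w \<in> pass_codes (Pass R0 C0 (set rr) (set rc)) \<and>
     narr m' aPREV 0 = card (set rr) \<and>
     narr m' aMORE 0 = (if (set rr, set rc) = (R, C) then 0 else narr m aMORE 0))"

lemma wp_seq_step:
  assumes st: "stored m" and cl: "lst (narr m aCOLS) cl" "distinct cl" "set cl \<subseteq> {..<n}"
    and rl: "lst (narr m aROWS) rl" "distinct rl" "set rl \<subseteq> R" "\<And>r c. \<lbrakk>r \<in> R - set rl; c \<in> set cl\<rbrakk> \<Longrightarrow> a r c \<noteq> 0"
    and R: "R \<subseteq> {..<s}" and prev: "narr m aPREV 0 = card R"
  shows "wp K seq_step m (\<lambda>t m'. t \<le> pass_time (length rl) (length cl) + 100 + 40 * card R + 40 * length cl \<and>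
    step_result R (set cl) m m')"
  unfolding seq_step_def wp_Then
proof (rule wp_call[OF wp_pass_prog[OF st cl rl R]], assumption)
  have finR: "finite R" using R by (rule finite_subset) simp
  fix t1 :: nat and m1 :: mem
  assume h1: "t1 \<le> pass_time (length rl) (length cl) \<and> pass_result R (set cl) m m1"
    "unchanged (nwrites pass_prog) (kwrites pass_prog) (silent pass_prog) m m1"
  obtain R0 C0 rr rc ys w where r: "lst (narr m1 aRROWS) rr" "lst (narr m1 aRCOLS) rc" "lst (narr m1 aY1) ys"
     "distinct rr" "distinct rc" "distinct ys" "set ys \<subseteq> set cl - C0" "HK a R (set cl) = (R0, C0)"
     "Kernel_Support a J R0 (set cl - C0) = (set rr, set rc)"
     "related_rows J R0 (set cl - C0) = {} \<longrightarrow> length ys = card R0 \<and> minor J R0 (set ys) \<noteq> 0"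
     "tape m1 = tape m @ w" "w \<in> pass_codes (Pass R0 C0 (set rr) (set rc))"
    using h1(1) unfolding pass_result_def by blast
  note ss = Seq_step[OF finR finite_set r(8,9)]
  have u1: "narr m1 aPREV 0 = card R" "narr m1 aCOLS 0 = length cl" "narr m1 aMORE = narr m aMORE"
    using h1(2) prev cl(1) by (simp_all add: unchanged_def lst_0)
  have len: "length rr \<le> card R" "length rc \<le> length cl"
    using length_le_card[OF r(4) ss(2) finR] length_le_card[OF r(5) ss(4)] card_length[of cl] by auto
  have same: "(length rr = card R \<and> length rc = length cl) \<longleftrightarrow> (set rr, set rc) = (R, set cl)"
  proof
    assume e: "length rr = card R \<and> length rc = length cl"
    have "set rr = R" using card_subset_eq[OF finR ss(2)] e distinct_card[OF r(4)] by simp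
    moreover have "set rc = set cl"
      using card_subset_eq[OF finite_set ss(4)] e distinct_card[OF r(5)] distinct_card[OF cl(2)] by simp
    ultimately show "(set rr, set rc) = (R, set cl)" by simp
  next
    assume "(set rr, set rc) = (R, set cl)"
    then show "length rr = card R \<and> length rc = length cl"
      using distinct_card[OF r(4)] distinct_card[OF r(5)] distinct_card[OF cl(2)] by simp
  qed
  let ?more = "if (set rr, set rc) = (R, set cl) then 0 else narr m aMORE 0"
  let ?cnd = "Cond (BAnd (NEq (at0 aRROWS) (at0 aPREV)) (NEq (at0 aRCOLS) (at0 aCOLS))) (NPut aMORE (Num 0) (Num 0)) Skip"
  have cnd: "wp K ?cnd m1 (\<lambda>t m2. t \<le> 30 \<and> narr m2 aMORE 0 = ?more \<and> tape m2 = tape m1 \<and>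
      (\<forall>x. x \<noteq> aMORE \<longrightarrow> narr m2 x = narr m1 x))"
    using same u1 lst_0[OF r(1)] lst_0[OF r(2)] by auto
  let ?Q = "\<lambda>t m'. t \<le> pass_time (length rl) (length cl) + 100 + 40 * card R + 40 * length cl \<and>
    step_result R (set cl) m m'"
  show "wp K ?cnd m1 (\<lambda>t2 m2. wp K (copy_list aRROWS aROWS) m2 (\<lambda>t3 m3. wp K (copy_list aRCOLS aCOLS) m3
      (\<lambda>t4 m4. wp K (NPut aPREV (Num 0) (at0 aROWS)) m4 (\<lambda>t5 m5. ?Q (t1 + (t2 + (t3 + (t4 + t5)))) m5))))"
  proof (rule wp_call[OF cnd])
    fix t2 :: nat and m2 :: mem
    assume h2: "t2 \<le> 30 \<and> narr m2 aMORE 0 = ?more \<and> tape m2 = tape m1 \<and> (\<forall>x. x \<noteq> aMORE \<longrightarrow> narr m2 x = narr m1 x)"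
    have u2: "narr m2 aRROWS = narr m1 aRROWS" "narr m2 aRCOLS = narr m1 aRCOLS" "narr m2 aY1 = narr m1 aY1"
      using h2 by simp_all
    show "wp K (copy_list aRROWS aROWS) m2 (\<lambda>t3 m3. wp K (copy_list aRCOLS aCOLS) m3
      (\<lambda>t4 m4. wp K (NPut aPREV (Num 0) (at0 aROWS)) m4 (\<lambda>t5 m5. ?Q (t1 + (t2 + (t3 + (t4 + t5)))) m5)))"
    proof (rule wp_copy_list[where xs = rr])
      fix t3 :: nat and m3 :: mem
      assume h3: "lst (narr m3 aROWS) rr" "unchanged {aI, aROWS} {} True m2 m3" "t3 \<le> 13 + length rr * 38"
      have u3: "narr m3 aRCOLS = narr m1 aRCOLS" "narr m3 aY1 = narr m1 aY1" "narr m3 aMORE 0 = ?more" "tape m3 = tape m1"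
        using h3(2) u2 h2 by (simp_all add: unchanged_def)
      show "wp K (copy_list aRCOLS aCOLS) m3
        (\<lambda>t4 m4. wp K (NPut aPREV (Num 0) (at0 aROWS)) m4 (\<lambda>t5 m5. ?Q (t1 + (t2 + (t3 + (t4 + t5)))) m5))"
      proof (rule wp_copy_list[where xs = rc])
        fix t4 :: nat and m4 :: mem
        assume h4: "lst (narr m4 aCOLS) rc" "unchanged {aI, aCOLS} {} True m3 m4" "t4 \<le> 13 + length rc * 38"
        let ?m5 = "m4\<lparr>narr := (narr m4)(aPREV := (narr m4 aPREV)(0 := length rr))\<rparr>"
        have u4: "lst (narr ?m5 aROWS) rr" "lst (narr ?m5 aCOLS) rc" "lst (narr ?m5 aY1) ys" "narr ?m5 aMORE 0 = ?more"
          "tape ?m5 = tape m @ w" "narr ?m5 aPREV 0 = card (set rr)"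
          using h4(1,2) h3(1) u3 r(3,11) distinct_card[OF r(4)] by (simp_all add: unchanged_def)
        have "narr m4 aROWS 0 = length rr" using u4(1) by (simp add: lst_0)
        moreover have "?Q (t1 + (t2 + (t3 + (t4 + (1 + ncost (Num 0) + ncost (at0 aROWS)))))) ?m5"
        proof (intro conjI)
          show "t1 + (t2 + (t3 + (t4 + (1 + ncost (Num 0) + ncost (at0 aROWS))))) \<le>
            pass_time (length rl) (length cl) + 100 + 40 * card R + 40 * length cl"
            using h1(1)[THEN conjunct1] h2[THEN conjunct1] h3(3) h4(3) len by simp
        next
          show "step_result R (set cl) m ?m5" unfolding step_result_def
            by (rule exI[of _ R0], rule exI[of _ C0], rule exI[of _ rr], rule exI[of _ rc],
                rule exI[of _ ys], rule exI[of _ w], intro conjI)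
              (fact u4(1-3) r(4-10) u4(5) r(12) u4(6) u4(4))+
        qed
        ultimately show "wp K (NPut aPREV (Num 0) (at0 aROWS)) m4 (\<lambda>t5 m5. ?Q (t1 + (t2 + (t3 + (t4 + t5)))) m5)"
          by (simp only: wp_NPut nval.simps)
      qed (use u3 r(2) in simp_all)
    qed (use u2 r(1) in simp_all)
  qed
qed

text \<open>
  \<open>R\<close> contains the trivial rows on the first pass only. The time is stated with upper bounds \<open>d\<close>, \<open>l\<close>, \<open>e\<close>
  for the sizes, which do not change during the run.
\<close>

lemma wp_seq_loop:
  assumes "stored m" "lst (narr m aCOLS) cl" "distinct cl" "set cl \<subseteq> {..<n}"
    "lst (narr m aROWS) rl" "distinct rl" "set rl \<subseteq> R" "\<And>r c. \<lbrakk>r \<in> R - set rl; c \<in> set cl\<rbrakk> \<Longrightarrow> a r c \<noteq> 0"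
    "R \<subseteq> {..<s}" "narr m aPREV 0 = card R" "narr m aMORE 0 = 1"
    and "length rl \<le> d" "length cl \<le> l" "card R \<le> e"
  shows "wp K seq_loop m (\<lambda>t m'. \<exists>ps rl' cl' ys. seq_result R (set cl) ps rl' cl' ys m m' \<and>
    t \<le> 10 + length ps * (pass_time d l + 200 + 40 * e + 40 * l))"
  using assms
proof (induction "card R + length cl" arbitrary: R rl cl m rule: less_induct)
  case less
  let ?T = "pass_time d l + 200 + 40 * e + 40 * l"
  have finR: "finite R" using less.prems(9) by (rule finite_subset) simp
  show ?case
    unfolding seq_loop_def
  proof (rule wp_Loop_True)
    show "bval (NLess (Num 0) (at0 aMORE)) m" using less.prems(11) by simp
    show "wp K seq_step m (\<lambda>t m'. wp K (Loop (NLess (Num 0) (at0 aMORE)) seq_step) m' (\<lambda>t' m''.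
      \<exists>ps rl' cl' ys. seq_result R (set cl) ps rl' cl' ys m m'' \<and>
        1 + bcost (NLess (Num 0) (at0 aMORE)) + t + t' \<le> 10 + length ps * ?T))"
    proof (rule wp_call[OF wp_seq_step[OF less.prems(1-10)]], assumption, assumption, goal_cases)
      case (1 t m1)
      note h = 1
      obtain R0 C0 rr rc ys w where r: "lst (narr m1 aROWS) rr" "lst (narr m1 aCOLS) rc" "lst (narr m1 aY1) ys"
         "distinct rr" "distinct rc" "distinct ys" "set ys \<subseteq> set cl - C0" "HK a R (set cl) = (R0, C0)"
         "Kernel_Support a J R0 (set cl - C0) = (set rr, set rc)"
         "related_rows J R0 (set cl - C0) = {} \<longrightarrow> length ys = card R0 \<and> minor J R0 (set ys) \<noteq> 0"
         "tape m1 = tape m @ w" "w \<in> pass_codes (Pass R0 C0 (set rr) (set rc))"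
         "narr m1 aPREV 0 = card (set rr)"
         "narr m1 aMORE 0 = (if (set rr, set rc) = (R, set cl) then 0 else narr m aMORE 0)"
        using h(1) unfolding step_result_def by blast
      note ss = Seq_step[OF finR finite_set r(8,9)]
      have st1: "stored m1" using less.prems(1) h(2) by (rule stored_unchanged) simp_all
      have tT: "t + 100 \<le> ?T"
        using h(1)[THEN conjunct1] pass_time_mono[OF less.prems(12,13)] less.prems(13,14) by simp
      show ?case
      proof (cases "(set rr, set rc) = (R, set cl)")
        case True
        then have eq: "set rr = R" "set rc = set cl" by simp_all
        note ind = Seq_stop_independent[OF finR finite_set r(8) r(9)[unfolded eq]]
        have "length ys = card R" "minor J R (set ys) \<noteq> 0"
          using r(10) ind unfolding ind(1,2) by simp_all
        moreover have "length rr = card R" using distinct_card[OF r(4)] eq by simp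
        moreover have "Seq_run a J R (set cl) [Pass R0 C0 R (set cl)] R (set cl)"
          by (rule Seq_stop[OF r(8) r(9)[unfolded eq]])
        moreover have "w @ [] \<in> cat (map pass_codes [Pass R0 C0 R (set cl)])"
          unfolding list.map by (rule cat_Cons[OF _ cat_Nil]) (use r(12) eq in simp)
        ultimately have "seq_result R (set cl) [Pass R0 C0 R (set cl)] rr rc ys m m1"
          unfolding seq_result_def eq using r(1-7,11) by auto
        then show ?thesis
          using r(14) True tT by (intro wp_Loop_False) (auto intro!: exI[of _ "[Pass R0 C0 R (set cl)]"])
      next
        case False
        have lt: "card (set rr) + length rc < card R + length cl"
        proof -
          have "length rc \<le> length cl" using length_le_card[OF r(5) ss(4)] card_length[of cl] by simp
          moreover have "card (set rr) \<le> card R" using ss(2) finR by (rule card_mono[rotated])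
          moreover have "card (set rr) \<noteq> card R \<or> length rc \<noteq> length cl"
          proof (rule ccontr)
            assume "\<not> ?thesis"
            then have "set rr = R" "set rc = set cl"
              using card_subset_eq[OF finR ss(2)] card_subset_eq[OF finite_set ss(4)]
                distinct_card[OF r(5)] distinct_card[OF less.prems(3)] by simp_all
            then show False using False by simp
          qed
          ultimately show ?thesis by linarith
        qed
        have i: "wp K seq_loop m1 (\<lambda>t m'. \<exists>ps rl' cl' ys. seq_result (set rr) (set rc) ps rl' cl' ys m1 m' \<and>
            t \<le> 10 + length ps * ?T)"
        proof (rule less.hyps[OF lt st1 r(2,5) _ r(1,4) order_refl _ _ r(13)])
          show "set rc \<subseteq> {..<n}" using ss(4) less.prems(4) by blast
          show "a i j \<noteq> 0" if "i \<in> set rr - set rr" "j \<in> set rc" for i j using that by blast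
          show "set rr \<subseteq> {..<s}" using ss(2) less.prems(9) by blast
          show "narr m1 aMORE 0 = 1" using r(14) False less.prems(11) by simp
          have "length rr = card (set rr)" using distinct_card[OF r(4)] by simp
          moreover have "set rr \<subseteq> set rl"
          proof
            fix i assume "i \<in> set rr"
            then have iR0: "i \<in> R0" using ss(1) by blast
            have "i \<in> R" using iR0 HK_subset(1)[OF finR finite_set r(8)] by blast
            then show "i \<in> set rl" using HK_row_nontrivial[OF finR finite_set r(8) iR0] less.prems(8) by blast
          qed
          ultimately show "length rr \<le> d"
            using length_le_card[OF r(4), of "set rl"] card_length[of rl] less.prems(12) by simp
          show "length rc \<le> l" using length_le_card[OF r(5) ss(4)] card_length[of cl] less.prems(13) by simp
          show "card (set rr) \<le> e" using card_mono[OF finR ss(2)] less.prems(14) by simp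
        qed
        show ?thesis
          unfolding seq_loop_def[symmetric]
        proof (rule wp_call[OF i])
          fix t' :: nat and m2 :: mem
          assume "\<exists>ps rl' cl' ys. seq_result (set rr) (set rc) ps rl' cl' ys m1 m2 \<and> t' \<le> 10 + length ps * ?T"
          then obtain ps rl' cl' ys' where q: "seq_result (set rr) (set rc) ps rl' cl' ys' m1 m2"
            "t' \<le> 10 + length ps * ?T" by blast
          let ?p = "Pass R0 C0 (set rr) (set rc)"
          obtain w' where w': "tape m2 = tape m1 @ w'" "w' \<in> cat (map pass_codes ps)"
            and run: "Seq_run a J (set rr) (set rc) ps (set rl') (set cl')"
            using q(1) unfolding seq_result_def by blast
          have "Seq_run a J R (set cl) (?p # ps) (set rl') (set cl')"
            by (rule Seq_again[OF r(8,9) False run])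
          moreover have "tape m2 = tape m @ (w @ w')" using w'(1) r(11) by simp
          moreover have "w @ w' \<in> cat (map pass_codes (?p # ps))"
            unfolding list.map by (rule cat_Cons[OF r(12) w'(2)])
          ultimately have "seq_result R (set cl) (?p # ps) rl' cl' ys' m m2"
            using q(1) unfolding seq_result_def by blast
          moreover have "1 + bcost (NLess (Num 0) (at0 aMORE)) + t + t' \<le> 10 + length (?p # ps) * ?T"
            using q(2) tT by simp
          ultimately show "\<exists>ps rl' cl' ys. seq_result R (set cl) ps rl' cl' ys m m2 \<and>
            1 + bcost (NLess (Num 0) (at0 aMORE)) + t + t' \<le> 10 + length ps * ?T" by blast
        qed
      qed
    qed
  qed
qed

end

subsection \<open>Finding the columns of B\<close>

definition zero_count :: "(nat \<Rightarrow> nat \<Rightarrow> ereal) \<Rightarrow> nat set \<Rightarrow> nat \<Rightarrow> nat" where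
  "zero_count a I j = card {i \<in> I. order_code (a i j) = Suc 0}"

definition positive_count :: "(nat \<Rightarrow> nat \<Rightarrow> ereal) \<Rightarrow> nat set \<Rightarrow> nat \<Rightarrow> nat" where
  "positive_count a I j = card {i \<in> I. Suc 0 < order_code (a i j)}"

lemma count_insert:
  assumes "finite I" "i \<notin> I"
  shows "zero_count a (insert i I) j = zero_count a I j + (if order_code (a i j) = Suc 0 then 1 else 0)"
    and "positive_count a (insert i I) j = positive_count a I j + (if Suc 0 < order_code (a i j) then 1 else 0)"
proof -
  have *: "card {x \<in> insert i I. P x} = card {x \<in> I. P x} + (if P i then 1 else 0)" for P
  proof (cases "P i")
    case True
    then have "{x \<in> insert i I. P x} = insert i {x \<in> I. P x}" by auto
    then show ?thesis using True assms by simp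
  next
    case False
    then have "{x \<in> insert i I. P x} = {x \<in> I. P x}" by auto
    then show ?thesis using False by simp
  qed
  show "zero_count a (insert i I) j = zero_count a I j + (if order_code (a i j) = Suc 0 then 1 else 0)"
    unfolding zero_count_def by (rule *)
  show "positive_count a (insert i I) j = positive_count a I j + (if Suc 0 < order_code (a i j) then 1 else 0)"
    unfolding positive_count_def by (rule *)
qed

definition count_cell :: prog where
  "count_cell = Cond (NEq (order_at (at0 aI) (at0 aJ)) (Num 0)) Skip
     (Then (NPut aFLAG (Num 0) (Num 1))
       (Cond (NEq (order_at (at0 aI) (at0 aJ)) (Num 1))
         (NPut aZERO (at0 aJ) (NAdd (NGet aZERO (at0 aJ)) (Num 1)))
         (NPut aPOS (at0 aJ) (NAdd (NGet aPOS (at0 aJ)) (Num 1)))))"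

definition count_row :: prog where
  "count_row = Then (NPut aFLAG (Num 0) (Num 0)) (Then (Foreach aJ aALL count_cell)
     (Cond (NEq (at0 aFLAG) (Num 0)) (NPut aBAD (Num 0) (Num 1)) Skip))"

definition init_prog :: prog where
  "init_prog = Then (Range aALL (at1 aSIZE)) (Then (Range aEQS (at0 aSIZE)) (Then (Foreach aI aEQS count_row)
     (Cond (NLess (at1 aSIZE) (at0 aSIZE)) (NPut aBAD (Num 0) (Num 1)) Skip)))"

definition delete_cell :: prog where
  "delete_cell = Cond (NEq (order_at (at0 aI) (at0 aJ)) (Num 0)) Skip
     (Cond (NEq (order_at (at0 aI) (at0 aJ)) (Num 1))
       (NPut aZERO (at0 aJ) (NSub (NGet aZERO (at0 aJ)) (Num 1)))
       (NPut aPOS (at0 aJ) (NSub (NGet aPOS (at0 aJ)) (Num 1))))"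

text \<open>
  Updating the counters here, entry by entry, costs \<open>O(n)\<close> for each equation ever removed.
\<close>

definition delete_row :: prog where
  "delete_row = Then (NPut aGONE (at0 aI) (Num 1)) (Foreach aJ aALL delete_cell)"

definition delete_prog :: prog where
  "delete_prog = Then (Foreach aI aROWS delete_row)
     (Then (Filter aI aEQS aFREE Skip (NEq (NGet aGONE (at0 aI)) (Num 0))) (copy_list aFREE aEQS))"

definition select_prog :: prog where
  "select_prog = Then (Filter aI aALL aCOLS Skip (BAnd (NEq (NGet aPOS (at0 aI)) (Num 0)) (NLess (Num 0) (NGet aZERO (at0 aI)))))
     (Filter aI aEQS aROWS (Exists aJ aCOLS aFLAG (NEq (order_at (at0 aI) (at0 aJ)) (Num 1))) (NEq (at0 aFLAG) (Num 1)))"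

lemma count_writes [simp]:
  "nwrites count_cell = {aFLAG, aZERO, aPOS}" "kwrites count_cell = {}" "silent count_cell"
  "nwrites count_row = {aFLAG, aZERO, aPOS, aJ, aBAD}" "kwrites count_row = {}" "silent count_row"
  "nwrites init_prog = {aALL, aEQS, aI, aFLAG, aZERO, aPOS, aJ, aBAD}" "kwrites init_prog = {}" "silent init_prog"
  "nwrites delete_cell = {aZERO, aPOS}" "kwrites delete_cell = {}" "silent delete_cell"
  "nwrites delete_row = {aGONE, aJ, aZERO, aPOS}" "kwrites delete_row = {}" "silent delete_row"
  "nwrites delete_prog = {aI, aGONE, aJ, aZERO, aPOS, aFREE, aEQS}" "kwrites delete_prog = {}" "silent delete_prog"
  "nwrites select_prog = {aI, aCOLS, aROWS, aJ, aFLAG}" "kwrites select_prog = {}" "silent select_prog"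
  by (auto simp: count_cell_def count_row_def init_prog_def delete_cell_def delete_row_def delete_prog_def
      select_prog_def)

context algorithm_input begin

definition counted :: "mem \<Rightarrow> nat set \<Rightarrow> bool" where
  "counted m I \<longleftrightarrow> (\<forall>j<n. narr m aZERO j = zero_count a I j \<and> narr m aPOS j = positive_count a I j)"

text \<open>
  The counters while a row is added or removed: the columns \<open>Z\<close> have already been updated.
\<close>

definition counted_partly :: "mem \<Rightarrow> nat set \<Rightarrow> nat set \<Rightarrow> nat set \<Rightarrow> bool" where
  "counted_partly m I I' Z \<longleftrightarrow> (\<forall>j<n.
     narr m aZERO j = zero_count a (if j \<in> Z then I' else I) j \<and>
     narr m aPOS j = positive_count a (if j \<in> Z then I' else I) j)"

lemma counted_partly_empty: "counted_partly m I I' {} \<longleftrightarrow> counted m I"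
  by (simp add: counted_partly_def counted_def)

lemma counted_partly_all: "counted_partly m I I' {0..<n} \<longleftrightarrow> counted m I'"
  by (simp add: counted_partly_def counted_def)

lemma counted_partly_step:
  assumes c: "counted_partly m I I' Z"
    and "\<And>j. \<lbrakk>j < n; j \<noteq> y\<rbrakk> \<Longrightarrow> narr m' aZERO j = narr m aZERO j \<and> narr m' aPOS j = narr m aPOS j"
    and "narr m' aZERO y = zero_count a I' y" "narr m' aPOS y = positive_count a I' y"
  shows "counted_partly m' I I' (insert y Z)"
  unfolding counted_partly_def
proof (intro allI impI, goal_cases)
  case (1 j)
  show ?case
  proof (cases "j = y")
    case True
    then show ?thesis using assms(3,4) by simp
  next
    case False
    then show ?thesis using assms(2)[OF 1 False] c 1 unfolding counted_partly_def by simp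
  qed
qed

lemma counted_partlyD:
  assumes "counted_partly m I I' Z" "y < n" "y \<notin> Z"
  shows "narr m aZERO y = zero_count a I y" "narr m aPOS y = positive_count a I y"
  using assms unfolding counted_partly_def by auto

lemma counted_partly_upd [simp]:
  "\<lbrakk>x \<noteq> aZERO; x \<noteq> aPOS\<rbrakk> \<Longrightarrow> counted_partly (m\<lparr>narr := (narr m)(x := f)\<rparr>) I I' Z = counted_partly m I I' Z"
  "\<lbrakk>x \<noteq> aZERO; x \<noteq> aPOS\<rbrakk> \<Longrightarrow> counted (m\<lparr>narr := (narr m)(x := f)\<rparr>) I = counted m I"
  by (simp_all add: counted_partly_def counted_def)

lemma counted_cong: "\<lbrakk>narr m' aZERO = narr m aZERO; narr m' aPOS = narr m aPOS\<rbrakk> \<Longrightarrow> counted m' I = counted m I"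
  by (simp add: counted_def)

lemma wp_count_cell:
  assumes st: "stored m" and i: "narr m aI 0 = i" "i < s" "i \<notin> I" "finite I"
    and y: "narr m aJ 0 = y" "y < n" "y \<notin> Z" and c: "counted_partly m I (insert i I) Z"
  shows "wp K count_cell m (\<lambda>t m'. t \<le> 60 \<and> counted_partly m' I (insert i I) (insert y Z) \<and>
    narr m' aFLAG 0 = (if a i y \<noteq> -\<infinity> then 1 else narr m aFLAG 0))"
proof -
  note cd = counted_partlyD[OF c y(2,3)] and ci = count_insert[OF i(4,3), of a y]
  have code: "narr m aORDER (i * n + y) = order_code (a i y)" "narr m aSIZE (Suc 0) = n"
    using storedD[OF st] i(2) y(2) by simp_all
  from i(2) y(2) show ?thesis
  proof (cases rule: order_cases)
    case 1
    then have "counted_partly m I (insert i I) (insert y Z)"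
      using c cd ci by (intro counted_partly_step) simp_all
    then show ?thesis using 1 code i(1) y(1) by (simp add: count_cell_def)
  next
    case 2
    have "counted_partly (m\<lparr>narr := (narr m)(aFLAG := (narr m aFLAG)(0 := Suc 0),
        aZERO := (narr m aZERO)(y := Suc (narr m aZERO y)))\<rparr>) I (insert i I) (insert y Z)"
      by (rule counted_partly_step[OF c]) (use 2 cd ci in simp_all)
    then show ?thesis using 2 code i(1) y(1) by (simp add: count_cell_def)
  next
    case (3 k)
    have "counted_partly (m\<lparr>narr := (narr m)(aFLAG := (narr m aFLAG)(0 := Suc 0),
        aPOS := (narr m aPOS)(y := Suc (narr m aPOS y)))\<rparr>) I (insert i I) (insert y Z)"
      by (rule counted_partly_step[OF c]) (use 3 cd ci in simp_all)
    then show ?thesis using 3 code i(1) y(1) by (simp add: count_cell_def)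
  qed
qed

lemma wp_count_row:
  assumes st: "stored m" and i: "narr m aI 0 = i" "i < s" "i \<notin> I" "finite I"
    and all: "lst (narr m aALL) [0..<n]" and c: "counted m I"
  shows "wp K count_row m (\<lambda>t m'. t \<le> 40 + n * 80 \<and> counted m' (insert i I) \<and>
    narr m' aBAD 0 = (if \<forall>j<n. a i j = -\<infinity> then 1 else narr m aBAD 0))"
  unfolding count_row_def wp_Then wp_NPut
proof (rule wp_Foreach[where xs = "[0..<n]" and T = 60 and Inv = "\<lambda>zs m'.
    counted_partly m' I (insert i I) (set zs) \<and> narr m' aFLAG 0 = (if \<exists>j\<in>set zs. a i j \<noteq> -\<infinity> then 1 else 0)"], goal_cases)
  case (7 ys y zs m')
  have y: "y < n" "y \<notin> set ys"
  proof -
    have "y \<in> set [0..<n]" unfolding 7(1) by simp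
    moreover have "distinct (ys @ y # zs)" unfolding 7(1)[symmetric] by simp
    ultimately show "y < n" "y \<notin> set ys" by auto
  qed
  have st': "stored m'" using st 7(4) by (simp add: stored_def unchanged_def)
  have i': "narr m' aI 0 = i" using 7(4) i(1) by (simp add: unchanged_def)
  have "wp K count_cell m' (\<lambda>t m''. t \<le> 60 \<and> counted_partly m'' I (insert i I) (insert y (set ys)) \<and>
    narr m'' aFLAG 0 = (if a i y \<noteq> -\<infinity> then 1 else narr m' aFLAG 0))"
    by (rule wp_count_cell[OF st' i' i(2-4) 7(3) y]) (use 7(2) in simp)
  then show ?case
    by (rule wp_call) (use 7(2) in \<open>auto simp: insert_commute\<close>)
next
  case (8 t m')
  have b: "narr m' aBAD = narr m aBAD" using 8(2) by (simp add: unchanged_def)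
  have c': "counted m' (insert i I)" using 8(1) counted_partly_all[of m' I] by simp
  have f: "narr m' aFLAG 0 = 0 \<longleftrightarrow> (\<forall>j<n. a i j = -\<infinity>)" using 8(1) by auto
  show ?case
    by (cases "\<forall>j<n. a i j = -\<infinity>") (use 8(3) b c' f in \<open>auto simp: algebra_simps\<close>)
qed (use all c in \<open>auto simp: counted_partly_empty\<close>)

lemma wp_init_prog:
  assumes st: "stored m" and z: "\<And>j. narr m aZERO j = 0" "\<And>j. narr m aPOS j = 0" "narr m aBAD 0 = 0"
  shows "wp K init_prog m (\<lambda>t m'. t \<le> 200 + 100 * n + 200 * s + s * (n * 80) \<and> counted m' {..<s} \<and>
    lst (narr m' aALL) [0..<n] \<and> lst (narr m' aEQS) [0..<s] \<and> (narr m' aBAD 0 \<noteq> 0 \<longleftrightarrow> hopeless n a {..<s}))"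
  unfolding init_prog_def wp_Then
proof (rule wp_Range[where k = n], goal_cases)
  case (1 m')
  then show ?case using storedD[OF st] by (simp add: unchanged_def)
next
  case (2 t1 m1)
  note h1 = 2
  have st1: "stored m1" using st h1(2) by (rule stored_unchanged) simp_all
  show ?case
  proof (rule wp_Range[where k = s], goal_cases)
    case (1 m')
    then show ?case using storedD[OF st1] by (simp add: unchanged_def)
  next
    case (2 t2 m2)
    note h2 = 2
    have st2: "stored m2" using st1 h2(2) by (rule stored_unchanged) simp_all
    have all2: "lst (narr m2 aALL) [0..<n]" using h1(1) h2(2) by (simp add: unchanged_def)
    have z2: "narr m2 aZERO j = 0" "narr m2 aPOS j = 0" "narr m2 aBAD 0 = 0" for j
      using z h1(2) h2(2) by (simp_all add: unchanged_def)
    show ?case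
    proof (rule wp_Foreach[where xs = "[0..<s]" and T = "40 + n * 80" and Inv = "\<lambda>ys m'. counted m' (set ys) \<and>
        narr m' aBAD 0 = (if \<exists>i\<in>set ys. \<forall>j<n. a i j = -\<infinity> then 1 else 0)"], goal_cases)
      case 5
      show ?case using z2 by (simp add: counted_def zero_count_def positive_count_def)
    next
      case (7 ys y zs m')
      have y: "y < s" "y \<notin> set ys"
      proof -
        have "y \<in> set [0..<s]" unfolding 7(1) by simp
    moreover have "distinct (ys @ y # zs)" unfolding 7(1)[symmetric] by simp
    ultimately show "y < s" "y \<notin> set ys" by auto
      qed
      have st': "stored m'" using st2 7(4) by (rule stored_unchanged) simp_all
      have all': "lst (narr m' aALL) [0..<n]" using all2 7(4) by (simp add: unchanged_def)
      have "wp K count_row m' (\<lambda>t m''. t \<le> 40 + n * 80 \<and> counted m'' (insert y (set ys)) \<and>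
          narr m'' aBAD 0 = (if \<forall>j<n. a y j = -\<infinity> then 1 else narr m' aBAD 0))"
        by (rule wp_count_row[OF st' 7(3) y finite_set all']) (use 7(2) in simp)
      then show ?case by (rule wp_call) (use 7(2) in auto)
    next
      case (8 t m')
      have u: "stored m'" "lst (narr m' aALL) [0..<n]" "lst (narr m' aEQS) [0..<s]"
        using stored_unchanged[OF st2 8(2)] 8(2) all2 h2(1) by (simp_all add: unchanged_def)
      have c': "counted m' {..<s}" using 8(1) by (simp add: lessThan_atLeast0)
      have b: "narr m' aBAD 0 \<noteq> 0 \<longleftrightarrow> (\<exists>i<s. \<forall>j<n. a i j = -\<infinity>)" using 8(1) by auto
      have tm: "t1 + (t2 + (t + 20)) \<le> 200 + 100 * n + 200 * s + s * (n * 80)"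
        using h1(3) h2(3) 8(3) by (simp add: algebra_simps)
      show ?case
        using u c' b tm storedD[OF u(1)] by (auto simp: hopeless_def)
    qed (use h2(1) in auto)
  qed
qed

lemma wp_delete_cell:
  assumes st: "stored m" and i: "narr m aI 0 = i" "i < s" "i \<in> I" "finite I"
    and y: "narr m aJ 0 = y" "y < n" "y \<notin> Z" and c: "counted_partly m I (I - {i}) Z"
  shows "wp K delete_cell m (\<lambda>t m'. t \<le> 60 \<and> counted_partly m' I (I - {i}) (insert y Z))"
proof -
  have I: "insert i (I - {i}) = I" using i(3) by blast
  have "finite (I - {i})" "i \<notin> I - {i}" using i(4) by simp_all
  note cd = counted_partlyD[OF c y(2,3)] and ci = count_insert[OF this, of a y, unfolded I]
  have code: "narr m aORDER (i * n + y) = order_code (a i y)" "narr m aSIZE (Suc 0) = n"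
    using storedD[OF st] i(2) y(2) by simp_all
  from i(2) y(2) show ?thesis
  proof (cases rule: order_cases)
    case 1
    then have "counted_partly m I (I - {i}) (insert y Z)"
      using c cd ci by (intro counted_partly_step) simp_all
    then show ?thesis using 1 code i(1) y(1) by (simp add: delete_cell_def)
  next
    case 2
    have "counted_partly (m\<lparr>narr := (narr m)(aZERO := (narr m aZERO)(y := narr m aZERO y - Suc 0))\<rparr>)
        I (I - {i}) (insert y Z)"
      by (rule counted_partly_step[OF c]) (use 2 cd ci in simp_all)
    then show ?thesis using 2 code i(1) y(1) by (simp add: delete_cell_def)
  next
    case (3 k)
    have "counted_partly (m\<lparr>narr := (narr m)(aPOS := (narr m aPOS)(y := narr m aPOS y - Suc 0))\<rparr>)
        I (I - {i}) (insert y Z)"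
      by (rule counted_partly_step[OF c]) (use 3 cd ci in simp_all)
    then show ?thesis using 3 code i(1) y(1) by (simp add: delete_cell_def)
  qed
qed

lemma wp_delete_row:
  assumes st: "stored m" and i: "narr m aI 0 = i" "i < s" "i \<in> I" "finite I"
    and all: "lst (narr m aALL) [0..<n]" and c: "counted m I"
  shows "wp K delete_row m (\<lambda>t m'. t \<le> 20 + n * 80 \<and> counted m' (I - {i}) \<and>
    narr m' aGONE = (narr m aGONE)(i := 1))"
  unfolding delete_row_def wp_Then wp_NPut
proof (rule wp_Foreach[where xs = "[0..<n]" and T = 60 and Inv = "\<lambda>zs m'.
    counted_partly m' I (I - {i}) (set zs)"], goal_cases)
  case (7 ys y zs m')
  have y: "y < n" "y \<notin> set ys"
  proof -
    have "y \<in> set [0..<n]" unfolding 7(1) by simp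
    moreover have "distinct (ys @ y # zs)" unfolding 7(1)[symmetric] by simp
    ultimately show "y < n" "y \<notin> set ys" by auto
  qed
  have st': "stored m'" using st 7(4) by (simp add: stored_def unchanged_def)
  have i': "narr m' aI 0 = i" using 7(4) i(1) by (simp add: unchanged_def)
  have "wp K delete_cell m' (\<lambda>t m''. t \<le> 60 \<and> counted_partly m'' I (I - {i}) (insert y (set ys)))"
    by (rule wp_delete_cell[OF st' i' i(2-4) 7(3) y 7(2)])
  then show ?case
    by (rule wp_call) simp
next
  case (8 t m')
  have c': "counted m' (I - {i})" using 8(1) counted_partly_all[of m' I] by simp
  have "narr m' aGONE = (narr m aGONE)(i := 1)" using 8(2) i(1) by (simp add: unchanged_def)
  then show ?case using 8(3) c' by (simp add: algebra_simps)
qed (use all c in \<open>auto simp: counted_partly_empty\<close>)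

lemma wp_delete_prog:
  assumes st: "stored m" and all: "lst (narr m aALL) [0..<n]" and c: "counted m I"
    and rl: "lst (narr m aROWS) rl" "distinct rl" "set rl \<subseteq> I" and I: "I \<subseteq> {..<s}"
    and il: "lst (narr m aEQS) il" "distinct il" "set il = I" and g: "\<And>i. i \<in> I \<Longrightarrow> narr m aGONE i = 0"
  shows "wp K delete_prog m (\<lambda>t m'. t \<le> 50 + length rl * (40 + n * 80) + length il * 100 \<and> counted m' (I - set rl) \<and>
    (\<exists>il'. lst (narr m' aEQS) il' \<and> distinct il' \<and> set il' = I - set rl) \<and> (\<forall>i\<in>I - set rl. narr m' aGONE i = 0))"
  unfolding delete_prog_def wp_Then
proof (rule wp_Foreach[where xs = rl and T = "20 + n * 80" and Inv = "\<lambda>ys m'. counted m' (I - set ys) \<and>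
    (\<forall>i\<in>I. narr m' aGONE i = (if i \<in> set ys then 1 else 0))"], goal_cases)
  case (7 ys y zs m')
  have y: "y \<in> set rl" "y \<notin> set ys" using 7(1) rl(2) by auto
  have yI: "y \<in> I - set ys" "y < s" using y rl(3) I by auto
  have finI: "finite (I - set ys)" using finite_subset[OF I] by simp
  have st': "stored m'" using st 7(4) by (rule stored_unchanged) simp_all
  have all': "lst (narr m' aALL) [0..<n]" using all 7(4) by (simp add: unchanged_def)
  have e: "I - set (ys @ [y]) = I - set ys - {y}" by auto
  have "wp K delete_row m' (\<lambda>t m''. t \<le> 20 + n * 80 \<and> counted m'' (I - set ys - {y}) \<and>
      narr m'' aGONE = (narr m' aGONE)(y := 1))"
    by (rule wp_delete_row[OF st' 7(3) yI(2,1) finI all']) (use 7(2) in simp)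
  then show ?case unfolding e by (rule wp_call) (use 7(2) in auto)
next
  case (8 t1 m1)
  note h1 = 8
  have il1: "lst (narr m1 aEQS) il" using h1(2) il(1) by (simp add: unchanged_def)
  show ?case
  proof (rule wp_Filter[where xs = il and T = 1 and P = "\<lambda>i. i \<notin> set rl"], goal_cases)
    case (10 z m')
    then have "narr m' aGONE = narr m1 aGONE" by (simp add: unchanged_def)
    then show ?case using 10 h1(1) il(3) by simp
  next
    case (11 t2 m2)
    note h2 = 11
    show ?case
    proof (rule wp_copy_list[OF h2(1)], goal_cases)
      case (4 t3 m3)
      have "narr m3 aGONE = narr m1 aGONE" "narr m3 aZERO = narr m1 aZERO" "narr m3 aPOS = narr m1 aPOS"
        using 4(2) h2(2) by (simp_all add: unchanged_def)
      then have "counted m3 (I - set rl)" "\<forall>i\<in>I - set rl. narr m3 aGONE i = 0"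
        using h1(1) counted_cong[of m3 m1] by simp_all
      moreover define L where "L = length (filter (\<lambda>i. i \<notin> set rl) il)"
      have "L \<le> length il" unfolding L_def by (rule length_filter_le)
      then have "t1 + (t2 + t3) \<le> 50 + length rl * (40 + n * 80) + length il * 100"
        using h1(3) h2(3) 4(3) unfolding L_def[symmetric] by (simp add: algebra_simps)
      moreover have "distinct (filter (\<lambda>i. i \<notin> set rl) il)" "set (filter (\<lambda>i. i \<notin> set rl) il) = I - set rl"
        using il(2,3) by auto
      ultimately show ?case using 4(1) by blast
    qed simp_all
  qed (use il1 in auto)
qed (use rl c g in auto)

text \<open>
  The membership of a column in \<open>B\<close> is decided by its two counters in constant time.
\<close>

lemma B_columns_counts:
  assumes "I \<subseteq> {..<s}" "j < n"
  shows "j \<in> B_columns n a I \<longleftrightarrow> positive_count a I j = 0 \<and> 0 < zero_count a I j"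
proof -
  have fin: "finite I" using assms(1) by (rule finite_subset) simp
  have p: "positive_count a I j = 0 \<longleftrightarrow> (\<forall>i\<in>I. order_code (a i j) \<le> Suc 0)"
    unfolding positive_count_def using fin by (auto simp: not_less)
  have z: "0 < zero_count a I j \<longleftrightarrow> (\<exists>i\<in>I. order_code (a i j) = Suc 0)"
    unfolding zero_count_def using fin by (auto simp: card_gt_0_iff)
  have c: "(order_code (a i j) \<le> Suc 0) = (a i j = -\<infinity> \<or> a i j = 0)"
    "(order_code (a i j) = Suc 0) = (a i j = 0)" if "i \<in> I" for i
  proof -
    have "i < s" using that assms(1) by auto
    then show "(order_code (a i j) \<le> Suc 0) = (a i j = -\<infinity> \<or> a i j = 0)" "(order_code (a i j) = Suc 0) = (a i j = 0)"
      using code_one_iff[of i j] code_zero_iff[of i j] assms(2) by (auto simp: le_Suc_eq)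
  qed
  have "\<exists>i\<in>I. a i j \<noteq> -\<infinity>" if "i \<in> I" "a i j = 0" for i using that by force
  then show ?thesis unfolding p z B_columns_def using c assms(2) by auto
qed

lemma wp_select_prog:
  assumes st: "stored m" and all: "lst (narr m aALL) [0..<n]" and c: "counted m I" and I: "I \<subseteq> {..<s}"
    and il: "lst (narr m aEQS) il" "distinct il" "set il = I"
  shows "wp K select_prog m (\<lambda>t m'. \<exists>cl rl. lst (narr m' aCOLS) cl \<and> distinct cl \<and> set cl = B_columns n a I \<and>
    lst (narr m' aROWS) rl \<and> distinct rl \<and> set rl = {i \<in> I. \<exists>j\<in>B_columns n a I. a i j = 0} \<and>
    t \<le> 50 + n * 80 + length il * (120 + length cl * 50))"
  unfolding select_prog_def wp_Then
proof (rule wp_Filter[where xs = "[0..<n]" and T = 1 and P = "\<lambda>j. j \<in> B_columns n a I"], goal_cases)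
  case (10 j m')
  then have u: "narr m' aPOS = narr m aPOS" "narr m' aZERO = narr m aZERO" by (simp_all add: unchanged_def)
  have j: "j < n" using 10(1) by simp
  show ?case using u 10(3) c j B_columns_counts[OF I j] by (simp add: counted_def)
next
  case (11 t1 m1)
  note h1 = 11
  let ?cl = "filter (\<lambda>j. j \<in> B_columns n a I) [0..<n]"
  have scl: "set ?cl = B_columns n a I" by (auto simp: B_columns_def)
  have st1: "stored m1" using st h1(2) by (rule stored_unchanged) simp_all
  have il1: "lst (narr m1 aEQS) il" using h1(2) il(1) by (simp add: unchanged_def)
  show ?case
  proof (rule wp_Filter[where xs = il and T = "13 + length ?cl * 40" and
        P = "\<lambda>i. \<exists>j\<in>set ?cl. a i j = 0"], goal_cases)
    case (10 i m')
    note h = 10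
    have i: "i < s" using h(1) il(3) I by auto
    have st': "stored m'" using st1 h(2) by (rule stored_unchanged) simp_all
    have cl': "lst (narr m' aCOLS) ?cl" using h1(1) h(2) by (simp add: unchanged_def)
    show ?case
    proof (rule wp_Exists[OF cl', where P = "\<lambda>j. a i j = 0"], goal_cases)
      case (4 j m'')
      have j: "j < n" using 4(1) by auto
      have "narr m'' aI 0 = i" using 4(2) h(3) by (simp add: unchanged_def)
      moreover have "stored m''" using st' 4(2) by (rule stored_unchanged) simp_all
      ultimately show ?case using 4(3) storedD[of m''] code_one_iff[OF i j] i j by simp
    next
      case (5 t m'')
      then show ?case by auto
    qed simp_all
  next
    case (11 t2 m2)
    have "lst (narr m2 aCOLS) ?cl" using h1(1) 11(2) by (simp add: unchanged_def)
    moreover have "distinct ?cl" "distinct (filter (\<lambda>i. \<exists>j\<in>set ?cl. a i j = 0) il)" using il(2) by simp_all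
    moreover have "set (filter (\<lambda>i. \<exists>j\<in>set ?cl. a i j = 0) il) = {i \<in> I. \<exists>j\<in>B_columns n a I. a i j = 0}"
      unfolding scl using il(3) by auto
    moreover have "t1 + t2 \<le> 50 + n * 80 + length il * (120 + length ?cl * 50)"
      using h1(3) 11(3) by (simp add: algebra_simps)
    ultimately show ?case using 11(1) scl by blast
  qed (use il1 in auto)
qed (use all in auto)

end

subsection \<open>The successive calls\<close>

definition head_prog :: prog where
  "head_prog = Then select_prog (Then (Output (Num 2)) (Then (Print aI aEQS) (Then (Print aI aCOLS)
     (Then (NPut aMORE (Num 0) (Num 1)) (Then (NPut aPREV (Num 0) (at0 aEQS)) seq_loop)))))"

definition accept_prog :: prog where
  "accept_prog = Then (Output (Num 4)) (Then (Print aI aY1) (Then (Foreach aI aY1 (Push aY (at0 aI))) delete_prog))"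

definition finish_prog :: prog where
  "finish_prog = Cond (BAnd (NLess (Num 0) (at0 aROWS)) (NLess (Num 0) (at0 aCOLS))) accept_prog
     (Then (Output (Num 4)) (Then (Output (Num 0)) (NPut aSTATE (Num 0) (Num 0))))"

definition empty_prog :: prog where
  "empty_prog = Then (Output (Num 2)) (Then (Output (Num 0)) (Then (Output (Num 0)) (Then (Output (Num 4))
     (Then (Output (Num 0)) (NPut aSTATE (Num 0) (Num 2))))))"

text \<open>
  A call with equations is never hopeless here, see \<open>ready\<close>; the call of the empty system is a success.
\<close>

definition call_step :: prog where
  "call_step = Cond (NEq (at0 aEQS) (Num 0)) empty_prog (Then head_prog finish_prog)"

definition call_loop :: prog where
  "call_loop = Loop (NEq (at0 aSTATE) (Num 1)) call_step"

definition hopeless_prog :: prog where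
  "hopeless_prog = Then (Output (Num 2)) (Then (Print aI aEQS) (Then (Output (Num 0)) (Then (Output (Num 4))
     (Then (Output (Num 0)) (Output (Num 0))))))"

definition result_prog :: prog where
  "result_prog = Cond (NEq (at0 aSTATE) (Num 0)) (Output (Num 0)) (Then (Output (Num 1)) (Print aI aY))"

definition obar_prog :: prog where
  "obar_prog = Then init_prog (Cond (NLess (Num 0) (at0 aBAD)) hopeless_prog
     (Then (NPut aSTATE (Num 0) (Num 1)) (Then call_loop result_prog)))"

lemma call_writes [simp]:
  "nwrites head_prog = {aI, aCOLS, aROWS, aJ, aFLAG, aMORE, aPREV, aCUR, aMARK, aLOST, aFREE, aBEST, aOWN, aPRICE,
     aCROWS, aCCOLS, aWORK, aK, aPIVOT, aNOPIV, aREL, aRROWS, aRCOLS, aY1}"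
  "kwrites head_prog = {kFAC, kMAT}" "\<not> silent head_prog"
  by (auto simp: head_prog_def)

lemma cat_snoc:
  assumes "u \<in> cat Ls" "[k] \<in> L" "v \<in> L'"
  shows "u @ k # v \<in> cat (Ls @ [L, L'])"
proof -
  have "[k] @ (v @ []) \<in> cat [L, L']" by (intro cat_Cons cat_Nil) (use assms in simp_all)
  then show ?thesis using cat_append[OF assms(1)] by fastforce
qed

context algorithm_input begin

text \<open>
  The state before a call for the equations \<open>I\<close>, with the columns \<open>ys\<close> chosen so far. These columns are
  \<open>-\<infinity>\<close> on \<open>I\<close>, hence distinct from the columns chosen later, which contain a zero. Hopelessness is tested
  for the first call only, since it passes from a nonempty system to every larger one.
\<close>

definition ready :: "nat set \<Rightarrow> nat list \<Rightarrow> mem \<Rightarrow> bool" where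
  "ready I ys m \<longleftrightarrow> stored m \<and> lst (narr m aALL) [0..<n] \<and> counted m I \<and> I \<subseteq> {..<s} \<and>
     (\<exists>il. lst (narr m aEQS) il \<and> distinct il \<and> set il = I) \<and> (\<forall>i\<in>I. narr m aGONE i = 0) \<and>
     narr m aSTATE 0 = 1 \<and> lst (narr m aY) ys \<and> distinct ys \<and> (\<forall>i\<in>I. \<forall>j\<in>set ys. a i j = -\<infinity>) \<and>
     (I \<noteq> {} \<longrightarrow> \<not> hopeless n a I)"

lemma ready_unchanged:
  assumes r: "ready I ys m" and u: "unchanged V W q m m'"
    and V: "V \<inter> {aSIZE, aORDER, aALL, aZERO, aPOS, aEQS, aGONE, aSTATE, aY} = {}" and W: "kJAC \<notin> W"
  shows "ready I ys m'"
proof -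
  have e: "narr m' x = narr m x" if "x \<in> {aSIZE, aORDER, aALL, aZERO, aPOS, aEQS, aGONE, aSTATE, aY}" for x
    using unchangedD(1)[OF u, of x] V that by blast
  have "stored m" using r by (simp add: ready_def)
  then have "stored m'" using u by (rule stored_unchanged) (use V W in auto)
  moreover have "counted m' I \<longleftrightarrow> counted m I" by (rule counted_cong) (simp_all add: e)
  ultimately show ?thesis using r unfolding ready_def by (simp add: e)
qed

text \<open>
  The cost of a call in terms of its record. The term with \<open>chosen\<close> pays for the removal of equations, as
  the block has as many rows as columns.
\<close>

definition call_time :: "call \<Rightarrow> nat" where
  "call_time c = 1000 * (1 + n + card (equations c) * (1 + card (columns c)) + card (chosen c) * (n + 1)) +
     length (passes c) * (pass_time (card (nontrivial_rows a c)) (card (columns c)) + 200 +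
       40 * card (equations c) + 40 * card (columns c))"

definition head_time :: "nat set \<Rightarrow> pass list \<Rightarrow> nat" where
  "head_time I ps = 200 + n * 80 + card I * (200 + card (B_columns n a I) * 50) + card (B_columns n a I) * 50 +
     length ps * (pass_time (card (nontrivial_rows a (Call I (B_columns n a I) ps {}))) (card (B_columns n a I)) + 200 +
       40 * card I + 40 * card (B_columns n a I))"

definition head_result :: "nat set \<Rightarrow> pass list \<Rightarrow> nat list \<Rightarrow> nat list \<Rightarrow> nat list \<Rightarrow> mem \<Rightarrow> mem \<Rightarrow> bool" where
  "head_result I ps rl cl zs m m' \<longleftrightarrow> Seq_run a J I (B_columns n a I) ps (set rl) (set cl) \<and>
     lst (narr m' aROWS) rl \<and> lst (narr m' aCOLS) cl \<and> lst (narr m' aY1) zs \<and>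
     distinct rl \<and> distinct cl \<and> distinct zs \<and> set zs \<subseteq> set cl \<and>
     length zs = length rl \<and> minor J (set rl) (set zs) \<noteq> 0 \<and>
     (\<exists>w. tape m' = tape m @ w \<and>
       w \<in> cat ([{[2]}, set_codes I, set_codes (B_columns n a I)] @ map pass_codes ps))"

lemma wp_head_prog:
  assumes r: "ready I ys m"
  shows "wp K head_prog m (\<lambda>t m'. \<exists>ps rl cl zs. head_result I ps rl cl zs m m' \<and> t \<le> head_time I ps)"
proof -
  let ?B = "B_columns n a I"
  have st: "stored m" and all: "lst (narr m aALL) [0..<n]" and c: "counted m I" and I: "I \<subseteq> {..<s}"
    using r by (simp_all add: ready_def)
  obtain il where il: "lst (narr m aEQS) il" "distinct il" "set il = I" using r by (auto simp: ready_def)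
  have lil: "length il = card I" using distinct_card[OF il(2)] il(3) by simp
  show ?thesis
    unfolding head_prog_def wp_Then
  proof (rule wp_call[OF wp_select_prog[OF st all c I il]], goal_cases)
    case (1 t1 m1)
    obtain cl rl where s1: "lst (narr m1 aCOLS) cl" "distinct cl" "set cl = ?B" "lst (narr m1 aROWS) rl" "distinct rl"
      "set rl = {i \<in> I. \<exists>j\<in>?B. a i j = 0}" "t1 \<le> 50 + n * 80 + length il * (120 + length cl * 50)"
      using 1(1) by blast
    note u1 = 1(2)
    have tp1: "tape m1 = tape m" using u1 by (simp add: unchanged_def)
    have e1: "lst (narr m1 aEQS) il" using u1 il(1) by (simp add: unchanged_def)
    have st1: "stored m1" using st u1 by (rule stored_unchanged) simp_all
    have lcl: "length cl = card ?B" using distinct_card[OF s1(2)] s1(3) by simp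
    define d where "d = card (nontrivial_rows a (Call I ?B [] {}))"
    have d: "card (nontrivial_rows a (Call I ?B ps {})) = d" for ps by (simp add: d_def nontrivial_rows_def)
    have lrl: "length rl = d" using distinct_card[OF s1(5)] s1(6) by (simp add: d_def nontrivial_rows_def)
    show ?case
      unfolding wp_Output
    proof (rule wp_Print[where xs = il], goal_cases)
      case (3 t3 m3)
      note h3 = 3
      have c3: "lst (narr m3 aCOLS) cl" "lst (narr m3 aROWS) rl" "lst (narr m3 aEQS) il"
        using h3(3) s1(1,4) e1 by (simp_all add: unchanged_def)
      have st3: "stored m3" using st1 h3(3) by (simp add: stored_def unchanged_def)
      show ?case
      proof (rule wp_Print[OF c3(1)], goal_cases)
        case (2 t4 m4)
        note h4 = 2
        have c4: "lst (narr m4 aCOLS) cl" "lst (narr m4 aROWS) rl" "lst (narr m4 aEQS) il"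
          using h4(3) c3 by (simp_all add: unchanged_def)
        have st4: "stored m4" using st3 h4(3) by (rule stored_unchanged) simp_all
        define m5 where "m5 = m4\<lparr>narr := (narr m4)(aMORE := (narr m4 aMORE)(0 := 1),
           aPREV := (narr m4 aPREV)(0 := card I))\<rparr>"
        have st5: "stored m5" using st4 by (simp add: m5_def stored_def)
        have q: "wp K seq_loop m5 (\<lambda>t m'. \<exists>ps rl' cl' ys. seq_result I (set cl) ps rl' cl' ys m5 m' \<and>
            t \<le> 10 + length ps * (pass_time d (card ?B) + 200 + 40 * card I + 40 * card ?B))"
        proof (rule wp_seq_loop[OF st5, where rl = rl])
          show "set cl \<subseteq> {..<n}" using s1(3) by (auto simp: B_columns_def)
          show "\<And>i j. \<lbrakk>i \<in> I - set rl; j \<in> set cl\<rbrakk> \<Longrightarrow> a i j \<noteq> 0" using s1(3,6) by blast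
          show "set rl \<subseteq> I" using s1(6) by blast
        qed (use c4 s1(2,5) I lcl lrl in \<open>simp_all add: m5_def\<close>)
        have fin: "\<exists>ps rl cl zs. head_result I ps rl cl zs m m' \<and>
            t1 + (1 + ncost (Num 2) + (t3 + (t4 + (1 + ncost (Num 0) + ncost (Num 1) + (1 + ncost (Num 0) + ncost (at0 aEQS) + t))))) \<le> head_time I ps"
          if qr: "seq_result I (set cl) ps rl' cl' ys m5 m'"
            "t \<le> 10 + length ps * (pass_time d (card ?B) + 200 + 40 * card I + 40 * card ?B)" for ps rl' cl' ys t m'
        proof -
          obtain w where w: "tape m' = tape m5 @ w" "w \<in> cat (map pass_codes ps)"
            using qr(1) unfolding seq_result_def by blast
          have "[2] @ (length il # il) @ (length cl # cl) @ [] \<in> cat [{[2]}, set_codes I, set_codes ?B]"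
            by (intro cat_Cons cat_Nil set_codes_list) (use il s1 in simp_all)
          then have "([2] @ (length il # il) @ (length cl # cl) @ []) @ w
              \<in> cat ([{[2]}, set_codes I, set_codes ?B] @ map pass_codes ps)"
            using w(2) by (rule cat_append)
          moreover have "tape m' = tape m @ ([2] @ (length il # il) @ (length cl # cl) @ []) @ w"
            using w(1) h4(1) h3(1) tp1 by (simp add: m5_def)
          ultimately have "\<exists>w. tape m' = tape m @ w \<and>
             w \<in> cat ([{[2]}, set_codes I, set_codes ?B] @ map pass_codes ps)" by blast
          then have "head_result I ps rl' cl' ys m m'"
            using qr(1) unfolding seq_result_def head_result_def s1(3) by blast
          moreover have "t1 + (1 + ncost (Num 2) + (t3 + (t4 + (1 + ncost (Num 0) + ncost (Num 1) + (1 + ncost (Num 0) + ncost (at0 aEQS) + t))))) \<le>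
              head_time I ps"
            using s1(7) h3(2) h4(2) qr(2) unfolding head_time_def d lil lcl by (simp add: algebra_simps)
          ultimately show ?thesis by blast
        qed
        have "narr m4 aEQS 0 = card I" using c4(3) lil by (simp add: lst_0)
        moreover have "wp K seq_loop m5 (\<lambda>t m'. \<exists>ps rl cl zs. head_result I ps rl cl zs m m' \<and>
            t1 + (1 + ncost (Num 2) + (t3 + (t4 + (1 + ncost (Num 0) + ncost (Num 1) + (1 + ncost (Num 0) + ncost (at0 aEQS) + t))))) \<le> head_time I ps)"
          by (rule wp_call[OF q], elim exE conjE) (rule fin)
        ultimately show ?case unfolding m5_def by simp
      qed simp_all
    qed (use e1 in simp_all)
  qed
qed

definition call_result :: "nat set \<Rightarrow> nat list \<Rightarrow> nat set \<Rightarrow> nat set \<Rightarrow> nat set \<Rightarrow> mem \<Rightarrow> bool" where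
  "call_result I ys R C Y1 m \<longleftrightarrow>
     (if R = {} \<or> C = {} then Y1 = {} \<and> narr m aSTATE 0 = 0
      else Y1 \<subseteq> C \<and> card Y1 = card R \<and> minor J R Y1 \<noteq> 0 \<and>
        (\<exists>ys'. set ys' = set ys \<union> Y1 \<and> ready (I - R) ys' m))"

text \<open>
  The block has been printed and is removed from the equations. Its columns only contain \<open>-\<infinity>\<close> in the
  rows left.
\<close>

lemma wp_accept_prog:
  assumes r: "ready I ys m" and run: "Seq_run a J I (B_columns n a I) ps (set rl) (set cl)"
    and rl: "lst (narr m aROWS) rl" "distinct rl" and zs: "lst (narr m aY1) zs" "distinct zs" "set zs \<subseteq> set cl"
    and ne: "set rl \<noteq> {}"
  shows "wp K accept_prog m (\<lambda>t m'. t \<le> 200 + length zs * 60 + length rl * (40 + n * 80) + card I * 100 \<and>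
    tape m' = tape m @ 4 # length zs # zs \<and> ready (I - set rl) (ys @ zs) m')"
proof -
  have I: "I \<subseteq> {..<s}" using r by (simp add: ready_def)
  have finI: "finite I" using I by (rule finite_subset) simp
  note sr = Seq_run_result[OF run finI finite_B_columns]
  have ys: "lst (narr m aY) ys" "distinct ys" using r by (simp_all add: ready_def)
  have g: "\<And>i. i \<in> I \<Longrightarrow> narr m aGONE i = 0" using r by (simp add: ready_def)
  obtain il where il: "lst (narr m aEQS) il" "distinct il" "set il = I" using r by (auto simp: ready_def)
  have lil: "length il = card I" using distinct_card[OF il(2)] il(3) by simp
  have zB: "set zs \<subseteq> B_columns n a I" using zs(3) sr(2) by blast
  have neg: "a i j = -\<infinity>" if "i \<in> I - set rl" "j \<in> set zs" for i j
  proof -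
    have "a i j \<noteq> 0" using sr(3)[OF that(1)] that(2) zs(3) by blast
    moreover have "j \<in> B_columns n a I" using zB that(2) by blast
    ultimately show ?thesis using B_columnsD(2)[of j n a I i] that(1) by blast
  qed
  have disj: "set ys \<inter> set zs = {}"
  proof -
    have "\<exists>i\<in>I. a i j \<noteq> -\<infinity>" if "j \<in> set zs" for j using zB that by (auto simp: B_columns_def)
    moreover have "\<forall>i\<in>I. \<forall>j\<in>set ys. a i j = -\<infinity>" using r by (simp add: ready_def)
    ultimately show ?thesis by blast
  qed
  have hl: "\<not> hopeless n a (I - set rl)"
  proof -
    have "I \<noteq> {}" using ne sr(1) by auto
    then have "\<not> hopeless n a I" using r by (simp add: ready_def)
    moreover have "card (I - set rl) \<le> card I" using finI by (intro card_mono) auto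
    ultimately show ?thesis unfolding hopeless_def by auto
  qed
  show ?thesis
    unfolding accept_prog_def wp_Then wp_Output
  proof (rule wp_Print[where xs = zs], goal_cases)
    case (3 t1 m1)
    note h1 = 3
    have l1: "lst (narr m1 aY1) zs" "lst (narr m1 aY) ys" using h1(3) zs(1) ys(1) by (simp_all add: unchanged_def)
    show ?case
    proof (rule wp_Foreach[where xs = zs and T = 13 and Inv = "\<lambda>us m'. lst (narr m' aY) (ys @ us)"], goal_cases)
      case (7 us y vs m')
      then show ?case by (auto intro!: wp_Push[where xs = "ys @ us"])
    next
      case (8 t2 m2)
      note h2 = 8
      have u: "unchanged {aI, aY} {} False m m2"
        using h1(3) h2(2) by (auto simp: unchanged_def)
      have l2: "lst (narr m2 aALL) [0..<n]" "lst (narr m2 aROWS) rl" "lst (narr m2 aEQS) il"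
        "\<And>i. i \<in> I \<Longrightarrow> narr m2 aGONE i = 0" "narr m2 aSTATE 0 = 1"
        using u r rl(1) il(1) by (simp_all add: unchanged_def ready_def)
      have st2: "stored m2" using r u by (simp add: stored_def ready_def unchanged_def)
      have c2: "counted m2 I \<longleftrightarrow> counted m I" by (rule counted_cong) (use u in \<open>simp_all add: unchanged_def\<close>)
      have c2': "counted m2 I" unfolding c2 using r by (simp add: ready_def)
      show ?case
      proof (rule wp_call[OF wp_delete_prog[OF st2 l2(1) c2' l2(2) rl(2) sr(1) I l2(3) il(2,3) l2(4)]], goal_cases)
        case (1 i)
        then show ?case .
      next
        case (2 t3 m3)
        note h3 = 2
        have "stored m3" using st2 h3(2) by (rule stored_unchanged) simp_all
        moreover have "lst (narr m3 aALL) [0..<n]" "narr m3 aSTATE 0 = 1" "lst (narr m3 aY) (ys @ zs)"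
          using h3(2) l2(1,5) h2(1) by (simp_all add: unchanged_def)
        moreover have "distinct (ys @ zs)" using ys(2) zs(2) disj by simp
        moreover have "\<forall>i\<in>I - set rl. \<forall>j\<in>set (ys @ zs). a i j = -\<infinity>"
          using neg r by (auto simp: ready_def)
        moreover have "I - set rl \<subseteq> {..<s}" using I by blast
        ultimately have "ready (I - set rl) (ys @ zs) m3"
          unfolding ready_def using h3(1) hl by blast
        moreover have "tape m3 = tape m @ 4 # length zs # zs"
          using h3(2) h2(2) h1(1) by (simp add: unchanged_def)
        moreover have "1 + ncost (Num 4) + (t1 + (t2 + t3)) \<le> 200 + length zs * 60 + length rl * (40 + n * 80) + card I * 100"
          using h1(2) h2(3) h3(1)[THEN conjunct1] lil by simp
        ultimately show ?case by blast
      qed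
    qed (use l1 in auto)
  qed (use zs(1) in simp_all)
qed

lemma wp_call_body:
  assumes r: "ready I ys m"
  shows "wp K (Then head_prog finish_prog) m (\<lambda>t m'. \<exists>ps R C Y1 w. Seq_run a J I (B_columns n a I) ps R C \<and>
     tape m' = tape m @ w \<and> w \<in> call_codes (Call I (B_columns n a I) ps Y1) \<and>
     t + 50 \<le> call_time (Call I (B_columns n a I) ps Y1) \<and> call_result I ys R C Y1 m')"
  (is "wp K _ m ?Q")
  unfolding wp_Then
proof (rule wp_call[OF wp_head_prog[OF r]], goal_cases)
  case (1 t1 m1)
  let ?B = "B_columns n a I"
  obtain ps rl cl zs where h: "head_result I ps rl cl zs m m1" "t1 \<le> head_time I ps" using 1(1) by blast
  have run: "Seq_run a J I ?B ps (set rl) (set cl)"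
    and l: "lst (narr m1 aROWS) rl" "lst (narr m1 aCOLS) cl" "lst (narr m1 aY1) zs"
    and di: "distinct rl" "distinct cl" "distinct zs"
    and zs: "set zs \<subseteq> set cl" "length zs = length rl" "minor J (set rl) (set zs) \<noteq> 0"
    using h(1) unfolding head_result_def by blast+
  obtain w where w: "tape m1 = tape m @ w" "w \<in> cat ([{[2]}, set_codes I, set_codes ?B] @ map pass_codes ps)"
    using h(1) unfolding head_result_def by blast
  have r1: "ready I ys m1" using r 1(2) by (rule ready_unchanged) simp_all
  have codes: "w @ 4 # v \<in> call_codes (Call I ?B ps Y1)" if "v \<in> set_codes Y1" for v Y1
  proof -
    have "w @ 4 # v \<in> cat (([{[2]}, set_codes I, set_codes ?B] @ map pass_codes ps) @ [{[4]}, set_codes Y1])"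
      by (rule cat_snoc[OF w(2) _ that]) simp
    then show ?thesis unfolding call_codes_def call.sel append_assoc .
  qed
  have time: "t1 + x + 100 \<le> call_time (Call I ?B ps Y1)"
    if "x \<le> 300 + card Y1 * 100 + card Y1 * (n * 80) + card I * 100" for x Y1
  proof -
    have d: "nontrivial_rows a (Call I ?B ps Y1) = nontrivial_rows a (Call I ?B ps {})"
      by (simp add: nontrivial_rows_def)
    have "card ?B \<le> n" using card_mono[of "{..<n}" ?B] by (auto simp: B_columns_def)
    then show ?thesis
      using h(2) that unfolding head_time_def call_time_def d call.sel by (simp add: algebra_simps)
  qed
  have cases: "0 < narr m1 aROWS 0 \<and> 0 < narr m1 aCOLS 0 \<longleftrightarrow> \<not> (set rl = {} \<or> set cl = {})"
    using l(1,2) by (simp add: lst_0)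
  show ?case
  proof (cases "set rl = {} \<or> set cl = {}")
    case True
    let ?m2 = "m1\<lparr>tape := tape m1 @ [4] @ [0], narr := (narr m1)(aSTATE := (narr m1 aSTATE)(0 := 0))\<rparr>"
    have cr: "call_result I ys (set rl) (set cl) {} ?m2" using True unfolding call_result_def by simp
    have Q: "?Q (t1 + x) ?m2" if "x \<le> 40" for x
      using run codes[OF set_codes_empty] time[of x "{}"] that w(1) cr
      by (intro exI[of _ ps] exI[of _ "set rl"] exI[of _ "set cl"] exI[of _ "{}"] exI[of _ "w @ 4 # [0]"]) simp
    let ?b = "BAnd (NLess (Num 0) (at0 aROWS)) (NLess (Num 0) (at0 aCOLS))"
    have nb: "\<not> bval ?b m1" using cases True by simp
    have "wp K (Then (Output (Num 4)) (Then (Output (Num 0)) (NPut aSTATE (Num 0) (Num 0)))) m1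
      (\<lambda>t m'. 1 + bcost ?b + t \<le> 40 \<and> m' = ?m2)" by simp
    then have fp: "wp K finish_prog m1 (\<lambda>t m'. t \<le> 40 \<and> m' = ?m2)"
      unfolding finish_prog_def wp_Cond using nb by (simp only: if_False)
    show ?thesis
    proof (rule wp_call[OF fp], elim conjE, goal_cases)
      case (1 t2 m2)
      show ?case unfolding 1(3) by (rule Q[OF 1(2)])
    qed
  next
    case False
    have ne: "set rl \<noteq> {}" using False by simp
    have p: "wp K accept_prog m1 (\<lambda>t m'. t \<le> 200 + length zs * 60 + length rl * (40 + n * 80) + card I * 100 \<and>
      tape m' = tape m1 @ 4 # length zs # zs \<and> ready (I - set rl) (ys @ zs) m')"
      by (rule wp_accept_prog[OF r1 run l(1) di(1) l(3) di(3) zs(1) ne])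
    have lz: "card (set zs) = length rl" "card (set rl) = length rl"
      using distinct_card[OF di(3)] distinct_card[OF di(1)] zs(2) by simp_all
    have fin: "?Q u m2"
      if u: "u \<le> t1 + (20 + t2)" and t2: "t2 \<le> 200 + length zs * 60 + length rl * (40 + n * 80) + card I * 100" "tape m2 = tape m1 @ 4 # length zs # zs"
        "ready (I - set rl) (ys @ zs) m2" for u t2 m2
    proof -
      have "call_result I ys (set rl) (set cl) (set zs) m2"
        using False zs lz t2(3) unfolding call_result_def by (auto intro!: exI[of _ "ys @ zs"])
      moreover have "u + 50 \<le> call_time (Call I ?B ps (set zs))"
        using u time[of "20 + t2" "set zs"] t2(1) zs(2) lz by (simp add: algebra_simps)
      moreover have "tape m2 = tape m @ (w @ 4 # length zs # zs)" using w(1) t2(2) by simp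
      moreover have "w @ 4 # length zs # zs \<in> call_codes (Call I ?B ps (set zs))"
        by (rule codes) (rule set_codes_list[OF di(3) refl])
      ultimately show ?thesis using run by blast
    qed
    have b: "bval (BAnd (NLess (Num 0) (at0 aROWS)) (NLess (Num 0) (at0 aCOLS))) m1" using cases False by simp
    have "wp K accept_prog m1 (\<lambda>t m'. ?Q (t1 + (1 + bcost (BAnd (NLess (Num 0) (at0 aROWS)) (NLess (Num 0) (at0 aCOLS))) + t)) m')"
    proof (rule wp_call[OF p], elim conjE, goal_cases)
      case (1 t m')
      show ?case by (rule fin[OF _ 1(2-4)]) simp
    qed
    then show ?thesis unfolding finish_prog_def wp_Cond using b by (simp only: if_True)
  qed
qed

text \<open>
  The recursion of the algorithm is a tail recursion up to the union with \<open>Y1\<close>, which is accumulated.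
\<close>

lemma wp_call_loop:
  assumes "ready I ys m"
  shows "wp K call_loop m (\<lambda>t m'. \<exists>cs res w. Obar_reg n a J I cs res \<and> tape m' = tape m @ w \<and>
    w \<in> cat (map call_codes cs) \<and> t \<le> 10 + (\<Sum>c\<leftarrow>cs. call_time c) \<and>
    (case res of None \<Rightarrow> narr m' aSTATE 0 = 0
     | Some Y2 \<Rightarrow> narr m' aSTATE 0 = 2 \<and> (\<exists>zs. lst (narr m' aY) zs \<and> distinct zs \<and> set zs = set ys \<union> Y2)))"
  using assms
proof (induction "card I" arbitrary: I ys m rule: less_induct)
  case less
  note r = less.prems
  let ?Q = "\<lambda>I ys m t m'. \<exists>cs res w. Obar_reg n a J I cs res \<and> tape m' = tape m @ w \<and>
    w \<in> cat (map call_codes cs) \<and> t \<le> 10 + (\<Sum>c\<leftarrow>cs. call_time c) \<and>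
    (case res of None \<Rightarrow> narr m' aSTATE 0 = 0
     | Some Y2 \<Rightarrow> narr m' aSTATE 0 = 2 \<and> (\<exists>zs. lst (narr m' aY) zs \<and> distinct zs \<and> set zs = set ys \<union> Y2))"
  let ?b = "NEq (at0 aSTATE) (Num 1)"
  have st1: "bval ?b m" using r by (simp add: ready_def)
  have finI: "finite I" using r finite_subset[of I "{..<s}"] by (simp add: ready_def)
  obtain il where il: "lst (narr m aEQS) il" "distinct il" "set il = I" using r by (auto simp: ready_def)
  have em: "narr m aEQS 0 = 0 \<longleftrightarrow> I = {}" using il(1,3) by (auto simp: lst_0)
  have "wp K call_step m (\<lambda>t m'. wp K call_loop m' (\<lambda>t' m''. ?Q I ys m (1 + bcost ?b + t + t') m''))"
  proof (cases "I = {}")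
    case True
    let ?m1 = "m\<lparr>tape := tape m @ [2, 0, 0, 4, 0], narr := (narr m)(aSTATE := (narr m aSTATE)(0 := 2))\<rparr>"
    let ?c = "Call {} {} [] {}"
    have w: "[2, 0, 0, 4, 0] \<in> cat (map call_codes [?c])"
    proof -
      have "[2] @ [0] @ [0] @ [4] @ [0] @ [] \<in> cat [{[2]}, set_codes {}, set_codes {}, {[4]}, set_codes {}]"
        by (intro cat_Cons cat_Nil set_codes_empty singletonI)
      then have "[2] @ [0] @ [0] @ [4] @ [0] @ [] \<in> call_codes ?c" by (simp add: call_codes_def)
      then have "([2] @ [0] @ [0] @ [4] @ [0] @ []) @ [] \<in> cat (map call_codes [?c])"
        unfolding list.map by (rule cat_Cons[OF _ cat_Nil])
      then show ?thesis by simp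
    qed
    have "1000 \<le> call_time ?c" by (simp add: call_time_def)
    moreover have "Obar_reg n a J I [?c] (Some {})" unfolding True by (rule Obar_empty)
    moreover have "\<exists>zs. lst (narr ?m1 aY) zs \<and> distinct zs \<and> set zs = set ys \<union> {}"
      using r by (auto simp: ready_def)
    ultimately have Q: "?Q I ys m x ?m1" if "x \<le> 100" for x
      using w that by (intro exI[of _ "[?c]"] exI[of _ "Some {}"] exI[of _ "[2, 0, 0, 4, 0]"]) simp
    have cs: "wp K call_step m (\<lambda>t m'. t \<le> 40 \<and> m' = ?m1)" using em True by (simp add: call_step_def empty_prog_def)
    show ?thesis
    proof (rule wp_call[OF cs], elim conjE, goal_cases)
      case (1 t m')
      have "1 + bcost ?b + t + (1 + bcost ?b) \<le> 100" using 1(2) by simp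
      note Q' = Q[OF this]
      show ?case unfolding 1(3) call_loop_def
      proof (rule wp_Loop_False, goal_cases)
        case 1
        show ?case by simp
      next
        case 2
        show ?case by (rule Q')
      qed
    qed
  next
    case False
    have b: "\<not> bval (NEq (at0 aEQS) (Num 0)) m" using em False by simp
    have "wp K (Then head_prog finish_prog) m
      (\<lambda>t m'. wp K call_loop m' (\<lambda>t' m''. ?Q I ys m (1 + bcost ?b + (1 + bcost (NEq (at0 aEQS) (Num 0)) + t) + t') m''))"
    proof (rule wp_call[OF wp_call_body[OF r]], goal_cases)
      case (1 t m1)
      let ?B = "B_columns n a I"
      obtain ps R C Y1 w where h: "Seq_run a J I ?B ps R C" "tape m1 = tape m @ w"
        "w \<in> call_codes (Call I ?B ps Y1)" "t + 50 \<le> call_time (Call I ?B ps Y1)" "call_result I ys R C Y1 m1"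
        using 1(1) by (elim exE conjE) blast
      let ?c = "Call I ?B ps Y1"
      let ?T = "\<lambda>t'. 1 + bcost ?b + (1 + bcost (NEq (at0 aEQS) (Num 0)) + t) + t'"
      have T: "?T t' \<le> call_time ?c + t'" for t' using h(4) by simp
      have hl: "\<not> hopeless n a I" using r False by (simp add: ready_def)
      show ?case
      proof (cases "R = {} \<or> C = {}")
        case True
        have res: "Y1 = {}" "narr m1 aSTATE 0 = 0" using h(5) True by (simp_all add: call_result_def)
        have "Obar_reg n a J I [?c] None" unfolding res(1) by (rule Obar_stuck[OF False hl h(1) True])
        moreover have "w @ [] \<in> cat (map call_codes [?c])" unfolding list.map by (rule cat_Cons[OF h(3) cat_Nil])
        ultimately have q: "?Q I ys m (?T (1 + bcost ?b)) m1"
          using h(2) res(2) T[of "1 + bcost ?b"] by (intro exI[of _ "[?c]"] exI[of _ None] exI[of _ w]) simp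
        have "\<not> bval ?b m1" using res(2) by simp
        then show ?thesis unfolding call_loop_def by (rule wp_Loop_False) (rule q)
      next
        case nz: False
        obtain ys' where y: "Y1 \<subseteq> C" "card Y1 = card R" "minor J R Y1 \<noteq> 0" "set ys' = set ys \<union> Y1"
          "ready (I - R) ys' m1"
          using h(5) nz unfolding call_result_def by auto
        have "R \<subseteq> I" by (rule Seq_run_result(1)[OF h(1) finI finite_B_columns])
        then have lt: "card (I - R) < card I" using nz finI by (intro psubset_card_mono) auto
        show ?thesis
        proof (rule wp_call[OF less.hyps[OF lt y(5)]], goal_cases)
          case (1 t' m2)
          obtain cs res w' where q: "Obar_reg n a J (I - R) cs res" "tape m2 = tape m1 @ w'"
            "w' \<in> cat (map call_codes cs)" "t' \<le> 10 + (\<Sum>c\<leftarrow>cs. call_time c)"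
            "case res of None \<Rightarrow> narr m2 aSTATE 0 = 0
              | Some Y2 \<Rightarrow> narr m2 aSTATE 0 = 2 \<and> (\<exists>zs. lst (narr m2 aY) zs \<and> distinct zs \<and> set zs = set ys' \<union> Y2)"
            using 1(1) by (elim exE conjE) blast
          have "Obar_reg n a J I (?c # cs) (map_option (\<lambda>Y2. Y1 \<union> Y2) res)"
            by (rule Obar_split[OF False hl h(1) nz y(1-3) q(1)])
          moreover have "tape m2 = tape m @ (w @ w')" using q(2) h(2) by simp
          moreover have "w @ w' \<in> cat (map call_codes (?c # cs))"
            unfolding list.map by (rule cat_Cons[OF h(3) q(3)])
          moreover have "?T t' \<le> 10 + (\<Sum>c\<leftarrow>?c # cs. call_time c)" using T[of t'] q(4) by simp
          moreover have "case map_option (\<lambda>Y2. Y1 \<union> Y2) res of None \<Rightarrow> narr m2 aSTATE 0 = 0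
              | Some Y2 \<Rightarrow> narr m2 aSTATE 0 = 2 \<and> (\<exists>zs. lst (narr m2 aY) zs \<and> distinct zs \<and> set zs = set ys \<union> Y2)"
            using q(5) y(4) by (cases res) (simp_all add: Un_assoc)
          ultimately show ?case by (intro exI[of _ "?c # cs"] exI conjI)
        qed
      qed
    qed
    then show ?thesis unfolding call_step_def wp_Cond using b by (simp only: if_False)
  qed
  then show ?case
    unfolding call_loop_def by (intro wp_Loop_True[OF st1]) simp
qed

lemma stored_input: "stored (input_mem s n a J)"
proof -
  have "i * n + j < s * n \<and> (i * n + j) div n = i \<and> (i * n + j) mod n = j" if "i < s" "j < n" for i j
  proof -
    have "i * n + j < Suc i * n" using that(2) by simp
    also have "\<dots> \<le> s * n" using that(1) by (intro mult_le_mono1) simp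
    finally show ?thesis using that(2) by simp
  qed
  then show ?thesis unfolding stored_def input_mem_def by simp
qed

lemma wp_obar_prog:
  shows "wp K obar_prog (input_mem s n a J) (\<lambda>t m'. \<exists>cs res. Obar_reg n a J {..<s} cs res \<and>
    tape m' \<in> run_codes cs res \<and> t \<le> 500 + 200 * n + 300 * s + s * (n * 80) + (\<Sum>c\<leftarrow>cs. call_time c))"
  unfolding obar_prog_def wp_Then
proof (rule wp_call[OF wp_init_prog[OF stored_input]], goal_cases)
  case (4 t1 m1)
  note h1 = 4
  have st1: "stored m1" using stored_input h1(2) by (rule stored_unchanged) simp_all
  have tp1: "tape m1 = []" using h1(2) by (simp add: unchanged_def input_mem_def)
  have e1: "lst (narr m1 aEQS) [0..<s]" using h1(1) by blast
  have es: "[0..<s] = [] \<longleftrightarrow> s = 0" by simp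
  have s0: "\<not> hopeless n a {}" by (simp add: hopeless_def)
  show ?case
  proof (cases "hopeless n a {..<s}")
    case True
    then have ne: "{..<s} \<noteq> {}" using s0 by metis
    have b: "bval (NLess (Num 0) (at0 aBAD)) m1" using True h1(1) by simp
    let ?c = "Call {..<s} {} [] {}"
    have o: "Obar_reg n a J {..<s} [?c] None" by (rule Obar_hopeless[OF ne True])
    have w: "2 # s # [0..<s] @ [0, 4, 0, 0] \<in> run_codes [?c] None"
    proof -
      have "[2] @ (length [0..<s] # [0..<s]) @ [0] @ [4] @ [0] @ []
          \<in> cat [{[2]}, set_codes {..<s}, set_codes {}, {[4]}, set_codes {}]"
        by (intro cat_Cons cat_Nil set_codes_empty singletonI set_codes_list) (auto simp: lessThan_atLeast0)
      then have "[2] @ (length [0..<s] # [0..<s]) @ [0] @ [4] @ [0] @ [] \<in> call_codes ?c"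
        by (simp add: call_codes_def)
      then have "([2] @ (length [0..<s] # [0..<s]) @ [0] @ [4] @ [0] @ []) @ [0] @ [] \<in> run_codes [?c] None"
        unfolding run_codes_def list.map append.simps(1) append_Cons[of "call_codes ?c"] result_codes_def option.case
        by (intro cat_Cons cat_Nil singletonI)
      then show ?thesis by simp
    qed
    have "wp K hopeless_prog m1 (\<lambda>t m'. t \<le> 100 + s * 23 \<and> tape m' = 2 # s # [0..<s] @ [0, 4, 0, 0])"
      unfolding hopeless_prog_def wp_Then wp_Output
      by (rule wp_Print[where xs = "[0..<s]"]) (use e1 tp1 in simp_all)
    then have "wp K hopeless_prog m1 (\<lambda>t m'. \<exists>cs res. Obar_reg n a J {..<s} cs res \<and> tape m' \<in> run_codes cs res \<and>
      t1 + (1 + bcost (NLess (Num 0) (at0 aBAD)) + t) \<le> 500 + 200 * n + 300 * s + s * (n * 80) + (\<Sum>c\<leftarrow>cs. call_time c))"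
    proof (rule wp_call, goal_cases)
      case (1 t m')
      then show ?case using o w h1(1)[THEN conjunct1]
        by (intro exI[of _ "[?c]"] exI[of _ None]) simp
    qed
    then show ?thesis unfolding wp_Cond using b by (simp only: if_True)
  next
    case False
    have b: "\<not> bval (NLess (Num 0) (at0 aBAD)) m1" using False h1(1) by simp
    define m2 where "m2 = m1\<lparr>narr := (narr m1)(aSTATE := (narr m1 aSTATE)(0 := 1))\<rparr>"
    have rd: "ready {..<s} [] m2"
      unfolding ready_def
    proof (intro conjI)
      show "stored m2" using st1 by (simp add: m2_def stored_def)
      show "\<exists>il. lst (narr m2 aEQS) il \<and> distinct il \<and> set il = {..<s}"
        using e1 by (intro exI[of _ "[0..<s]"]) (auto simp: m2_def)
      show "\<forall>i\<in>{..<s}. narr m2 aGONE i = 0" using h1(2) by (simp add: m2_def unchanged_def input_mem_def)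
      show "lst (narr m2 aY) []" using h1(2) by (simp add: m2_def unchanged_def input_mem_def lst_Nil)
    qed (use h1(1) False in \<open>simp_all add: m2_def\<close>)
    have tp2: "tape m2 = []" using tp1 by (simp add: m2_def)
    let ?T = "500 + 200 * n + 300 * s + s * (n * 80)"
    have "wp K call_loop m2 (\<lambda>t m'. wp K result_prog m' (\<lambda>t' m''. \<exists>cs res. Obar_reg n a J {..<s} cs res \<and>
      tape m'' \<in> run_codes cs res \<and> t1 + (1 + bcost (NLess (Num 0) (at0 aBAD)) + (1 + ncost (Num 0) + ncost (Num 1) + (t + t')))
        \<le> ?T + (\<Sum>c\<leftarrow>cs. call_time c)))"
    proof (rule wp_call[OF wp_call_loop[OF rd]], goal_cases)
      case (1 t m3)
      obtain cs res w where q: "Obar_reg n a J {..<s} cs res" "tape m3 = tape m2 @ w"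
            "w \<in> cat (map call_codes cs)" "t \<le> 10 + (\<Sum>c\<leftarrow>cs. call_time c)"
            "case res of None \<Rightarrow> narr m3 aSTATE 0 = 0
              | Some Y2 \<Rightarrow> narr m3 aSTATE 0 = 2 \<and> (\<exists>zs. lst (narr m3 aY) zs \<and> distinct zs \<and> set zs = set [] \<union> Y2)"
        using 1(1) by (elim exE conjE) blast
      have run: "w @ v \<in> run_codes cs res" if "v \<in> result_codes res" for v
      proof -
        have "v @ [] \<in> cat [result_codes res]" by (rule cat_Cons[OF that cat_Nil])
        then show ?thesis unfolding run_codes_def using cat_append[OF q(3)] by fastforce
      qed
      have fin: "wp K result_prog m3 (\<lambda>t' m4. t' \<le> 50 + n * 23 \<and> (\<exists>v. tape m4 = w @ v \<and> v \<in> result_codes res))"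
      proof (cases res)
        case None
        then show ?thesis using q(2,5) tp2 by (simp add: result_prog_def result_codes_def)
      next
        case (Some Y2)
        then obtain zs where z: "lst (narr m3 aY) zs" "distinct zs" "set zs = Y2" "narr m3 aSTATE 0 = 2"
          using q(5) by auto
        have "Y2 \<subseteq> {..<n}" using Obar_reg_correct[OF q(1) ad] Some by auto
        then have lz: "length zs \<le> n" using length_le_card[OF z(2), of "{..<n}"] z(3) by simp
        have v: "1 # length zs # zs \<in> result_codes res"
        proof -
          have "[1] @ (length zs # zs) @ [] \<in> cat [{[1]}, set_codes Y2]"
            by (intro cat_Cons cat_Nil singletonI set_codes_list z)
          then show ?thesis using Some by (simp add: result_codes_def)
        qed
        have "wp K (Then (Output (Num 1)) (Print aI aY)) m3 (\<lambda>t' m4. t' \<le> 40 + n * 23 \<and>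
          (\<exists>v. tape m4 = w @ v \<and> v \<in> result_codes res))"
          unfolding wp_Then wp_Output
          by (rule wp_Print[where xs = zs]) (use z v lz q(2) tp2 in \<open>auto intro!: exI[of _ "1 # length zs # zs"]\<close>)
        then have "wp K (Then (Output (Num 1)) (Print aI aY)) m3 (\<lambda>t' m4. 1 + bcost (NEq (at0 aSTATE) (Num 0)) + t' \<le> 50 + n * 23 \<and>
          (\<exists>v. tape m4 = w @ v \<and> v \<in> result_codes res))"
          by (rule wp_call) simp
        moreover have "\<not> bval (NEq (at0 aSTATE) (Num 0)) m3" using z(4) by simp
        ultimately show ?thesis unfolding result_prog_def wp_Cond by (simp only: if_False)
      qed
      show ?case
      proof (rule wp_call[OF fin], goal_cases)
        case (1 t' m4)
        then obtain v where v: "tape m4 = w @ v" "v \<in> result_codes res" "t' \<le> 50 + n * 23" by blast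
        then show ?case using q(1,4) run[OF v(2)] h1(1)[THEN conjunct1]
          by (intro exI[of _ cs] exI[of _ res]) simp
      qed
    qed
    then show ?thesis unfolding wp_Cond using b by (simp add: m2_def)
  qed
qed (simp_all add: input_mem_def)

end

section \<open>Counting operations\<close>

text \<open>
  A first pass that discards only the trivial rows is followed by exactly one pass, which changes nothing,
  since the nontrivial rows by themselves form the minimum cover. Hence the number of passes exceeds the
  number of iterations by 1 at most.
\<close>

lemma Seq_run_iterations:
  assumes run: "Seq_run a J I B ps R C" and fin: "finite I" "finite B"
  shows "length ps \<le> Suc (Seq_iterations a (Call I B ps Y))"
    and "Seq_iterations a (Call I B ps Y) \<le> 1 \<Longrightarrow> nontrivial_rows a (Call I B ps Y) \<subseteq> R"
    and "B = {} \<Longrightarrow> Seq_iterations a (Call I B ps Y) \<le> 1"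
proof -
  let ?N = "{i \<in> I. \<exists>j\<in>B. a i j = 0}"
  have N: "nontrivial_rows a (Call I B ps Y) = ?N" for ps Y by (simp add: nontrivial_rows_def)
  have it: "Seq_iterations a (Call I B (Pass R0 C0 R' C' # ps') Y) =
      (if R' = ?N \<and> C' = B then 1 else Suc (length ps'))" for R0 C0 R' C' ps' Y
    by (simp add: Seq_iterations_def N)
  have ne: "ps \<noteq> []" if "Seq_run a J I' B' ps R C" for I' B' ps R C using that by (auto elim: Seq_run.cases)
  have "length ps \<le> Suc (Seq_iterations a (Call I B ps Y)) \<and>
    (Seq_iterations a (Call I B ps Y) \<le> 1 \<longrightarrow> ?N \<subseteq> R) \<and> (B = {} \<longrightarrow> Seq_iterations a (Call I B ps Y) \<le> 1)"
    using run
  proof cases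
    case (Seq_stop R0 C0)
    then show ?thesis using it[of R0 C0 I B "[]"] by (auto split: if_splits)
  next
    case (Seq_again R0 C0 R' C' ps')
    note st = Seq_step[OF fin Seq_again(2,3)]
    have R0N: "R0 \<subseteq> ?N"
      using HK_row_nontrivial[OF fin Seq_again(2)] HK_subset(1)[OF fin Seq_again(2)] by blast
    show ?thesis
    proof (cases "R' = ?N \<and> C' = B")
      case False
      have "B \<noteq> {}"
      proof
        assume B: "B = {}"
        then have "?N = {}" "C' = {}" using st(4) by auto
        moreover have "R' = {}" using st(1) R0N \<open>?N = {}\<close> by blast
        ultimately show False using False B by simp
      qed
      moreover have "ps' \<noteq> []" using Seq_again(5) by (rule ne)
      ultimately show ?thesis using False by (auto simp: Seq_again(1) it)
    next
      case True
      \<comment> \<open>The first pass has discarded only trivial rows; HK then finds the same cover again.\<close>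
      have ze: "zero_entries a ?N B = zero_entries a I B" by (auto simp: zero_entries_def)
      then have tr: "term_rank a ?N B = term_rank a I B" by (simp add: term_rank_def)
      have R0: "R0 = ?N" using R0N st(1) True by blast
      have C0: "C0 = {}" using st(3) True HK_subset(2)[OF fin Seq_again(2)] by blast
      have "card ?N = term_rank a I B"
        using minimum_coversD(4)[OF HK_subset(4)[OF fin Seq_again(2)]] by (simp add: R0 C0)
      then have "(?N, {}) \<in> minimum_covers a ?N B"
        unfolding minimum_covers_def tr by (auto simp: zero_entries_def)
      then have hk: "HK a ?N B = (?N, {})"
        by (rule HK_eqI) (auto dest: minimum_coversD(1))
      have ks: "Kernel_Support a J ?N (B - {}) = (?N, B)" using Seq_again(3) True unfolding R0 C0 by simp
      have "Seq_run a J ?N B ps' R C" using Seq_again(5) True by simp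
      then have "length ps' = 1 \<and> R = ?N"
      proof cases
        case (Seq_stop R1 C1)
        then show ?thesis by simp
      next
        case (Seq_again R1 C1 R2 C2 ps2)
        have "R1 = ?N" "C1 = {}" using Seq_again(2) unfolding hk by simp_all
        then have "(R2, C2) = (?N, B)" using Seq_again(3) ks by simp
        then show ?thesis using Seq_again(4) by simp
      qed
      then have r: "R = ?N" "length ps = 2" using Seq_again(1) by simp_all
      have e: "Seq_iterations a (Call I B ps Y) = 1" unfolding Seq_again(1) it using True by simp
      show ?thesis unfolding e using r by simp
    qed
  qed
  then show "length ps \<le> Suc (Seq_iterations a (Call I B ps Y))"
    "Seq_iterations a (Call I B ps Y) \<le> 1 \<Longrightarrow> nontrivial_rows a (Call I B ps Y) \<subseteq> R"
    "B = {} \<Longrightarrow> Seq_iterations a (Call I B ps Y) \<le> 1"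
    unfolding N by blast+
qed

lemma passes_le_iterations: "\<lbrakk>passes c \<noteq> []; length (passes c) \<le> Suc (Seq_iterations a c)\<rbrakk> \<Longrightarrow>
    length (passes c) \<le> 2 * Seq_iterations a c"
  by (cases "passes c") (auto simp: Seq_iterations_def split: if_splits)

text \<open>
  The number \<open>d\<close> of nontrivial rows and the number \<open>l\<close> of columns vanish simultaneously, as every column of
  \<open>B\<close> contains a zero.
\<close>

lemma pass_time_le:
  assumes "(d = 0 \<and> l = 0) \<or> (0 < d \<and> 0 < l)"
  shows "pass_time d l \<le> 700 + 4000 * (d * d * l)"
proof (cases "d = 0")
  case True
  then show ?thesis using assms by (simp add: pass_time_def cover_time_def kernel_time_def)
next
  case False
  then obtain x y where d: "d = Suc x" and l: "l = Suc y" using assms by (cases d; cases l) auto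
  show ?thesis
    unfolding d l pass_time_def cover_time_def kernel_time_def by (simp add: algebra_simps)
qed

context algorithm_input begin

lemma Obar_reg_calls:
  assumes "Obar_reg n a J I cs res" "finite I" "c \<in> set cs"
  shows "equations c \<subseteq> I \<and> card (chosen c) \<le> card (equations c) \<and> card (columns c) \<le> n \<and> finite (columns c) \<and>
    length (passes c) \<le> Suc (Seq_iterations a c) \<and> (passes c \<noteq> [] \<longrightarrow> card (equations c) \<le> n) \<and>
    (columns c = {} \<longleftrightarrow> nontrivial_rows a c = {}) \<and> (columns c = {} \<longrightarrow> length (passes c) \<le> 2)"
  using assms
proof (induction rule: Obar_reg.induct)
  case (Obar_stuck I ps R C)
  let ?c = "Call I (B_columns n a I) ps {}"
  have c: "c = ?c" using Obar_stuck.prems(2) by simp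
  note it = Seq_run_iterations[OF Obar_stuck.hyps(3) Obar_stuck.prems(1) finite_B_columns, of "{}"]
  have B: "B_columns n a I \<subseteq> {..<n}" by (auto simp: B_columns_def)
  then have "card (B_columns n a I) \<le> n" "finite (B_columns n a I)"
    using card_mono[of "{..<n}" "B_columns n a I"] by (simp_all add: finite_B_columns)
  moreover have "B_columns n a I = {} \<longleftrightarrow> nontrivial_rows a ?c = {}"
    by (auto simp: nontrivial_rows_def B_columns_def)
  moreover have "card I \<le> n" using Obar_stuck.hyps(2) by (auto simp: hopeless_def)
  ultimately show ?case unfolding c using it B by auto
next
  case (Obar_split I ps R C Y1 cs res)
  have IR: "finite (I - R)" using Obar_split.prems(1) by simp
  show ?case
  proof (cases "c \<in> set cs")
    case True
    then show ?thesis using Obar_split.IH[OF IR] by blast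
  next
    case False
    let ?c = "Call I (B_columns n a I) ps Y1"
    have c: "c = ?c" using Obar_split.prems(2) False by simp
    note it = Seq_run_iterations[OF Obar_split.hyps(3) Obar_split.prems(1) finite_B_columns, of "Y1"]
    have "R \<subseteq> I" by (rule Seq_run_result(1)[OF Obar_split.hyps(3) Obar_split.prems(1) finite_B_columns])
    then have "card Y1 \<le> card I" using card_mono[OF Obar_split.prems(1)] Obar_split.hyps(6) by simp
    moreover have B: "B_columns n a I \<subseteq> {..<n}" by (auto simp: B_columns_def)
    moreover have "card (B_columns n a I) \<le> n" "finite (B_columns n a I)"
      using card_mono[OF _ B] by (simp_all add: finite_B_columns)
    moreover have "B_columns n a I = {} \<longleftrightarrow> nontrivial_rows a ?c = {}"
      by (auto simp: nontrivial_rows_def B_columns_def)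
    moreover have "card I \<le> n" using Obar_split.hyps(2) by (auto simp: hopeless_def)
    ultimately show ?thesis unfolding c using it by auto
  qed
qed (simp_all add: nontrivial_rows_def)

text \<open>
  If Seq needs a single iteration in every call, the columns of \<open>B\<close> in different calls are disjoint.
\<close>

lemma Obar_reg_totals:
  assumes "Obar_reg n a J I cs res" "finite I"
  shows "length cs \<le> Suc (card I)" "(\<Sum>c\<leftarrow>cs. card (chosen c)) \<le> card I"
    "\<lbrakk>\<And>c. c \<in> set cs \<Longrightarrow> Seq_iterations a c \<le> 1\<rbrakk> \<Longrightarrow>
      (\<Sum>c\<leftarrow>cs. card (columns c)) \<le> card {j. j < n \<and> (\<exists>i\<in>I. a i j \<noteq> -\<infinity>)}"
proof -
  let ?V = "\<lambda>I. {j. j < n \<and> (\<exists>i\<in>I. a i j \<noteq> -\<infinity>)}"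
  have "length cs \<le> Suc (card I) \<and> (\<Sum>c\<leftarrow>cs. card (chosen c)) \<le> card I \<and>
    ((\<forall>c\<in>set cs. Seq_iterations a c \<le> 1) \<longrightarrow> (\<Sum>c\<leftarrow>cs. card (columns c)) \<le> card (?V I))"
    using assms
  proof (induction rule: Obar_reg.induct)
    case (Obar_stuck I ps R C)
    have "card (B_columns n a I) \<le> card (?V I)" by (rule card_mono) (auto simp: B_columns_def)
    then show ?case by simp
  next
    case (Obar_split I ps R C Y1 cs res)
    note sr = Seq_run_result[OF Obar_split.hyps(3) Obar_split.prems finite_B_columns]
    have IR: "finite (I - R)" using Obar_split.prems by simp
    note ih = Obar_split.IH[OF IR]
    have "finite R" using sr(1) Obar_split.prems by (rule finite_subset)
    then have cI: "card I = card R + card (I - R)" and R0: "0 < card R"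
      using card_Diff_subset[OF _ sr(1)] card_mono[OF Obar_split.prems sr(1)] Obar_split.hyps(4)
      by (simp_all add: card_gt_0_iff)
    have "card (B_columns n a I) + card (?V (I - R)) \<le> card (?V I)"
      if "Seq_iterations a (Call I (B_columns n a I) ps Y1) \<le> 1"
    proof -
      \<comment> \<open>All nontrivial rows have been chosen, hence the other rows are $-\infty$ on these columns.\<close>
      have N: "nontrivial_rows a (Call I (B_columns n a I) ps Y1) \<subseteq> R"
        using Seq_run_iterations(2)[OF Obar_split.hyps(3) Obar_split.prems finite_B_columns that] .
      have "a i j = -\<infinity>" if "j \<in> B_columns n a I" "i \<in> I - R" for i j
      proof -
        have "a i j = -\<infinity> \<or> a i j = 0" using B_columnsD(2)[OF that(1)] that(2) by blast
        moreover have "a i j \<noteq> 0" using N that by (auto simp: nontrivial_rows_def)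
        ultimately show ?thesis by blast
      qed
      then have "B_columns n a I \<inter> ?V (I - R) = {}" by blast
      then have "card (B_columns n a I) + card (?V (I - R)) = card (B_columns n a I \<union> ?V (I - R))"
        using finite_B_columns by (intro card_Un_disjoint[symmetric]) simp_all
      also have "\<dots> \<le> card (?V I)" by (rule card_mono) (auto simp: B_columns_def)
      finally show ?thesis .
    qed
    then show ?case using ih cI R0 Obar_split.hyps(6) by auto
  qed simp_all
  then show "length cs \<le> Suc (card I)" "(\<Sum>c\<leftarrow>cs. card (chosen c)) \<le> card I"
    "\<lbrakk>\<And>c. c \<in> set cs \<Longrightarrow> Seq_iterations a c \<le> 1\<rbrakk> \<Longrightarrow> (\<Sum>c\<leftarrow>cs. card (columns c)) \<le> card (?V I)"
    by blast+
qed

lemma call_time_le: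
  assumes "Obar_reg n a J I cs res" "finite I" "c \<in> set cs"
  shows "call_time c \<le> 1000 * (1 + n + card (equations c) * (1 + card (columns c)) + card (chosen c) * (n + 1)) +
    length (passes c) * (900 + 4000 * ((card (nontrivial_rows a c))\<^sup>2 * card (columns c)) +
      40 * card (equations c) + 40 * card (columns c))"
proof -
  have c: "equations c \<subseteq> I" "columns c = {} \<longleftrightarrow> nontrivial_rows a c = {}" "finite (columns c)"
    using Obar_reg_calls[OF assms] by blast+
  have "finite (nontrivial_rows a c)"
    using finite_subset[OF c(1) assms(2)] by (simp add: nontrivial_rows_def)
  then have "pass_time (card (nontrivial_rows a c)) (card (columns c)) \<le>
      700 + 4000 * (card (nontrivial_rows a c) * card (nontrivial_rows a c) * card (columns c))"
    using c(2,3) by (intro pass_time_le) (auto simp: card_gt_0_iff)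
  then have "pass_time (card (nontrivial_rows a c)) (card (columns c)) + 200 + 40 * card (equations c) + 40 * card (columns c) \<le>
      900 + 4000 * (card (nontrivial_rows a c) * card (nontrivial_rows a c) * card (columns c)) +
      40 * card (equations c) + 40 * card (columns c)" by simp
  then show ?thesis
    unfolding call_time_def power2_eq_square by (rule add_le_mono[OF order_refl mult_le_mono2])
qed

definition run_time_bound :: "call list \<Rightarrow> nat" where
  "run_time_bound cs = 500 + 200 * n + 300 * s + s * (n * 80) + (\<Sum>c\<leftarrow>cs. call_time c)"

lemma sum_list_le_bound:
  fixes f :: "'c \<Rightarrow> real" and B :: real
  assumes "\<And>c. c \<in> set cs \<Longrightarrow> f c \<le> B"
  shows "(\<Sum>c\<leftarrow>cs. f c) \<le> length cs * B"
  using sum_list_mono[of cs f "\<lambda>_. B"] assms by (simp add: sum_list_triv)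

lemma sum_list_linear:
  fixes f g :: "'c \<Rightarrow> nat"
  shows "(\<Sum>c\<leftarrow>cs. A + B * f c + D * g c) = length cs * A + B * (\<Sum>c\<leftarrow>cs. f c) + D * (\<Sum>c\<leftarrow>cs. g c)"
  by (induction cs) (simp_all add: algebra_simps)

text \<open>
  A call costs \<open>O(sn)\<close> and its passes \<open>O(d\<^sup>2n + e)\<close> each, where \<open>e\<close> is its number of equations. A call that
  is not hopeless has \<open>e \<le> n\<close>, so that the passes are within \<open>O(d\<^sup>2n)\<close> if \<open>d > 0\<close>; otherwise there are at
  most two of them.
\<close>

lemma run_time_le:
  assumes run: "Obar_reg n a J {..<s} cs res" and pos: "1 \<le> n" "1 \<le> s"
  shows "real (run_time_bound cs) \<le> 12000 * (real (num_calls cs) *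
    (real (max_iterations a cs) * (real (max_nontrivial a cs))\<^sup>2 + real s) * real n)"
proof -
  define q d where "q = max_iterations a cs" and "d = max_nontrivial a cs"
  have sn: "1 \<le> s * n" "n \<le> s * n" "s \<le> s * n" using pos by simp_all
  have ct: "call_time c \<le> 10000 * ((q * d\<^sup>2 + s) * n)" if "c \<in> set cs" for c
  proof -
    let ?e = "card (equations c)" and ?l = "card (columns c)" and ?y = "card (chosen c)" and ?k = "length (passes c)"
      and ?d = "card (nontrivial_rows a c)"
    note oc = Obar_reg_calls[OF run finite_lessThan that]
    have q: "Seq_iterations a c \<le> q" and d: "?d \<le> d"
      using that unfolding q_def d_def max_iterations_def max_nontrivial_def by (auto intro!: Max_ge)
    have e: "?e \<le> s" using oc card_mono[of "{..<s}" "equations c"] by simp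
    have l: "?l \<le> n" and y: "?y \<le> s" using oc e by auto
    have "?e * (1 + ?l) \<le> s * (1 + n)" by (rule mult_le_mono[OF e]) (use l in simp)
    moreover have "?y * (n + 1) \<le> s * (1 + n)" by (rule mult_le_mono[OF y]) simp
    moreover have "s * (1 + n) = s + s * n" by simp
    ultimately have A: "1 + n + ?e * (1 + ?l) + ?y * (n + 1) \<le> 6 * (s * n)"
      using sn by linarith
    have B: "?k * (900 + 4000 * (?d\<^sup>2 * ?l) + 40 * ?e + 40 * ?l) \<le> 10000 * (q * d\<^sup>2 * n) + 2000 * (s * n)"
    proof (cases "columns c = {} \<or> passes c = []")
      case True
      then show ?thesis
      proof
        assume "columns c = {}"
        then have "?k \<le> 2" "?l = 0" using oc by auto
        then have "?k * (900 + 4000 * (?d\<^sup>2 * ?l) + 40 * ?e + 40 * ?l) \<le> 2 * (900 + 40 * s)"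
          using e by (intro mult_le_mono) auto
        moreover have "2 * (900 + 40 * s) = 1800 + 80 * s" by simp
        then have "2 * (900 + 40 * s) \<le> 2000 * (s * n)" using sn by linarith
        ultimately show ?thesis by (intro trans_le_add2) (rule le_trans)
      qed simp
    next
      case False
      have k: "?k \<le> 2 * q" using passes_le_iterations[of c a] oc False q by auto
      have d1: "1 \<le> ?d"
        using oc False finite_subset[of "nontrivial_rows a c" "{..<s}"]
        by (auto simp: Suc_le_eq card_gt_0_iff nontrivial_rows_def)
      then have dd: "1 \<le> d\<^sup>2" "?d\<^sup>2 \<le> d\<^sup>2" using d by (auto intro!: power_mono)
      have "1 * n \<le> d\<^sup>2 * n" by (rule mult_le_mono1[OF dd(1)])
      moreover have "?d\<^sup>2 * ?l \<le> d\<^sup>2 * n" by (rule mult_le_mono[OF dd(2) l])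
      moreover have "?e \<le> n" using oc False by blast
      ultimately have "900 + 4000 * (?d\<^sup>2 * ?l) + 40 * ?e + 40 * ?l \<le> 5000 * (d\<^sup>2 * n)"
        using l pos by linarith
      with k have "?k * (900 + 4000 * (?d\<^sup>2 * ?l) + 40 * ?e + 40 * ?l) \<le> (2 * q) * (5000 * (d\<^sup>2 * n))"
        by (rule mult_le_mono)
      then show ?thesis by (simp add: algebra_simps)
    qed
    note call_time_le[OF run finite_lessThan that]
    also note add_le_mono[OF mult_le_mono2[OF A] B]
    also have "1000 * (6 * (s * n)) + (10000 * (q * d\<^sup>2 * n) + 2000 * (s * n)) \<le> 10000 * ((q * d\<^sup>2 + s) * n)"
      by (simp add: algebra_simps)
    finally show ?thesis .
  qed
  have "cs \<noteq> []" using run by (auto elim: Obar_reg.cases)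
  then have p: "1 \<le> real (length cs)" by (cases cs) auto
  let ?X = "real q * (real d)\<^sup>2 + real s"
  have X: "real s * real n \<le> ?X * real n" by (intro mult_right_mono) simp_all
  have "real (s * n) \<le> real (length cs) * (?X * real n)"
    using mult_mono[OF p X] by simp
  moreover have "real (\<Sum>c\<leftarrow>cs. call_time c) \<le> real (length cs) * (10000 * (?X * real n))"
  proof -
    have "real (\<Sum>c\<leftarrow>cs. call_time c) = (\<Sum>c\<leftarrow>cs. real (call_time c))" by (induction cs) simp_all
    also have "\<dots> \<le> real (length cs) * (10000 * (?X * real n))"
    proof (rule sum_list_le_bound)
      fix c assume "c \<in> set cs"
      then have "real (call_time c) \<le> real (10000 * ((q * d\<^sup>2 + s) * n))" using ct by (simp only: of_nat_le_iff)
      then show "real (call_time c) \<le> 10000 * (?X * real n)" by simp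
    qed
    finally show ?thesis .
  qed
  moreover have "real (500 + 200 * n + 300 * s + s * (n * 80)) \<le> 1080 * real (s * n)"
  proof -
    have "500 + 200 * n + 300 * s + s * (n * 80) \<le> 1080 * (s * n)"
    proof -
      have "s * (n * 80) = 80 * (s * n)" by simp
      then show ?thesis using sn by linarith
    qed
    then have "real (500 + 200 * n + 300 * s + s * (n * 80)) \<le> real (1080 * (s * n))" by (simp only: of_nat_le_iff)
    then show ?thesis by simp
  qed
  ultimately have "real (500 + 200 * n + 300 * s + s * (n * 80)) + real (\<Sum>c\<leftarrow>cs. call_time c)
      \<le> 12000 * (real (length cs) * (?X * real n))"
    using of_nat_0_le_iff[of "s * n", where 'a = real] by (simp only: mult.left_commute[of _ 10000])
  then show ?thesis
    unfolding run_time_bound_def num_calls_def q_def d_def of_nat_add[of "500 + 200 * n + 300 * s + s * (n * 80)"]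
    by (simp only: mult.assoc)
qed

text \<open>
  As \<open>q = 1\<close>, the system is not hopeless, so that \<open>s \<le> n\<close>. There are at most \<open>s + 1\<close> calls and at most \<open>n\<close>
  columns in all of them. Finally \<open>sn\<close> is absorbed by \<open>s ln(s) n\<close> for \<open>s \<ge> 2\<close> and by \<open>d\<^sup>2n\<close> for \<open>s = 1\<close>.
\<close>

lemma run_time_le_single:
  assumes run: "Obar_reg n a J {..<s} cs res" and pos: "1 \<le> n" "1 \<le> s" and q: "max_iterations a cs = 1"
    and d: "2 \<le> s \<or> 0 < max_nontrivial a cs"
  shows "real (run_time_bound cs) \<le> 42000 * (((real (max_nontrivial a cs))\<^sup>2 + ln (real s) * real s) * real n)"
proof -
  define d where "d = max_nontrivial a cs"
  have sn: "1 \<le> s * n" "n \<le> s * n" "s \<le> s * n" using pos by simp_all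
  have q1: "Seq_iterations a c \<le> 1" if "c \<in> set cs" for c
    using that unfolding q[symmetric] max_iterations_def by (auto intro!: Max_ge)
  have nh: "\<not> hopeless n a {..<s}"
  proof
    assume h: "hopeless n a {..<s}"
    have "cs = [Call {..<s} {} [] {}]" using run h pos by (auto elim: Obar_reg.cases)
    then show False using q by (simp add: max_iterations_def Seq_iterations_def)
  qed
  then have sn': "s \<le> n" by (auto simp: hopeless_def)
  have le: "length cs \<le> 2 * s" "(\<Sum>c\<leftarrow>cs. card (chosen c)) \<le> s" "(\<Sum>c\<leftarrow>cs. card (columns c)) \<le> n"
  proof -
    note t = Obar_reg_totals[OF run finite_lessThan]
    show "length cs \<le> 2 * s" "(\<Sum>c\<leftarrow>cs. card (chosen c)) \<le> s" using t(1,2) pos by simp_all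
    have "card {j. j < n \<and> (\<exists>i\<in>{..<s}. a i j \<noteq> -\<infinity>)} \<le> card {..<n}" by (rule card_mono) auto
    then show "(\<Sum>c\<leftarrow>cs. card (columns c)) \<le> n" using t(3)[OF q1] by simp
  qed
  have ct: "call_time c \<le> 5000 * (n + s) + (1080 * s + 80 + 8000 * d\<^sup>2) * card (columns c) + 2000 * n * card (chosen c)"
    if c: "c \<in> set cs" for c
  proof -
    let ?e = "card (equations c)" and ?l = "card (columns c)" and ?y = "card (chosen c)" and ?k = "length (passes c)"
      and ?d = "card (nontrivial_rows a c)"
    note oc = Obar_reg_calls[OF run finite_lessThan c]
    have d: "?d \<le> d" using c unfolding d_def max_nontrivial_def by (auto intro!: Max_ge)
    have e: "?e \<le> s" using oc card_mono[of "{..<s}" "equations c"] by simp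
    have "?k \<le> 2" using oc q1[OF c] by simp
    moreover have "?d\<^sup>2 * ?l \<le> d\<^sup>2 * ?l" using d by (intro mult_le_mono1 power_mono) simp_all
    then have "900 + 4000 * (?d\<^sup>2 * ?l) + 40 * ?e + 40 * ?l \<le> 900 + 4000 * (d\<^sup>2 * ?l) + 40 * s + 40 * ?l"
      using e by linarith
    ultimately have B: "?k * (900 + 4000 * (?d\<^sup>2 * ?l) + 40 * ?e + 40 * ?l) \<le> 2 * (900 + 4000 * (d\<^sup>2 * ?l) + 40 * s + 40 * ?l)"
      by (rule mult_le_mono)
    have A: "?e * (1 + ?l) \<le> s * (1 + ?l)" by (rule mult_le_mono1[OF e])
    have A': "?y * (n + 1) \<le> ?y * (2 * n)" by (rule mult_le_mono2) (use pos in simp)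
    have "1 + n + ?e * (1 + ?l) + ?y * (n + 1) \<le> 1 + n + s * (1 + ?l) + ?y * (2 * n)"
      by (rule add_le_mono[OF add_le_mono[OF order_refl A] A'])
    note AB = add_le_mono[OF mult_le_mono2[OF this] B]
    note call_time_le[OF run finite_lessThan c]
    also note AB
    also have "1000 * (1 + n + s * (1 + ?l) + ?y * (2 * n)) + 2 * (900 + 4000 * (d\<^sup>2 * ?l) + 40 * s + 40 * ?l) \<le>
        5000 * (n + s) + (1080 * s + 80 + 8000 * d\<^sup>2) * ?l + 2000 * n * ?y"
      using pos by (simp add: algebra_simps)
    finally show ?thesis .
  qed
  have "(\<Sum>c\<leftarrow>cs. call_time c) \<le> length cs * (5000 * (n + s)) +
      (1080 * s + 80 + 8000 * d\<^sup>2) * (\<Sum>c\<leftarrow>cs. card (columns c)) + 2000 * n * (\<Sum>c\<leftarrow>cs. card (chosen c))"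
  proof -
    have "(\<Sum>c\<leftarrow>cs. call_time c) \<le> (\<Sum>c\<leftarrow>cs. 5000 * (n + s) + (1080 * s + 80 + 8000 * d\<^sup>2) * card (columns c) +
        2000 * n * card (chosen c))" by (rule sum_list_mono) (rule ct)
    also have "\<dots> = length cs * (5000 * (n + s)) +
      (1080 * s + 80 + 8000 * d\<^sup>2) * (\<Sum>c\<leftarrow>cs. card (columns c)) + 2000 * n * (\<Sum>c\<leftarrow>cs. card (chosen c))"
      by (rule sum_list_linear)
    finally show ?thesis .
  qed
  also have "\<dots> \<le> (2 * s) * (5000 * (n + s)) + (1080 * s + 80 + 8000 * d\<^sup>2) * n + 2000 * n * s"
    using le by (intro add_mono mult_le_mono) simp_all
  also have "\<dots> \<le> 25000 * (s * n) + 8000 * (d\<^sup>2 * n)"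
  proof -
    have "s * s \<le> s * n" using sn' by simp
    moreover have "(2 * s) * (5000 * (n + s)) + (1080 * s + 80 + 8000 * d\<^sup>2) * n + 2000 * n * s =
        13080 * (s * n) + 10000 * (s * s) + 80 * n + 8000 * (d\<^sup>2 * n)" by (simp add: algebra_simps)
    ultimately show ?thesis using sn by linarith
  qed
  finally have "(\<Sum>c\<leftarrow>cs. call_time c) \<le> 25000 * (s * n) + 8000 * (d\<^sup>2 * n)" .
  moreover have "s * (n * 80) = 80 * (s * n)" by simp
  ultimately have rt: "run_time_bound cs \<le> 27000 * (s * n) + 8000 * (d\<^sup>2 * n)"
    unfolding run_time_bound_def using sn by linarith
  have t: "real (run_time_bound cs) \<le> 27000 * (real s * real n) + 8000 * ((real d)\<^sup>2 * real n)"
  proof -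
    have "real (run_time_bound cs) \<le> real (27000 * (s * n) + 8000 * (d\<^sup>2 * n))"
      using rt by (simp only: of_nat_le_iff)
    then show ?thesis by simp
  qed
  show ?thesis
  proof (cases "2 \<le> s")
    case True
    have "ln 2 \<le> ln (real s)" using True by simp
    then have "2 / 3 \<le> ln (real s)" using ln2_ge_two_thirds by linarith
    then have "2 / 3 * (real s * real n) \<le> ln (real s) * (real s * real n)" by (intro mult_right_mono) simp_all
    moreover have "0 \<le> (real d)\<^sup>2 * real n" by simp
    moreover have "0 \<le> real s * real n" by simp
    ultimately have "27000 * (real s * real n) + 8000 * ((real d)\<^sup>2 * real n) \<le>
        42000 * ((real d)\<^sup>2 * real n) + 42000 * (ln (real s) * (real s * real n))" by linarith
    also have "\<dots> = 42000 * (((real d)\<^sup>2 + ln (real s) * real s) * real n)" by (simp add: algebra_simps)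
    finally show ?thesis using t unfolding d_def by linarith
  next
    case False
    then have "s = 1" "1 \<le> d" using d pos by (simp_all add: d_def)
    then have "real n \<le> (real d)\<^sup>2 * real n" by (simp add: mult_le_cancel_right1)
    then show ?thesis using t \<open>s = 1\<close> by (simp add: d_def)
  qed
qed

lemma obar_prog_carries_out:
  "\<exists>cs res t. carries_out K obar_prog s n a J cs res t \<and> t \<le> run_time_bound cs"
  using wp_obar_prog unfolding wp_def carries_out_def run_time_bound_def by blast

end

section \<open>The theorem\<close>

lemma system_input:
  assumes "system_at n s P U \<eta>" "real_subfield K" "\<forall>i<s. \<forall>j<n. jacobian_at P \<eta> i j \<in> K"
  shows "algorithm_input n s (order_matrix U P) (jacobian_at P \<eta>) K"
  using system_admissible[OF assms(1)] assms(2,3) by (simp add: algorithm_input_def)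

theorem theorem70:
  shows
    "(\<forall>(n::nat) (s::nat) P U \<eta>. system_at n s P U \<eta> \<longrightarrow>
        (\<exists>cs res. Obar_reg n (order_matrix U P) (jacobian_at P \<eta>) {..<s} cs res) \<and>
        (\<forall>cs res. Obar_reg n (order_matrix U P) (jacobian_at P \<eta>) {..<s} cs res \<longrightarrow>
           (res = None \<longleftrightarrow> \<not> obar_regular n s P U \<eta>) \<and>
           (\<forall>Y. res = Some Y \<longrightarrow> obar_regular_wrt n s P U \<eta> Y)))
     \<and>
     (\<exists>(prog::prog) (M::real). \<forall>(n::nat) (s::nat) P U \<eta> K.
        n \<ge> 1 \<and> s \<ge> 1 \<and> system_at n s P U \<eta> \<and>
        real_subfield K \<and> (\<forall>i<s. \<forall>j<n. jacobian_at P \<eta> i j \<in> K) \<longrightarrow>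
        (\<exists>cs res t. carries_out K prog s n (order_matrix U P) (jacobian_at P \<eta>) cs res t \<and>
           (let p = real (num_calls cs);
                q = real (max_iterations (order_matrix U P) cs);
                d = real (max_nontrivial (order_matrix U P) cs)
            in real t \<le> M * (p * (q * d\<^sup>2 + real s) * real n))))
     \<and>
     (\<exists>(prog::prog) (M::real). \<forall>(n::nat) (s::nat) P U \<eta> K.
        n \<ge> 1 \<and> s \<ge> 1 \<and> system_at n s P U \<eta> \<and>
        real_subfield K \<and> (\<forall>i<s. \<forall>j<n. jacobian_at P \<eta> i j \<in> K) \<longrightarrow>
        (\<exists>cs res t. carries_out K prog s n (order_matrix U P) (jacobian_at P \<eta>) cs res t \<and>
           (let q = max_iterations (order_matrix U P) cs;
                d = real (max_nontrivial (order_matrix U P) cs)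
            in q = 1 \<and> (\<forall>c\<in>set cs. \<forall>b\<in>set (passes c). cover_cols b = {}) \<and> (s \<ge> 2 \<or> d > 0) \<longrightarrow>
               real t \<le> M * ((d\<^sup>2 + ln (real s) * real s) * real n))))"
proof (intro conjI, goal_cases)
  case 1
  show ?case
  proof (intro allI impI conjI, goal_cases)
    case (1 n s P U \<eta>)
    then show ?case by (rule correctness(1))
  next
    case (2 n s P U \<eta> cs res)
    then show ?case using correctness(2)[OF 2(1,2)] by blast
  next
    case (3 n s P U \<eta> cs res Y)
    then show ?case using correctness(2)[OF 3(1,2)] by blast
  qed
next
  case 2
  show ?case
  proof (rule exI[of _ obar_prog], rule exI[of _ 12000], intro allI impI, elim conjE, goal_cases)
    case (1 n s P U \<eta> K)
    let ?a = "order_matrix U P"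
    interpret algorithm_input n s ?a "jacobian_at P \<eta>" K using 1(3-5) by (rule system_input)
    obtain cs res t where c: "carries_out K obar_prog s n ?a (jacobian_at P \<eta>) cs res t" "t \<le> run_time_bound cs"
      using obar_prog_carries_out by blast
    have "real t \<le> real (run_time_bound cs)" using c(2) by simp
    also have "\<dots> \<le> 12000 * (real (num_calls cs) *
        (real (max_iterations ?a cs) * (real (max_nontrivial ?a cs))\<^sup>2 + real s) * real n)"
      by (rule run_time_le) (use c(1) 1(1,2) in \<open>auto simp: carries_out_def\<close>)
    finally show ?case unfolding Let_def using c(1) by blast
  qed
next
  case 3
  show ?case
  proof (rule exI[of _ obar_prog], rule exI[of _ 42000], intro allI impI, elim conjE, goal_cases)
    case (1 n s P U \<eta> K)
    let ?a = "order_matrix U P"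
    interpret algorithm_input n s ?a "jacobian_at P \<eta>" K using 1(3-5) by (rule system_input)
    obtain cs res t where c: "carries_out K obar_prog s n ?a (jacobian_at P \<eta>) cs res t" "t \<le> run_time_bound cs"
      using obar_prog_carries_out by blast
    have "real t \<le> 42000 * (((real (max_nontrivial ?a cs))\<^sup>2 + ln (real s) * real s) * real n)"
      if "max_iterations ?a cs = 1" "2 \<le> s \<or> 0 < real (max_nontrivial ?a cs)"
    proof -
      have "real t \<le> real (run_time_bound cs)" using c(2) by simp
      also have "\<dots> \<le> 42000 * (((real (max_nontrivial ?a cs))\<^sup>2 + ln (real s) * real s) * real n)"
        by (rule run_time_le_single) (use c(1) 1(1,2) that in \<open>auto simp: carries_out_def\<close>)
      finally show ?thesis .
    qed
    then show ?case unfolding Let_def using c(1) by blast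
  qed
qed

end
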